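(* Let $\theta_0$ be an interior point of $\Theta$ and $f_0\in H$ with $\dot K_{\theta_0}f_0\neq0$. Assume: (a) There is a normed space $(S,\|\cdot\|_S)$ with $S\subset H$, whose norm is stronger than that of $H$, such that $K_\theta H\subset S$ for all $\theta\in\Theta$ and $$\int_0^1\sqrt{\log N\bigl(\epsilon,\{h:\|h\|_S\le 1\},\|\cdot\|_H\bigr)}\,d\epsilon<\infty .$$ (b) There are operators $\dot K_\theta:H\to H$ with $(K_{\theta+s}f-K_\theta f)/s\to\dot K_\theta f$ in $H$ as $s\to0$, for every $f\in H$, $\theta\in\Theta$, and constants $D_0,\dots,D_3$ such that for all $\theta,\theta_1,\theta_2\in\Theta$ and $f_1,f_2\in H$: (i) $\|K_\theta\|\le D_0$, $\|\dot K_\theta\|\le D_0$; (ii) $\|K_\theta-K_{\theta_0}\|_{H\to S}\le D_1|\theta-\theta_0|$; (iii) $\|K_\theta-K_{\theta_0}-(\theta-\theta_0)\dot K_{\theta_0}\|_{H\to S}\le D_2(\theta-\theta_0)^2$; (iv) $\|K_{\theta_1}f_1-K_{\theta_2}f_2\|\le D_3|\theta_1-\theta_2|(\|f_1\|\wedge\|f_2\|)+D_3\|f_1-f_2\|$. (c) The posterior distribution of $(\theta,f)$ and the posterior distribution of $f$ given $\theta=\theta_0$ contract at rate $\epsilon_n$, where $\epsilon_n\to0$ and $\epsilon_n\gg n^{-1/2}$. (d) There are positive numbers $\eta_n\to0$, elements $\gamma_n\in H$ and numbers $\rho_n$ with $\|\gamma_n-\gamma_{\theta_0,f_0}\|\lesssim\rho_n$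 and $n\epsilon_n^4+n\epsilon_n^2\rho_n^2\to0$, such that $$\pi_f\bigl(\|f-f_0\|\le\epsilon_n/(2D_3+2)\bigr)\ge e^{-n\epsilon_n^2/65},$$ $$\pi_f\Bigl(\exists\,s,t\in(-\epsilon_n,\epsilon_n):\ \Bigl|\log\frac{d\pi_{f+(s+t)\gamma_n}}{d\pi_{f+s\gamma_n}}(f)\Bigr|>\eta_n(1+nt^2)\Bigr)\le e^{-3n\epsilon_n^2}.$$ Then the Bernstein-von Mises theorem holds at $(\theta_0,f_0)$, i.e. in $P^n_{\theta_0,f_0}$-probability as $n\to\infty$, $$\Big\|\Pi(\theta\in\cdot\mid X^n)-N\Big(\theta_0+\tfrac1{\sqrt n}\Delta^n_{\theta_0,f_0},\ \tfrac1n\tilde I_{\theta_0,f_0}^{-1}\Big)\Big\|_{\rm TV}\to0 .$$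
   Context: Model. $\Theta\subset\mathbb R$ is compact, $(H,\langle\cdot,\cdot\rangle,\|\cdot\|)$ is a separable Hilbert space, and $K_\theta:H\to H$, $\theta\in\Theta$, are bounded linear operators with adjoints $K_\theta^*$. $\|A\|_{H\to S}=\sup_{\|h\|\le1}\|Ah\|_S$ is the operator norm, written $\|A\|$ if $S=H$. $N(\epsilon,A,d)$ is the minimal number of $d$-balls of radius $\epsilon$ needed to cover $A$; $a\wedge b$ is the minimum; $a_n\lesssim b_n$ means $a_n/b_n$ is bounded; $a_n\gg b_n$ means $b_n/a_n\to0$. Fix an orthonormal basis $(e_k)_{k\in\mathbb N}$ of $H$. $P^n_{\theta,f}$ is the law of $X^n=(X^{(1)},X^{(2)})$, two sequences with $$X^{(1)}_k=\langle f,e_k\rangle+n^{-1/2}Z_{1,k},\qquad X^{(2)}_k=\langle K_\theta f,e_k\rangle+n^{-1/2}Z_{2,k},$$ where the $Z_{i,k}$ are i.i.d. standard normal. For $h\in H$, $\langle X^{(i)},h\rangle:=\sum_kX^{(i)}_k\langle h,e_k\rangle$ (convergent in $L_2$ and almost surely), and, under $P^n_{\theta,f}$, $\langle h,\dot W^{(1)}\rangle:=\sqrt n(\langle X^{(1)},h\rangle-\langle f,h\rangle)$ and $\langle h,\dot W^{(2)}\rangle:=\sqrt n(\langle X^{(2)},h\rangle-\langle K_\theta f,h\rangle)$. With $P_0^n$ the law for $f=0$, $$\log\frac{dP^n_{\theta,f}}{dP^n_0}(X^n)=n\langle X^{(1)},f\rangle-\tfrac n2\|f\|^2+n\langle X^{(2)},K_\theta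 f\rangle-\tfrac n2\|K_\theta f\|^2 .$$ Prior and posterior. The prior is $\Pi=\pi_\theta\times\pi_f$, where $\pi_\theta$ has a continuous Lebesgue density on $\Theta$ bounded away from $0$ and $\infty$, and $\pi_f$ is a probability measure on $H$. $\Pi(\cdot\mid X^n)$ is the posterior of $(\theta,f)$ obtained from the likelihood $\frac{dP^n_{\theta,f}}{dP^n_0}(X^n)=\exp\bigl(n\langle X^{(1)},f\rangle-\tfrac n2\|f\|^2+n\langle X^{(2)},K_\theta f\rangle-\tfrac n2\|K_\theta f\|^2\bigr)$ by Bayes' formula; $\Pi^{\theta=\theta_0}(\cdot\mid X^n)$ is the posterior of $f$ (prior $\pi_f$) in the model where $\theta=\theta_0$ is known. For $h\in H$, $\pi_{f+h}$ denotes the law of $f+h$ when $f\sim\pi_f$. The posterior of $(\theta,f)$ contracts at rate $\epsilon_n$ if $\Pi(|\theta-\theta_0|<\epsilon_n,\|f-f_0\|<\epsilon_n\mid X^n)\to1$ in $P^n_{\theta_0,f_0}$-probability; the posterior of $f$ given $\theta_0$ contracts at rate $\epsilon_n$ if $\Pi^{\theta=\theta_0}(\|f-f_0\|<\epsilon_n\mid X^n)\to1$ in $P^n_{\theta_0,f_0}$-probability. Semiparametric quantities. The least favorable direction is $\gamma_{\theta,f}=(I+K_\theta^*K_\theta)^{-1}K_\theta^*\dot K_\theta f$, and the efficient Fisher information is $\tilde I_{\theta,f}=\|\gamma_{\theta,f}\|^2+\|\dot K_\theta f-K_\theta\gamma_{\theta,f}\|^2$. Further $$\Delta^n_{\theta,f}=\frac1{\tilde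 I_{\theta,f}}\bigl(\langle\dot K_\theta f,\dot W^{(2)}\rangle-\langle\gamma_{\theta,f},\dot W^{(1)}\rangle-\langle K_\theta\gamma_{\theta,f},\dot W^{(2)}\rangle\bigr),$$ a measurable transformation of $X^n$ distributed as $N(0,\tilde I_{\theta,f}^{-1})$ under $P^n_{\theta,f}$. The total variation distance is $\|P-Q\|_{\rm TV}=2\sup_F|P(F)-Q(F)|$. *)

theory Defs
  imports "HOL-Probability.Probability"
begin

section \<open>Functional-analytic notions\<close>

definition orthonormal_basis :: "(nat \<Rightarrow> 'h::real_inner) \<Rightarrow> bool" where
  "orthonormal_basis e \<longleftrightarrow>
     (\<forall>i j. e i \<bullet> e j = (if i = j then 1 else 0)) \<and> closure (span (range e)) = UNIV"

text \<open>A normed space contained in \<open>H\<close> is given by its carrier \<open>S\<close>, a linear subspace of \<open>H\<close>,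
  and its norm \<open>nS\<close>, whose values outside \<open>S\<close> carry no meaning.\<close>

definition normed_subspace :: "'h::real_vector set \<Rightarrow> ('h \<Rightarrow> real) \<Rightarrow> bool" where
  "normed_subspace S nS \<longleftrightarrow> subspace S \<and>
     (\<forall>x\<in>S. 0 \<le> nS x \<and> (nS x = 0 \<longleftrightarrow> x = 0)) \<and>
     (\<forall>x\<in>S. \<forall>c. nS (c *\<^sub>R x) = \<bar>c\<bar> * nS x) \<and>
     (\<forall>x\<in>S. \<forall>y\<in>S. nS (x + y) \<le> nS x + nS y)"

definition stronger_norm :: "'h::real_normed_vector set \<Rightarrow> ('h \<Rightarrow> real) \<Rightarrow> bool" where
  "stronger_norm S nS \<longleftrightarrow> (\<exists>C. \<forall>x\<in>S. norm x \<le> C * nS x)"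

text \<open>The norm of an operator from \<open>H\<close> to \<open>S\<close> is infinite if the operator is unbounded or
  takes a value outside \<open>S\<close>.\<close>

definition opnorm_into ::
  "'h::real_normed_vector set \<Rightarrow> ('h \<Rightarrow> real) \<Rightarrow> ('h \<Rightarrow> 'h) \<Rightarrow> ereal" where
  "opnorm_into S nS A = (SUP h\<in>{h. norm h \<le> 1}. if A h \<in> S then ereal (nS (A h)) else \<infinity>)"

definition covering_number :: "real \<Rightarrow> 'h::metric_space set \<Rightarrow> enat" where
  "covering_number r A = (INF C\<in>{C. finite C \<and> A \<subseteq> (\<Union>c\<in>C. cball c r)}. enat (card C))"

definition sqrt_entropy :: "real \<Rightarrow> 'h::metric_space set \<Rightarrow> ennreal" where
  "sqrt_entropy r A =
     (case covering_number r A of enat m \<Rightarrow> ennreal (sqrt (ln (real m))) | \<infinity> \<Rightarrow> \<infinity>)"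


section \<open>The observation model\<close>

abbreviation std_normal :: "real measure" where
  "std_normal \<equiv> density lborel (\<lambda>x. ennreal (std_normal_density x))"

abbreviation seq_space :: "(nat \<Rightarrow> real) measure" where
  "seq_space \<equiv> Pi\<^sub>M UNIV (\<lambda>_. borel)"

definition obs_law :: "(nat \<Rightarrow> 'h::real_inner) \<Rightarrow> (real \<Rightarrow> 'h \<Rightarrow>\<^sub>L 'h) \<Rightarrow> nat \<Rightarrow> real \<Rightarrow> 'h
    \<Rightarrow> ((nat \<Rightarrow> real) \<times> (nat \<Rightarrow> real)) measure" where
  "obs_law e K n \<theta> f =
     distr (Pi\<^sub>M UNIV (\<lambda>_::nat. std_normal) \<Otimes>\<^sub>M Pi\<^sub>M UNIV (\<lambda>_::nat. std_normal))
       (seq_space \<Otimes>\<^sub>M seq_space)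
       (\<lambda>(z1, z2). (\<lambda>k. f \<bullet> e k + z1 k / sqrt (real n),
                    \<lambda>k. blinfun_apply (K \<theta>) f \<bullet> e k + z2 k / sqrt (real n)))"

text \<open>For fixed \<open>h\<close> the series converges almost surely under every law of the model; elsewhere
  the library function \<open>suminf\<close> returns a fixed unspecified number.\<close>

definition pairing :: "(nat \<Rightarrow> 'h::real_inner) \<Rightarrow> (nat \<Rightarrow> real) \<Rightarrow> 'h \<Rightarrow> real" where
  "pairing e x h = (\<Sum>k. x k * (h \<bullet> e k))"

definition noise1 :: "(nat \<Rightarrow> 'h::real_inner) \<Rightarrow> nat \<Rightarrow> 'h
    \<Rightarrow> (nat \<Rightarrow> real) \<times> (nat \<Rightarrow> real) \<Rightarrow> 'h \<Rightarrow> real" where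
  "noise1 e n f x h = sqrt (real n) * (pairing e (fst x) h - f \<bullet> h)"

definition noise2 :: "(nat \<Rightarrow> 'h::real_inner) \<Rightarrow> (real \<Rightarrow> 'h \<Rightarrow>\<^sub>L 'h) \<Rightarrow> nat \<Rightarrow> real \<Rightarrow> 'h
    \<Rightarrow> (nat \<Rightarrow> real) \<times> (nat \<Rightarrow> real) \<Rightarrow> 'h \<Rightarrow> real" where
  "noise2 e K n \<theta> f x h =
     sqrt (real n) * (pairing e (snd x) h - blinfun_apply (K \<theta>) f \<bullet> h)"

definition likelihood :: "(nat \<Rightarrow> 'h::real_inner) \<Rightarrow> (real \<Rightarrow> 'h \<Rightarrow>\<^sub>L 'h) \<Rightarrow> nat
    \<Rightarrow> (nat \<Rightarrow> real) \<times> (nat \<Rightarrow> real) \<Rightarrow> real \<Rightarrow> 'h \<Rightarrow> real" where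
  "likelihood e K n x \<theta> f =
     exp (real n * pairing e (fst x) f - real n / 2 * (norm f)\<^sup>2
        + real n * pairing e (snd x) (blinfun_apply (K \<theta>) f)
        - real n / 2 * (norm (blinfun_apply (K \<theta>) f))\<^sup>2)"


section \<open>Prior and posterior\<close>

text \<open>The prior of the parameter has density \<open>p\<close> and lives on the space \<open>\<Theta>\<close>: nothing is known
  about the operators at parameter values outside \<open>\<Theta>\<close>.\<close>

definition param_prior :: "real set \<Rightarrow> (real \<Rightarrow> real) \<Rightarrow> real measure" where
  "param_prior \<Theta> p = density (restrict_space lborel \<Theta>) (\<lambda>\<theta>. ennreal (p \<theta>))"

definition bayes :: "'a measure \<Rightarrow> ('a \<Rightarrow> real) \<Rightarrow> 'a measure" where
  "bayes M L = density M (\<lambda>z. ennreal (L z) / (\<integral>\<^sup>+w. ennreal (L w) \<partial>M))"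

definition joint_posterior :: "(nat \<Rightarrow> 'h::{real_inner,second_countable_topology})
    \<Rightarrow> (real \<Rightarrow> 'h \<Rightarrow>\<^sub>L 'h) \<Rightarrow> real measure \<Rightarrow> 'h measure \<Rightarrow> nat
    \<Rightarrow> (nat \<Rightarrow> real) \<times> (nat \<Rightarrow> real) \<Rightarrow> (real \<times> 'h) measure" where
  "joint_posterior e K \<pi>\<^sub>\<theta> \<pi>\<^sub>f n x = bayes (\<pi>\<^sub>\<theta> \<Otimes>\<^sub>M \<pi>\<^sub>f) (\<lambda>(\<theta>, f). likelihood e K n x \<theta> f)"

definition param_posterior :: "(nat \<Rightarrow> 'h::{real_inner,second_countable_topology})
    \<Rightarrow> (real \<Rightarrow> 'h \<Rightarrow>\<^sub>L 'h) \<Rightarrow> real measure \<Rightarrow> 'h measure \<Rightarrow> nat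
    \<Rightarrow> (nat \<Rightarrow> real) \<times> (nat \<Rightarrow> real) \<Rightarrow> real measure" where
  "param_posterior e K \<pi>\<^sub>\<theta> \<pi>\<^sub>f n x = distr (joint_posterior e K \<pi>\<^sub>\<theta> \<pi>\<^sub>f n x) borel fst"

definition posterior_given :: "(nat \<Rightarrow> 'h::{real_inner,second_countable_topology})
    \<Rightarrow> (real \<Rightarrow> 'h \<Rightarrow>\<^sub>L 'h) \<Rightarrow> real \<Rightarrow> 'h measure \<Rightarrow> nat
    \<Rightarrow> (nat \<Rightarrow> real) \<times> (nat \<Rightarrow> real) \<Rightarrow> 'h measure" where
  "posterior_given e K \<theta>\<^sub>0 \<pi>\<^sub>f n x = bayes \<pi>\<^sub>f (\<lambda>f. likelihood e K n x \<theta>\<^sub>0 f)"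

text \<open>Outer measure makes the notion meaningful without a measurability proof for \<open>Y n\<close>;
  for measurable \<open>Y n\<close> it is convergence in probability.\<close>

definition tendsto_in_prob ::
  "(nat \<Rightarrow> 'a measure) \<Rightarrow> (nat \<Rightarrow> 'a \<Rightarrow> real) \<Rightarrow> real \<Rightarrow> bool" where
  "tendsto_in_prob P Y c \<longleftrightarrow>
     (\<forall>\<delta>>0. (\<lambda>n. outer_measure_of (P n) {x \<in> space (P n). \<bar>Y n x - c\<bar> > \<delta>}) \<longlonglongrightarrow> 0)"

definition joint_contracts :: "(nat \<Rightarrow> 'h::{real_inner,second_countable_topology})
    \<Rightarrow> (real \<Rightarrow> 'h \<Rightarrow>\<^sub>L 'h) \<Rightarrow> real measure \<Rightarrow> 'h measure \<Rightarrow> real \<Rightarrow> 'h \<Rightarrow> (nat \<Rightarrow> real) \<Rightarrow> bool"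
  where
  "joint_contracts e K \<pi>\<^sub>\<theta> \<pi>\<^sub>f \<theta>\<^sub>0 f\<^sub>0 \<epsilon> \<longleftrightarrow>
     tendsto_in_prob (\<lambda>n. obs_law e K n \<theta>\<^sub>0 f\<^sub>0)
       (\<lambda>n x. measure (joint_posterior e K \<pi>\<^sub>\<theta> \<pi>\<^sub>f n x)
          {(\<theta>, f) \<in> space (\<pi>\<^sub>\<theta> \<Otimes>\<^sub>M \<pi>\<^sub>f). \<bar>\<theta> - \<theta>\<^sub>0\<bar> < \<epsilon> n \<and> norm (f - f\<^sub>0) < \<epsilon> n}) 1"

definition given_contracts :: "(nat \<Rightarrow> 'h::{real_inner,second_countable_topology})
    \<Rightarrow> (real \<Rightarrow> 'h \<Rightarrow>\<^sub>L 'h) \<Rightarrow> 'h measure \<Rightarrow> real \<Rightarrow> 'h \<Rightarrow> (nat \<Rightarrow> real) \<Rightarrow> bool"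
  where
  "given_contracts e K \<pi>\<^sub>f \<theta>\<^sub>0 f\<^sub>0 \<epsilon> \<longleftrightarrow>
     tendsto_in_prob (\<lambda>n. obs_law e K n \<theta>\<^sub>0 f\<^sub>0)
       (\<lambda>n x. measure (posterior_given e K \<theta>\<^sub>0 \<pi>\<^sub>f n x) {f. norm (f - f\<^sub>0) < \<epsilon> n}) 1"

definition shifted_law :: "'h::{topological_space,plus} measure \<Rightarrow> 'h \<Rightarrow> 'h measure" where
  "shifted_law \<pi>\<^sub>f h = distr \<pi>\<^sub>f borel (\<lambda>f. f + h)"

definition density_version :: "'h::topological_space measure \<Rightarrow> 'h measure \<Rightarrow> ('h \<Rightarrow> real) \<Rightarrow> bool"
  where
  "density_version M N r \<longleftrightarrow> r \<in> borel_measurable M \<and> (\<forall>f. 0 \<le> r f) \<and>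
     N = density M (\<lambda>f. ennreal (r f))"

text \<open>The absolute value of the logarithm, with \<open>log 0 = -\<infinity>\<close> (in the library \<open>ln 0 = 0\<close>).\<close>

definition abs_log :: "real \<Rightarrow> ereal" where
  "abs_log y = (if y = 0 then \<infinity> else ereal \<bar>ln y\<bar>)"


section \<open>Semiparametric quantities\<close>

definition least_favorable :: "(real \<Rightarrow> 'h::real_inner \<Rightarrow>\<^sub>L 'h) \<Rightarrow> (real \<Rightarrow> 'h \<Rightarrow>\<^sub>L 'h)
    \<Rightarrow> real \<Rightarrow> 'h \<Rightarrow> 'h" where
  "least_favorable K K' \<theta> f =
     inv (\<lambda>h. h + adjoint (blinfun_apply (K \<theta>)) (blinfun_apply (K \<theta>) h))
       (adjoint (blinfun_apply (K \<theta>)) (blinfun_apply (K' \<theta>) f))"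

definition efficient_info :: "(real \<Rightarrow> 'h::real_inner \<Rightarrow>\<^sub>L 'h) \<Rightarrow> (real \<Rightarrow> 'h \<Rightarrow>\<^sub>L 'h)
    \<Rightarrow> real \<Rightarrow> 'h \<Rightarrow> real" where
  "efficient_info K K' \<theta> f =
     (norm (least_favorable K K' \<theta> f))\<^sup>2
     + (norm (blinfun_apply (K' \<theta>) f - blinfun_apply (K \<theta>) (least_favorable K K' \<theta> f)))\<^sup>2"

definition Delta :: "(nat \<Rightarrow> 'h::real_inner) \<Rightarrow> (real \<Rightarrow> 'h \<Rightarrow>\<^sub>L 'h) \<Rightarrow> (real \<Rightarrow> 'h \<Rightarrow>\<^sub>L 'h)
    \<Rightarrow> nat \<Rightarrow> real \<Rightarrow> 'h \<Rightarrow> (nat \<Rightarrow> real) \<times> (nat \<Rightarrow> real) \<Rightarrow> real" where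
  "Delta e K K' n \<theta> f x =
     1 / efficient_info K K' \<theta> f *
     (noise2 e K n \<theta> f x (blinfun_apply (K' \<theta>) f)
      - noise1 e n f x (least_favorable K K' \<theta> f)
      - noise2 e K n \<theta> f x (blinfun_apply (K \<theta>) (least_favorable K K' \<theta> f)))"

text \<open>The second argument is the variance, whereas \<open>normal_density\<close> takes a standard deviation.\<close>

definition normal_law :: "real \<Rightarrow> real \<Rightarrow> real measure" where
  "normal_law m v = density lborel (\<lambda>y. ennreal (normal_density m (sqrt v) y))"

definition tv_dist :: "real measure \<Rightarrow> real measure \<Rightarrow> real" where
  "tv_dist P Q = 2 * (SUP F\<in>sets borel. \<bar>measure P F - measure Q F\<bar>)"

end

theory Submission
  imports Defs
begin

text \<open>
  Write \<open>t = \<theta> - \<theta>\<^sub>0\<close> and substitute \<open>f = g - t \<gamma>\<^sub>n\<close> in the likelihood. The equation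
  \<open>(I + K\<^sup>* K) \<gamma> = K\<^sup>* K' f\<^sub>0\<close> makes the direction \<open>(- \<gamma>, K' f\<^sub>0 - K \<gamma>)\<close> of the path orthogonal to every
  \<open>(h, K h)\<close>, so the cross terms in \<open>t\<close> and \<open>g\<close> disappear: near \<open>(\<theta>\<^sub>0, f\<^sub>0)\<close> the log likelihood ratio at
  \<open>(\<theta>, f)\<close> is the one at \<open>(\<theta>\<^sub>0, g)\<close> plus a Gaussian exponent in \<open>t\<close>, up to \<open>o(1) (1 + n t\<^sup>2)\<close>. The stochastic
  part of the error is uniformly small because the noise is bounded on the unit ball of \<open>S\<close>
  (chaining). The shift condition on the prior shows that the substitution changes integrals with
  respect to \<open>\<pi>\<^sub>f\<close> by a factor \<open>exp (o(1) (1 + n t\<^sup>2))\<close> off a set of negligible posterior mass. The integral over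
  \<open>g\<close> therefore factors out, bounded above on the set where the joint posterior concentrates and
  below on the set where the posterior given \<open>\<theta>\<^sub>0\<close> concentrates. What remains of the posterior of \<open>\<theta>\<close> is a
  normal density with the efficient centring and variance. A one-sided bound
  \<open>\<Pi>(F) \<le> N(F) + o(1)\<close>, uniform in \<open>F\<close>, suffices for total variation.

  All laws of the data are transported to one space carrying the noise sequences, so that the
  noise process and its bounds do not depend on \<open>n\<close>.
\<close>


section \<open>Orthonormal bases and adjoints\<close>

text \<open>The order of the choices matters. The constants in the Gaussian perturbation bounds grow
  with the noise in the direction of the efficient score, and the expansion error grows with the
  noise bound on the unit ball of \<open>S\<close>. Both are finite but unbounded random variables,
  the same for all \<open>n\<close>. They are truncated at a level \<open>M\<close>; a tolerance
  \<open>\<delta>\<close> is chosen from \<open>M\<close> and the target accuracy, and only then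
  does \<open>n\<close> grow. Tightness removes the truncation. Budget of exponents, with y = n
  eps_n^2: on the prior neighbourhood with radius eps_n / (2 D_3 + 2) in f, the signal differs from
  the truth by a squared norm of at most (1 + 1/4) y after scaling by n. So the evidence is, up to a
  factor, at least exp(-5y/4) times a prior mass of order exp(-y/65). A set of prior mass exp(-3y)
  is negligible because 3 exceeds 5/4 + 1/65. The substitution costs sqrt n |t| times sqrt n eps_n
  (eps_n + rho_n); the two summands of the rate condition are the squares of the terms in the second
  factor.\<close>

lemma inner_sum_orthonormal:
  fixes e :: "nat \<Rightarrow> 'h::real_inner"
  assumes e: "\<And>i j. e i \<bullet> e j = (if i = j then 1 else 0)"
  shows "(\<Sum>k<m. a k *\<^sub>R e k) \<bullet> e j = (if j < m then a j else 0)"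
  by (simp add: inner_sum_left e if_distrib cong: if_cong)

lemma norm_sum_orthonormal:
  fixes e :: "nat \<Rightarrow> 'h::real_inner"
  assumes e: "\<And>i j. e i \<bullet> e j = (if i = j then 1 else 0)"
  shows "(norm (\<Sum>k<m. a k *\<^sub>R e k))\<^sup>2 = (\<Sum>k<m. (a k)\<^sup>2)"
proof -
  have "(\<Sum>k<m. a k *\<^sub>R e k) \<bullet> (\<Sum>k<m. a k *\<^sub>R e k) = (\<Sum>k<m. a k * ((\<Sum>j<m. a j *\<^sub>R e j) \<bullet> e k))"
    by (simp add: inner_sum_right)
  also have "\<dots> = (\<Sum>k<m. (a k)\<^sup>2)"
    by (simp add: inner_sum_orthonormal[OF e] power2_eq_square)
  finally show ?thesis by (simp add: dot_square_norm)
qed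

lemma bessel:
  fixes e :: "nat \<Rightarrow> 'h::real_inner"
  assumes e: "\<And>i j. e i \<bullet> e j = (if i = j then 1 else 0)"
  shows "(\<Sum>k<m. (h \<bullet> e k)\<^sup>2) \<le> (norm h)\<^sup>2"
proof -
  let ?P = "\<Sum>k<m. (h \<bullet> e k) *\<^sub>R e k"
  have "h \<bullet> ?P = (\<Sum>k<m. (h \<bullet> e k)\<^sup>2)"
    by (simp add: inner_sum_right power2_eq_square)
  moreover have "?P \<bullet> ?P = (\<Sum>k<m. (h \<bullet> e k)\<^sup>2)"
    using norm_sum_orthonormal[OF e, of "\<lambda>k. h \<bullet> e k" m] by (simp add: dot_square_norm)
  ultimately have "(norm (h - ?P))\<^sup>2 = (norm h)\<^sup>2 - (\<Sum>k<m. (h \<bullet> e k)\<^sup>2)"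
    by (simp add: power2_norm_eq_inner inner_diff_left inner_diff_right inner_commute)
  then show ?thesis by (metis diff_ge_0_iff_ge zero_le_power2)
qed

lemma summable_bessel:
  fixes e :: "nat \<Rightarrow> 'h::real_inner"
  assumes e: "\<And>i j. e i \<bullet> e j = (if i = j then 1 else 0)"
  shows "summable (\<lambda>k. (h \<bullet> e k)\<^sup>2)"
  by (rule summableI_nonneg_bounded[OF _ bessel[OF e]]) simp

text \<open>The partial sums are the best approximations from the spans of the first
  \<open>m\<close> basis vectors, so density of the full span forces them to converge.\<close>

lemma orthonormal_expansion:
  fixes e :: "nat \<Rightarrow> 'h::real_inner"
  assumes "orthonormal_basis e"
  shows "(\<lambda>k. (h \<bullet> e k) *\<^sub>R e k) sums h"
proof -
  have e: "\<And>i j. e i \<bullet> e j = (if i = j then 1 else 0)"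
    and dense: "closure (span (range e)) = UNIV"
    using assms by (auto simp: orthonormal_basis_def)
  define P where "P m = (\<Sum>k<m. (h \<bullet> e k) *\<^sub>R e k)" for m
  have orth: "(h - P m) \<bullet> e k = 0" if "k < m" for k m
    using that by (simp add: P_def inner_diff_left inner_sum_orthonormal[OF e])
  have best: "norm (h - P m) \<le> norm (h - (\<Sum>k<m. a k *\<^sub>R e k))" for m a
  proof -
    let ?g = "\<Sum>k<m. a k *\<^sub>R e k"
    have "P m - ?g = (\<Sum>k<m. (h \<bullet> e k - a k) *\<^sub>R e k)"
      by (simp add: P_def sum_subtractf scaleR_diff_left)
    then have 0: "(h - P m) \<bullet> (P m - ?g) = 0"
      by (simp add: inner_sum_right orth)
    have "h - ?g = (h - P m) + (P m - ?g)" by simp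
    then have "(norm (h - ?g))\<^sup>2 = (norm (h - P m))\<^sup>2 + (norm (P m - ?g))\<^sup>2"
      using norm_add_Pythagorean[of "h - P m" "P m - ?g"] 0 by (simp add: orthogonal_def)
    then show ?thesis by (smt (verit) norm_ge_zero power2_le_imp_le zero_le_power2)
  qed
  have span_form: "\<exists>m a. g = (\<Sum>k<m. a k *\<^sub>R e k)" if "g \<in> span (range e)" for g
    using that
  proof (induction rule: span_induct_alt)
    case base
    show ?case by (rule exI[of _ 0]) simp
  next
    case (step c x y)
    then obtain j m a where x: "x = e j" and y: "y = (\<Sum>k<m. a k *\<^sub>R e k)" by auto
    \<comment> \<open>The index \<open>j\<close> of the added vector may exceed \<open>m\<close>;
      both coefficient lists are padded with zeros to the common length \<open>M\<close>.\<close>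
    define M where "M = max m (Suc j)"
    define b where "b k = (if k < m then a k else 0) + (if k = j then c else 0)" for k
    have "(\<Sum>k<M. b k *\<^sub>R e k) = (\<Sum>k<M. (if k < m then a k else 0) *\<^sub>R e k) + (\<Sum>k<M. (if k = j then c else 0) *\<^sub>R e k)"
      by (simp add: b_def scaleR_add_left sum.distrib)
    also have "(\<Sum>k<M. (if k < m then a k else 0) *\<^sub>R e k) = y"
      unfolding y by (rule sum.mono_neutral_cong_right) (auto simp: M_def)
    also have "(\<Sum>k<M. (if k = j then c else 0) *\<^sub>R e k) = c *\<^sub>R x"
    proof -
      have "(\<Sum>k<M. (if k = j then c else 0) *\<^sub>R e k) = (\<Sum>k\<in>{j}. c *\<^sub>R e k)"
        by (rule sum.mono_neutral_cong_right) (auto simp: M_def)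
      then show ?thesis by (simp add: x)
    qed
    finally show ?case by (metis add.commute)
  qed
  have "P \<longlonglongrightarrow> h"
  proof (rule LIMSEQ_I)
    fix r :: real assume "0 < r"
    have "h \<in> closure (span (range e))" using dense by simp
    with \<open>0 < r\<close> obtain g where "g \<in> span (range e)" and g: "dist g h < r"
      by (meson closure_approachable)
    then obtain m a where ga: "g = (\<Sum>k<m. a k *\<^sub>R e k)" using span_form by blast
    show "\<exists>no. \<forall>n\<ge>no. norm (P n - h) < r"
    proof (intro exI allI impI)
      fix n assume "m \<le> n"
      have "g = (\<Sum>k<n. (if k < m then a k else 0) *\<^sub>R e k)"
        unfolding ga by (rule sum.mono_neutral_cong_left) (use \<open>m \<le> n\<close> in auto)
      then have "norm (h - P n) \<le> norm (h - g)" using best by metis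
      also have "\<dots> < r" using g by (simp add: dist_norm norm_minus_commute)
      finally show "norm (P n - h) < r" by (simp add: norm_minus_commute)
    qed
  qed
  then show ?thesis unfolding sums_def P_def .
qed

lemma parseval_inner:
  fixes e :: "nat \<Rightarrow> 'h::real_inner"
  assumes "orthonormal_basis e"
  shows "(\<lambda>k. (f \<bullet> e k) * (h \<bullet> e k)) sums (f \<bullet> h)"
proof -
  have "(\<lambda>k. ((f \<bullet> e k) *\<^sub>R e k) \<bullet> h) sums (f \<bullet> h)"
    by (rule bounded_linear.sums[OF bounded_linear_inner_left orthonormal_expansion[OF assms]])
  then show ?thesis by (simp add: inner_commute)
qed

text \<open>The constant \<open>adjoint\<close> is a choice, so a representing map has to be
  exhibited. It is the Riesz vector of the functional sending \<open>x\<close> to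
  \<open>T x \<bullet> y\<close>, written as a series in the basis; square summable coefficients and
  completeness make the series converge.\<close>

lemma adjoint_inner:
  fixes e :: "nat \<Rightarrow> 'h::{real_inner,banach}"
    and T :: "'h \<Rightarrow> 'h"
  assumes onb: "orthonormal_basis e" and T: "bounded_linear T"
  shows "T x \<bullet> y = x \<bullet> adjoint T y"
proof -
  interpret T: bounded_linear T by fact
  have e: "\<And>i j. e i \<bullet> e j = (if i = j then 1 else 0)"
    using onb by (auto simp: orthonormal_basis_def)
  obtain C where C: "\<And>x. norm (T x) \<le> norm x * C" and "C > 0"
    using T.pos_bounded by blast
  have summ: "summable (\<lambda>k. (T (e k) \<bullet> y) *\<^sub>R e k)" for y
  proof -
    let ?a = "\<lambda>k. T (e k) \<bullet> y"
    \<comment> \<open>\<open>T\<close> is tested on the combination with the coefficients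
      \<open>?a k\<close> themselves: the sum \<open>?s\<close> is then at most
      \<open>sqrt ?s * (C * norm y)\<close>, and one factor \<open>sqrt ?s\<close> cancels.\<close>
    have bound: "(\<Sum>k<m. (?a k)\<^sup>2) \<le> (C * norm y)\<^sup>2" for m
    proof -
      let ?s = "\<Sum>k<m. (?a k)\<^sup>2"
      have "?s = T (\<Sum>k<m. ?a k *\<^sub>R e k) \<bullet> y"
        by (simp add: T.sum T.scaleR inner_sum_left power2_eq_square)
      also have "\<dots> \<le> norm (T (\<Sum>k<m. ?a k *\<^sub>R e k)) * norm y" by (rule norm_cauchy_schwarz)
      also have "\<dots> \<le> (sqrt ?s * C) * norm y"
        using C[of "\<Sum>k<m. ?a k *\<^sub>R e k"] norm_sum_orthonormal[OF e, of ?a m]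
        by (intro mult_right_mono) (auto simp: real_sqrt_unique)
      finally have "?s \<le> sqrt ?s * (C * norm y)" by simp
      moreover have "0 \<le> ?s" by (simp add: sum_nonneg)
      ultimately have "sqrt ?s * sqrt ?s \<le> sqrt ?s * (C * norm y)" by simp
      then have "sqrt ?s \<le> C * norm y"
        using \<open>0 \<le> ?s\<close> \<open>C > 0\<close> 
        by (cases "?s = 0") (auto simp del: real_sqrt_mult_self real_sqrt_eq_zero_cancel_iff simp: mult_le_cancel_left)
      then have "(sqrt ?s)\<^sup>2 \<le> (C * norm y)\<^sup>2"
        by (intro power_mono) (use \<open>0 \<le> ?s\<close> in auto)
      then show ?thesis using \<open>0 \<le> ?s\<close> by simp
    qed
    have sa: "summable (\<lambda>k. (?a k)\<^sup>2)"
      by (rule summableI_nonneg_bounded[OF _ bound]) simp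
    show ?thesis
      unfolding summable_Cauchy
    proof (intro allI impI)
      fix r :: real assume "0 < r"
      then obtain N where N: "\<And>m n. m \<ge> N \<Longrightarrow> norm (\<Sum>k=m..<n. (?a k)\<^sup>2) < r\<^sup>2"
        using sa unfolding summable_Cauchy by (metis zero_less_power)
      show "\<exists>N. \<forall>m\<ge>N. \<forall>n. norm (\<Sum>k=m..<n. ?a k *\<^sub>R e k) < r"
      proof (intro exI allI impI)
        fix m n assume "N \<le> m"
        have "(\<Sum>k=m..<n. ?a k *\<^sub>R e k) = (\<Sum>k<n. (if m \<le> k then ?a k else 0) *\<^sub>R e k)"
          by (rule sum.mono_neutral_cong_left) auto
        then have "(norm (\<Sum>k=m..<n. ?a k *\<^sub>R e k))\<^sup>2 = (\<Sum>k<n. (if m \<le> k then ?a k else 0)\<^sup>2)"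
          by (simp only: norm_sum_orthonormal[OF e])
        also have "\<dots> = (\<Sum>k=m..<n. (?a k)\<^sup>2)"
          by (rule sum.mono_neutral_cong_right) auto
        also have "\<dots> < r\<^sup>2" using N[OF \<open>N \<le> m\<close>, of n] by (smt (verit) real_norm_def)
        finally show "norm (\<Sum>k=m..<n. ?a k *\<^sub>R e k) < r"
          using \<open>0 < r\<close> by (simp add: power_less_imp_less_base)
      qed
    qed
  qed
  have rep: "T x \<bullet> y = x \<bullet> (\<Sum>k. (T (e k) \<bullet> y) *\<^sub>R e k)" for x y
  proof -
    have "(\<lambda>k. T ((x \<bullet> e k) *\<^sub>R e k) \<bullet> y) sums (T x \<bullet> y)"
      by (intro bounded_linear.sums[OF bounded_linear_inner_left] T.sums orthonormal_expansion onb)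
    moreover have "(\<lambda>k. x \<bullet> ((T (e k) \<bullet> y) *\<^sub>R e k)) sums (x \<bullet> (\<Sum>k. (T (e k) \<bullet> y) *\<^sub>R e k))"
      by (intro bounded_linear.sums[OF bounded_linear_inner_right] summable_sums summ)
    moreover have "T ((x \<bullet> e k) *\<^sub>R e k) \<bullet> y = x \<bullet> ((T (e k) \<bullet> y) *\<^sub>R e k)" for k
      by (simp add: T.scaleR)
    ultimately show ?thesis by (metis (no_types, lifting) sums_cong sums_unique2)
  qed
  have "\<exists>f'. \<forall>x y. T x \<bullet> y = x \<bullet> f' y"
    by (intro exI[of _ "\<lambda>y. \<Sum>k. (T (e k) \<bullet> y) *\<^sub>R e k"] allI rep)
  from someI_ex[OF this] show ?thesis unfolding adjoint_def by (elim allE)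
qed

text \<open>The map \<open>h \<mapsto> h - \<tau> (h + T\<^sup>* T h - y)\<close> is a contraction for small \<open>\<tau>\<close>, so
  \<open>I + T\<^sup>* T\<close> is onto.\<close>

lemma surj_id_plus_adjoint_comp:
  fixes e :: "nat \<Rightarrow> 'h::{real_inner,banach}"
    and T :: "'h \<Rightarrow> 'h"
  assumes onb: "orthonormal_basis e" and T: "bounded_linear T"
  shows "surj (\<lambda>h. h + adjoint T (T h))"
proof (unfold surj_def, intro allI)
  fix y
  interpret T: bounded_linear T by fact
  note adj = adjoint_inner[OF onb T]
  obtain C where C: "\<And>x. norm (T x) \<le> norm x * C" and "C > 0"
    using T.pos_bounded by blast
  have adj_diff: "adjoint T a - adjoint T b = adjoint T (a - b)" for a b
  proof -
    have "x \<bullet> (adjoint T a - adjoint T b - adjoint T (a - b)) = 0" for x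
      by (simp add: inner_diff_right adj[symmetric])
    then show ?thesis by (metis inner_eq_zero_iff right_minus_eq)
  qed
  have adj_norm: "norm (adjoint T a) \<le> C * norm a" for a
  proof -
    have "(norm (adjoint T a))\<^sup>2 = T (adjoint T a) \<bullet> a"
      by (simp add: adj power2_norm_eq_inner)
    also have "\<dots> \<le> norm (T (adjoint T a)) * norm a" by (rule norm_cauchy_schwarz)
    also have "\<dots> \<le> (norm (adjoint T a) * C) * norm a"
      by (intro mult_right_mono C) auto
    finally have "norm (adjoint T a) * norm (adjoint T a) \<le> norm (adjoint T a) * (C * norm a)"
      by (simp add: power2_eq_square)
    then show ?thesis
      using \<open>C > 0\<close> by (cases "norm (adjoint T a) = 0") (auto simp: mult_le_cancel_left)
  qed
  define A where "A h = h + adjoint T (T h)" for h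
  define L where "L = 1 + C * C"
  have "L > 1" using \<open>C > 0\<close> by (simp add: L_def)
  have A_diff: "A a - A b = A (a - b)" for a b
    by (simp add: A_def T.diff adj_diff[symmetric])
  have A_norm: "norm (A h) \<le> L * norm h" for h
  proof -
    have "norm (A h) \<le> norm h + C * (norm h * C)"
      unfolding A_def using adj_norm[of "T h"] C[of h] \<open>C > 0\<close>
      by (smt (verit) mult_left_mono norm_triangle_ineq)
    then show ?thesis by (simp add: L_def algebra_simps)
  qed
  have A_pos: "(norm h)\<^sup>2 \<le> h \<bullet> A h" for h
    by (simp add: A_def inner_add_right adj[symmetric] power2_norm_eq_inner)
  \<comment> \<open>Since \<open>A\<close> has norm at most \<open>L\<close> and is bounded below by
    the identity, the squared norm of \<open>d - \<tau> A d\<close> is at most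
    \<open>1 - 2 \<tau> + \<tau>\<^sup>2 L\<^sup>2\<close> times that of \<open>d\<close>. This
    choice turns the last term into \<open>\<tau>\<close>, so the factor is
    \<open>1 - \<tau>\<close>.\<close>
  define \<tau> where "\<tau> = 1 / L\<^sup>2"
  have tau: "0 < \<tau>" "\<tau> < 1" using \<open>L > 1\<close> by (auto simp: \<tau>_def power_less_one_iff divide_less_eq)
  define F where "F h = h - \<tau> *\<^sub>R (A h - y)" for h
  have F_lip: "norm (F a - F b) \<le> sqrt (1 - \<tau>) * norm (a - b)" for a b
  proof -
    let ?d = "a - b"
    have "F a - F b = ?d - \<tau> *\<^sub>R A ?d"
      by (simp add: F_def A_diff[symmetric] algebra_simps)
    then have "(norm (F a - F b))\<^sup>2 = (norm ?d)\<^sup>2 - 2 * \<tau> * (?d \<bullet> A ?d) + \<tau>\<^sup>2 * (norm (A ?d))\<^sup>2"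
      by (simp only: power2_norm_eq_inner)
         (simp add: inner_diff_left inner_diff_right inner_commute power2_eq_square algebra_simps)
    also have "\<dots> \<le> (norm ?d)\<^sup>2 - 2 * \<tau> * (norm ?d)\<^sup>2 + \<tau>\<^sup>2 * (L * norm ?d)\<^sup>2"
      using A_pos[of ?d] A_norm[of ?d] tau
      by (intro add_mono diff_mono mult_left_mono power_mono) auto
    also have "\<tau>\<^sup>2 * (L * norm ?d)\<^sup>2 = \<tau> * (norm ?d)\<^sup>2"
      using \<open>L > 1\<close> by (simp add: \<tau>_def power2_eq_square)
    also have "(norm ?d)\<^sup>2 - 2 * \<tau> * (norm ?d)\<^sup>2 + \<tau> * (norm ?d)\<^sup>2 = (sqrt (1 - \<tau>) * norm ?d)\<^sup>2"
      using tau by (simp add: power_mult_distrib algebra_simps)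
    finally show ?thesis by (rule power2_le_imp_le) (use tau in auto)
  qed
  have "\<exists>!x\<in>UNIV. F x = x"
    by (rule Banach_fix[where c = "sqrt (1 - \<tau>)"]) (use F_lip tau in \<open>auto simp: dist_norm complete_UNIV\<close>)
  then obtain x where "F x = x" by auto
  then have "A x = y" using tau by (simp add: F_def)
  then show "\<exists>x. y = x + adjoint T (T x)" by (auto simp: A_def)
qed

text \<open>The normal equation in weak form. \<open>least_favorable\<close> is given by
  \<open>inv\<close>, so surjectivity of I + K* K is what turns the definition into an equation;
  pairing with \<open>h\<close> and moving the adjoints across removes them.\<close>

lemma least_favorable_inner:
  fixes e :: "nat \<Rightarrow> 'h::{real_inner,banach}" and K K' :: "real \<Rightarrow> 'h \<Rightarrow>\<^sub>L 'h"
  assumes onb: "orthonormal_basis e"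
  shows "least_favorable K K' \<theta> f \<bullet> h + K \<theta> (least_favorable K K' \<theta> f) \<bullet> K \<theta> h = K' \<theta> f \<bullet> K \<theta> h"
proof -
  have bl: "bounded_linear (blinfun_apply (K \<theta>))" by (rule blinfun.bounded_linear_right)
  note adj = adjoint_inner[OF onb bl]
  let ?\<gamma> = "least_favorable K K' \<theta> f"
  have "?\<gamma> + adjoint (K \<theta>) (K \<theta> ?\<gamma>) = adjoint (K \<theta>) (K' \<theta> f)"
    unfolding least_favorable_def
    using surj_f_inv_f[OF surj_id_plus_adjoint_comp[OF onb bl]] .
  then have "h \<bullet> (?\<gamma> + adjoint (K \<theta>) (K \<theta> ?\<gamma>)) = h \<bullet> adjoint (K \<theta>) (K' \<theta> f)" by simp
  then show ?thesis by (simp add: inner_add_right adj[symmetric] inner_commute)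
qed

lemma efficient_info_pos:
  assumes "blinfun_apply (K' \<theta>) f \<noteq> 0"
  shows "0 < efficient_info K K' \<theta> f"
proof (cases "least_favorable K K' \<theta> f = 0")
  case True
  then show ?thesis using assms by (simp add: efficient_info_def)
next
  case False
  then show ?thesis by (simp add: efficient_info_def add_pos_nonneg)
qed


section \<open>Gaussian sequences\<close>

abbreviation gauss_seq :: "(nat \<Rightarrow> real) measure" where
  "gauss_seq \<equiv> Pi\<^sub>M UNIV (\<lambda>_. std_normal)"

lemma prob_space_std_normal: "prob_space std_normal"
  by (rule prob_space_normal_density) simp

lemma sequence_space_std_normal: "sequence_space std_normal"
proof -
  interpret prob_space std_normal by (rule prob_space_std_normal)
  show ?thesis by unfold_locales
qed

lemma prob_space_gauss_seq: "prob_space gauss_seq"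
  by (rule prob_space_PiM) (rule prob_space_std_normal)

lemma sets_gauss_seq [simp, measurable_cong]: "sets gauss_seq = sets seq_space"
  by (rule sets_PiM_cong) auto

lemma space_gauss_seq [simp]: "space gauss_seq = UNIV"
  by (auto simp: space_PiM)

text \<open>Splitting off the first coordinate leaves a sequence with the same law. This is the
  recursion behind the inductions on the number of coordinates below.\<close>

lemma nn_integral_gauss_seq_iter:
  assumes f [measurable]: "f \<in> borel_measurable gauss_seq"
  shows "(\<integral>\<^sup>+z. f z \<partial>gauss_seq) = (\<integral>\<^sup>+x. \<integral>\<^sup>+z. f (case_nat x z) \<partial>gauss_seq \<partial>std_normal)"
proof -
  interpret G: prob_space gauss_seq by (rule prob_space_gauss_seq)
  have [measurable]: "(\<lambda>(x, z). case_nat x z) \<in> std_normal \<Otimes>\<^sub>M gauss_seq \<rightarrow>\<^sub>M gauss_seq"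
    by measurable
  have "(\<integral>\<^sup>+z. f z \<partial>gauss_seq)
      = (\<integral>\<^sup>+z. f z \<partial>distr (std_normal \<Otimes>\<^sub>M gauss_seq) gauss_seq (\<lambda>(x, z). case_nat x z))"
    by (simp add: sequence_space.PiM_iter[OF sequence_space_std_normal])
  also have "\<dots> = (\<integral>\<^sup>+p. f ((\<lambda>(x, z). case_nat x z) p) \<partial>(std_normal \<Otimes>\<^sub>M gauss_seq))"
    by (rule nn_integral_distr) (use f in auto)
  also have "\<dots> = (\<integral>\<^sup>+x. \<integral>\<^sup>+z. f (case_nat x z) \<partial>gauss_seq \<partial>std_normal)"
    by (subst G.nn_integral_fst[symmetric]) auto
  finally show ?thesis .
qed

lemma nn_integral_std_normal_exp:
  "(\<integral>\<^sup>+x. ennreal (exp (a * x)) \<partial>std_normal) = ennreal (exp (a\<^sup>2 / 2))"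
proof -
  \<comment> \<open>Completing the square: tilting the standard normal density by
    \<open>exp (a * x)\<close> moves its mean to \<open>a\<close>.\<close>
  have *: "std_normal_density x * exp (a * x) = exp (a\<^sup>2 / 2) * normal_density a 1 x" for x
  proof -
    have "exp (- x\<^sup>2 / 2) * exp (a * x) = exp (a\<^sup>2 / 2) * exp (- (x - a)\<^sup>2 / 2)"
      by (simp add: exp_add[symmetric] power2_eq_square field_simps)
    then show ?thesis by (simp add: normal_density_def)
  qed
  have "(\<integral>\<^sup>+x. ennreal (exp (a * x)) \<partial>std_normal) = (\<integral>\<^sup>+x. ennreal (std_normal_density x) * ennreal (exp (a * x)) \<partial>lborel)"
    by (subst nn_integral_density) auto
  also have "\<dots> = (\<integral>\<^sup>+x. ennreal (exp (a\<^sup>2 / 2) * normal_density a 1 x) \<partial>lborel)"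
    by (simp add: ennreal_mult[symmetric] *)
  also have "\<dots> = ennreal (exp (a\<^sup>2 / 2))"
    by (subst nn_integral_eq_integral) auto
  finally show ?thesis .
qed

lemma nn_integral_std_normal_affine_square:
  "(\<integral>\<^sup>+x. ennreal ((c + a * x)\<^sup>2) \<partial>std_normal) = ennreal (c\<^sup>2 + a\<^sup>2)"
proof -
  have m0: "has_bochner_integral lborel std_normal_density 1"
    by (simp add: has_bochner_integral_iff)
  have m1: "has_bochner_integral lborel (\<lambda>x. std_normal_density x * x) 0"
    using std_normal_moment_odd[of 0] by simp
  have m2: "has_bochner_integral lborel (\<lambda>x. std_normal_density x * x\<^sup>2) 1"
    using std_normal_moment_even[of 1] by (simp add: numeral_2_eq_2)
  have "has_bochner_integral lborel (\<lambda>x. c\<^sup>2 * std_normal_density x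
      + 2 * a * c * (std_normal_density x * x) + a\<^sup>2 * (std_normal_density x * x\<^sup>2)) (c\<^sup>2 * 1 + 2 * a * c * 0 + a\<^sup>2 * 1)"
    by (intro has_bochner_integral_add has_bochner_integral_mult_right m0 m1 m2)
  moreover have "c\<^sup>2 * std_normal_density x + 2 * a * c * (std_normal_density x * x) + a\<^sup>2 * (std_normal_density x * x\<^sup>2)
      = std_normal_density x * (c + a * x)\<^sup>2" for x
    by (simp add: power2_eq_square algebra_simps)
  ultimately have *: "has_bochner_integral lborel (\<lambda>x. std_normal_density x * (c + a * x)\<^sup>2) (c\<^sup>2 + a\<^sup>2)"
    by simp
  have "(\<integral>\<^sup>+x. ennreal ((c + a * x)\<^sup>2) \<partial>std_normal)
      = (\<integral>\<^sup>+x. ennreal (std_normal_density x) * ennreal ((c + a * x)\<^sup>2) \<partial>lborel)"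
    by (subst nn_integral_density) auto
  also have "\<dots> = (\<integral>\<^sup>+x. ennreal (std_normal_density x * (c + a * x)\<^sup>2) \<partial>lborel)"
    by (simp add: ennreal_mult[symmetric])
  also have "\<dots> = ennreal (c\<^sup>2 + a\<^sup>2)"
    using * by (subst nn_integral_eq_integral) (auto simp: has_bochner_integral_iff)
  finally show ?thesis .
qed

lemma nn_integral_gauss_seq_exp_sum:
  "(\<integral>\<^sup>+z. ennreal (exp (\<Sum>i<m. a i * z i)) \<partial>gauss_seq) = ennreal (exp ((\<Sum>i<m. (a i)\<^sup>2) / 2))"
proof (induction m arbitrary: a)
  case 0
  interpret G: prob_space gauss_seq by (rule prob_space_gauss_seq)
  show ?case using G.emeasure_space_1 by simp
next
  case (Suc m)
  have "(\<integral>\<^sup>+z. ennreal (exp (\<Sum>i<Suc m. a i * z i)) \<partial>gauss_seq)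
     = (\<integral>\<^sup>+x. \<integral>\<^sup>+z. ennreal (exp (a 0 * x)) * ennreal (exp (\<Sum>i<m. a (Suc i) * z i)) \<partial>gauss_seq \<partial>std_normal)"
    by (subst nn_integral_gauss_seq_iter)
       (auto simp: sum.lessThan_Suc_shift exp_add ennreal_mult simp del: sum.lessThan_Suc)
  also have "\<dots> = (\<integral>\<^sup>+x. ennreal (exp (a 0 * x)) * ennreal (exp ((\<Sum>i<m. (a (Suc i))\<^sup>2) / 2)) \<partial>std_normal)"
    by (subst nn_integral_cmult) (auto simp: Suc.IH)
  also have "\<dots> = ennreal (exp ((a 0)\<^sup>2 / 2)) * ennreal (exp ((\<Sum>i<m. (a (Suc i))\<^sup>2) / 2))"
    by (subst nn_integral_multc) (auto simp: nn_integral_std_normal_exp)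
  also have "\<dots> = ennreal (exp ((\<Sum>i<Suc m. (a i)\<^sup>2) / 2))"
    by (simp add: ennreal_mult[symmetric] exp_add[symmetric] sum.lessThan_Suc_shift add_divide_distrib
        del: sum.lessThan_Suc)
  finally show ?case .
qed

text \<open>The free initial value \<open>c\<close> allows an induction that
  conditions on the first coordinate, so that no stopping time is needed.\<close>

lemma kolmogorov_maximal:
  assumes u: "0 < u"
  shows "emeasure gauss_seq {z. \<exists>k\<le>m. u \<le> \<bar>c + (\<Sum>i<k. a i * z i)\<bar>}
           \<le> ennreal ((c\<^sup>2 + (\<Sum>i<m. (a i)\<^sup>2)) / u\<^sup>2)"
proof (induction m arbitrary: a c)
  case 0
  interpret G: prob_space gauss_seq by (rule prob_space_gauss_seq)
  show ?case
  proof (cases "u \<le> \<bar>c\<bar>")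
    case True
    then have "u\<^sup>2 \<le> \<bar>c\<bar>\<^sup>2" using u by (intro power_mono) auto
    then have "1 \<le> c\<^sup>2 / u\<^sup>2" using u by (simp add: le_divide_eq)
    then have "1 \<le> ennreal (c\<^sup>2 / u\<^sup>2)" by (metis ennreal_1 ennreal_leI)
    moreover have "emeasure gauss_seq UNIV = 1" using G.emeasure_space_1 by simp
    ultimately show ?thesis using True by simp
  next
    case False
    then show ?thesis by simp
  qed
next
  case (Suc m)
  interpret G: prob_space gauss_seq by (rule prob_space_gauss_seq)
  interpret N: prob_space std_normal by (rule prob_space_std_normal)
  let ?A = "\<lambda>m c a. {z. \<exists>k\<le>m. u \<le> \<bar>c + (\<Sum>i<k. a i * z i)\<bar>}"
  have meas: "?A m c a \<in> sets gauss_seq" for m c a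
  proof -
    have "{z \<in> space gauss_seq. \<exists>k\<le>m. u \<le> \<bar>c + (\<Sum>i<k. a i * z i)\<bar>} \<in> sets gauss_seq" by measurable
    then show ?thesis by simp
  qed
  show ?case
  proof (cases "u \<le> \<bar>c\<bar>")
    case True
    then have "u\<^sup>2 \<le> \<bar>c\<bar>\<^sup>2" using u by (intro power_mono) auto
    then have "u\<^sup>2 \<le> c\<^sup>2" by simp
    then have "1 \<le> (c\<^sup>2 + (\<Sum>i<Suc m. (a i)\<^sup>2)) / u\<^sup>2"
      using u by (simp add: le_divide_eq add_increasing2 sum_nonneg del: sum.lessThan_Suc)
    then have "1 \<le> ennreal ((c\<^sup>2 + (\<Sum>i<Suc m. (a i)\<^sup>2)) / u\<^sup>2)" by (metis ennreal_1 ennreal_leI)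
    then show ?thesis using G.emeasure_le_1 order_trans by blast
  next
    case False
    \<comment> \<open>As \<open>\<bar>c\<bar> < u\<close>, the index \<open>k = 0\<close> cannot
      witness the event; all others use the first coordinate, which is absorbed into the initial
      value \<open>c + a 0 * x\<close>.\<close>
    have step: "case_nat x z \<in> ?A (Suc m) c a \<longleftrightarrow> z \<in> ?A m (c + a 0 * x) (\<lambda>i. a (Suc i))" for x z
    proof -
      have "(\<exists>k\<le>Suc m. u \<le> \<bar>c + (\<Sum>i<k. a i * case_nat x z i)\<bar>)
          \<longleftrightarrow> (\<exists>k\<le>m. u \<le> \<bar>c + (\<Sum>i<Suc k. a i * case_nat x z i)\<bar>)"
        using False by (metis (no_types, lifting) Suc_le_mono add.right_neutral lessThan_0 not0_implies_Suc sum.empty)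
      then show ?thesis
        by (simp add: sum.lessThan_Suc_shift add.assoc del: sum.lessThan_Suc)
    qed
    have "emeasure gauss_seq (?A (Suc m) c a) = (\<integral>\<^sup>+z. indicator (?A (Suc m) c a) z \<partial>gauss_seq)"
      by (rule nn_integral_indicator[symmetric]) (rule meas)
    also have "\<dots> = (\<integral>\<^sup>+x. \<integral>\<^sup>+z. indicator (?A (Suc m) c a) (case_nat x z) \<partial>gauss_seq \<partial>std_normal)"
      by (rule nn_integral_gauss_seq_iter) (rule borel_measurable_indicator[OF meas])
    also have "\<dots> = (\<integral>\<^sup>+x. emeasure gauss_seq (?A m (c + a 0 * x) (\<lambda>i. a (Suc i))) \<partial>std_normal)"
    proof (intro nn_integral_cong)
      fix x
      have "(\<integral>\<^sup>+z. indicator (?A (Suc m) c a) (case_nat x z) \<partial>gauss_seq)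
          = (\<integral>\<^sup>+z. indicator (?A m (c + a 0 * x) (\<lambda>i. a (Suc i))) z \<partial>gauss_seq)"
        by (intro nn_integral_cong) (simp only: indicator_def step)
      then show "(\<integral>\<^sup>+z. indicator (?A (Suc m) c a) (case_nat x z) \<partial>gauss_seq)
          = emeasure gauss_seq (?A m (c + a 0 * x) (\<lambda>i. a (Suc i)))"
        by (simp only: nn_integral_indicator[OF meas])
    qed
    \<comment> \<open>The induction hypothesis is quadratic in the new initial value, and
      \<open>(c + a 0 * x)\<^sup>2\<close> has mean \<open>c\<^sup>2 + (a 0)\<^sup>2\<close>, which
      restores the form of the bound.\<close>
    also have "\<dots> \<le> (\<integral>\<^sup>+x. ennreal (1 / u\<^sup>2) * (ennreal ((c + a 0 * x)\<^sup>2) + ennreal (\<Sum>i<m. (a (Suc i))\<^sup>2)) \<partial>std_normal)"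
    proof (rule nn_integral_mono)
      fix x
      have "ennreal (((c + a 0 * x)\<^sup>2 + (\<Sum>i<m. (a (Suc i))\<^sup>2)) / u\<^sup>2)
         = ennreal (1 / u\<^sup>2) * (ennreal ((c + a 0 * x)\<^sup>2) + ennreal (\<Sum>i<m. (a (Suc i))\<^sup>2))"
        by (simp add: ennreal_plus[symmetric] ennreal_mult[symmetric] sum_nonneg del: ennreal_plus)
      then show "emeasure gauss_seq (?A m (c + a 0 * x) (\<lambda>i. a (Suc i)))
         \<le> ennreal (1 / u\<^sup>2) * (ennreal ((c + a 0 * x)\<^sup>2) + ennreal (\<Sum>i<m. (a (Suc i))\<^sup>2))"
        using Suc.IH[of "c + a 0 * x" "\<lambda>i. a (Suc i)"] by simp
    qed
    also have "\<dots> = ennreal (1 / u\<^sup>2) * (ennreal (c\<^sup>2 + (a 0)\<^sup>2) + ennreal (\<Sum>i<m. (a (Suc i))\<^sup>2))"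
    proof -
      have "emeasure std_normal UNIV = 1" using N.emeasure_space_1 by simp
      then show ?thesis
        by (subst nn_integral_cmult, simp, subst nn_integral_add)
           (simp_all add: nn_integral_std_normal_affine_square)
    qed
    also have "\<dots> = ennreal ((c\<^sup>2 + (\<Sum>i<Suc m. (a i)\<^sup>2)) / u\<^sup>2)"
      by (simp add: ennreal_plus[symmetric] ennreal_mult[symmetric] sum_nonneg sum.lessThan_Suc_shift add.assoc
          del: ennreal_plus sum.lessThan_Suc)
    finally show ?thesis .
  qed
qed

lemma kolmogorov_maximal_infinite:
  assumes u: "0 < u" and a: "summable (\<lambda>i. (a i)\<^sup>2)"
  shows "emeasure gauss_seq {z. \<exists>k. u \<le> \<bar>\<Sum>i<k. a i * z i\<bar>} \<le> ennreal ((\<Sum>i. (a i)\<^sup>2) / u\<^sup>2)"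
proof -
  let ?A = "\<lambda>m. {z \<in> space gauss_seq. \<exists>k\<le>m. u \<le> \<bar>\<Sum>i<k. a i * z i\<bar>}"
  have "(SUP m. emeasure gauss_seq (?A m)) = emeasure gauss_seq (\<Union>m. ?A m)"
  proof (rule SUP_emeasure_incseq)
    show "range ?A \<subseteq> sets gauss_seq"
    proof -
      have "?A m \<in> sets gauss_seq" for m by measurable
      then show ?thesis by blast
    qed
    show "incseq ?A" by (intro monoI) (auto intro: order_trans)
  qed
  moreover have "(\<Union>m. ?A m) = {z. \<exists>k. u \<le> \<bar>\<Sum>i<k. a i * z i\<bar>}" by auto
  moreover have "emeasure gauss_seq (?A m) \<le> ennreal ((\<Sum>i. (a i)\<^sup>2) / u\<^sup>2)" for m
  proof -
    have "emeasure gauss_seq (?A m) \<le> ennreal ((0\<^sup>2 + (\<Sum>i<m. (a i)\<^sup>2)) / u\<^sup>2)"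
      using kolmogorov_maximal[OF u, of m 0 a] by simp
    also have "\<dots> \<le> ennreal ((\<Sum>i. (a i)\<^sup>2) / u\<^sup>2)"
      using sum_le_suminf[OF a, of "{..<m}"] by (intro ennreal_leI divide_right_mono) auto
    finally show ?thesis .
  qed
  ultimately show ?thesis by (metis (no_types, lifting) SUP_least)
qed

section \<open>Almost sure convergence of Gaussian series\<close>

text \<open>The maximal inequality, applied to the coefficients from \<open>N\<close> on, bounds the
  oscillation of the partial sums beyond \<open>N\<close> by a tail of a convergent series. Hence
  almost surely the partial sums are Cauchy.\<close>

lemma AE_summable_gauss_seq:
  assumes b: "summable (\<lambda>k. (b k)\<^sup>2)"
  shows "AE z in gauss_seq. summable (\<lambda>k. z k * b k)"
proof -
  define a where "a N i = (if i < N then 0 else b i)" for N i :: nat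
  have sa: "summable (\<lambda>i. (a N i)\<^sup>2)" for N
    by (rule summable_comparison_test[OF _ b]) (auto simp: a_def)
  have tail: "(\<lambda>N. \<Sum>i. (a N i)\<^sup>2) \<longlonglongrightarrow> 0"
  proof -
    have "(\<Sum>i. (a N i)\<^sup>2) = (\<Sum>i. (b i)\<^sup>2) - (\<Sum>i<N. (b i)\<^sup>2)" for N
    proof -
      have "(\<Sum>i. (a N i)\<^sup>2) = (\<Sum>i. (a N (i + N))\<^sup>2) + (\<Sum>i<N. (a N i)\<^sup>2)"
        by (rule suminf_split_initial_segment[OF sa])
      also have "\<dots> = (\<Sum>i. (b (i + N))\<^sup>2)" by (simp add: a_def)
      also have "\<dots> = (\<Sum>i. (b i)\<^sup>2) - (\<Sum>i<N. (b i)\<^sup>2)"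
        by (rule suminf_minus_initial_segment[OF b])
      finally show ?thesis .
    qed
    moreover have "(\<lambda>N. (\<Sum>i. (b i)\<^sup>2) - (\<Sum>i<N. (b i)\<^sup>2)) \<longlonglongrightarrow> (\<Sum>i. (b i)\<^sup>2) - (\<Sum>i. (b i)\<^sup>2)"
      by (intro tendsto_intros summable_LIMSEQ b)
    ultimately show ?thesis by simp
  qed
  have ae: "AE z in gauss_seq. \<exists>N. \<forall>k. \<bar>\<Sum>i<k. a N i * z i\<bar> < u" if "0 < u" for u
  proof -
    let ?B = "\<lambda>N. {z. \<exists>k. u \<le> \<bar>\<Sum>i<k. a N i * z i\<bar>}"
    have m: "?B N \<in> sets gauss_seq" for N
    proof -
      have "{z \<in> space gauss_seq. \<exists>k. u \<le> \<bar>\<Sum>i<k. a N i * z i\<bar>} \<in> sets gauss_seq" by measurable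
      then show ?thesis by simp
    qed
    have "emeasure gauss_seq (\<Inter>N. ?B N) = 0"
    proof -
      have le: "emeasure gauss_seq (\<Inter>N. ?B N) \<le> ennreal ((\<Sum>i. (a N i)\<^sup>2) / u\<^sup>2)" for N
        using kolmogorov_maximal_infinite[OF that sa[of N]]
        by (rule order_trans[rotated]) (intro emeasure_mono m, auto)
      have "(\<lambda>N. ennreal ((\<Sum>i. (a N i)\<^sup>2) / u\<^sup>2)) \<longlonglongrightarrow> ennreal (0 / u\<^sup>2)"
        by (intro tendsto_ennrealI tendsto_divide tail tendsto_const) (use that in auto)
      then have "emeasure gauss_seq (\<Inter>N. ?B N) \<le> ennreal (0 / u\<^sup>2)"
        by (rule LIMSEQ_le_const) (use le in blast)
      then show ?thesis by simp
    qed
    moreover have "(\<Inter>N. ?B N) \<in> sets gauss_seq" using m by blast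
    ultimately have "(\<Inter>N. ?B N) \<in> null_sets gauss_seq" by blast
    then show ?thesis
      by (rule AE_I') (auto simp: not_less)
  qed
  have "AE z in gauss_seq. \<forall>j. \<exists>N. \<forall>k. \<bar>\<Sum>i<k. a N i * z i\<bar> < inverse (real (Suc j))"
    by (subst AE_all_countable) (auto intro!: ae)
  then show ?thesis
  proof eventually_elim
    case (elim z)
    show ?case
      unfolding summable_Cauchy
    proof (intro allI impI)
      fix r :: real assume "0 < r"
      then obtain j where j: "inverse (real (Suc j)) < r / 2"
        using reals_Archimedean[of "r / 2"] by auto
      obtain N where N: "\<And>k. \<bar>\<Sum>i<k. a N i * z i\<bar> < inverse (real (Suc j))" using elim by blast
      show "\<exists>N. \<forall>m\<ge>N. \<forall>n. norm (\<Sum>k=m..<n. z k * b k) < r"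
      proof (intro exI[of _ N] allI impI)
        fix m n assume "N \<le> m"
        show "norm (\<Sum>k=m..<n. z k * b k) < r"
        proof (cases "m \<le> n")
          case True
          have "(\<Sum>k=m..<n. z k * b k) = (\<Sum>k=m..<n. a N k * z k)"
            using \<open>N \<le> m\<close> by (intro sum.cong) (auto simp: a_def)
          also have "\<dots> = (\<Sum>k<n. a N k * z k) - (\<Sum>k<m. a N k * z k)"
            using True by (simp add: sum_diff_nat_ivl[of 0 m n, symmetric] lessThan_atLeast0)
          finally have "norm (\<Sum>k=m..<n. z k * b k) = \<bar>(\<Sum>k<n. a N k * z k) - (\<Sum>k<m. a N k * z k)\<bar>" by simp
          then show ?thesis using N[of n] N[of m] j by linarith
        qed (use \<open>0 < r\<close> in auto)
      qed
    qed
  qed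
qed

lemma AE_summable_pairing:
  fixes e :: "nat \<Rightarrow> 'h::real_inner"
  assumes "orthonormal_basis e"
  shows "AE z in gauss_seq. summable (\<lambda>k. z k * (h \<bullet> e k))"
  by (rule AE_summable_gauss_seq[OF summable_bessel])
     (use assms in \<open>simp add: orthonormal_basis_def\<close>)

lemma measurable_pairing [measurable (raw)]:
  fixes e :: "nat \<Rightarrow> 'h::{real_inner,second_countable_topology}"
  assumes [measurable]: "f \<in> M \<rightarrow>\<^sub>M seq_space" "g \<in> borel_measurable M"
  shows "(\<lambda>x. pairing e (f x) (g x)) \<in> borel_measurable M"
  unfolding pairing_def by measurable

text \<open>Convergence is replaced by the Cauchy property, which involves only countably many
  conditions on the partial sums.\<close>

lemma pred_summable_pairing [measurable (raw)]:
  fixes e :: "nat \<Rightarrow> 'h::{real_inner,second_countable_topology}"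
  assumes [measurable]: "f \<in> M \<rightarrow>\<^sub>M seq_space" "g \<in> borel_measurable M"
  shows "Measurable.pred M (\<lambda>x. summable (\<lambda>k. f x k * (g x \<bullet> e k)))"
  unfolding summable_iff_convergent Cauchy_convergent_iff[symmetric] by measurable

text \<open>Fatou's lemma along the finite sums, whose exponential moments are explicit and bounded
  through Bessel's inequality. An upper bound is all that the tail and evidence estimates
  use.\<close>

lemma nn_integral_exp_pairing_le:
  fixes e :: "nat \<Rightarrow> 'h::{real_inner,second_countable_topology}"
  assumes onb: "orthonormal_basis e"
  shows "(\<integral>\<^sup>+z. ennreal (exp (pairing e z h)) \<partial>gauss_seq) \<le> ennreal (exp ((norm h)\<^sup>2 / 2))"
proof -
  have e: "\<And>i j. e i \<bullet> e j = (if i = j then 1 else 0)"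
    using onb by (auto simp: orthonormal_basis_def)
  let ?S = "\<lambda>m z. exp (\<Sum>i<m. (h \<bullet> e i) * z i)"
  have "(\<integral>\<^sup>+z. ennreal (exp (pairing e z h)) \<partial>gauss_seq) = (\<integral>\<^sup>+z. liminf (\<lambda>m. ennreal (?S m z)) \<partial>gauss_seq)"
  proof (rule nn_integral_cong_AE)
    show "AE z in gauss_seq. ennreal (exp (pairing e z h)) = liminf (\<lambda>m. ennreal (?S m z))"
      using AE_summable_pairing[OF onb, of h]
    proof eventually_elim
      case (elim z)
      have "(\<lambda>m. ennreal (?S m z)) \<longlonglongrightarrow> ennreal (exp (pairing e z h))"
        unfolding pairing_def
        by (intro tendsto_ennrealI tendsto_exp) (use summable_LIMSEQ[OF elim] in \<open>simp add: mult.commute\<close>)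
      then show ?case by (rule lim_imp_Liminf[OF sequentially_bot, symmetric])
    qed
  qed
  also have "\<dots> \<le> liminf (\<lambda>m. \<integral>\<^sup>+z. ennreal (?S m z) \<partial>gauss_seq)"
    by (rule nn_integral_liminf) measurable
  also have "\<dots> = liminf (\<lambda>m. ennreal (exp ((\<Sum>i<m. (h \<bullet> e i)\<^sup>2) / 2)))"
    by (simp only: nn_integral_gauss_seq_exp_sum)
  also have "\<dots> \<le> liminf (\<lambda>m::nat. ennreal (exp ((norm h)\<^sup>2 / 2)))"
    by (intro Liminf_mono always_eventually allI ennreal_leI) (simp add: bessel[OF e])
  also have "\<dots> = ennreal (exp ((norm h)\<^sup>2 / 2))"
    by (simp add: Liminf_const)
  finally show ?thesis .
qed


section \<open>Isonormal processes\<close>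

text \<open>The process is linear only on the set \<open>dom z\<close> of vectors at which the series defining
  it converges. No bound holds for all vectors at a common \<open>z\<close>; bounds hold for almost every
  \<open>z\<close> at a fixed vector, and by Fubini for almost every vector with respect to a prior.\<close>

locale isonormal = prob_space \<mu>
  for \<mu> :: "'z measure" +
  fixes W :: "'z \<Rightarrow> 'v::{real_inner,second_countable_topology} \<Rightarrow> real"
    and dom :: "'z \<Rightarrow> 'v set"
  assumes measurable_W: "(\<lambda>(z, h). W z h) \<in> borel_measurable (\<mu> \<Otimes>\<^sub>M borel)"
    and pred_dom: "Measurable.pred (\<mu> \<Otimes>\<^sub>M borel) (\<lambda>(z, h). h \<in> dom z)"
    and AE_dom: "AE z in \<mu>. h \<in> dom z"
    and subspace_dom: "subspace (dom z)"
    and W_add: "g \<in> dom z \<Longrightarrow> h \<in> dom z \<Longrightarrow> W z (g + h) = W z g + W z h"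
    and W_scale: "h \<in> dom z \<Longrightarrow> W z (c *\<^sub>R h) = c * W z h"
    and exp_moment: "(\<integral>\<^sup>+z. ennreal (exp (W z h)) \<partial>\<mu>) \<le> ennreal (exp ((norm h)\<^sup>2 / 2))"
begin

lemma borel_measurable_W [measurable (raw)]:
  assumes [measurable]: "f \<in> M \<rightarrow>\<^sub>M \<mu>" "g \<in> borel_measurable M"
  shows "(\<lambda>x. W (f x) (g x)) \<in> borel_measurable M"
  using measurable_compose[OF _ measurable_W, of "\<lambda>x. (f x, g x)" M] by simp

lemma pred_dom_comp [measurable (raw)]:
  assumes [measurable]: "f \<in> M \<rightarrow>\<^sub>M \<mu>" "g \<in> borel_measurable M"
  shows "Measurable.pred M (\<lambda>x. g x \<in> dom (f x))"
  using measurable_compose[OF _ pred_dom, of "\<lambda>x. (f x, g x)" M] by simp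

lemma W_diff: "g \<in> dom z \<Longrightarrow> h \<in> dom z \<Longrightarrow> W z (g - h) = W z g - W z h"
  using W_add[of g z "- h"] W_scale[of h z "-1"] subspace_neg[OF subspace_dom] by simp

lemma W_zero [simp]: "W z 0 = 0"
  using W_scale[OF subspace_0[OF subspace_dom], of z 0] by simp

lemma exp_moment_scaled:
  "(\<integral>\<^sup>+z. ennreal (exp (c * W z h)) \<partial>\<mu>) \<le> ennreal (exp (c\<^sup>2 * (norm h)\<^sup>2 / 2))"
proof -
  have "(\<integral>\<^sup>+z. ennreal (exp (c * W z h)) \<partial>\<mu>) = (\<integral>\<^sup>+z. ennreal (exp (W z (c *\<^sub>R h))) \<partial>\<mu>)"
    by (rule nn_integral_cong_AE) (use AE_dom[of h] in eventually_elim, simp add: W_scale)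
  also have "\<dots> \<le> ennreal (exp ((norm (c *\<^sub>R h))\<^sup>2 / 2))" by (rule exp_moment)
  finally show ?thesis by (simp add: power_mult_distrib)
qed

section \<open>Tail bounds and chaining for isonormal processes\<close>

lemma lower_tail:
  assumes s: "0 < s" "norm h \<le> s" and u: "0 \<le> u"
  shows "emeasure \<mu> {z \<in> space \<mu>. W z h \<le> - u} \<le> ennreal (exp (- (u\<^sup>2 / (2 * s\<^sup>2))))"
proof -
  \<comment> \<open>Chernoff's optimal tilt: it minimises
    \<open>- c * u + c\<^sup>2 * s\<^sup>2 / 2\<close>.\<close>
  define c where "c = u / s\<^sup>2"
  have "emeasure \<mu> {z \<in> space \<mu>. W z h \<le> - u}
      \<le> emeasure \<mu> {z \<in> space \<mu>. 1 \<le> ennreal (exp (- (c * u))) * ennreal (exp ((- c) * W z h))}"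
  proof (rule emeasure_mono)
    show "{z \<in> space \<mu>. W z h \<le> - u}
      \<subseteq> {z \<in> space \<mu>. 1 \<le> ennreal (exp (- (c * u))) * ennreal (exp ((- c) * W z h))}"
    proof safe
      fix z assume "W z h \<le> - u"
      then have "0 \<le> c * (- u - W z h)" using u s by (simp add: c_def)
      then have "1 \<le> exp (- (c * u) + (- c) * W z h)" by (simp add: algebra_simps)
      then have "ennreal 1 \<le> ennreal (exp (- (c * u)) * exp ((- c) * W z h))"
        unfolding exp_add by (rule ennreal_leI)
      then show "1 \<le> ennreal (exp (- (c * u))) * ennreal (exp ((- c) * W z h))"
        by (simp only: ennreal_1 ennreal_mult exp_ge_zero)
    qed
  qed measurable
  also have "\<dots> \<le> ennreal (exp (- (c * u))) * (\<integral>\<^sup>+z. ennreal (exp ((- c) * W z h)) * indicator (space \<mu>) z \<partial>\<mu>)"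
    by (rule order_trans[OF _ nn_integral_Markov_inequality[where A = "space \<mu>"]]) auto
  also have "\<dots> = ennreal (exp (- (c * u))) * (\<integral>\<^sup>+z. ennreal (exp ((- c) * W z h)) \<partial>\<mu>)"
    by (intro arg_cong2[where f = times] refl nn_integral_cong) auto
  also have "\<dots> \<le> ennreal (exp (- (c * u))) * ennreal (exp ((- c)\<^sup>2 * (norm h)\<^sup>2 / 2))"
    by (intro mult_left_mono exp_moment_scaled) auto
  also have "\<dots> = ennreal (exp (- (c * u) + (- c)\<^sup>2 * (norm h)\<^sup>2 / 2))"
    by (simp only: ennreal_mult exp_add exp_ge_zero)
  also have "\<dots> \<le> ennreal (exp (- (u\<^sup>2 / (2 * s\<^sup>2))))"
  proof -
    have "(- c)\<^sup>2 * (norm h)\<^sup>2 / 2 \<le> c\<^sup>2 * s\<^sup>2 / 2"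
      using s by (intro divide_right_mono) (auto intro!: mult_left_mono power_mono)
    also have "\<dots> = c * u / 2" using s by (simp add: c_def power2_eq_square)
    finally have "- (c * u) + (- c)\<^sup>2 * (norm h)\<^sup>2 / 2 \<le> - (c * u / 2)" by simp
    also have "\<dots> = - (u\<^sup>2 / (2 * s\<^sup>2))" by (simp add: c_def power2_eq_square)
    finally show ?thesis by (intro ennreal_leI) simp
  qed
  finally show ?thesis .
qed

text \<open>One random variable controls all levels. The exponential moments of level
  \<open>k\<close> are weighted so that their means are summable; the weighted sum is then almost
  surely finite and dominates each single exponential. The inequality \<open>y \<le> exp y\<close>
  turns this into a bound on the exponents without taking logarithms.\<close>

lemma AE_exponential_bound:
  fixes D :: "nat \<Rightarrow> 'v set" and m :: "nat \<Rightarrow> nat" and \<kappa> :: "nat \<Rightarrow> real"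
  assumes fin: "\<And>k. finite (D k)" and nrm: "\<And>k d. d \<in> D k \<Longrightarrow> norm d \<le> 1"
    and card: "\<And>k. card (D k) \<le> m k" and m: "\<And>k. 1 \<le> m k"
  shows "\<exists>\<psi>\<in>borel_measurable \<mu>. (\<forall>z. 0 \<le> \<psi> z) \<and>
    (AE z in \<mu>. \<forall>k. \<forall>d\<in>D k. \<kappa> k * \<bar>W z d\<bar> \<le> (\<kappa> k)\<^sup>2 / 2 + real k + ln (real (m k)) + \<psi> z)"
proof -
  define T where "T k z = (\<Sum>d\<in>D k. ennreal (exp (\<kappa> k * W z d)) + ennreal (exp ((- \<kappa> k) * W z d)))" for k z
  \<comment> \<open>The weight cancels the number \<open>m k\<close> of vectors and the moment
    \<open>exp ((\<kappa> k)\<^sup>2 / 2)\<close>, leaving a mean of at most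
    \<open>2 * exp (- 1) ^ k\<close>.\<close>
  define a where "a k = exp (- real k - ln (real (m k)) - (\<kappa> k)\<^sup>2 / 2)" for k
  define \<Psi> where "\<Psi> z = (\<Sum>k. ennreal (a k) * T k z)" for z
  have [measurable]: "T k \<in> borel_measurable \<mu>" for k unfolding T_def by measurable
  have [measurable]: "\<Psi> \<in> borel_measurable \<mu>" unfolding \<Psi>_def by measurable
  have T_int: "(\<integral>\<^sup>+z. ennreal (a k) * T k z \<partial>\<mu>) \<le> ennreal (2 * exp (- 1) ^ k)" for k
  proof -
    have "(\<integral>\<^sup>+z. T k z \<partial>\<mu>) = (\<Sum>d\<in>D k. (\<integral>\<^sup>+z. ennreal (exp (\<kappa> k * W z d)) \<partial>\<mu>) + (\<integral>\<^sup>+z. ennreal (exp ((- \<kappa> k) * W z d)) \<partial>\<mu>))"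
      unfolding T_def by (subst nn_integral_sum) (auto simp: nn_integral_add)
    also have "\<dots> \<le> (\<Sum>d\<in>D k. ennreal (exp ((\<kappa> k)\<^sup>2 / 2)) + ennreal (exp ((\<kappa> k)\<^sup>2 / 2)))"
    proof (intro sum_mono add_mono)
      fix d assume d: "d \<in> D k"
      have "(norm d)\<^sup>2 \<le> 1" using nrm[OF d] by (simp add: power_le_one)
      then have le: "(\<kappa> k)\<^sup>2 * (norm d)\<^sup>2 / 2 \<le> (\<kappa> k)\<^sup>2 / 2"
        by (simp add: mult_left_le)
      show "(\<integral>\<^sup>+z. ennreal (exp (\<kappa> k * W z d)) \<partial>\<mu>) \<le> ennreal (exp ((\<kappa> k)\<^sup>2 / 2))"
        by (rule order_trans[OF exp_moment_scaled]) (use le in \<open>simp add: ennreal_leI\<close>)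
      show "(\<integral>\<^sup>+z. ennreal (exp ((- \<kappa> k) * W z d)) \<partial>\<mu>) \<le> ennreal (exp ((\<kappa> k)\<^sup>2 / 2))"
        by (rule order_trans[OF exp_moment_scaled]) (use le in \<open>simp add: ennreal_leI\<close>)
    qed
    also have "\<dots> = ennreal (real (card (D k)) * (2 * exp ((\<kappa> k)\<^sup>2 / 2)))"
      by (simp add: ennreal_mult ennreal_plus[symmetric] ennreal_of_nat_eq_real_of_nat del: ennreal_plus)
    also have "\<dots> \<le> ennreal (real (m k) * (2 * exp ((\<kappa> k)\<^sup>2 / 2)))"
      using card[of k] by (intro ennreal_leI mult_right_mono) auto
    finally have "(\<integral>\<^sup>+z. ennreal (a k) * T k z \<partial>\<mu>) \<le> ennreal (a k) * ennreal (real (m k) * (2 * exp ((\<kappa> k)\<^sup>2 / 2)))"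
      by (subst nn_integral_cmult) (auto intro: mult_left_mono)
    also have "\<dots> = ennreal (2 * exp (- 1) ^ k)"
    proof -
      have mk: "exp (- ln (real (m k))) = 1 / real (m k)" using m[of k]
        by (simp add: exp_minus field_simps)
      have "a k = exp (- real k) * exp (- ln (real (m k))) * exp (- ((\<kappa> k)\<^sup>2 / 2))"
        unfolding a_def by (simp add: exp_add[symmetric])
      then have "a k * (real (m k) * (2 * exp ((\<kappa> k)\<^sup>2 / 2))) = 2 * exp (- real k) * (exp (- ((\<kappa> k)\<^sup>2 / 2)) * exp ((\<kappa> k)\<^sup>2 / 2))"
        using m[of k] by (simp add: mk)
      also have "\<dots> = 2 * exp (- 1) ^ k"
        by (simp add: exp_add[symmetric] exp_of_nat_mult[symmetric])
      finally show ?thesis by (simp add: ennreal_mult[symmetric] a_def)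
    qed
    finally show ?thesis .
  qed
  have "(\<integral>\<^sup>+z. \<Psi> z \<partial>\<mu>) = (\<Sum>k. \<integral>\<^sup>+z. ennreal (a k) * T k z \<partial>\<mu>)"
    unfolding \<Psi>_def by (rule nn_integral_suminf) measurable
  also have "\<dots> \<le> (\<Sum>k. ennreal (2 * exp (- 1) ^ k))"
    by (intro suminf_le T_int) auto
  also have "\<dots> < \<infinity>"
  proof -
    have "summable (\<lambda>k. 2 * exp (- 1 :: real) ^ k)" by (intro summable_mult summable_geometric) simp
    then show ?thesis by (simp add: suminf_ennreal2 ennreal_suminf_neq_top less_top[symmetric])
  qed
  finally have "AE z in \<mu>. \<Psi> z \<noteq> \<infinity>" by (intro nn_integral_noteq_infinite) auto
  then have "AE z in \<mu>. \<forall>k. \<forall>d\<in>D k. \<kappa> k * \<bar>W z d\<bar> \<le> (\<kappa> k)\<^sup>2 / 2 + real k + ln (real (m k)) + enn2real (\<Psi> z)"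
  proof eventually_elim
    case (elim z)
    show ?case
    proof (intro allI ballI)
      fix k d assume d: "d \<in> D k"
      have "ennreal (exp (\<kappa> k * \<bar>W z d\<bar>)) \<le> ennreal (exp (\<kappa> k * W z d)) + ennreal (exp ((- \<kappa> k) * W z d))"
        by (cases "0 \<le> W z d") (auto simp: add_increasing add_increasing2)
      also have "\<dots> \<le> T k z"
        unfolding T_def by (rule member_le_sum[OF d _ fin]) auto
      finally have "ennreal (a k) * ennreal (exp (\<kappa> k * \<bar>W z d\<bar>)) \<le> ennreal (a k) * T k z"
        by (rule mult_left_mono) auto
      also have "\<dots> \<le> \<Psi> z"
        using sum_le_suminf[of "\<lambda>k. ennreal (a k) * T k z" "{k}"] unfolding \<Psi>_def by simp
      finally have "ennreal (a k * exp (\<kappa> k * \<bar>W z d\<bar>)) \<le> ennreal (enn2real (\<Psi> z))"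
        using elim by (simp add: ennreal_mult a_def less_top)
      then have "a k * exp (\<kappa> k * \<bar>W z d\<bar>) \<le> enn2real (\<Psi> z)"
        by (simp add: a_def)
      then have "exp (\<kappa> k * \<bar>W z d\<bar> - real k - ln (real (m k)) - (\<kappa> k)\<^sup>2 / 2) \<le> enn2real (\<Psi> z)"
        by (simp add: a_def exp_add[symmetric] algebra_simps)
      moreover have "\<kappa> k * \<bar>W z d\<bar> - real k - ln (real (m k)) - (\<kappa> k)\<^sup>2 / 2
          \<le> exp (\<kappa> k * \<bar>W z d\<bar> - real k - ln (real (m k)) - (\<kappa> k)\<^sup>2 / 2)"
        by (smt (verit) exp_ge_add_one_self)
      ultimately show "\<kappa> k * \<bar>W z d\<bar> \<le> (\<kappa> k)\<^sup>2 / 2 + real k + ln (real (m k)) + enn2real (\<Psi> z)"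
        by linarith
    qed
  qed
  then show ?thesis by (intro bexI[of _ "\<lambda>z. enn2real (\<Psi> z)"]) auto
qed

text \<open>Only almost sure finiteness of the supremum is claimed, so that the exponential moments of the
  links of Dudley's chains, summed over all links, already control every link at once.\<close>

lemma AE_chaining_bound:
  fixes B :: "'v set" and C :: "nat \<Rightarrow> 'v set"
  assumes fin: "\<And>k. finite (C k)"
    and cover: "\<And>k x. x \<in> B \<Longrightarrow> \<exists>c\<in>C k. norm (x - c) \<le> (1 / 2) ^ k"
    and entropy: "summable (\<lambda>k. (1 / 2) ^ k * sqrt (ln (real (card (C k)))))"
  shows "\<exists>Y\<in>borel_measurable \<mu>. \<forall>x\<in>B. AE z in \<mu>. \<bar>W z x\<bar> \<le> Y z"
proof (cases "B = {}")
  case True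
  then show ?thesis by (intro bexI[of _ "\<lambda>_. 0"]) auto
next
  case False
  then have "C k \<noteq> {}" for k using cover by blast
  then have c1: "1 \<le> card (C k)" for k using fin by (simp add: Suc_le_eq card_gt_0_iff)
  define m where "m k = card (C k) * card (C (Suc k))" for k
  have m1: "1 \<le> m k" for k using c1[of k] c1[of "Suc k"] unfolding m_def by (simp add: Suc_le_eq)
  have ln_m: "ln (real (m k)) = ln (real (card (C k))) + ln (real (card (C (Suc k))))" for k
    using c1[of k] c1[of "Suc k"] unfolding m_def of_nat_mult by (intro ln_mult_pos) auto
  \<comment> \<open>Chosen so that \<open>real k + ln (real (m k))\<close> is at most
    \<open>(\<kappa> k)\<^sup>2 / 2\<close>. The bound on a normalised link then reads
    \<open>\<kappa> k * \<bar>W z d\<bar> \<le> (\<kappa> k)\<^sup>2 + \<psi> z\<close>, and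
    dividing by \<open>\<kappa> k \<ge> 1\<close> leaves
    \<open>\<kappa> k + \<psi> z\<close>.\<close>
  define \<kappa> where "\<kappa> k = sqrt (2 * (ln (real (m k)) + real k + 1))" for k
  \<comment> \<open>Bounds the length of a link, since approximations of the same point at levels
    \<open>k\<close> and \<open>Suc k\<close> are within
    \<open>(1 / 2) ^ k + (1 / 2) ^ Suc k\<close>.\<close>
  define \<sigma> :: "nat \<Rightarrow> real" where "\<sigma> k = 2 * (1 / 2) ^ k" for k
  have lnm0: "0 \<le> ln (real (m k))" for k using m1[of k] by simp
  have lam1: "1 \<le> \<kappa> k" for k using lnm0[of k] by (simp add: \<kappa>_def)
  have lam2: "(\<kappa> k)\<^sup>2 = 2 * (ln (real (m k)) + real k + 1)" for k using lnm0[of k] by (simp add: \<kappa>_def)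
  have sig0: "0 < \<sigma> k" for k by (simp add: \<sigma>_def)
  \<comment> \<open>All possible links between consecutive nets, rescaled into the unit ball. They
    do not depend on the point \<open>x\<close>, so neither does the bound \<open>Y\<close>.\<close>
  define D where "D k = (\<lambda>(c, c'). (c' - c) /\<^sub>R \<sigma> k) ` {(c, c') \<in> C k \<times> C (Suc k). norm (c' - c) \<le> \<sigma> k}" for k
  have finD: "finite (D k)" for k
    unfolding D_def by (rule finite_imageI, rule finite_subset[of _ "C k \<times> C (Suc k)"]) (auto simp: fin)
  have nrmD: "norm d \<le> 1" if "d \<in> D k" for d k
    using that sig0[of k] by (auto simp: D_def divide_inverse[symmetric] mult.commute[of "inverse _"] pos_divide_le_eq)
  have cardD: "card (D k) \<le> m k" for k
  proof -
    have "card (D k) \<le> card {(c, c') \<in> C k \<times> C (Suc k). norm (c' - c) \<le> \<sigma> k}"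
      unfolding D_def by (rule card_image_le, rule finite_subset[of _ "C k \<times> C (Suc k)"]) (auto simp: fin)
    also have "\<dots> \<le> card (C k \<times> C (Suc k))" by (rule card_mono) (auto simp: fin)
    finally show ?thesis by (simp add: m_def card_cartesian_product)
  qed
  obtain \<psi> where [measurable]: "\<psi> \<in> borel_measurable \<mu>" and psi0: "\<And>z. 0 \<le> \<psi> z"
    and psi: "AE z in \<mu>. \<forall>k. \<forall>d\<in>D k. \<kappa> k * \<bar>W z d\<bar> \<le> (\<kappa> k)\<^sup>2 / 2 + real k + ln (real (m k)) + \<psi> z"
    using AE_exponential_bound[where D = D and m = m and \<kappa> = \<kappa>] finD nrmD cardD m1 by blast
  have summ1: "summable (\<lambda>k. \<sigma> k * \<kappa> k)"
  proof (rule summable_comparison_test)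
    let ?s = "\<lambda>k. (1 / 2) ^ k * sqrt (ln (real (card (C k))))"
    let ?b = "\<lambda>k. 4 * ?s k + 8 * ?s (Suc k) + 4 * (real (Suc k) * (1 / 2) ^ k)"
    have "norm (\<sigma> k * \<kappa> k) \<le> ?b k" for k
    proof -
      have "\<kappa> k \<le> sqrt 2 * (sqrt (ln (real (card (C k)))) + sqrt (ln (real (card (C (Suc k))))) + sqrt (real (Suc k)))"
      proof -
        have "sqrt (ln (real (m k)) + real k + 1) \<le> sqrt (ln (real (m k))) + sqrt (real (Suc k))"
          using sqrt_add_le_add_sqrt[of "ln (real (m k))" "real k + 1"] lnm0[of k] by (simp add: ac_simps)
        moreover have "sqrt (ln (real (m k))) \<le> sqrt (ln (real (card (C k)))) + sqrt (ln (real (card (C (Suc k)))))"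
          unfolding ln_m using c1[of k] c1[of "Suc k"] by (intro sqrt_add_le_add_sqrt) auto
        ultimately show ?thesis unfolding \<kappa>_def real_sqrt_mult by (intro mult_left_mono) auto
      qed
      also have "\<dots> \<le> 2 * (sqrt (ln (real (card (C k)))) + sqrt (ln (real (card (C (Suc k))))) + real (Suc k))"
      proof (intro mult_mono add_mono order_refl)
        show "sqrt 2 \<le> 2" using real_sqrt_le_mono[of 2 4] by simp
        have "sqrt (real (Suc k)) \<le> sqrt ((real (Suc k))\<^sup>2)"
          by (intro real_sqrt_le_mono) (simp add: power2_eq_square)
        then show "sqrt (real (Suc k)) \<le> real (Suc k)" by simp
      qed (use c1[of k] c1[of "Suc k"] in auto)
      finally have "\<sigma> k * \<kappa> k \<le> \<sigma> k * \<dots>" using sig0[of k] by (intro mult_left_mono) auto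
      also have "\<dots> = ?b k" by (simp add: \<sigma>_def algebra_simps)
      finally show ?thesis using sig0[of k] lam1[of k] by (simp add: abs_of_nonneg)
    qed
    then show "\<exists>N. \<forall>k\<ge>N. norm (\<sigma> k * \<kappa> k) \<le> ?b k" by blast
    have "summable (\<lambda>k. real (Suc k) * (1 / 2 :: real) ^ k)"
    proof -
      have "summable (\<lambda>k. of_nat (Suc k) * (1 :: real) * (1 / 2) ^ k)"
        using termdiff_converges[of "1/2" 1 "\<lambda>_. 1 :: real"] by (simp add: diffs_def)
      then show ?thesis by simp
    qed
    moreover have "summable (\<lambda>k. ?s (Suc k))" using entropy summable_Suc_iff[of ?s] by blast
    ultimately show "summable ?b" by (intro summable_add summable_mult entropy)
  qed
  have summ2: "summable \<sigma>" unfolding \<sigma>_def by (intro summable_mult summable_geometric) simp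
  have summ: "summable (\<lambda>k. \<sigma> k * (\<kappa> k + x))" for x
    using summable_add[OF summ1 summable_mult2[OF summ2, of x]] by (simp add: algebra_simps)
  define Y where "Y z = (\<Sum>c\<in>C 0. \<bar>W z c\<bar>) + (\<Sum>k. \<sigma> k * (\<kappa> k + \<psi> z))" for z
  have [measurable]: "Y \<in> borel_measurable \<mu>" unfolding Y_def by measurable
  have AE_C: "AE z in \<mu>. \<forall>k. \<forall>c\<in>C k. c \<in> dom z"
    by (simp add: AE_all_countable AE_finite_all fin AE_dom)
  have "AE z in \<mu>. \<bar>W z x\<bar> \<le> Y z" if x: "x \<in> B" for x
  proof -
    obtain c where c: "\<And>k. c k \<in> C k" "\<And>k. norm (x - c k) \<le> (1 / 2) ^ k" using cover[OF x] by metis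
    \<comment> \<open>The chain must also converge to \<open>x\<close>. A second use with a single
      vector per level shows that the rescaled errors \<open>2 ^ k *\<^sub>R (x - c k)\<close> have
      noise growing at most linearly in \<open>k\<close>, so the noise at \<open>c k\<close> tends
      to that at \<open>x\<close>. This null set does depend on \<open>x\<close>.\<close>
    have "\<exists>\<psi>'\<in>borel_measurable \<mu>. (\<forall>z. 0 \<le> \<psi>' z) \<and>
       (AE z in \<mu>. \<forall>k. \<forall>d\<in>{2 ^ k *\<^sub>R (x - c k)}. 1 * \<bar>W z d\<bar> \<le> 1\<^sup>2 / 2 + real k + ln (real (1::nat)) + \<psi>' z)"
    proof (rule AE_exponential_bound[where \<kappa> = "\<lambda>_. 1" and m = "\<lambda>_. 1" and D = "\<lambda>k. {2 ^ k *\<^sub>R (x - c k)}"])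
      fix k d assume "d \<in> {2 ^ k *\<^sub>R (x - c k)}"
      then have "norm d = 2 ^ k * norm (x - c k)" by simp
      also have "\<dots> \<le> 2 ^ k * (1 / 2) ^ k" by (intro mult_left_mono c) simp
      finally show "norm d \<le> 1" by (simp add: power_one_over)
    qed auto
    then obtain \<psi>' where psi': "AE z in \<mu>. \<forall>k. \<bar>W z (2 ^ k *\<^sub>R (x - c k))\<bar> \<le> 1 / 2 + real k + \<psi>' z"
      by auto
    show ?thesis
      using psi psi' AE_C AE_dom[of x]
    proof eventually_elim
      case (elim z)
      have cd: "c k \<in> dom z" for k using elim(3) c(1) by blast
      have link: "\<bar>W z (c (Suc k)) - W z (c k)\<bar> \<le> \<sigma> k * (\<kappa> k + \<psi> z)" for k
      proof -
        let ?d = "(c (Suc k) - c k) /\<^sub>R \<sigma> k"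
        have "norm (c (Suc k) - c k) \<le> norm (x - c k) + norm (x - c (Suc k))"
          using norm_triangle_ineq4[of "x - c k" "x - c (Suc k)"] by simp
        also have "\<dots> \<le> \<sigma> k" using c(2)[of k] c(2)[of "Suc k"] norm_ge_zero[of "x - c (Suc k)"]
          unfolding \<sigma>_def power_Suc by linarith
        finally have "?d \<in> D k" unfolding D_def using c(1)[of k] c(1)[of "Suc k"] by (auto intro!: image_eqI[of _ _ "(c k, c (Suc k))"])
        then have "\<kappa> k * \<bar>W z ?d\<bar> \<le> (\<kappa> k)\<^sup>2 / 2 + real k + ln (real (m k)) + \<psi> z" using elim(1) by blast
        also have "\<dots> \<le> (\<kappa> k)\<^sup>2 + \<kappa> k * \<psi> z"
        proof -
          have "\<psi> z \<le> \<kappa> k * \<psi> z" using mult_right_mono[OF lam1[of k] psi0[of z]] by simp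
          moreover have "(\<kappa> k)\<^sup>2 / 2 + real k + ln (real (m k)) \<le> (\<kappa> k)\<^sup>2"
            unfolding lam2 by (simp add: add_divide_distrib)
          ultimately show ?thesis by (rule add_mono[rotated])
        qed
        also have "\<dots> = \<kappa> k * \<kappa> k + \<kappa> k * \<psi> z" by (simp add: power2_eq_square)
        finally have "\<bar>W z ?d\<bar> \<le> \<kappa> k + \<psi> z"
          using lam1[of k] by (simp add: distrib_left[symmetric])
        moreover have "W z ?d = (W z (c (Suc k)) - W z (c k)) / \<sigma> k"
          using subspace_diff[OF subspace_dom cd cd] by (simp add: W_scale W_diff cd divide_inverse mult.commute)
        ultimately show ?thesis using sig0[of k] by (simp add: abs_divide pos_divide_le_eq mult.commute)
      qed
      have "\<bar>W z x\<bar> \<le> Y z + (1 / 2) ^ k * (1 / 2 + real k + \<psi>' z)" for k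
      proof -
        have "W z (c k) = W z (c 0) + (\<Sum>j<k. W z (c (Suc j)) - W z (c j))"
          using sum_lessThan_telescope[of "\<lambda>j. W z (c j)" k] by simp
        then have "\<bar>W z (c k)\<bar> \<le> \<bar>W z (c 0)\<bar> + (\<Sum>j<k. \<bar>W z (c (Suc j)) - W z (c j)\<bar>)"
          using sum_abs[of "\<lambda>j. W z (c (Suc j)) - W z (c j)" "{..<k}"] by linarith
        also have "\<dots> \<le> (\<Sum>c\<in>C 0. \<bar>W z c\<bar>) + (\<Sum>j<k. \<sigma> j * (\<kappa> j + \<psi> z))"
          by (intro add_mono sum_mono link member_le_sum c fin) auto
        also have "\<dots> \<le> Y z"
        proof -
          have "0 \<le> \<sigma> j * (\<kappa> j + \<psi> z)" for j
            using sig0[of j] lam1[of j] psi0[of z] by simp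
          then show ?thesis unfolding Y_def by (intro add_left_mono sum_le_suminf summ) auto
        qed
        finally have 1: "\<bar>W z (c k)\<bar> \<le> Y z" .
        have "W z (2 ^ k *\<^sub>R (x - c k)) = 2 ^ k * (W z x - W z (c k))"
          using subspace_diff[OF subspace_dom elim(4) cd] by (simp add: W_scale W_diff elim(4) cd)
        then have "2 ^ k * \<bar>W z x - W z (c k)\<bar> \<le> 1 / 2 + real k + \<psi>' z"
          using elim(2)[rule_format, of k] by (simp add: abs_mult)
        then have "\<bar>W z x - W z (c k)\<bar> \<le> (1 / 2) ^ k * (1 / 2 + real k + \<psi>' z)"
          by (simp add: power_one_over field_simps)
        then show ?thesis using 1 by linarith
      qed
      moreover have "(\<lambda>k. Y z + (1 / 2) ^ k * (1 / 2 + real k + \<psi>' z)) \<longlonglongrightarrow> Y z"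
      proof -
        have "(\<lambda>k. (1 / 2) ^ k) \<longlonglongrightarrow> (0 :: real)" by (rule LIMSEQ_power_zero) simp
        moreover have "(\<lambda>k. real k * (1 / 2) ^ k) \<longlonglongrightarrow> (0 :: real)" using powser_times_n_limit_0[of "1 / 2 :: real"] by simp
        ultimately have "(\<lambda>k. Y z + ((1 / 2 + \<psi>' z) * (1 / 2) ^ k + real k * (1 / 2) ^ k))
            \<longlonglongrightarrow> Y z + ((1 / 2 + \<psi>' z) * 0 + 0)"
          by (rule tendsto_add[OF tendsto_const tendsto_add[OF tendsto_mult[OF tendsto_const]]])
        then show ?thesis by (simp add: algebra_simps)
      qed
      ultimately show "\<bar>W z x\<bar> \<le> Y z" by (meson LIMSEQ_le_const)
    qed
  qed
  then show ?thesis by (intro bexI[of _ Y]) auto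
qed


subsection \<open>Evidence bounds\<close>

text \<open>By Tonelli, because the likelihood ratio at each fixed parameter has mean at most
  one.\<close>

lemma nn_integral_likelihood_ratio_le:
  assumes M: "sigma_finite_measure M" and [measurable]: "g \<in> borel_measurable M" "C \<in> sets M"
  shows "(\<integral>\<^sup>+z. (\<integral>\<^sup>+m\<in>C. ennreal (exp (W z (g m) - (norm (g m))\<^sup>2 / 2)) \<partial>M) \<partial>\<mu>) \<le> emeasure M C"
proof -
  interpret M: sigma_finite_measure M by fact
  interpret pair_sigma_finite \<mu> M by unfold_locales
  have "(\<integral>\<^sup>+z. (\<integral>\<^sup>+m\<in>C. ennreal (exp (W z (g m) - (norm (g m))\<^sup>2 / 2)) \<partial>M) \<partial>\<mu>)
      = (\<integral>\<^sup>+m. (\<integral>\<^sup>+z. ennreal (exp (W z (g m) - (norm (g m))\<^sup>2 / 2)) * indicator C m \<partial>\<mu>) \<partial>M)"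
    by (rule Fubini'[symmetric]) measurable
  also have "\<dots> \<le> (\<integral>\<^sup>+m. indicator C m \<partial>M)"
  proof (rule nn_integral_mono)
    fix m
    have "(\<integral>\<^sup>+z. ennreal (exp (W z (g m) - (norm (g m))\<^sup>2 / 2)) \<partial>\<mu>)
        = (\<integral>\<^sup>+z. ennreal (exp (- (norm (g m))\<^sup>2 / 2)) * ennreal (exp (W z (g m))) \<partial>\<mu>)"
      by (intro nn_integral_cong) (simp add: ennreal_mult[symmetric] exp_add[symmetric])
    also have "\<dots> = ennreal (exp (- (norm (g m))\<^sup>2 / 2)) * (\<integral>\<^sup>+z. ennreal (exp (W z (g m))) \<partial>\<mu>)"
      by (rule nn_integral_cmult) measurable
    also have "\<dots> \<le> ennreal (exp (- (norm (g m))\<^sup>2 / 2)) * ennreal (exp ((norm (g m))\<^sup>2 / 2))"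
      by (intro mult_left_mono exp_moment) auto
    also have "\<dots> = 1" by (simp add: ennreal_mult[symmetric] exp_add[symmetric])
    finally show "(\<integral>\<^sup>+z. ennreal (exp (W z (g m) - (norm (g m))\<^sup>2 / 2)) * indicator C m \<partial>\<mu>) \<le> indicator C m"
      by (auto simp: indicator_def)
  qed
  finally show ?thesis by simp
qed

text \<open>For fixed \<open>m\<close> in \<open>B\<close> the log ratio falls below
  \<open>- S\<close> only if the noise is at most \<open>- (S / 2)\<close>, an event of probability
  at most \<open>exp (- S / 8)\<close>. By Tonelli the mean prior mass of such \<open>m\<close> is
  small, and by Markov's inequality at least half of \<open>B\<close> remains good outside an event
  of probability \<open>2 * exp (- S / 8)\<close>.\<close>

lemma evidence_lower_bound:
  assumes M: "finite_measure M" and [measurable]: "g \<in> borel_measurable M"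
    and B [measurable]: "B \<in> sets M" and S: "0 < S" "\<And>m. m \<in> B \<Longrightarrow> (norm (g m))\<^sup>2 \<le> S"
  shows "emeasure \<mu> {z \<in> space \<mu>. (\<integral>\<^sup>+m\<in>B. ennreal (exp (W z (g m) - (norm (g m))\<^sup>2 / 2)) \<partial>M)
            < ennreal (measure M B * exp (- S) / 2)} \<le> ennreal (2 * exp (- S / 8))"
    (is "emeasure \<mu> ?E \<le> _")
proof (cases "measure M B = 0")
  case True
  then show ?thesis by simp
next
  case False
  interpret M: finite_measure M by fact
  interpret pair_sigma_finite \<mu> M by unfold_locales
  define b where "b = measure M B"
  have b: "0 < b" using False by (simp add: b_def zero_less_measure_iff)
  \<comment> \<open>Off this set the noise exceeds \<open>- (S / 2)\<close>, and half the squared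
    norm costs at most another \<open>S / 2\<close>.\<close>
  define A where "A z = {m \<in> space M. m \<in> B \<and> W z (g m) \<le> - (S / 2)}" for z
  have A_sets [measurable]: "A z \<in> sets M" if "z \<in> space \<mu>" for z
    unfolding A_def using that by measurable
  have A_ind: "emeasure M (A z) = (\<integral>\<^sup>+m. indicator {p \<in> space (\<mu> \<Otimes>\<^sub>M M). snd p \<in> B \<and> W (fst p) (g (snd p)) \<le> - (S / 2)} (z, m) \<partial>M)"
    if "z \<in> space \<mu>" for z
  proof -
    have "emeasure M (A z) = (\<integral>\<^sup>+m. indicator (A z) m \<partial>M)"
      using A_sets[OF that] by simp
    also have "\<dots> = (\<integral>\<^sup>+m. indicator {p \<in> space (\<mu> \<Otimes>\<^sub>M M). snd p \<in> B \<and> W (fst p) (g (snd p)) \<le> - (S / 2)} (z, m) \<partial>M)"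
      using that by (intro nn_integral_cong) (auto simp: A_def indicator_def space_pair_measure)
    finally show ?thesis .
  qed
  have meas_A [measurable]: "(\<lambda>z. emeasure M (A z)) \<in> borel_measurable \<mu>"
    by (subst measurable_cong[OF A_ind]) measurable
  have "(\<integral>\<^sup>+z. emeasure M (A z) \<partial>\<mu>) = (\<integral>\<^sup>+z. \<integral>\<^sup>+m. indicator {p \<in> space (\<mu> \<Otimes>\<^sub>M M). snd p \<in> B \<and> W (fst p) (g (snd p)) \<le> - (S / 2)} (z, m) \<partial>M \<partial>\<mu>)"
    by (intro nn_integral_cong A_ind)
  also have "\<dots> = (\<integral>\<^sup>+m. \<integral>\<^sup>+z. indicator {p \<in> space (\<mu> \<Otimes>\<^sub>M M). snd p \<in> B \<and> W (fst p) (g (snd p)) \<le> - (S / 2)} (z, m) \<partial>\<mu> \<partial>M)"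
    by (rule Fubini'[symmetric]) measurable
  also have "\<dots> \<le> (\<integral>\<^sup>+m. ennreal (exp (- S / 8)) * indicator B m \<partial>M)"
  proof (rule nn_integral_mono)
    fix m assume m: "m \<in> space M"
    show "(\<integral>\<^sup>+z. indicator {p \<in> space (\<mu> \<Otimes>\<^sub>M M). snd p \<in> B \<and> W (fst p) (g (snd p)) \<le> - (S / 2)} (z, m) \<partial>\<mu>)
        \<le> ennreal (exp (- S / 8)) * indicator B m"
    proof (cases "m \<in> B")
      case True
      have "(\<integral>\<^sup>+z. indicator {p \<in> space (\<mu> \<Otimes>\<^sub>M M). snd p \<in> B \<and> W (fst p) (g (snd p)) \<le> - (S / 2)} (z, m) \<partial>\<mu>)
          = (\<integral>\<^sup>+z. indicator {z \<in> space \<mu>. W z (g m) \<le> - (S / 2)} z \<partial>\<mu>)"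
        using m True by (intro nn_integral_cong) (auto simp: indicator_def space_pair_measure)
      also have "\<dots> = emeasure \<mu> {z \<in> space \<mu>. W z (g m) \<le> - (S / 2)}"
        by (rule nn_integral_indicator) measurable
      also have "\<dots> \<le> ennreal (exp (- ((S / 2)\<^sup>2 / (2 * (sqrt S)\<^sup>2))))"
        using S True by (intro lower_tail) (auto simp: real_le_rsqrt)
      also have "(S / 2)\<^sup>2 / (2 * (sqrt S)\<^sup>2) = S / 8"
        using S by (simp add: power2_eq_square)
      finally show ?thesis using True by simp
    qed (auto simp: indicator_def)
  qed
  also have "\<dots> = ennreal (exp (- S / 8)) * ennreal b"
    by (subst nn_integral_cmult) (auto simp: b_def M.emeasure_eq_measure)
  finally have int_A: "(\<integral>\<^sup>+z. emeasure M (A z) \<partial>\<mu>) \<le> ennreal (exp (- S / 8)) * ennreal b" .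
  have "emeasure \<mu> ?E \<le> emeasure \<mu> {z \<in> space \<mu>. 1 \<le> ennreal (2 / b) * emeasure M (A z)}"
  proof (rule emeasure_mono)
    show "?E \<subseteq> {z \<in> space \<mu>. 1 \<le> ennreal (2 / b) * emeasure M (A z)}"
    proof safe
      fix z assume z: "z \<in> space \<mu>"
        and lt: "(\<integral>\<^sup>+m\<in>B. ennreal (exp (W z (g m) - (norm (g m))\<^sup>2 / 2)) \<partial>M) < ennreal (measure M B * exp (- S) / 2)"
      note [measurable] = A_sets[OF z]
      show "1 \<le> ennreal (2 / b) * emeasure M (A z)"
      proof (rule ccontr)
        have eq: "ennreal (2 / b) * emeasure M (A z) = ennreal (2 / b * measure M (A z))"
          using b by (subst ennreal_mult) (auto simp: M.emeasure_eq_measure)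
        assume "\<not> 1 \<le> ennreal (2 / b) * emeasure M (A z)"
        then have "ennreal (2 / b * measure M (A z)) < ennreal 1"
          unfolding eq by simp
        then have "2 / b * measure M (A z) < 1" using b by (subst (asm) ennreal_less_iff) auto
        then have "measure M (A z) < b / 2" using b by (simp add: field_simps)
        moreover have "measure M (B - A z) = b - measure M (A z)"
          unfolding b_def by (rule M.finite_measure_Diff[OF B A_sets[OF z]]) (auto simp: A_def)
        ultimately have half: "b / 2 \<le> measure M (B - A z)" by simp
        have "ennreal (measure M B * exp (- S) / 2) \<le> ennreal (exp (- S)) * ennreal (measure M (B - A z))"
          using half by (subst ennreal_mult[symmetric]) (auto simp: b_def[symmetric] intro!: ennreal_leI)
        also have "\<dots> = (\<integral>\<^sup>+m\<in>B - A z. ennreal (exp (- S)) \<partial>M)"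
          by (subst nn_integral_cmult_indicator) (auto simp: M.emeasure_eq_measure)
        also have "\<dots> \<le> (\<integral>\<^sup>+m\<in>B. ennreal (exp (W z (g m) - (norm (g m))\<^sup>2 / 2)) \<partial>M)"
        proof (rule nn_integral_mono)
          fix m assume m: "m \<in> space M"
          show "ennreal (exp (- S)) * indicator (B - A z) m
              \<le> ennreal (exp (W z (g m) - (norm (g m))\<^sup>2 / 2)) * indicator B m"
          proof (cases "m \<in> B - A z")
            case True
            then have "- (S / 2) < W z (g m)" "(norm (g m))\<^sup>2 \<le> S" using m S by (auto simp: A_def)
            then show ?thesis using True by (auto intro!: ennreal_leI)
          qed simp
        qed
        finally show False using lt by simp
      qed
    qed
  qed measurable
  also have "\<dots> \<le> ennreal (2 / b) * (\<integral>\<^sup>+z. emeasure M (A z) * indicator (space \<mu>) z \<partial>\<mu>)"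
    by (rule order_trans[OF _ nn_integral_Markov_inequality[where A = "space \<mu>"]]) auto
  also have "\<dots> = ennreal (2 / b) * (\<integral>\<^sup>+z. emeasure M (A z) \<partial>\<mu>)"
    by (intro arg_cong2[where f = times] refl nn_integral_cong) auto
  also have "\<dots> \<le> ennreal (2 / b) * (ennreal (exp (- S / 8)) * ennreal b)"
    by (intro mult_left_mono int_A) auto
  also have "\<dots> = ennreal (2 * exp (- S / 8))"
    using b by (simp add: ennreal_mult[symmetric])
  finally show ?thesis .
qed

text \<open>The integral over \<open>B\<close> is bounded below with high probability by the
  evidence bound, the one over \<open>C\<close> above by Markov's inequality and its mean; the two
  exceptional probabilities add up.\<close>

lemma evidence_ratio:
  assumes M: "finite_measure M" and g [measurable]: "g \<in> borel_measurable M"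
    and B [measurable]: "B \<in> sets M" and C [measurable]: "C \<in> sets M"
    and S: "0 < S" "\<And>m. m \<in> B \<Longrightarrow> (norm (g m))\<^sup>2 \<le> S"
    and b: "0 < measure M B" and \<kappa>: "0 < \<kappa>"
  shows "emeasure \<mu> {z \<in> space \<mu>.
           ennreal \<kappa> * (\<integral>\<^sup>+m\<in>B. ennreal (exp (W z (g m) - (norm (g m))\<^sup>2 / 2)) \<partial>M)
           < (\<integral>\<^sup>+m\<in>C. ennreal (exp (W z (g m) - (norm (g m))\<^sup>2 / 2)) \<partial>M)}
      \<le> ennreal (2 * exp (- S / 8) + 2 * exp S * measure M C / (\<kappa> * measure M B))"
    (is "emeasure \<mu> {z \<in> space \<mu>. ennreal \<kappa> * ?I B z < ?I C z} \<le> _")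
proof -
  interpret M: finite_measure M by fact
  define q where "q = measure M B * exp (- S) / 2"
  have q: "0 < q" using b by (simp add: q_def)
  have "emeasure \<mu> {z \<in> space \<mu>. ennreal \<kappa> * ?I B z < ?I C z}
      \<le> emeasure \<mu> ({z \<in> space \<mu>. ?I B z < ennreal q} \<union> {z \<in> space \<mu>. 1 \<le> ennreal (1 / (\<kappa> * q)) * ?I C z})"
  proof (rule emeasure_mono)
    show "{z \<in> space \<mu>. ennreal \<kappa> * ?I B z < ?I C z}
      \<subseteq> {z \<in> space \<mu>. ?I B z < ennreal q} \<union> {z \<in> space \<mu>. 1 \<le> ennreal (1 / (\<kappa> * q)) * ?I C z}"
    proof safe
      fix z assume "ennreal \<kappa> * ?I B z < ?I C z" and "\<not> 1 \<le> ennreal (1 / (\<kappa> * q)) * ?I C z"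
      show "?I B z < ennreal q"
      proof (rule ccontr)
        assume "\<not> ?I B z < ennreal q"
        then have "ennreal \<kappa> * ennreal q \<le> ennreal \<kappa> * ?I B z" by (intro mult_left_mono) auto
        also have "\<dots> \<le> ?I C z" using \<open>ennreal \<kappa> * ?I B z < ?I C z\<close> by simp
        finally have "ennreal (1 / (\<kappa> * q)) * (ennreal \<kappa> * ennreal q) \<le> ennreal (1 / (\<kappa> * q)) * ?I C z"
          by (rule mult_left_mono) simp
        then show False using \<open>\<not> 1 \<le> ennreal (1 / (\<kappa> * q)) * ?I C z\<close> q \<kappa>
          by (simp add: ennreal_mult[symmetric])
      qed
    qed
  qed measurable
  also have "\<dots> \<le> emeasure \<mu> {z \<in> space \<mu>. ?I B z < ennreal q} + emeasure \<mu> {z \<in> space \<mu>. 1 \<le> ennreal (1 / (\<kappa> * q)) * ?I C z}"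
    by (rule emeasure_subadditive) measurable
  also have "\<dots> \<le> ennreal (2 * exp (- S / 8)) + ennreal (2 * exp S * measure M C / (\<kappa> * measure M B))"
  proof (rule add_mono)
    show "emeasure \<mu> {z \<in> space \<mu>. ?I B z < ennreal q} \<le> ennreal (2 * exp (- S / 8))"
      unfolding q_def by (rule evidence_lower_bound[OF M g B S])
    have "emeasure \<mu> {z \<in> space \<mu>. 1 \<le> ennreal (1 / (\<kappa> * q)) * ?I C z}
        \<le> ennreal (1 / (\<kappa> * q)) * (\<integral>\<^sup>+z. ?I C z * indicator (space \<mu>) z \<partial>\<mu>)"
      by (rule order_trans[OF _ nn_integral_Markov_inequality[where A = "space \<mu>"]]) auto
    also have "\<dots> = ennreal (1 / (\<kappa> * q)) * (\<integral>\<^sup>+z. ?I C z \<partial>\<mu>)"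
      by (intro arg_cong2[where f = times] refl nn_integral_cong) auto
    also have "\<dots> \<le> ennreal (1 / (\<kappa> * q)) * ennreal (measure M C)"
      unfolding M.emeasure_eq_measure[symmetric]
      by (intro mult_left_mono nn_integral_likelihood_ratio_le M.sigma_finite_measure_axioms g C) simp
    also have "\<dots> = ennreal (2 * exp S * measure M C / (\<kappa> * measure M B))"
      using q \<kappa> by (simp add: ennreal_mult[symmetric] q_def exp_minus field_simps)
    finally show "emeasure \<mu> {z \<in> space \<mu>. 1 \<le> ennreal (1 / (\<kappa> * q)) * ?I C z}
        \<le> ennreal (2 * exp S * measure M C / (\<kappa> * measure M B))" .
  qed
  also have "\<dots> = ennreal (2 * exp (- S / 8) + 2 * exp S * measure M C / (\<kappa> * measure M B))"
    using b \<kappa> by (intro ennreal_plus[symmetric]) auto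
  finally show ?thesis .
qed

end


section \<open>Metric entropy\<close>

lemma covering_number_antimono:
  assumes "r \<le> r'"
  shows "covering_number r' A \<le> covering_number r A"
proof -
  have "(\<Union>c\<in>C. cball c r) \<subseteq> (\<Union>c\<in>C. cball c r')" for C
    by (intro UN_mono order_refl subset_cball assms)
  then have "{C. finite C \<and> A \<subseteq> (\<Union>c\<in>C. cball c r)} \<subseteq> {C. finite C \<and> A \<subseteq> (\<Union>c\<in>C. cball c r')}"
    by blast
  then show ?thesis unfolding covering_number_def by (rule INF_superset_mono) (rule order_refl)
qed

lemma sqrt_entropy_antimono:
  assumes "r \<le> r'"
  shows "sqrt_entropy r' A \<le> sqrt_entropy r A"
proof (cases "covering_number r A")
  case (enat m)
  obtain m' where m': "covering_number r' A = enat m'" "m' \<le> m"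
    using covering_number_antimono[OF assms, of A] unfolding enat
    by (metis enat_ile enat_ord_simps(1))
  \<comment> \<open>The value \<open>ln 0 = 0\<close> keeps monotonicity when a covering number is
    zero.\<close>
  have "ln (real m') \<le> ln (real m)"
    using m'(2) by (cases "m' = 0"; cases "m = 0") auto
  then show ?thesis using enat m' by (simp add: sqrt_entropy_def ennreal_leI)
next
  case infinity
  then show ?thesis by (simp add: sqrt_entropy_def)
qed

text \<open>The infimum of an empty family would be infinite, and a nonempty set of extended
  naturals contains its infimum by well-ordering.\<close>

lemma covering_number_attained:
  assumes "covering_number r A = enat m"
  shows "\<exists>C. finite C \<and> A \<subseteq> (\<Union>c\<in>C. cball c r) \<and> card C = m"
proof -
  let ?S = "(\<lambda>C. enat (card C)) ` {C. finite C \<and> A \<subseteq> (\<Union>c\<in>C. cball c r)}"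
  have "?S \<noteq> {}"
  proof
    assume "?S = {}"
    then have "covering_number r A = Inf {}" unfolding covering_number_def by (rule arg_cong)
    with assms show False by (simp add: top_enat_def)
  qed
  then obtain x where "x \<in> ?S" by (auto simp only: ex_in_conv[symmetric])
  then have "Inf ?S \<in> ?S" by (rule wellorder_InfI)
  moreover have "Inf ?S = enat m" using assms unfolding covering_number_def .
  ultimately have "enat m \<in> ?S" by (rule subst[rotated])
  then show ?thesis by (elim imageE) auto
qed

text \<open>The entropy is decreasing in the radius, so its integral dominates a sum over dyadic
  intervals, in each of which the integrand is at least its value at the right end point.\<close>

lemma dyadic_nets:
  fixes A :: "'h::metric_space set"
  assumes fin: "(\<integral>\<^sup>+r\<in>{0<..<1}. sqrt_entropy r A \<partial>lborel) < \<infinity>"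
  shows "\<exists>C. (\<forall>k. finite (C k)) \<and> (\<forall>k. \<forall>x\<in>A. \<exists>c\<in>C k. dist x c \<le> (1 / 2) ^ k)
     \<and> summable (\<lambda>k. (1 / 2) ^ k * sqrt (ln (real (card (C k)))))"
proof -
  let ?g = "\<lambda>r. sqrt_entropy r A"
  \<comment> \<open>The radii start at one half, so all intervals
    \<open>{\<rho> (Suc k)<..<\<rho> k}\<close> lie inside the range of integration. Each has length
    \<open>\<rho> (Suc k)\<close>.\<close>
  define \<rho> :: "nat \<Rightarrow> real" where "\<rho> k = (1 / 2) ^ Suc k" for k
  have rho: "0 < \<rho> k" "\<rho> k < 1" "\<rho> (Suc k) = \<rho> k / 2" for k
    unfolding \<rho>_def by (simp, rule power_Suc_less_one, auto)
  have rho_mono: "\<rho> j \<le> \<rho> k" if "k \<le> j" for j k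
    unfolding \<rho>_def by (rule power_decreasing) (use that in auto)
  have step: "(\<Sum>k<n. ?g (\<rho> k) * indicator {\<rho> (Suc k)<..<\<rho> k} r) \<le> ?g r * indicator {0<..<1} r" for n r
  proof (cases "\<exists>k<n. r \<in> {\<rho> (Suc k)<..<\<rho> k}")
    case True
    then obtain k where k: "k < n" "r \<in> {\<rho> (Suc k)<..<\<rho> k}" by blast
    have "r \<notin> {\<rho> (Suc j)<..<\<rho> j}" if "j \<noteq> k" for j
      using k(2) rho_mono[of "Suc k" j] rho_mono[of "Suc j" k] that by (cases "j < k") (auto simp: not_less_iff_gr_or_eq)
    then have "(\<Sum>k<n. ?g (\<rho> k) * indicator {\<rho> (Suc k)<..<\<rho> k} r) = (\<Sum>j\<in>{k}. ?g (\<rho> j) * indicator {\<rho> (Suc j)<..<\<rho> j} r)"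
      by (intro sum.mono_neutral_right) (use k(1) in auto)
    also have "\<dots> = ?g (\<rho> k)" using k(2) by simp
    also have "\<dots> \<le> ?g r" using k(2) by (intro sqrt_entropy_antimono) auto
    also have "\<dots> = ?g r * indicator {0<..<1} r"
      using k(2) rho[of k] by auto
    finally show ?thesis .
  next
    case False
    then have "(\<Sum>k<n. ?g (\<rho> k) * indicator {\<rho> (Suc k)<..<\<rho> k} r) = 0"
      by (intro sum.neutral) (auto simp: indicator_def)
    then show ?thesis by simp
  qed
  have sum_le: "(\<Sum>k<n. ?g (\<rho> k) * ennreal (\<rho> (Suc k))) \<le> (\<integral>\<^sup>+r\<in>{0<..<1}. ?g r \<partial>lborel)" for n
  proof -
    have "(\<Sum>k<n. ?g (\<rho> k) * ennreal (\<rho> (Suc k))) = (\<Sum>k<n. \<integral>\<^sup>+r. ?g (\<rho> k) * indicator {\<rho> (Suc k)<..<\<rho> k} r \<partial>lborel)"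
      by (intro sum.cong refl) (simp add: nn_integral_cmult_indicator rho)
    also have "\<dots> = (\<integral>\<^sup>+r. (\<Sum>k<n. ?g (\<rho> k) * indicator {\<rho> (Suc k)<..<\<rho> k} r) \<partial>lborel)"
      by (rule nn_integral_sum[symmetric]) measurable
    also have "\<dots> \<le> (\<integral>\<^sup>+r\<in>{0<..<1}. ?g r \<partial>lborel)"
      by (intro nn_integral_mono step)
    finally show ?thesis .
  qed
  \<comment> \<open>One infinite covering number would make its summand, of positive weight,
    infinite and contradict the finite integral.\<close>
  have "\<exists>m. covering_number (\<rho> k) A = enat m" for k
  proof (rule ccontr)
    assume "\<not> ?thesis"
    then have "?g (\<rho> k) = \<infinity>" by (simp add: sqrt_entropy_def)
    then have "?g (\<rho> k) * ennreal (\<rho> (Suc k)) = \<infinity>" using rho(1)[of "Suc k"] by (simp add: ennreal_top_mult)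
    then have "\<infinity> \<le> (\<Sum>k<Suc k. ?g (\<rho> k) * ennreal (\<rho> (Suc k)))" by simp
    also have "\<dots> < \<infinity>" using le_less_trans[OF sum_le fin] .
    finally show False by simp
  qed
  then obtain m where m: "\<And>k. covering_number (\<rho> k) A = enat (m k)" by metis
  then have "\<forall>k. \<exists>C. finite C \<and> A \<subseteq> (\<Union>c\<in>C. cball c (\<rho> k)) \<and> card C = m k"
    using covering_number_attained by blast
  then obtain C where C: "\<And>k. finite (C k)" "\<And>k. A \<subseteq> (\<Union>c\<in>C k. cball c (\<rho> k))" "\<And>k. card (C k) = m k"
    by metis
  show ?thesis
  proof (intro exI[of _ C] conjI allI ballI C)
    fix k x assume "x \<in> A"
    then obtain c where "c \<in> C k" "dist c x \<le> \<rho> k" using C(2) by (auto simp: subset_iff)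
    moreover have "\<rho> k \<le> (1 / 2) ^ k" by (simp add: \<rho>_def)
    ultimately show "\<exists>c\<in>C k. dist x c \<le> (1 / 2) ^ k" by (metis dist_commute order_trans)
  next
    have "summable (\<lambda>k. sqrt (ln (real (m k))) * \<rho> (Suc k))"
    proof (rule summableI_nonneg_bounded)
      have ln0: "0 \<le> ln (real j)" for j by (cases "j = 0") auto
      show "0 \<le> sqrt (ln (real (m k))) * \<rho> (Suc k)" for k
        using rho(1)[of "Suc k"] ln0 by simp
      fix n
      have "ennreal (\<Sum>k<n. sqrt (ln (real (m k))) * \<rho> (Suc k)) = (\<Sum>k<n. ?g (\<rho> k) * ennreal (\<rho> (Suc k)))"
        using rho(1) ln0 by (subst sum_ennreal[symmetric]) (auto simp: sqrt_entropy_def m ennreal_mult less_imp_le)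
      also have "\<dots> \<le> (\<integral>\<^sup>+r\<in>{0<..<1}. ?g r \<partial>lborel)" by (rule sum_le)
      also have "\<dots> = ennreal (enn2real (\<integral>\<^sup>+r\<in>{0<..<1}. ?g r \<partial>lborel))" using fin by (simp add: less_top)
      finally show "(\<Sum>k<n. sqrt (ln (real (m k))) * \<rho> (Suc k)) \<le> enn2real (\<integral>\<^sup>+r\<in>{0<..<1}. ?g r \<partial>lborel)"
        by (simp add: ennreal_le_iff)
    qed
    \<comment> \<open>Because \<open>(1 / 2) ^ k = 4 * \<rho> (Suc k)\<close>.\<close>
    then have "summable (\<lambda>k. 4 * (sqrt (ln (real (m k))) * \<rho> (Suc k)))" by (rule summable_mult)
    then show "summable (\<lambda>k. (1 / 2) ^ k * sqrt (ln (real (card (C k)))))"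
      by (simp add: C \<rho>_def mult.commute)
  qed
qed


section \<open>Perturbed normal laws\<close>

lemma prob_space_normal_law: "0 < v \<Longrightarrow> prob_space (normal_law m v)"
  unfolding normal_law_def by (rule prob_space_normal_density) simp

lemma sets_normal_law [simp, measurable_cong]: "sets (normal_law m v) = sets borel"
  by (simp add: normal_law_def)

text \<open>The exponential factor cancels half of the quadratic exponent: the integrand is a normal
  density with doubled variance, up to the ratio \<open>sqrt 2\<close> of the normalising
  constants.\<close>

lemma nn_integral_normal_exp_square:
  assumes "0 < \<sigma>"
  shows "(\<integral>\<^sup>+\<theta>. ennreal (normal_density m \<sigma> \<theta> * exp ((\<theta> - m)\<^sup>2 / (4 * \<sigma>\<^sup>2))) \<partial>lborel) = ennreal (sqrt 2)"
proof -
  have *: "normal_density m \<sigma> \<theta> * exp ((\<theta> - m)\<^sup>2 / (4 * \<sigma>\<^sup>2)) = sqrt 2 * normal_density m (sqrt 2 * \<sigma>) \<theta>" for \<theta>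
  proof -
    have "exp (- (\<theta> - m)\<^sup>2 / (2 * \<sigma>\<^sup>2)) * exp ((\<theta> - m)\<^sup>2 / (4 * \<sigma>\<^sup>2)) = exp (- (\<theta> - m)\<^sup>2 / (2 * (sqrt 2 * \<sigma>)\<^sup>2))"
      using assms by (simp add: exp_add[symmetric] power_mult_distrib field_simps)
    moreover have "sqrt (2 * pi * (sqrt 2 * \<sigma>)\<^sup>2) = sqrt 2 * sqrt (2 * pi * \<sigma>\<^sup>2)"
      unfolding real_sqrt_mult[symmetric] by (simp add: power_mult_distrib)
    ultimately show ?thesis unfolding normal_density_def by (simp del: real_sqrt_mult)
  qed
  have "(\<integral>\<^sup>+\<theta>. ennreal (sqrt 2 * normal_density m (sqrt 2 * \<sigma>) \<theta>) \<partial>lborel) = ennreal (sqrt 2)"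
    using assms by (subst nn_integral_eq_integral) auto
  then show ?thesis by (simp add: *)
qed

text \<open>Convexity of \<open>exp\<close> between 0 and \<open>\<delta>' * y\<close>. An unbounded
  small perturbation thus costs a factor linear in \<open>\<delta>\<close> times a moment at the
  fixed level \<open>\<delta>'\<close>.\<close>

lemma exp_chord:
  assumes "0 \<le> \<delta>" "\<delta> \<le> \<delta>'" "0 < \<delta>'"
  shows "exp (\<delta> * y) \<le> 1 + \<delta> / \<delta>' * exp (\<delta>' * y :: real)"
proof -
  let ?l = "\<delta> / \<delta>'"
  have l: "0 \<le> ?l" "?l \<le> 1" using assms by auto
  have "exp ((1 - ?l) *\<^sub>R 0 + ?l *\<^sub>R (\<delta>' * y)) \<le> (1 - ?l) * exp 0 + ?l * exp (\<delta>' * y)"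
    by (rule convex_onD[OF exp_convex]) (use l in auto)
  moreover have "?l * (\<delta>' * y) = \<delta> * y" using assms by simp
  ultimately have "exp (\<delta> * y) \<le> 1 - ?l + ?l * exp (\<delta>' * y)" by simp
  then show ?thesis using l(1) by linarith
qed

text \<open>Completing the square writes \<open>exp (q t)\<close> as \<open>Z\<close> times the
  density of \<open>N\<close>. Both bounds then compare the perturbed density with the unperturbed
  one at the price of the exponential moment \<open>Q\<close> at level \<open>I / 8\<close>; the
  factor \<open>8 * \<delta> / I\<close> is the ratio of the perturbation to that level.\<close>

lemma
  fixes I V \<theta>\<^sub>0 \<delta> :: real and n :: nat
  assumes I: "0 < I" and n: "1 \<le> n" and \<delta>: "0 \<le> \<delta>" "\<delta> \<le> I / 8"
  defines "N \<equiv> normal_law (\<theta>\<^sub>0 + 1 / sqrt (real n) * (1 / I * V)) (1 / real n * (1 / I))"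
    and "q \<equiv> \<lambda>t. sqrt (real n) * t * V - real n * t\<^sup>2 * I / 2"
    and "Q \<equiv> sqrt 2 * exp (I / 8 * (1 + 2 * V\<^sup>2 / I\<^sup>2))"
    and "Z \<equiv> sqrt (2 * pi * (1 / real n * (1 / I))) * exp (V\<^sup>2 / (2 * I))"
  shows perturbed_normal_upper: "F \<in> sets borel \<Longrightarrow>
      (\<integral>\<^sup>+\<theta>\<in>F. ennreal (exp (\<delta> * (1 + real n * (\<theta> - \<theta>\<^sub>0)\<^sup>2) + q (\<theta> - \<theta>\<^sub>0))) \<partial>lborel)
        \<le> ennreal (Z * (measure N F + Q * (8 * \<delta> / I)))"
    and perturbed_normal_lower: "0 \<le> \<tau> \<Longrightarrow>
      ennreal (Z * (1 - Q * (8 * \<delta> / I) - Q * exp (- (I / 8 * real n * \<tau>\<^sup>2))))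
      \<le> (\<integral>\<^sup>+\<theta>\<in>{\<theta>\<^sub>0 - \<tau><..<\<theta>\<^sub>0 + \<tau>}.
           ennreal (exp (- (\<delta> * (1 + real n * (\<theta> - \<theta>\<^sub>0)\<^sup>2)) + q (\<theta> - \<theta>\<^sub>0))) \<partial>lborel)"
proof -
  define v where "v = 1 / real n * (1 / I)"
  define m where "m = \<theta>\<^sub>0 + 1 / sqrt (real n) * (1 / I * V)"
  let ?\<phi> = "normal_density m (sqrt v)"
  let ?y = "\<lambda>\<theta>. 1 + real n * (\<theta> - \<theta>\<^sub>0)\<^sup>2"
  let ?d = "I / 8"
  have v: "0 < v" using I n by (simp add: v_def)
  have Z: "0 < Z" unfolding Z_def v_def[symmetric] using v by simp
  have Q: "0 \<le> Q" by (simp add: Q_def)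
  interpret N: prob_space N unfolding N_def by (rule prob_space_normal_law) (use v in \<open>simp add: v_def\<close>)
  have N_emeasure: "emeasure N F = (\<integral>\<^sup>+\<theta>\<in>F. ennreal (?\<phi> \<theta>) \<partial>lborel)" if "F \<in> sets borel" for F
    using that unfolding N_def normal_law_def m_def[symmetric] v_def[symmetric]
    by (subst emeasure_density) auto
  have N_all: "(\<integral>\<^sup>+\<theta>. ennreal (?\<phi> \<theta>) \<partial>lborel) = 1"
    using N_emeasure[of UNIV] N.emeasure_space_1 by (simp add: N_def normal_law_def)
  have dens: "exp (q (\<theta> - \<theta>\<^sub>0)) = Z * ?\<phi> \<theta>" for \<theta>
  proof -
    have "q (\<theta> - \<theta>\<^sub>0) = V\<^sup>2 / (2 * I) + - (\<theta> - m)\<^sup>2 / (2 * v)"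
    proof -
      define s where "s = sqrt (real n)"
      have s: "s\<^sup>2 = real n" "0 < s" using n by (auto simp: s_def)
      have "(\<theta> - m)\<^sup>2 / (2 * v) = s\<^sup>2 * I / 2 * ((\<theta> - \<theta>\<^sub>0) - V / (s * I))\<^sup>2"
        unfolding m_def v_def s(1)[symmetric] using s(2) I by (simp add: field_simps)
      also have "\<dots> = s\<^sup>2 * (\<theta> - \<theta>\<^sub>0)\<^sup>2 * I / 2 - s * (\<theta> - \<theta>\<^sub>0) * V + V\<^sup>2 / (2 * I)"
        using s(2) I by (simp add: power2_diff field_simps power2_eq_square)
      finally show ?thesis unfolding q_def s(1)[symmetric] using s(2) by simp
    qed
    then have "exp (q (\<theta> - \<theta>\<^sub>0)) = exp (V\<^sup>2 / (2 * I)) * exp (- (\<theta> - m)\<^sup>2 / (2 * v))"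
      by (simp add: exp_add[symmetric])
    then show ?thesis unfolding Z_def normal_density_def v_def[symmetric] using v by simp
  qed
  \<comment> \<open>Splitting \<open>\<theta> - \<theta>\<^sub>0\<close> at the mean
    \<open>m\<close> doubles the squares, and \<open>I / 8\<close> is then exactly the level at
    which the exponent becomes \<open>(\<theta> - m)\<^sup>2 / (4 * v)\<close>, for which the
    variance doubling applies.\<close>
  have moment: "(\<integral>\<^sup>+\<theta>. ennreal (exp (?d * ?y \<theta>) * ?\<phi> \<theta>) \<partial>lborel) \<le> ennreal Q"
  proof -
    have le: "exp (?d * ?y \<theta>) * ?\<phi> \<theta>
        \<le> exp (?d * (1 + 2 * V\<^sup>2 / I\<^sup>2)) * (?\<phi> \<theta> * exp ((\<theta> - m)\<^sup>2 / (4 * (sqrt v)\<^sup>2)))" for \<theta>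
    proof -
      have "(\<theta> - \<theta>\<^sub>0)\<^sup>2 \<le> 2 * (\<theta> - m)\<^sup>2 + 2 * (m - \<theta>\<^sub>0)\<^sup>2"
      proof -
        have "0 \<le> ((\<theta> - m) - (m - \<theta>\<^sub>0))\<^sup>2" by simp
        then show ?thesis by (simp add: power2_eq_square algebra_simps)
      qed
      then have "real n * (\<theta> - \<theta>\<^sub>0)\<^sup>2 \<le> real n * (2 * (\<theta> - m)\<^sup>2 + 2 * (m - \<theta>\<^sub>0)\<^sup>2)"
        by (intro mult_left_mono) auto
      also have "real n * (2 * (\<theta> - m)\<^sup>2 + 2 * (m - \<theta>\<^sub>0)\<^sup>2) = 2 * real n * (\<theta> - m)\<^sup>2 + 2 * V\<^sup>2 / I\<^sup>2"
        using n I by (simp add: m_def power_mult_distrib power_divide field_simps)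
      finally have "?d * ?y \<theta> \<le> ?d * (1 + (2 * real n * (\<theta> - m)\<^sup>2 + 2 * V\<^sup>2 / I\<^sup>2))"
        using I by (intro mult_left_mono) auto
      also have "\<dots> = ?d * (1 + 2 * V\<^sup>2 / I\<^sup>2) + (\<theta> - m)\<^sup>2 / (4 * v)"
        using n I by (simp add: v_def field_simps)
      finally have "exp (?d * ?y \<theta>) \<le> exp (?d * (1 + 2 * V\<^sup>2 / I\<^sup>2)) * exp ((\<theta> - m)\<^sup>2 / (4 * v))"
        by (simp add: exp_add[symmetric])
      then have "exp (?d * ?y \<theta>) * ?\<phi> \<theta> \<le> (exp (?d * (1 + 2 * V\<^sup>2 / I\<^sup>2)) * exp ((\<theta> - m)\<^sup>2 / (4 * v))) * ?\<phi> \<theta>"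
        by (rule mult_right_mono) simp
      then show ?thesis using v by (simp add: mult_ac)
    qed
    have "(\<integral>\<^sup>+\<theta>. ennreal (exp (?d * ?y \<theta>) * ?\<phi> \<theta>) \<partial>lborel)
      \<le> (\<integral>\<^sup>+\<theta>. ennreal (exp (?d * (1 + 2 * V\<^sup>2 / I\<^sup>2))) * ennreal (?\<phi> \<theta> * exp ((\<theta> - m)\<^sup>2 / (4 * (sqrt v)\<^sup>2))) \<partial>lborel)"
      by (intro nn_integral_mono, subst ennreal_mult[symmetric], simp, simp, intro ennreal_leI le)
    also have "\<dots> = ennreal (exp (?d * (1 + 2 * V\<^sup>2 / I\<^sup>2))) * ennreal (sqrt 2)"
      by (subst nn_integral_cmult, measurable, subst nn_integral_normal_exp_square) (use v in auto)
    also have "\<dots> = ennreal Q" by (simp add: Q_def ennreal_mult[symmetric] mult.commute)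
    finally show ?thesis .
  qed
  have d: "0 < ?d" "8 * \<delta> / I = \<delta> / ?d" using I by auto
  {
    assume F: "F \<in> sets borel"
    have "(\<integral>\<^sup>+\<theta>\<in>F. ennreal (exp (\<delta> * ?y \<theta> + q (\<theta> - \<theta>\<^sub>0))) \<partial>lborel)
        \<le> (\<integral>\<^sup>+\<theta>. ennreal Z * (ennreal (?\<phi> \<theta>) * indicator F \<theta> + ennreal (8 * \<delta> / I) * ennreal (exp (?d * ?y \<theta>) * ?\<phi> \<theta>)) \<partial>lborel)"
    proof (rule nn_integral_mono)
      fix \<theta>
      have "exp (\<delta> * ?y \<theta> + q (\<theta> - \<theta>\<^sub>0)) = exp (\<delta> * ?y \<theta>) * (Z * ?\<phi> \<theta>)"
        unfolding exp_add dens ..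
      also have "\<dots> \<le> (1 + 8 * \<delta> / I * exp (?d * ?y \<theta>)) * (Z * ?\<phi> \<theta>)"
        unfolding d(2) using Z by (intro mult_right_mono exp_chord \<delta> d) auto
      also have "\<dots> = Z * (?\<phi> \<theta> + 8 * \<delta> / I * (exp (?d * ?y \<theta>) * ?\<phi> \<theta>))"
        by (simp add: algebra_simps)
      finally have "ennreal (exp (\<delta> * ?y \<theta> + q (\<theta> - \<theta>\<^sub>0)))
          \<le> ennreal Z * (ennreal (?\<phi> \<theta>) + ennreal (8 * \<delta> / I) * ennreal (exp (?d * ?y \<theta>) * ?\<phi> \<theta>))"
        using Z \<delta> I by (simp add: ennreal_mult[symmetric] ennreal_plus[symmetric] ennreal_leI del: ennreal_plus)
      then show "ennreal (exp (\<delta> * ?y \<theta> + q (\<theta> - \<theta>\<^sub>0))) * indicator F \<theta>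
          \<le> ennreal Z * (ennreal (?\<phi> \<theta>) * indicator F \<theta> + ennreal (8 * \<delta> / I) * ennreal (exp (?d * ?y \<theta>) * ?\<phi> \<theta>))"
        by (auto simp: indicator_def)
    qed
    also have "\<dots> = ennreal Z * (emeasure N F + ennreal (8 * \<delta> / I) * (\<integral>\<^sup>+\<theta>. ennreal (exp (?d * ?y \<theta>) * ?\<phi> \<theta>) \<partial>lborel))"
      using F by (subst nn_integral_cmult, measurable, subst nn_integral_add, measurable, subst nn_integral_cmult, measurable)
        (simp add: N_emeasure)
    also have "\<dots> \<le> ennreal Z * (emeasure N F + ennreal (8 * \<delta> / I) * ennreal Q)"
      by (intro mult_left_mono add_left_mono moment) auto
    also have "\<dots> = ennreal (Z * (measure N F + Q * (8 * \<delta> / I)))"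
      using Z Q \<delta> I by (simp add: N.emeasure_eq_measure ennreal_mult[symmetric] ennreal_plus[symmetric] mult.commute del: ennreal_plus)
    finally show "(\<integral>\<^sup>+\<theta>\<in>F. ennreal (exp (\<delta> * ?y \<theta> + q (\<theta> - \<theta>\<^sub>0))) \<partial>lborel)
        \<le> ennreal (Z * (measure N F + Q * (8 * \<delta> / I)))" .
  }
  {
    assume \<tau>: "0 \<le> \<tau>"
    let ?T = "{\<theta>\<^sub>0 - \<tau><..<\<theta>\<^sub>0 + \<tau>}"
    let ?L = "\<integral>\<^sup>+\<theta>\<in>?T. ennreal (exp (- (\<delta> * ?y \<theta>) + q (\<theta> - \<theta>\<^sub>0))) \<partial>lborel"
    let ?c = "8 * \<delta> / I + exp (- (?d * real n * \<tau>\<^sup>2))"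
    have c0: "0 \<le> ?c" using \<delta> I by (intro add_nonneg_nonneg) auto
    have "ennreal Z = (\<integral>\<^sup>+\<theta>. ennreal Z * ennreal (?\<phi> \<theta>) \<partial>lborel)"
      by (subst nn_integral_cmult) (auto simp: N_all)
    also have "\<dots> \<le> (\<integral>\<^sup>+\<theta>. ennreal (exp (- (\<delta> * ?y \<theta>) + q (\<theta> - \<theta>\<^sub>0))) * indicator ?T \<theta>
        + ennreal (Z * ?c) * ennreal (exp (?d * ?y \<theta>) * ?\<phi> \<theta>) \<partial>lborel)"
    proof (rule nn_integral_mono)
      fix \<theta>
      \<comment> \<open>Inside the interval the loss \<open>\<delta> * ?y \<theta>\<close> is paid
        by the first part of \<open>?c\<close>; outside, the second part pays because the moment
        weight is at least \<open>exp (?d * real n * \<tau>\<^sup>2)\<close> there.\<close>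
      have "1 \<le> exp (- (\<delta> * ?y \<theta>)) * indicator ?T \<theta> + ?c * exp (?d * ?y \<theta>)"
      proof (cases "\<theta> \<in> ?T")
        case True
        have "1 - \<delta> * ?y \<theta> \<le> exp (- (\<delta> * ?y \<theta>))" using exp_ge_add_one_self[of "- (\<delta> * ?y \<theta>)"] by simp
        moreover have "\<delta> * ?y \<theta> \<le> 8 * \<delta> / I * exp (?d * ?y \<theta>)"
        proof -
          have "?d * ?y \<theta> \<le> exp (?d * ?y \<theta>)" using exp_ge_add_one_self[of "?d * ?y \<theta>"] by linarith
          then have "8 * \<delta> / I * (?d * ?y \<theta>) \<le> 8 * \<delta> / I * exp (?d * ?y \<theta>)"
            using \<delta> I by (intro mult_left_mono) auto
          then show ?thesis using I by simp
        qed
        moreover have "8 * \<delta> / I * exp (?d * ?y \<theta>) \<le> ?c * exp (?d * ?y \<theta>)"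
          by (intro mult_right_mono) auto
        ultimately show ?thesis using True by simp
      next
        case False
        then have "\<tau> \<le> \<bar>\<theta> - \<theta>\<^sub>0\<bar>" by auto
        then have "\<tau>\<^sup>2 \<le> (\<theta> - \<theta>\<^sub>0)\<^sup>2" using \<tau> by (metis abs_le_square_iff abs_of_nonneg)
        then have "real n * \<tau>\<^sup>2 \<le> real n * (\<theta> - \<theta>\<^sub>0)\<^sup>2" by (rule mult_left_mono) simp
        then have "?d * (real n * \<tau>\<^sup>2) \<le> ?d * ?y \<theta>" by (intro mult_left_mono) (use I in auto)
        then have "?d * real n * \<tau>\<^sup>2 \<le> ?d * ?y \<theta>" by (simp only: mult.assoc)
        then have "1 \<le> exp (- (?d * real n * \<tau>\<^sup>2) + ?d * ?y \<theta>)" by simp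
        also have "\<dots> = exp (- (?d * real n * \<tau>\<^sup>2)) * exp (?d * ?y \<theta>)" by (rule exp_add)
        also have "\<dots> \<le> ?c * exp (?d * ?y \<theta>)"
          using \<delta> I by (intro mult_right_mono) auto
        finally show ?thesis using False by simp
      qed
      then have "(Z * ?\<phi> \<theta>) * 1 \<le> (Z * ?\<phi> \<theta>) * (exp (- (\<delta> * ?y \<theta>)) * indicator ?T \<theta> + ?c * exp (?d * ?y \<theta>))"
        using Z by (intro mult_left_mono) auto
      also have "\<dots> = exp (- (\<delta> * ?y \<theta>) + q (\<theta> - \<theta>\<^sub>0)) * indicator ?T \<theta> + Z * ?c * (exp (?d * ?y \<theta>) * ?\<phi> \<theta>)"
        unfolding exp_add dens by (simp add: algebra_simps)
      finally have "Z * ?\<phi> \<theta> \<le> \<dots>" by simp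
      then have "ennreal (Z * ?\<phi> \<theta>) \<le> ennreal (exp (- (\<delta> * ?y \<theta>) + q (\<theta> - \<theta>\<^sub>0)) * indicator ?T \<theta> + Z * ?c * (exp (?d * ?y \<theta>) * ?\<phi> \<theta>))"
        by (rule ennreal_leI)
      also have "\<dots> = ennreal (exp (- (\<delta> * ?y \<theta>) + q (\<theta> - \<theta>\<^sub>0)) * indicator ?T \<theta>) + ennreal (Z * ?c * (exp (?d * ?y \<theta>) * ?\<phi> \<theta>))"
        using Z c0 by (intro ennreal_plus) (auto intro!: mult_nonneg_nonneg)
      also have "\<dots> = ennreal (exp (- (\<delta> * ?y \<theta>) + q (\<theta> - \<theta>\<^sub>0))) * indicator ?T \<theta>
        + ennreal (Z * ?c) * ennreal (exp (?d * ?y \<theta>) * ?\<phi> \<theta>)"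
        using Z c0 by (subst ennreal_mult) (auto simp: indicator_def)
      finally show "ennreal Z * ennreal (?\<phi> \<theta>) \<le> ennreal (exp (- (\<delta> * ?y \<theta>) + q (\<theta> - \<theta>\<^sub>0))) * indicator ?T \<theta>
        + ennreal (Z * ?c) * ennreal (exp (?d * ?y \<theta>) * ?\<phi> \<theta>)"
        using Z by (simp add: ennreal_mult)
    qed
    also have "\<dots> = ?L + ennreal (Z * ?c) * (\<integral>\<^sup>+\<theta>. ennreal (exp (?d * ?y \<theta>) * ?\<phi> \<theta>) \<partial>lborel)"
      unfolding q_def by (subst nn_integral_add, measurable, subst nn_integral_cmult, measurable)
    also have "\<dots> \<le> ?L + ennreal (Z * ?c) * ennreal Q"
      by (intro add_left_mono mult_left_mono moment) auto
    finally have le: "ennreal Z \<le> ?L + ennreal (Z * ?c * Q)"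
      using Z c0 Q by (simp add: ennreal_mult)
    have "ennreal (Z * (1 - Q * (8 * \<delta> / I) - Q * exp (- (?d * real n * \<tau>\<^sup>2)))) = ennreal (Z - Z * ?c * Q)"
      by (simp add: algebra_simps)
    also have "\<dots> = ennreal Z - ennreal (Z * ?c * Q)"
      by (intro ennreal_minus[symmetric] mult_nonneg_nonneg c0 Q less_imp_le[OF Z])
    also have "\<dots> \<le> ?L" using le by (simp add: ennreal_minus_le_iff add.commute)
    finally show "ennreal (Z * (1 - Q * (8 * \<delta> / I) - Q * exp (- (?d * real n * \<tau>\<^sup>2)))) \<le> ?L" .
  }
qed

text \<open>The bound applied to the complement of \<open>F\<close> gives the reverse inequality, as
  both measures have total mass one. The factor 2 is that of the normalisation of
  \<open>tv_dist\<close>.\<close>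

lemma tv_dist_le:
  assumes P: "prob_space P" "sets P = sets borel" and N: "prob_space N" "sets N = sets borel"
    and le: "\<And>F. F \<in> sets borel \<Longrightarrow> measure P F \<le> measure N F + y"
  shows "\<bar>tv_dist P N\<bar> \<le> 2 * y"
proof -
  interpret P: prob_space P by fact
  interpret N: prob_space N by fact
  have sp: "space P = UNIV" "space N = UNIV" using P(2) N(2) by (auto dest: sets_eq_imp_space_eq)
  have abs_le: "\<bar>measure P F - measure N F\<bar> \<le> y" if F: "F \<in> sets borel" for F
  proof -
    have "measure P (- F) = 1 - measure P F" "measure N (- F) = 1 - measure N F"
      using P.prob_compl[of F] N.prob_compl[of F] F P(2) N(2) by (auto simp: sp Compl_eq_Diff_UNIV)
    then show ?thesis using le[OF F] le[of "- F"] F by (auto simp: abs_le_iff)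
  qed
  have "(SUP F\<in>sets borel. \<bar>measure P F - measure N F\<bar>) \<le> y"
    by (rule cSUP_least) (use abs_le in auto)
  moreover have "\<bar>measure P {} - measure N {}\<bar> \<le> (SUP F\<in>sets borel. \<bar>measure P F - measure N F\<bar>)"
    by (rule cSUP_upper) (use abs_le in \<open>auto intro!: bdd_aboveI2\<close>)
  ultimately show ?thesis unfolding tv_dist_def by simp
qed


section \<open>Events of vanishing outer probability\<close>

text \<open>Phrased with measurable covers and only for large \<open>n\<close>: total variation
  distances of posteriors are not known to be measurable in the data, and the transport of the data
  degenerates at \<open>n = 0\<close>.\<close>

definition vanishing :: "'z measure \<Rightarrow> (nat \<Rightarrow> 'z set) \<Rightarrow> bool" where
  "vanishing \<mu> A \<longleftrightarrow> (\<forall>\<omega>>0. \<forall>\<^sub>F n in sequentially. \<exists>B\<in>sets \<mu>. A n \<subseteq> B \<and> emeasure \<mu> B < ennreal \<omega>)"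

lemma vanishing_mono:
  assumes "vanishing \<mu> B" and "\<forall>\<^sub>F n in sequentially. A n \<subseteq> B n"
  shows "vanishing \<mu> A"
  unfolding vanishing_def
proof (intro allI impI)
  fix \<omega> :: real assume "0 < \<omega>"
  then have "\<forall>\<^sub>F n in sequentially. \<exists>C\<in>sets \<mu>. B n \<subseteq> C \<and> emeasure \<mu> C < ennreal \<omega>"
    using assms(1) by (simp add: vanishing_def)
  with assms(2) show "\<forall>\<^sub>F n in sequentially. \<exists>C\<in>sets \<mu>. A n \<subseteq> C \<and> emeasure \<mu> C < ennreal \<omega>"
    by eventually_elim blast
qed

lemma vanishing_Un:
  assumes "vanishing \<mu> A" and "vanishing \<mu> B"
  shows "vanishing \<mu> (\<lambda>n. A n \<union> B n)"
  unfolding vanishing_def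
proof (intro allI impI)
  fix \<omega> :: real assume "0 < \<omega>"
  then have "0 < \<omega> / 2" by simp
  then have "\<forall>\<^sub>F n in sequentially. \<exists>C\<in>sets \<mu>. A n \<subseteq> C \<and> emeasure \<mu> C < ennreal (\<omega> / 2)"
    and "\<forall>\<^sub>F n in sequentially. \<exists>C\<in>sets \<mu>. B n \<subseteq> C \<and> emeasure \<mu> C < ennreal (\<omega> / 2)"
    using assms unfolding vanishing_def by blast+
  then show "\<forall>\<^sub>F n in sequentially. \<exists>C\<in>sets \<mu>. A n \<union> B n \<subseteq> C \<and> emeasure \<mu> C < ennreal \<omega>"
  proof eventually_elim
    case (elim n)
    then obtain C D where C: "C \<in> sets \<mu>" "A n \<subseteq> C" "emeasure \<mu> C < ennreal (\<omega> / 2)"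
      and D: "D \<in> sets \<mu>" "B n \<subseteq> D" "emeasure \<mu> D < ennreal (\<omega> / 2)" by blast
    have "emeasure \<mu> (C \<union> D) \<le> emeasure \<mu> C + emeasure \<mu> D"
      by (rule emeasure_subadditive) (use C D in auto)
    also have "\<dots> < ennreal (\<omega> / 2) + ennreal (\<omega> / 2)"
      using C(3) D(3) by (rule add_strict_mono)
    also have "\<dots> = ennreal \<omega>" using \<open>0 < \<omega>\<close> by (simp add: ennreal_plus[symmetric] del: ennreal_plus)
    finally show ?case using C D by (intro bexI[of _ "C \<union> D"]) auto
  qed
qed

lemma vanishing_AE:
  assumes "\<forall>\<^sub>F n in sequentially. AE z in \<mu>. z \<notin> A n" and "\<And>n. A n \<subseteq> space \<mu>"
  shows "vanishing \<mu> A"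
  unfolding vanishing_def
proof (intro allI impI)
  fix \<omega> :: real assume "0 < \<omega>"
  from assms(1) show "\<forall>\<^sub>F n in sequentially. \<exists>B\<in>sets \<mu>. A n \<subseteq> B \<and> emeasure \<mu> B < ennreal \<omega>"
  proof eventually_elim
    case (elim n)
    then obtain N where "N \<in> null_sets \<mu>" "{z \<in> space \<mu>. \<not> z \<notin> A n} \<subseteq> N"
      by (auto simp: eventually_ae_filter)
    then show ?case using assms(2)[of n] \<open>0 < \<omega>\<close> by (intro bexI[of _ N]) (auto simp: null_sets_def)
  qed
qed

lemma vanishing_emeasure:
  assumes "\<forall>\<^sub>F n in sequentially. A n \<in> sets \<mu> \<and> emeasure \<mu> (A n) \<le> ennreal (a n)" and "a \<longlonglongrightarrow> 0"
  shows "vanishing \<mu> A"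
  unfolding vanishing_def
proof (intro allI impI)
  fix \<omega> :: real assume "0 < \<omega>"
  from order_tendstoD(2)[OF assms(2) this] assms(1)
  show "\<forall>\<^sub>F n in sequentially. \<exists>B\<in>sets \<mu>. A n \<subseteq> B \<and> emeasure \<mu> B < ennreal \<omega>"
  proof eventually_elim
    case (elim n)
    then have "ennreal (a n) < ennreal \<omega>" using \<open>0 < \<omega>\<close> by (simp add: ennreal_less_iff ennreal_lessI)
    then show ?case using elim by (intro bexI[of _ "A n"]) auto
  qed
qed

text \<open>A single random variable is tight: its large values can be put into one event of small
  probability, independent of \<open>n\<close>. On the rest all constants may depend on
  \<open>M\<close>.\<close>

lemma vanishing_if_bounded:
  assumes \<mu>: "prob_space \<mu>" and [measurable]: "Y \<in> borel_measurable \<mu>"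
    and A: "\<And>M. 0 < M \<Longrightarrow> vanishing \<mu> (\<lambda>n. A n \<inter> {z \<in> space \<mu>. \<bar>Y z :: real\<bar> \<le> M})" and sub: "\<And>n. A n \<subseteq> space \<mu>"
  shows "vanishing \<mu> A"
  unfolding vanishing_def
proof (intro allI impI)
  fix \<omega> :: real assume "0 < \<omega>"
  interpret prob_space \<mu> by fact
  have "(\<lambda>k. measure \<mu> {z \<in> space \<mu>. real k < \<bar>Y z\<bar>}) \<longlonglongrightarrow> measure \<mu> (\<Inter>k. {z \<in> space \<mu>. real k < \<bar>Y z\<bar>})"
    by (rule finite_Lim_measure_decseq) (auto simp: decseq_def)
  also have "(\<Inter>k. {z \<in> space \<mu>. real k < \<bar>Y z\<bar>}) = {}"
  proof -
    have "\<exists>k. \<not> real k < \<bar>Y z\<bar>" for z using real_arch_simple[of "\<bar>Y z\<bar>"] by (auto simp: not_less)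
    then show ?thesis by blast
  qed
  finally have "(\<lambda>k. measure \<mu> {z \<in> space \<mu>. real k < \<bar>Y z\<bar>}) \<longlonglongrightarrow> 0" by simp
  then have "\<forall>\<^sub>F k in sequentially. measure \<mu> {z \<in> space \<mu>. real k < \<bar>Y z\<bar>} < \<omega> / 2"
    using \<open>0 < \<omega>\<close> by (intro order_tendstoD) auto
  then obtain k where k: "measure \<mu> {z \<in> space \<mu>. real k < \<bar>Y z\<bar>} < \<omega> / 2"
    using eventually_happens by force
  define M where "M = real (Suc k)"
  have "measure \<mu> {z \<in> space \<mu>. M < \<bar>Y z\<bar>} \<le> measure \<mu> {z \<in> space \<mu>. real k < \<bar>Y z\<bar>}"
    by (rule finite_measure_mono) (auto simp: M_def)
  with k have M: "emeasure \<mu> {z \<in> space \<mu>. M < \<bar>Y z\<bar>} < ennreal (\<omega> / 2)"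
    by (simp add: emeasure_eq_measure ennreal_less_iff)
  have "\<forall>\<^sub>F n in sequentially. \<exists>B\<in>sets \<mu>. A n \<inter> {z \<in> space \<mu>. \<bar>Y z\<bar> \<le> M} \<subseteq> B \<and> emeasure \<mu> B < ennreal (\<omega> / 2)"
    using A[of M] \<open>0 < \<omega>\<close> by (simp add: vanishing_def M_def)
  then show "\<forall>\<^sub>F n in sequentially. \<exists>B\<in>sets \<mu>. A n \<subseteq> B \<and> emeasure \<mu> B < ennreal \<omega>"
  proof eventually_elim
    case (elim n)
    then obtain B where B: "B \<in> sets \<mu>" "A n \<inter> {z \<in> space \<mu>. \<bar>Y z\<bar> \<le> M} \<subseteq> B" "emeasure \<mu> B < ennreal (\<omega> / 2)"
      by blast
    let ?C = "B \<union> {z \<in> space \<mu>. M < \<bar>Y z\<bar>}"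
    have "emeasure \<mu> ?C \<le> emeasure \<mu> B + emeasure \<mu> {z \<in> space \<mu>. M < \<bar>Y z\<bar>}"
      by (rule emeasure_subadditive) (use B in auto)
    also have "\<dots> < ennreal (\<omega> / 2) + ennreal (\<omega> / 2)"
      using B(3) M by (rule add_strict_mono)
    also have "\<dots> = ennreal \<omega>" using \<open>0 < \<omega>\<close> by (simp add: ennreal_plus[symmetric] del: ennreal_plus)
    finally have "emeasure \<mu> ?C < ennreal \<omega>" .
    moreover have "A n \<subseteq> ?C" using B(2) sub[of n] by (auto simp: not_le[symmetric])
    moreover have "?C \<in> sets \<mu>" using B(1) by measurable
    ultimately show ?case by blast
  qed
qed

lemma tendsto_in_prob_distrD:
  assumes lim: "tendsto_in_prob (\<lambda>n. distr \<mu> N (T n)) Y c"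
    and T [measurable]: "\<And>n. T n \<in> \<mu> \<rightarrow>\<^sub>M N" and "0 < \<delta>"
  shows "vanishing \<mu> (\<lambda>n. {z \<in> space \<mu>. \<delta> < \<bar>Y n (T n z) - c\<bar>})"
  unfolding vanishing_def
proof (intro allI impI)
  fix \<omega> :: real assume "0 < \<omega>"
  let ?A = "\<lambda>n. {x \<in> space (distr \<mu> N (T n)). \<bar>Y n x - c\<bar> > \<delta>}"
  have "(\<lambda>n. outer_measure_of (distr \<mu> N (T n)) (?A n)) \<longlonglongrightarrow> 0"
    using lim \<open>0 < \<delta>\<close> by (simp add: tendsto_in_prob_def)
  then have "\<forall>\<^sub>F n in sequentially. outer_measure_of (distr \<mu> N (T n)) (?A n) < ennreal \<omega>"
    using \<open>0 < \<omega>\<close> by (intro order_tendstoD) auto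
  then show "\<forall>\<^sub>F n in sequentially. \<exists>B\<in>sets \<mu>. {z \<in> space \<mu>. \<delta> < \<bar>Y n (T n z) - c\<bar>} \<subseteq> B \<and> emeasure \<mu> B < ennreal \<omega>"
  proof eventually_elim
    case (elim n)
    then obtain B where B: "B \<in> sets N" "?A n \<subseteq> B" "emeasure (distr \<mu> N (T n)) B < ennreal \<omega>"
      unfolding outer_measure_of_def by (auto simp: INF_less_iff)
    have "{z \<in> space \<mu>. \<delta> < \<bar>Y n (T n z) - c\<bar>} \<subseteq> T n -` B \<inter> space \<mu>"
      using B(2) measurable_space[OF T[of n]] by auto
    moreover have "emeasure \<mu> (T n -` B \<inter> space \<mu>) < ennreal \<omega>"
      using B by (simp add: emeasure_distr)
    ultimately show ?case using B(1) by (intro bexI[of _ "T n -` B \<inter> space \<mu>"]) auto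
  qed
qed

text \<open>A measurable cover on the noise side has to become a measurable cover on the data side,
  which is its preimage under the measurable inverse \<open>T' n\<close>.\<close>

lemma tendsto_in_prob_distrI:
  assumes van: "\<And>\<delta>. 0 < \<delta> \<Longrightarrow> vanishing \<mu> (\<lambda>n. {z \<in> space \<mu>. \<delta> < \<bar>Y n (T n z) - c\<bar>})"
    and T: "\<And>n. T n \<in> \<mu> \<rightarrow>\<^sub>M N" and T': "\<And>n. 1 \<le> n \<Longrightarrow> T' n \<in> N \<rightarrow>\<^sub>M \<mu>"
    and inv: "\<And>n z. 1 \<le> n \<Longrightarrow> z \<in> space \<mu> \<Longrightarrow> T' n (T n z) = z"
      "\<And>n x. 1 \<le> n \<Longrightarrow> x \<in> space N \<Longrightarrow> T n (T' n x) = x"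
  shows "tendsto_in_prob (\<lambda>n. distr \<mu> N (T n)) Y c"
  unfolding tendsto_in_prob_def
proof (intro allI impI)
  fix \<delta> :: real assume "0 < \<delta>"
  let ?A = "\<lambda>n. {x \<in> space (distr \<mu> N (T n)). \<bar>Y n x - c\<bar> > \<delta>}"
  show "(\<lambda>n. outer_measure_of (distr \<mu> N (T n)) (?A n)) \<longlonglongrightarrow> 0"
  proof (rule order_tendstoI)
    fix a :: ennreal assume "0 < a"
    then obtain b where b: "0 < b" "b < a" using dense by blast
    have "b < top" using b(2) top_greatest by (rule order_less_le_trans)
    then obtain \<omega> where "b = ennreal \<omega>" by (cases b) auto
    with b have \<omega>: "0 < ennreal \<omega>" "ennreal \<omega> < a" by auto
    have "\<forall>\<^sub>F n in sequentially. \<exists>B\<in>sets \<mu>. {z \<in> space \<mu>. \<delta> < \<bar>Y n (T n z) - c\<bar>} \<subseteq> B \<and> emeasure \<mu> B < ennreal \<omega>"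
      using van[OF \<open>0 < \<delta>\<close>] \<omega>(1) by (simp add: vanishing_def)
    then show "\<forall>\<^sub>F n in sequentially. outer_measure_of (distr \<mu> N (T n)) (?A n) < a"
      using eventually_ge_at_top[of 1]
    proof eventually_elim
      case (elim n)
      then obtain B where B: "B \<in> sets \<mu>" "{z \<in> space \<mu>. \<delta> < \<bar>Y n (T n z) - c\<bar>} \<subseteq> B" "emeasure \<mu> B < ennreal \<omega>"
        by blast
      let ?B = "T' n -` B \<inter> space N"
      have sB: "?B \<in> sets N" using T'[OF elim(2)] B(1) by (rule measurable_sets)
      have "?A n \<subseteq> ?B"
      proof
        fix x assume x: "x \<in> ?A n"
        then have "T' n x \<in> space \<mu>" using measurable_space[OF T'[OF elim(2)]] by simp
        moreover have "T n (T' n x) = x" using inv(2)[OF elim(2)] x by simp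
        ultimately show "x \<in> ?B" using B(2) x by auto
      qed
      moreover have "T n -` ?B \<inter> space \<mu> = B"
        using inv(1)[OF elim(2)] measurable_space[OF T[of n]] sets.sets_into_space[OF B(1)] by auto
      ultimately have "outer_measure_of (distr \<mu> N (T n)) (?A n) \<le> emeasure \<mu> B"
        using emeasure_distr[OF T sB] sB unfolding outer_measure_of_def
        by (intro INF_lower2[of ?B]) auto
      also have "\<dots> < ennreal \<omega>" by (rule B(3))
      also have "\<dots> < a" by (rule \<omega>(2))
      finally show ?case .
    qed
  qed simp
qed


section \<open>Posterior distributions\<close>

lemma emeasure_bayes:
  assumes [measurable]: "L \<in> borel_measurable M" "A \<in> sets M"
  shows "emeasure (bayes M L) A = (\<integral>\<^sup>+z\<in>A. ennreal (L z) \<partial>M) / (\<integral>\<^sup>+z. ennreal (L z) \<partial>M)"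
proof -
  let ?D = "\<integral>\<^sup>+z. ennreal (L z) \<partial>M"
  have "emeasure (bayes M L) A = (\<integral>\<^sup>+z\<in>A. (ennreal (L z) / ?D) \<partial>M)"
    unfolding bayes_def by (rule emeasure_density) measurable
  also have "\<dots> = (\<integral>\<^sup>+z. (ennreal (L z) * indicator A z) / ?D \<partial>M)"
    by (intro nn_integral_cong) (auto simp: indicator_def)
  also have "\<dots> = (\<integral>\<^sup>+z\<in>A. ennreal (L z) \<partial>M) / ?D"
    by (rule nn_integral_divide) measurable
  finally show ?thesis .
qed

lemma sets_bayes [simp, measurable_cong]: "sets (bayes M L) = sets M"
  and space_bayes [simp]: "space (bayes M L) = space M"
  by (simp_all add: bayes_def)

text \<open>A factor that is constant in the parameter cancels between numerator and
  evidence.\<close>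

lemma bayes_cong_AE:
  assumes c: "0 < c" and L: "L \<in> borel_measurable M" and L': "L' \<in> borel_measurable M"
    and eq: "AE z in M. L z = c * L' z"
  shows "bayes M L = bayes M L'"
proof -
  have e: "AE z in M. ennreal (L z) = ennreal c * ennreal (L' z)"
    using eq by eventually_elim (use c in \<open>simp add: ennreal_mult'\<close>)
  have "(\<integral>\<^sup>+w. ennreal (L w) \<partial>M) = (\<integral>\<^sup>+w. ennreal c * ennreal (L' w) \<partial>M)"
    by (rule nn_integral_cong_AE[OF e])
  also have "\<dots> = ennreal c * (\<integral>\<^sup>+w. ennreal (L' w) \<partial>M)"
    using L' by (intro nn_integral_cmult) auto
  finally have D: "(\<integral>\<^sup>+w. ennreal (L w) \<partial>M) = ennreal c * (\<integral>\<^sup>+w. ennreal (L' w) \<partial>M)" .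
  show ?thesis
    unfolding bayes_def
  proof (rule density_cong)
    show "AE z in M. ennreal (L z) / (\<integral>\<^sup>+w. ennreal (L w) \<partial>M) = ennreal (L' z) / (\<integral>\<^sup>+w. ennreal (L' w) \<partial>M)"
      using e
    proof eventually_elim
      case (elim z)
      show ?case
        unfolding elim D mult.commute[of "ennreal c"] using c by (intro divide_mult_eq) auto
    qed
  qed (use L L' in measurable)
qed

lemma nn_integral_param_prior:
  assumes \<Theta>: "\<Theta> \<in> sets borel" and p: "p \<in> borel_measurable (restrict_space lborel \<Theta>)"
    and f: "f \<in> borel_measurable (restrict_space lborel \<Theta>)"
  shows "(\<integral>\<^sup>+\<theta>. f \<theta> \<partial>param_prior \<Theta> p) = (\<integral>\<^sup>+\<theta>\<in>\<Theta>. (ennreal (p \<theta>) * f \<theta>) \<partial>lborel)"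
  unfolding param_prior_def
  using assms by (subst nn_integral_density) (auto simp: nn_integral_restrict_space)

lemma sets_param_prior [simp, measurable_cong]: "sets (param_prior \<Theta> p) = sets (restrict_space borel \<Theta>)"
  unfolding param_prior_def by (simp add: sets_restrict_space)

lemma space_param_prior [simp]: "space (param_prior \<Theta> p) = \<Theta>"
  by (simp add: param_prior_def space_restrict_space)

text \<open>Here \<open>u\<close> and \<open>l\<close> are the upper and the lower bound, up to the factors \<open>d0\<close> and \<open>g0\<close>, of
  the integrated likelihood of the parameter.\<close>

lemma posterior_marginal_bound:
  fixes \<nu> :: "'h::topological_space measure" and R :: "real \<Rightarrow> 'h \<Rightarrow> real" and NF :: "real set \<Rightarrow> real"
  assumes \<Theta> [measurable]: "\<Theta> \<in> sets borel" and p [measurable]: "p \<in> borel_measurable (restrict_space lborel \<Theta>)"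
    and prior: "prob_space (param_prior \<Theta> p)" and \<nu>: "prob_space \<nu>"
    and R [measurable]: "(\<lambda>(\<theta>, f). R \<theta> f) \<in> borel_measurable (param_prior \<Theta> p \<Otimes>\<^sub>M \<nu>)"
    and G [measurable]: "G \<in> sets \<nu>"
    and x: "0 < x" "x < 1 / 4" and p0: "0 < p0"
    and E: "{\<theta>\<^sub>0 - \<epsilon><..<\<theta>\<^sub>0 + \<epsilon>} \<subseteq> \<Theta>" and \<tau>: "\<tau> \<le> \<epsilon>"
    and p_le: "\<And>\<theta>. \<theta> \<in> {\<theta>\<^sub>0 - \<epsilon><..<\<theta>\<^sub>0 + \<epsilon>} \<Longrightarrow> p \<theta> \<le> (1 + x) * p0"
    and p_ge: "\<And>\<theta>. \<theta> \<in> {\<theta>\<^sub>0 - \<epsilon><..<\<theta>\<^sub>0 + \<epsilon>} \<Longrightarrow> (1 - x) * p0 \<le> p \<theta>"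
    and post: "1 - x \<le> measure (bayes (param_prior \<Theta> p \<Otimes>\<^sub>M \<nu>) (\<lambda>(\<theta>, f). R \<theta> f)) ({\<theta>\<^sub>0 - \<epsilon><..<\<theta>\<^sub>0 + \<epsilon>} \<times> G)"
    and d0: "0 < d0" and g0: "(1 - x) * d0 \<le> g0"
    and u [measurable]: "u \<in> borel_measurable borel" and l [measurable]: "l \<in> borel_measurable borel"
    and u0: "\<And>\<theta>. 0 \<le> u \<theta>" and l0: "\<And>\<theta>. 0 \<le> l \<theta>"
    and U: "AE \<theta> in param_prior \<Theta> p. \<theta> \<in> {\<theta>\<^sub>0 - \<epsilon><..<\<theta>\<^sub>0 + \<epsilon>} \<longrightarrow> (\<integral>\<^sup>+f\<in>G. ennreal (R \<theta> f) \<partial>\<nu>) \<le> ennreal (d0 * u \<theta>)"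
    and L: "AE \<theta> in param_prior \<Theta> p. \<theta> \<in> {\<theta>\<^sub>0 - \<tau><..<\<theta>\<^sub>0 + \<tau>} \<longrightarrow> ennreal (g0 * l \<theta>) \<le> (\<integral>\<^sup>+f. ennreal (R \<theta> f) \<partial>\<nu>)"
    and Z: "0 < Z"
    and u_int: "\<And>F. F \<in> sets borel \<Longrightarrow> (\<integral>\<^sup>+\<theta>\<in>F. ennreal (u \<theta>) \<partial>lborel) \<le> ennreal (Z * (NF F + x))"
    and l_int: "ennreal (Z * (1 - 2 * x)) \<le> (\<integral>\<^sup>+\<theta>\<in>{\<theta>\<^sub>0 - \<tau><..<\<theta>\<^sub>0 + \<tau>}. ennreal (l \<theta>) \<partial>lborel)"
    and NF: "\<And>F. 0 \<le> NF F"
  defines "P \<equiv> distr (bayes (param_prior \<Theta> p \<Otimes>\<^sub>M \<nu>) (\<lambda>(\<theta>, f). R \<theta> f)) borel fst"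
  shows "prob_space P"
    and "F \<in> sets borel \<Longrightarrow> measure P F \<le> x + (1 + x) * (NF F + x) / ((1 - x)\<^sup>2 * (1 - 2 * x))"
proof -
  let ?\<pi> = "param_prior \<Theta> p"
  let ?R = "\<lambda>(\<theta>, f). R \<theta> f"
  let ?Q = "bayes (?\<pi> \<Otimes>\<^sub>M \<nu>) ?R"
  let ?E = "{\<theta>\<^sub>0 - \<epsilon><..<\<theta>\<^sub>0 + \<epsilon>}" and ?T = "{\<theta>\<^sub>0 - \<tau><..<\<theta>\<^sub>0 + \<tau>}"
  interpret \<pi>: prob_space ?\<pi> by (rule prior)
  interpret \<nu>: prob_space \<nu> by (rule \<nu>)
  have TE: "?T \<subseteq> ?E" using \<tau> by auto
  have sets_\<pi>: "X \<in> sets ?\<pi>" if "X \<in> sets borel" "X \<subseteq> \<Theta>" for X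
    using that \<Theta> by (auto simp: sets_restrict_space_iff)
  have [measurable]: "?E \<in> sets ?\<pi>" "?T \<in> sets ?\<pi>" by (rule sets_\<pi>, simp, use E TE in blast)+
  have meas_id: "f \<in> borel_measurable (restrict_space lborel \<Theta>)" if "f \<in> borel_measurable borel" for f :: "real \<Rightarrow> ennreal"
    using that by (simp add: measurable_restrict_space1)
  let ?D = "\<integral>\<^sup>+w. ennreal (?R w) \<partial>(?\<pi> \<Otimes>\<^sub>M \<nu>)"
  have D_eq: "?D = (\<integral>\<^sup>+\<theta>. \<integral>\<^sup>+f. ennreal (R \<theta> f) \<partial>\<nu> \<partial>?\<pi>)"
    by (subst \<nu>.nn_integral_fst[symmetric]) (auto simp: case_prod_beta)
  \<comment> \<open>The lower bound of the evidence: \<open>(1 - x) * p0\<close> for the prior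
    density, \<open>(1 - x) * d0\<close> for the integral over \<open>f\<close>, and
    \<open>Z * (1 - 2 * x)\<close> for the integral over the parameter.\<close>
  define dl where "dl = (1 - x)\<^sup>2 * (1 - 2 * x) * p0 * d0 * Z"
  have dl: "0 < dl" unfolding dl_def using x p0 d0 Z by (intro mult_pos_pos) auto
  have "0 \<le> (1 - x) * d0" "0 \<le> (1 - x) * p0" using x d0 p0 by auto
  then have g0': "0 \<le> g0" and p_nonneg: "\<And>\<theta>. \<theta> \<in> ?E \<Longrightarrow> 0 \<le> p \<theta>"
    using g0 p_ge by (linarith, meson order_trans)
  have D_low: "ennreal dl \<le> ?D"
  proof -
    have "dl = ((1 - x) * p0) * ((1 - x) * d0) * (Z * (1 - 2 * x))"
      by (simp add: dl_def power2_eq_square mult_ac)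
    also have "\<dots> \<le> ((1 - x) * p0) * g0 * (Z * (1 - 2 * x))"
      using g0 x p0 Z by (intro mult_right_mono mult_left_mono) auto
    finally have "ennreal dl \<le> ennreal ((1 - x) * p0 * g0) * ennreal (Z * (1 - 2 * x))"
      using x p0 g0' Z by (subst ennreal_mult[symmetric]) (auto intro!: ennreal_leI)
    also have "\<dots> \<le> ennreal ((1 - x) * p0 * g0) * (\<integral>\<^sup>+\<theta>\<in>?T. ennreal (l \<theta>) \<partial>lborel)"
      by (intro mult_left_mono l_int) auto
    also have "\<dots> = (\<integral>\<^sup>+\<theta>. ennreal ((1 - x) * p0 * g0) * (ennreal (l \<theta>) * indicator ?T \<theta>) \<partial>lborel)"
      by (rule nn_integral_cmult[symmetric]) measurable
    also have "\<dots> \<le> (\<integral>\<^sup>+\<theta>\<in>\<Theta>. (ennreal (p \<theta>) * (ennreal (g0 * l \<theta>) * indicator ?T \<theta>)) \<partial>lborel)"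
    proof (rule nn_integral_mono)
      fix \<theta>
      show "ennreal ((1 - x) * p0 * g0) * (ennreal (l \<theta>) * indicator ?T \<theta>)
          \<le> ennreal (p \<theta>) * (ennreal (g0 * l \<theta>) * indicator ?T \<theta>) * indicator \<Theta> \<theta>"
      proof (cases "\<theta> \<in> ?T")
        case True
        then have th: "\<theta> \<in> ?E" "\<theta> \<in> \<Theta>" using TE E by blast+
        have "(1 - x) * p0 * g0 * l \<theta> \<le> p \<theta> * (g0 * l \<theta>)"
          using mult_right_mono[OF p_ge[OF th(1)], of "g0 * l \<theta>"] g0' l0[of \<theta>] by (simp add: mult_ac)
        moreover have "0 \<le> p \<theta>" by (rule p_nonneg[OF th(1)])
        ultimately show ?thesis
          using True th x p0 g0' l0[of \<theta>] by (simp add: ennreal_mult[symmetric] ennreal_leI)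
      qed simp
    qed
    also have "\<dots> = (\<integral>\<^sup>+\<theta>\<in>?T. ennreal (g0 * l \<theta>) \<partial>?\<pi>)"
      by (subst nn_integral_param_prior[OF \<Theta> p]) (auto intro!: meas_id)
    also have "\<dots> \<le> (\<integral>\<^sup>+\<theta>. \<integral>\<^sup>+f. ennreal (R \<theta> f) \<partial>\<nu> \<partial>?\<pi>)"
      by (rule nn_integral_mono_AE) (use L in eventually_elim, auto simp: indicator_def)
    finally show ?thesis unfolding D_eq .
  qed
  have EG [measurable]: "?E \<times> G \<in> sets (?\<pi> \<Otimes>\<^sub>M \<nu>)" by measurable
  \<comment> \<open>Division by an infinite evidence gives 0 in \<open>ennreal\<close>, so the
    posterior would vanish and contradict \<open>post\<close>.\<close>
  have D_fin: "?D \<noteq> \<infinity>"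
  proof
    assume "?D = \<infinity>"
    moreover have "emeasure ?Q (?E \<times> G) = (\<integral>\<^sup>+w\<in>?E \<times> G. ennreal (?R w) \<partial>(?\<pi> \<Otimes>\<^sub>M \<nu>)) / ?D"
      by (rule emeasure_bayes[OF R EG])
    ultimately have "emeasure ?Q (?E \<times> G) = 0" by simp
    then show False using post x by (simp add: measure_def)
  qed
  define d where "d = enn2real ?D"
  have D: "?D = ennreal d" using D_fin by (simp add: d_def less_top)
  have d: "dl \<le> d" "0 < d"
    using D_low dl unfolding D by (auto simp: ennreal_le_iff2)
  have "emeasure ?Q (space (?\<pi> \<Otimes>\<^sub>M \<nu>)) = (\<integral>\<^sup>+w\<in>space (?\<pi> \<Otimes>\<^sub>M \<nu>). ennreal (?R w) \<partial>(?\<pi> \<Otimes>\<^sub>M \<nu>)) / ?D"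
    by (rule emeasure_bayes[OF R sets.top])
  also have "(\<integral>\<^sup>+w\<in>space (?\<pi> \<Otimes>\<^sub>M \<nu>). ennreal (?R w) \<partial>(?\<pi> \<Otimes>\<^sub>M \<nu>)) = ?D"
    by (intro nn_integral_cong) simp
  also have "?D / ?D = 1" unfolding D using d by (simp add: ennreal_divide_self)
  finally have "emeasure ?Q (space ?Q) = 1" by simp
  then interpret Q: prob_space ?Q by (rule prob_spaceI)
  have fst_meas [measurable]: "fst \<in> ?Q \<rightarrow>\<^sub>M borel"
  proof -
    have "fst \<in> ?\<pi> \<Otimes>\<^sub>M \<nu> \<rightarrow>\<^sub>M ?\<pi>" by measurable
    moreover have "(\<lambda>x. x) \<in> ?\<pi> \<rightarrow>\<^sub>M borel"
      by (subst measurable_cong_sets[OF sets_param_prior refl]) (rule measurable_restrict_space1, simp)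
    ultimately have "fst \<in> ?\<pi> \<Otimes>\<^sub>M \<nu> \<rightarrow>\<^sub>M borel" by (rule measurable_compose)
    then show ?thesis by (subst measurable_cong_sets[OF sets_bayes refl])
  qed
  show "prob_space P" unfolding P_def by (rule Q.prob_space_distr) (rule fst_meas)
  assume F [measurable]: "F \<in> sets borel"
  let ?EF = "?E \<inter> F"
  have EF_sets [measurable]: "?EF \<in> sets ?\<pi>" using E by (intro sets_\<pi>) auto
  have s1: "?EF \<times> G \<in> sets ?Q" unfolding sets_bayes by (rule pair_measureI[OF EF_sets G])
  have EQ: "?E \<times> G \<in> sets ?Q" unfolding sets_bayes by (rule EG)
  have s2: "space ?Q - ?E \<times> G \<in> sets ?Q" by (rule sets.compl_sets[OF EQ])
  have "emeasure ?Q (?EF \<times> G) = (\<integral>\<^sup>+w\<in>?EF \<times> G. ennreal (?R w) \<partial>(?\<pi> \<Otimes>\<^sub>M \<nu>)) / ennreal d"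
    unfolding D[symmetric] by (rule emeasure_bayes) measurable
  also have "(\<integral>\<^sup>+w\<in>?EF \<times> G. ennreal (?R w) \<partial>(?\<pi> \<Otimes>\<^sub>M \<nu>))
      = (\<integral>\<^sup>+\<theta>. \<integral>\<^sup>+f. ennreal (R \<theta> f) * indicator (?EF \<times> G) (\<theta>, f) \<partial>\<nu> \<partial>?\<pi>)"
    by (subst \<nu>.nn_integral_fst[symmetric]) (auto simp: case_prod_beta)
  also have "\<dots> \<le> (\<integral>\<^sup>+\<theta>\<in>?EF. ennreal (d0 * u \<theta>) \<partial>?\<pi>)"
  proof (rule nn_integral_mono_AE)
    show "AE \<theta> in ?\<pi>. (\<integral>\<^sup>+f. ennreal (R \<theta> f) * indicator (?EF \<times> G) (\<theta>, f) \<partial>\<nu>) \<le> ennreal (d0 * u \<theta>) * indicator ?EF \<theta>"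
      using U
    proof eventually_elim
      case (elim \<theta>)
      show ?case
      proof (cases "\<theta> \<in> ?EF")
        case True
        then have "(\<integral>\<^sup>+f. ennreal (R \<theta> f) * indicator (?EF \<times> G) (\<theta>, f) \<partial>\<nu>) = (\<integral>\<^sup>+f\<in>G. ennreal (R \<theta> f) \<partial>\<nu>)"
          by (intro nn_integral_cong) (auto simp: indicator_def)
        then show ?thesis using elim True by simp
      next
        case False
        then have "indicator (?EF \<times> G) (\<theta>, f) = (0 :: ennreal)" for f by (intro indicator_simps) blast
        then show ?thesis by simp
      qed
    qed
  qed
  also have "\<dots> = (\<integral>\<^sup>+\<theta>\<in>\<Theta>. (ennreal (p \<theta>) * (ennreal (d0 * u \<theta>) * indicator ?EF \<theta>)) \<partial>lborel)"
    by (rule nn_integral_param_prior[OF \<Theta> p]) (auto intro!: meas_id)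
  also have "\<dots> \<le> (\<integral>\<^sup>+\<theta>. ennreal ((1 + x) * p0 * d0) * (ennreal (u \<theta>) * indicator F \<theta>) \<partial>lborel)"
  proof (rule nn_integral_mono)
    fix \<theta>
    show "ennreal (p \<theta>) * (ennreal (d0 * u \<theta>) * indicator ?EF \<theta>) * indicator \<Theta> \<theta>
        \<le> ennreal ((1 + x) * p0 * d0) * (ennreal (u \<theta>) * indicator F \<theta>)"
    proof (cases "\<theta> \<in> ?EF")
      case True
      then have th: "\<theta> \<in> ?E" "\<theta> \<in> \<Theta>" "\<theta> \<in> F" using E by blast+
      have "p \<theta> * (d0 * u \<theta>) \<le> (1 + x) * p0 * d0 * u \<theta>"
        using mult_right_mono[OF p_le[OF th(1)], of "d0 * u \<theta>"] d0 u0[of \<theta>] by (simp add: mult_ac)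
      moreover have "0 \<le> p \<theta>" by (rule p_nonneg[OF th(1)])
      ultimately show ?thesis
        using True th x p0 d0 u0[of \<theta>] by (simp add: ennreal_mult[symmetric] ennreal_leI)
    qed simp
  qed
  also have "\<dots> = ennreal ((1 + x) * p0 * d0) * (\<integral>\<^sup>+\<theta>\<in>F. ennreal (u \<theta>) \<partial>lborel)"
    by (rule nn_integral_cmult) measurable
  also have "\<dots> \<le> ennreal ((1 + x) * p0 * d0) * ennreal (Z * (NF F + x))"
    by (intro mult_left_mono u_int F) auto
  also have "\<dots> = ennreal ((1 + x) * p0 * d0 * (Z * (NF F + x)))"
    using x p0 d0 Z NF[of F] by (subst ennreal_mult[symmetric]) auto
  finally have "emeasure ?Q (?EF \<times> G) \<le> ennreal ((1 + x) * p0 * d0 * (Z * (NF F + x))) / ennreal d"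
    by (simp add: divide_right_mono_ennreal)
  also have "\<dots> = ennreal ((1 + x) * p0 * d0 * (Z * (NF F + x)) / d)"
    using x p0 d0 Z NF[of F] d by (intro divide_ennreal) auto
  finally have "measure ?Q (?EF \<times> G) \<le> (1 + x) * p0 * d0 * (Z * (NF F + x)) / d"
    using x p0 d0 Z NF[of F] d by (simp add: Q.emeasure_eq_measure ennreal_le_iff)
  also have "\<dots> \<le> (1 + x) * p0 * d0 * (Z * (NF F + x)) / dl"
    using x p0 d0 Z NF[of F] d dl by (intro divide_left_mono) auto
  also have "\<dots> = (1 + x) * (NF F + x) / ((1 - x)\<^sup>2 * (1 - 2 * x))"
    using p0 d0 Z x by (simp add: dl_def field_simps)
  finally have EF: "measure ?Q (?EF \<times> G) \<le> (1 + x) * (NF F + x) / ((1 - x)\<^sup>2 * (1 - 2 * x))" .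
  \<comment> \<open>What lies outside the localising set \<open>?E \<times> G\<close> has posterior
    mass at most \<open>x\<close>; inside it the bound \<open>u\<close> applies.\<close>
  have "measure P F = measure ?Q (fst -` F \<inter> space ?Q)"
    unfolding P_def by (rule measure_distr) measurable
  also have "\<dots> \<le> measure ?Q (?EF \<times> G \<union> (space ?Q - ?E \<times> G))"
    by (rule Q.finite_measure_mono[OF _ sets.Un[OF s1 s2]]) auto
  also have "\<dots> \<le> measure ?Q (?EF \<times> G) + measure ?Q (space ?Q - ?E \<times> G)"
    by (rule measure_Un_le[OF s1 s2])
  also have "measure ?Q (space ?Q - ?E \<times> G) = 1 - measure ?Q (?E \<times> G)"
    by (rule Q.prob_compl[OF EQ])
  finally show "measure P F \<le> x + (1 + x) * (NF F + x) / ((1 - x)\<^sup>2 * (1 - 2 * x))"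
    using EF post by linarith
qed


section \<open>Shifted priors\<close>

text \<open>The shifted law has density \<open>r\<close> with respect to \<open>\<nu>\<close>;
  restricting to \<open>G\<close> and using the lower bound of \<open>r\<close> there leaves the
  left-hand side.\<close>

lemma shift_bound_upper:
  fixes \<nu> :: "'h::{real_normed_vector,second_countable_topology} measure"
  assumes \<nu>: "sets \<nu> = sets borel" and r: "density_version (shifted_law \<nu> 0) (shifted_law \<nu> h) r"
    and G: "G \<in> sets borel" and c: "0 \<le> c" "\<And>f. f \<in> G \<Longrightarrow> c \<le> r f"
    and \<phi>: "\<phi> \<in> borel_measurable borel"
  shows "ennreal c * (\<integral>\<^sup>+f\<in>G. \<phi> f \<partial>\<nu>) \<le> (\<integral>\<^sup>+f. \<phi> (f + h) \<partial>\<nu>)"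
proof -
  note \<nu> [measurable_cong, simp] and G [measurable] and \<phi> [measurable]
  have shift0: "shifted_law \<nu> 0 = \<nu>"
    unfolding shifted_law_def using distr_id2[of borel \<nu>] \<nu> by simp
  have [measurable]: "r \<in> borel_measurable \<nu>" and dens: "shifted_law \<nu> h = density \<nu> (\<lambda>f. ennreal (r f))"
    using r by (auto simp: density_version_def shift0)
  have "ennreal c * (\<integral>\<^sup>+f\<in>G. \<phi> f \<partial>\<nu>) = (\<integral>\<^sup>+f. ennreal c * (\<phi> f * indicator G f) \<partial>\<nu>)"
    by (rule nn_integral_cmult[symmetric]) measurable
  also have "\<dots> \<le> (\<integral>\<^sup>+f. ennreal (r f) * \<phi> f \<partial>\<nu>)"
    by (intro nn_integral_mono) (auto simp: indicator_def intro!: mult_right_mono ennreal_leI c)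
  also have "\<dots> = (\<integral>\<^sup>+f. \<phi> f \<partial>shifted_law \<nu> h)"
    unfolding dens by (rule nn_integral_density[symmetric]) measurable
  also have "\<dots> = (\<integral>\<^sup>+f. \<phi> (f + h) \<partial>\<nu>)"
    unfolding shifted_law_def by (rule nn_integral_distr) measurable
  finally show ?thesis .
qed

text \<open>The ratio of \<open>\<nu>\<close> shifted by \<open>h\<close> to \<open>\<nu>\<close>, evaluated at \<open>g + h\<close>, is almost everywhere the ratio
  of \<open>\<nu>\<close> to \<open>\<nu>\<close> shifted by \<open>- h\<close> at \<open>g\<close>. Hence a bound on the latter over \<open>G\<close> suffices.\<close>

lemma shift_bound_lower:
  fixes \<nu> :: "'h::{real_normed_vector,second_countable_topology} measure"
  assumes \<nu>: "sets \<nu> = sets borel" "prob_space \<nu>"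
    and r: "density_version (shifted_law \<nu> 0) (shifted_law \<nu> h) r"
    and r': "density_version (shifted_law \<nu> (- h)) (shifted_law \<nu> 0) r'"
    and G: "G \<in> sets borel" and c: "\<And>f. f \<in> G \<Longrightarrow> r' f \<le> c" and \<phi>: "\<phi> \<in> borel_measurable borel"
  shows "(\<integral>\<^sup>+f\<in>G. \<phi> (f + h) \<partial>\<nu>) \<le> ennreal c * (\<integral>\<^sup>+f. \<phi> f \<partial>\<nu>)"
proof -
  note \<nu>(1) [measurable_cong, simp] and G [measurable] and \<phi> [measurable]
  interpret \<nu>: prob_space \<nu> by fact
  have shift0: "shifted_law \<nu> 0 = \<nu>"
    unfolding shifted_law_def using distr_id2[of borel \<nu>] \<nu>(1) by simp
  let ?m = "shifted_law \<nu> (- h)"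
  have m_sets [measurable_cong, simp]: "sets ?m = sets borel" by (simp add: shifted_law_def)
  have [measurable]: "r \<in> borel_measurable \<nu>" and dens: "shifted_law \<nu> h = density \<nu> (\<lambda>f. ennreal (r f))"
    and r0: "\<And>f. 0 \<le> r f"
    using r by (auto simp: density_version_def shift0)
  have rm [measurable]: "r' \<in> borel_measurable ?m" and dens': "\<nu> = density ?m (\<lambda>f. ennreal (r' f))"
    and r'0: "\<And>f. 0 \<le> r' f"
    using r' by (auto simp: density_version_def shift0)
  have rb [measurable]: "r \<in> borel_measurable borel" "r' \<in> borel_measurable borel"
    using \<open>r \<in> borel_measurable \<nu>\<close> rm measurable_cong_sets[OF \<nu>(1) refl] measurable_cong_sets[OF m_sets refl] by auto
  interpret m: prob_space ?m
    unfolding shifted_law_def by (rule \<nu>.prob_space_distr) measurable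
  \<comment> \<open>Both \<open>r\<close> translated by \<open>h\<close> and \<open>r'\<close> are
    densities of \<open>\<nu>\<close> relative to the same shifted law, so uniqueness of densities
    identifies them almost everywhere.\<close>
  have "density ?m (\<lambda>g. ennreal (r (g + h))) = \<nu>"
  proof (rule measure_eqI)
    fix X assume "X \<in> sets (density ?m (\<lambda>g. ennreal (r (g + h))))"
    then have X [measurable]: "X \<in> sets borel" by simp
    have "emeasure (density ?m (\<lambda>g. ennreal (r (g + h)))) X = (\<integral>\<^sup>+g. ennreal (r (g + h)) * indicator X g \<partial>?m)"
      by (rule emeasure_density) measurable
    also have "\<dots> = (\<integral>\<^sup>+f. ennreal (r f) * indicator X (f - h) \<partial>\<nu>)"
      unfolding shifted_law_def by (subst nn_integral_distr) auto
    also have "\<dots> = (\<integral>\<^sup>+f. indicator X (f - h) \<partial>shifted_law \<nu> h)"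
      unfolding dens by (rule nn_integral_density[symmetric]) measurable
    also have "\<dots> = (\<integral>\<^sup>+f. indicator X f \<partial>\<nu>)"
      unfolding shifted_law_def by (subst nn_integral_distr) auto
    finally show "emeasure (density ?m (\<lambda>g. ennreal (r (g + h)))) X = emeasure \<nu> X" by simp
  qed simp
  then have "density ?m (\<lambda>g. ennreal (r (g + h))) = density ?m (\<lambda>g. ennreal (r' g))"
    using dens' by simp
  then have "AE g in ?m. ennreal (r (g + h)) = ennreal (r' g)"
    by (rule m.density_unique[rotated 2]) measurable
  then have "AE g in density ?m (\<lambda>f. ennreal (r' f)). ennreal (r (g + h)) = ennreal (r' g)"
    by (subst AE_density) auto
  then have "AE g in \<nu>. ennreal (r (g + h)) = ennreal (r' g)"
    unfolding dens'[symmetric] .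
  then have ae: "AE g in \<nu>. r (g + h) = r' g"
    by eventually_elim (use r0 r'0 in auto)
  \<comment> \<open>At almost every \<open>g\<close> in \<open>G\<close> the shifted point satisfies
    \<open>r (g + h) = r' g \<le> c\<close>. Inserting this indicator converts the bound on
    \<open>r'\<close> over \<open>G\<close> into one on \<open>r\<close>, after which the integral
    can be changed back to \<open>\<nu>\<close>.\<close>
  have "(\<integral>\<^sup>+g\<in>G. \<phi> (g + h) \<partial>\<nu>) \<le> (\<integral>\<^sup>+g. \<phi> (g + h) * indicator {f. r f \<le> c} (g + h) \<partial>\<nu>)"
    by (rule nn_integral_mono_AE) (use ae in eventually_elim, auto simp: indicator_def c)
  also have "\<dots> = (\<integral>\<^sup>+f. \<phi> f * indicator {f. r f \<le> c} f \<partial>shifted_law \<nu> h)"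
    unfolding shifted_law_def by (rule nn_integral_distr[symmetric]) measurable
  also have "\<dots> = (\<integral>\<^sup>+f. ennreal (r f) * (\<phi> f * indicator {f. r f \<le> c} f) \<partial>\<nu>)"
    unfolding dens by (rule nn_integral_density) measurable
  also have "\<dots> \<le> (\<integral>\<^sup>+f. ennreal c * \<phi> f \<partial>\<nu>)"
    by (intro nn_integral_mono) (auto simp: indicator_def intro!: mult_right_mono ennreal_leI)
  also have "\<dots> = ennreal c * (\<integral>\<^sup>+f. \<phi> f \<partial>\<nu>)"
    by (rule nn_integral_cmult) measurable
  finally show ?thesis .
qed


section \<open>The observation model\<close>

abbreviation noise_law :: "((nat \<Rightarrow> real) \<times> (nat \<Rightarrow> real)) measure" where
  "noise_law \<equiv> gauss_seq \<Otimes>\<^sub>M gauss_seq"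

definition noise_pairing :: "(nat \<Rightarrow> 'h::real_inner) \<Rightarrow> (nat \<Rightarrow> real) \<times> (nat \<Rightarrow> real) \<Rightarrow> 'h \<times> 'h \<Rightarrow> real" where
  "noise_pairing e z h = pairing e (fst z) (fst h) + pairing e (snd z) (snd h)"

definition noise_dom :: "(nat \<Rightarrow> 'h::real_inner) \<Rightarrow> (nat \<Rightarrow> real) \<times> (nat \<Rightarrow> real) \<Rightarrow> ('h \<times> 'h) set" where
  "noise_dom e z = {h. summable (\<lambda>k. fst z k * (fst h \<bullet> e k)) \<and> summable (\<lambda>k. snd z k * (snd h \<bullet> e k))}"

lemma pairing_add:
  assumes "summable (\<lambda>k. x k * (g \<bullet> e k))" and "summable (\<lambda>k. x k * (h \<bullet> e k))"
  shows "pairing e x (g + h) = pairing e x g + pairing e x h"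
  unfolding pairing_def using suminf_add[OF assms] by (simp add: inner_add_left algebra_simps)

lemma pairing_scaleR:
  assumes "summable (\<lambda>k. x k * (h \<bullet> e k))"
  shows "pairing e x (c *\<^sub>R h) = c * pairing e x h"
  unfolding pairing_def using suminf_mult[OF assms, of c] by (simp add: mult_ac)

lemma isonormal_noise:
  fixes e :: "nat \<Rightarrow> 'h::{real_inner,banach,second_countable_topology}"
  assumes onb: "orthonormal_basis e"
  shows "isonormal noise_law (noise_pairing e) (noise_dom e)"
proof -
  interpret G: prob_space gauss_seq by (rule prob_space_gauss_seq)
  interpret P: pair_prob_space gauss_seq gauss_seq ..
  show ?thesis
  proof
    show "(\<lambda>(z, h). noise_pairing e z h) \<in> borel_measurable (noise_law \<Otimes>\<^sub>M borel)"
      unfolding noise_pairing_def borel_prod[symmetric] by measurable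
    show "Measurable.pred (noise_law \<Otimes>\<^sub>M borel) (\<lambda>(z, h). h \<in> noise_dom e z)"
      unfolding noise_dom_def mem_Collect_eq borel_prod[symmetric] by measurable
    show "AE z in noise_law. h \<in> noise_dom e z" for h
    proof -
      have "AE z in noise_law. summable (\<lambda>k. fst z k * (fst h \<bullet> e k))"
        by (rule P.AE_pair_measure, measurable) (simp add: AE_summable_pairing[OF onb])
      moreover have "AE z in noise_law. summable (\<lambda>k. snd z k * (snd h \<bullet> e k))"
        by (rule P.AE_pair_measure, measurable) (simp add: AE_summable_pairing[OF onb])
      ultimately show ?thesis by (auto simp: noise_dom_def)
    qed
    show "subspace (noise_dom e z)" for z
      unfolding subspace_def noise_dom_def
      by (auto simp: inner_add_left distrib_left mult.left_commute[of _ "_::real"]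
          intro!: summable_add summable_mult)
    show "noise_pairing e z (g + h) = noise_pairing e z g + noise_pairing e z h"
      if "g \<in> noise_dom e z" "h \<in> noise_dom e z" for g h z
      using that by (simp add: noise_pairing_def noise_dom_def pairing_add)
    show "noise_pairing e z (c *\<^sub>R h) = c * noise_pairing e z h" if "h \<in> noise_dom e z" for h z c
      using that by (simp add: noise_pairing_def noise_dom_def pairing_scaleR distrib_left)
    show "(\<integral>\<^sup>+z. ennreal (exp (noise_pairing e z h)) \<partial>noise_law) \<le> ennreal (exp ((norm h)\<^sup>2 / 2))" for h
    proof -
      have "(\<integral>\<^sup>+z. ennreal (exp (noise_pairing e z h)) \<partial>noise_law)
          = (\<integral>\<^sup>+x. \<integral>\<^sup>+y. ennreal (exp (pairing e x (fst h))) * ennreal (exp (pairing e y (snd h))) \<partial>gauss_seq \<partial>gauss_seq)"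
        unfolding noise_pairing_def
        by (subst G.nn_integral_fst[symmetric]) (auto simp: exp_add ennreal_mult)
      also have "\<dots> = (\<integral>\<^sup>+x. ennreal (exp (pairing e x (fst h))) \<partial>gauss_seq) * (\<integral>\<^sup>+y. ennreal (exp (pairing e y (snd h))) \<partial>gauss_seq)"
        by (subst nn_integral_cmult, measurable, subst nn_integral_multc, measurable)
      also have "\<dots> \<le> ennreal (exp ((norm (fst h))\<^sup>2 / 2)) * ennreal (exp ((norm (snd h))\<^sup>2 / 2))"
        by (intro mult_mono nn_integral_exp_pairing_le onb) auto
      also have "\<dots> = ennreal (exp ((norm h)\<^sup>2 / 2))"
        by (simp add: ennreal_mult[symmetric] exp_add[symmetric] norm_prod_def add_divide_distrib)
      finally show ?thesis .
    qed
  qed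
qed

section \<open>Transport of the data to the noise space\<close>

definition obs_map :: "(nat \<Rightarrow> 'h::real_inner) \<Rightarrow> 'h \<Rightarrow> 'h \<Rightarrow> nat
    \<Rightarrow> (nat \<Rightarrow> real) \<times> (nat \<Rightarrow> real) \<Rightarrow> (nat \<Rightarrow> real) \<times> (nat \<Rightarrow> real)" where
  "obs_map e a b n z = (\<lambda>k. a \<bullet> e k + fst z k / sqrt (real n), \<lambda>k. b \<bullet> e k + snd z k / sqrt (real n))"

definition obs_map_inv :: "(nat \<Rightarrow> 'h::real_inner) \<Rightarrow> 'h \<Rightarrow> 'h \<Rightarrow> nat
    \<Rightarrow> (nat \<Rightarrow> real) \<times> (nat \<Rightarrow> real) \<Rightarrow> (nat \<Rightarrow> real) \<times> (nat \<Rightarrow> real)" where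
  "obs_map_inv e a b n x = (\<lambda>k. sqrt (real n) * (fst x k - a \<bullet> e k), \<lambda>k. sqrt (real n) * (snd x k - b \<bullet> e k))"

lemma obs_law_eq: "obs_law e K n \<theta> f = distr noise_law (seq_space \<Otimes>\<^sub>M seq_space) (obs_map e f (K \<theta> f) n)"
  unfolding obs_law_def obs_map_def by (simp add: case_prod_beta')

lemma measurable_seq_space:
  assumes "\<And>k. (\<lambda>x. f x k) \<in> borel_measurable M"
  shows "f \<in> M \<rightarrow>\<^sub>M seq_space"
  by (rule measurable_PiM_single') (use assms in auto)

lemma measurable_seq_component [measurable (raw)]:
  assumes "f \<in> M \<rightarrow>\<^sub>M seq_space"
  shows "(\<lambda>x. f x k) \<in> borel_measurable M"
  using measurable_component_singleton[of k UNIV "\<lambda>_. borel"] assms by (auto intro: measurable_compose)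

lemma measurable_obs_map [measurable]: "obs_map e a b n \<in> noise_law \<rightarrow>\<^sub>M seq_space \<Otimes>\<^sub>M seq_space"
  unfolding obs_map_def by (intro measurable_Pair measurable_seq_space) measurable

lemma measurable_obs_map_inv [measurable]: "obs_map_inv e a b n \<in> seq_space \<Otimes>\<^sub>M seq_space \<rightarrow>\<^sub>M noise_law"
proof -
  have "sets noise_law = sets (seq_space \<Otimes>\<^sub>M seq_space)" by (rule sets_pair_measure_cong) simp_all
  moreover have "obs_map_inv e a b n \<in> seq_space \<Otimes>\<^sub>M seq_space \<rightarrow>\<^sub>M seq_space \<Otimes>\<^sub>M seq_space"
    unfolding obs_map_inv_def by (intro measurable_Pair measurable_seq_space) measurable
  ultimately show ?thesis using measurable_cong_sets by blast
qed

lemma obs_map_inverse: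
  assumes "1 \<le> n"
  shows "obs_map_inv e a b n (obs_map e a b n z) = z" and "obs_map e a b n (obs_map_inv e a b n x) = x"
  using assms by (auto simp: obs_map_def obs_map_inv_def prod_eq_iff)

lemma pairing_obs:
  assumes onb: "orthonormal_basis e" and "summable (\<lambda>k. z k * (h \<bullet> e k))"
  shows "pairing e (\<lambda>k. a \<bullet> e k + z k / sqrt (real n)) h = a \<bullet> h + pairing e z h / sqrt (real n)"
proof -
  have "(\<lambda>k. (a \<bullet> e k) * (h \<bullet> e k) + z k * (h \<bullet> e k) / sqrt (real n)) sums (a \<bullet> h + pairing e z h / sqrt (real n))"
    unfolding pairing_def
    by (intro sums_add sums_divide parseval_inner onb summable_sums assms)
  then show ?thesis unfolding pairing_def by (simp add: distrib_right sums_iff)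
qed

text \<open>After transport the centring is one fixed noise functional divided by the information:
  its dependence on \<open>n\<close> disappears.\<close>

lemma Delta_obs:
  fixes e :: "nat \<Rightarrow> 'h::{real_inner,banach,second_countable_topology}" and K K' :: "real \<Rightarrow> 'h \<Rightarrow>\<^sub>L 'h"
  assumes onb: "orthonormal_basis e" and n: "1 \<le> n"
    and z: "(least_favorable K K' \<theta> f, K \<theta> (least_favorable K K' \<theta> f)) \<in> noise_dom e z" "(0, K' \<theta> f) \<in> noise_dom e z"
  shows "Delta e K K' n \<theta> f (obs_map e f (K \<theta> f) n z)
    = 1 / efficient_info K K' \<theta> f * noise_pairing e z
        (- least_favorable K K' \<theta> f, K' \<theta> f - K \<theta> (least_favorable K K' \<theta> f))"
proof -
  interpret isonormal noise_law "noise_pairing e" "noise_dom e" by (rule isonormal_noise[OF onb])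
  let ?g = "least_favorable K K' \<theta> f"
  have "(- ?g, K' \<theta> f - K \<theta> ?g) = (0, K' \<theta> f) - (?g, K \<theta> ?g)" by simp
  then have "noise_pairing e z (- ?g, K' \<theta> f - K \<theta> ?g)
      = pairing e (snd z) (K' \<theta> f) - pairing e (fst z) ?g - pairing e (snd z) (K \<theta> ?g)"
    using W_diff[OF z(2,1)] by (simp add: noise_pairing_def pairing_def)
  then show ?thesis
    using z n by (simp add: Delta_def noise1_def noise2_def obs_map_def pairing_obs[OF onb] noise_dom_def)
qed

definition centered :: "(real \<Rightarrow> 'h::real_inner \<Rightarrow>\<^sub>L 'h) \<Rightarrow> real \<Rightarrow> 'h \<Rightarrow> nat \<Rightarrow> real \<Rightarrow> 'h \<Rightarrow> 'h \<times> 'h" where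
  "centered K \<theta>\<^sub>0 f\<^sub>0 n \<theta> f = sqrt (real n) *\<^sub>R (f - f\<^sub>0, K \<theta> f - K \<theta>\<^sub>0 f\<^sub>0)"

text \<open>The Cameron-Martin density of the data law at \<open>(\<theta>, f)\<close> relative to
  the law at the truth, instead of the law at \<open>f = 0\<close>. Its mean under the noise is at
  most one, which the evidence bounds exploit.\<close>

definition likelihood_ratio :: "(nat \<Rightarrow> 'h::real_inner) \<Rightarrow> (real \<Rightarrow> 'h \<Rightarrow>\<^sub>L 'h) \<Rightarrow> real \<Rightarrow> 'h \<Rightarrow> nat
    \<Rightarrow> (nat \<Rightarrow> real) \<times> (nat \<Rightarrow> real) \<Rightarrow> real \<Rightarrow> 'h \<Rightarrow> real" where
  "likelihood_ratio e K \<theta>\<^sub>0 f\<^sub>0 n z \<theta> f =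
     exp (noise_pairing e z (centered K \<theta>\<^sub>0 f\<^sub>0 n \<theta> f) - (norm (centered K \<theta>\<^sub>0 f\<^sub>0 n \<theta> f))\<^sup>2 / 2)"

text \<open>The change of reference law from \<open>f = 0\<close> to the truth contributes a factor
  that depends on the data and on \<open>n\<close> but not on \<open>(\<theta>, f)\<close>.\<close>

lemma likelihood_obs:
  fixes e :: "nat \<Rightarrow> 'h::{real_inner,banach,second_countable_topology}" and K :: "real \<Rightarrow> 'h \<Rightarrow>\<^sub>L 'h"
  assumes onb: "orthonormal_basis e" and n: "1 \<le> n"
    and z: "(f, K \<theta> f) \<in> noise_dom e z" "(f\<^sub>0, K \<theta>\<^sub>0 f\<^sub>0) \<in> noise_dom e z"
  shows "likelihood e K n (obs_map e f\<^sub>0 (K \<theta>\<^sub>0 f\<^sub>0) n z) \<theta> f =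
     exp (real n / 2 * ((norm f\<^sub>0)\<^sup>2 + (norm (K \<theta>\<^sub>0 f\<^sub>0))\<^sup>2) + sqrt (real n) * noise_pairing e z (f\<^sub>0, K \<theta>\<^sub>0 f\<^sub>0))
     * likelihood_ratio e K \<theta>\<^sub>0 f\<^sub>0 n z \<theta> f"
proof -
  interpret isonormal noise_law "noise_pairing e" "noise_dom e" by (rule isonormal_noise[OF onb])
  define s where "s = sqrt (real n)"
  have s: "s * s = real n" "0 < s" using n by (auto simp: s_def)
  let ?a = "K \<theta>\<^sub>0 f\<^sub>0" and ?b = "K \<theta> f"
  have "pairing e (fst (obs_map e f\<^sub>0 ?a n z)) f = f\<^sub>0 \<bullet> f + pairing e (fst z) f / s"
    "pairing e (snd (obs_map e f\<^sub>0 ?a n z)) ?b = ?a \<bullet> ?b + pairing e (snd z) ?b / s"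
    using z unfolding obs_map_def s_def by (simp_all add: pairing_obs[OF onb] noise_dom_def)
  then have ps: "real n * pairing e (fst (obs_map e f\<^sub>0 ?a n z)) f = real n * (f\<^sub>0 \<bullet> f) + s * pairing e (fst z) f"
    "real n * pairing e (snd (obs_map e f\<^sub>0 ?a n z)) ?b = real n * (?a \<bullet> ?b) + s * pairing e (snd z) ?b"
    using s(2) by (simp_all add: s(1)[symmetric] distrib_left)
  have "(f - f\<^sub>0, ?b - ?a) = (f, ?b) - (f\<^sub>0, ?a)" by simp
  then have W: "noise_pairing e z (f - f\<^sub>0, ?b - ?a) = noise_pairing e z (f, ?b) - noise_pairing e z (f\<^sub>0, ?a)"
    using W_diff[OF z] by simp
  have d: "(f - f\<^sub>0, ?b - ?a) \<in> noise_dom e z"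
    using subspace_diff[OF subspace_dom z] by simp
  have Wc: "noise_pairing e z (centered K \<theta>\<^sub>0 f\<^sub>0 n \<theta> f) = s * (noise_pairing e z (f, ?b) - noise_pairing e z (f\<^sub>0, ?a))"
    unfolding centered_def by (subst W_scale[OF d]) (simp add: W s_def)
  have nc: "(norm (centered K \<theta>\<^sub>0 f\<^sub>0 n \<theta> f))\<^sup>2 = real n * ((norm (f - f\<^sub>0))\<^sup>2 + (norm (?b - ?a))\<^sup>2)"
    unfolding centered_def norm_scaleR power_mult_distrib by (simp add: norm_prod_def)
  show ?thesis
    unfolding likelihood_def likelihood_ratio_def exp_add[symmetric] ps Wc nc
    by (simp add: noise_pairing_def power2_norm_eq_inner inner_diff_left inner_diff_right inner_commute s_def[symmetric] algebra_simps
        add_divide_distrib diff_divide_distrib)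
qed

section \<open>Null sets that depend on the parameter\<close>

text \<open>The exceptional null set of the noise varies with the parameter; Fubini exchanges the
  quantifiers, so that for almost every noise the property holds at almost every parameter.\<close>

lemma (in isonormal) AE_AE_swap:
  assumes M: "sigma_finite_measure M" and P: "Measurable.pred (\<mu> \<Otimes>\<^sub>M M) (\<lambda>(z, m). P z m)"
    and AE: "\<And>m. m \<in> space M \<Longrightarrow> AE z in \<mu>. P z m"
  shows "AE z in \<mu>. AE m in M. P z m"
proof -
  interpret M: sigma_finite_measure M by fact
  interpret pair_sigma_finite \<mu> M ..
  have "AE m in M. AE z in \<mu>. P z m" by (rule AE_I2) (rule AE)
  then show ?thesis
    by (subst AE_commute) (use P in \<open>simp_all add: pred_def case_prod_beta\<close>)
qed

text \<open>The factorisation of the likelihood holds where the noise series converge, hence for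
  almost all parameters, and the common factor cancels in Bayes' formula.\<close>

lemma AE_bayes_likelihood:
  fixes e :: "nat \<Rightarrow> 'h::{real_inner,banach,second_countable_topology}" and K :: "real \<Rightarrow> 'h \<Rightarrow>\<^sub>L 'h"
  assumes onb: "orthonormal_basis e" and n: "1 \<le> n" and M: "sigma_finite_measure M"
    and [measurable]: "F \<in> borel_measurable M" "(\<lambda>m. K (T m) (F m)) \<in> borel_measurable M"
  shows "AE z in noise_law. bayes M (\<lambda>m. likelihood e K n (obs_map e f\<^sub>0 (K \<theta>\<^sub>0 f\<^sub>0) n z) (T m) (F m))
     = bayes M (\<lambda>m. likelihood_ratio e K \<theta>\<^sub>0 f\<^sub>0 n z (T m) (F m))"
proof -
  interpret isonormal noise_law "noise_pairing e" "noise_dom e" by (rule isonormal_noise[OF onb])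
  have "AE z in noise_law. AE m in M. (F m, K (T m) (F m)) \<in> noise_dom e z"
    by (rule AE_AE_swap[OF M]) (measurable, rule AE_dom)
  then show ?thesis
    using AE_dom[of "(f\<^sub>0, K \<theta>\<^sub>0 f\<^sub>0)"] AE_space
  proof eventually_elim
    case (elim z)
    note dom0 = elim(2)
    note [measurable] = elim(3)
    have m1: "(\<lambda>m. fst (obs_map e f\<^sub>0 (K \<theta>\<^sub>0 f\<^sub>0) n z)) \<in> M \<rightarrow>\<^sub>M seq_space"
      and m2: "(\<lambda>m. snd (obs_map e f\<^sub>0 (K \<theta>\<^sub>0 f\<^sub>0) n z)) \<in> M \<rightarrow>\<^sub>M seq_space"
      by (simp_all add: space_PiM)
    show ?case
    proof (rule bayes_cong_AE)
      show "(\<lambda>m. likelihood e K n (obs_map e f\<^sub>0 (K \<theta>\<^sub>0 f\<^sub>0) n z) (T m) (F m)) \<in> borel_measurable M"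
        unfolding likelihood_def using m1 m2 by measurable
      show "(\<lambda>m. likelihood_ratio e K \<theta>\<^sub>0 f\<^sub>0 n z (T m) (F m)) \<in> borel_measurable M"
        unfolding likelihood_ratio_def centered_def using elim(3) by measurable
      show "AE m in M. likelihood e K n (obs_map e f\<^sub>0 (K \<theta>\<^sub>0 f\<^sub>0) n z) (T m) (F m)
        = exp (real n / 2 * ((norm f\<^sub>0)\<^sup>2 + (norm (K \<theta>\<^sub>0 f\<^sub>0))\<^sup>2) + sqrt (real n) * noise_pairing e z (f\<^sub>0, K \<theta>\<^sub>0 f\<^sub>0))
          * likelihood_ratio e K \<theta>\<^sub>0 f\<^sub>0 n z (T m) (F m)"
        using elim(1) by eventually_elim (intro likelihood_obs onb n dom0)
    qed simp
  qed
qed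


section \<open>Local expansion of the likelihood\<close>

text \<open>Orthogonality replaces \<open>a \<bullet> w\<close> by
  \<open>a \<bullet> (w - w\<^sub>0)\<close>, which gains the factor \<open>\<rho>\<close>. The
  remaining products are estimated by Cauchy-Schwarz and sorted by their power of
  \<open>\<bar>t\<bar>\<close>: those involving \<open>a\<close> contain it once, the others
  twice.\<close>

lemma norm_square_expansion:
  fixes a w w\<^sub>0 E :: "'v::real_inner"
  assumes orth: "a \<bullet> w\<^sub>0 = 0" and a: "norm a \<le> c * \<epsilon>" and w: "norm (w - w\<^sub>0) \<le> \<rho>" and w0: "norm w\<^sub>0 \<le> c"
    and E: "norm E \<le> c * (\<bar>t\<bar> * \<epsilon>)" and nonneg: "0 \<le> c" "0 \<le> \<epsilon>"
  shows "\<bar>(norm (a + t *\<^sub>R w + E))\<^sup>2 - (norm a)\<^sup>2 - t\<^sup>2 * (norm w\<^sub>0)\<^sup>2\<bar>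
    \<le> 2 * \<bar>t\<bar> * (c * \<epsilon> * \<rho> + c\<^sup>2 * \<epsilon>\<^sup>2) + t\<^sup>2 * (\<rho> * (2 * c + \<rho>) + 2 * (c + \<rho>) * c * \<epsilon> + c\<^sup>2 * \<epsilon>\<^sup>2)"
proof -
  have rho: "0 \<le> \<rho>" by (rule order_trans[OF norm_ge_zero w])
  have wn: "norm w \<le> c + \<rho>" using norm_triangle_ineq[of "w - w\<^sub>0" w\<^sub>0] w w0 by simp
  have e1: "(norm (a + t *\<^sub>R w + E))\<^sup>2 = (norm a)\<^sup>2 + t\<^sup>2 * (norm w)\<^sup>2 + (norm E)\<^sup>2
      + 2 * t * (a \<bullet> w) + 2 * (a \<bullet> E) + 2 * t * (w \<bullet> E)"
    unfolding power2_norm_eq_inner by (simp add: inner_add_left inner_add_right inner_commute power2_eq_square algebra_simps)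
  have e2: "a \<bullet> w = a \<bullet> (w - w\<^sub>0)" by (simp add: inner_diff_right orth)
  have e3: "(norm w)\<^sup>2 = (norm w\<^sub>0)\<^sup>2 + (w - w\<^sub>0) \<bullet> (w + w\<^sub>0)"
    by (simp add: power2_norm_eq_inner inner_add_right inner_diff_left inner_commute[of w\<^sub>0 w])
  have eq: "(norm (a + t *\<^sub>R w + E))\<^sup>2 - (norm a)\<^sup>2 - t\<^sup>2 * (norm w\<^sub>0)\<^sup>2
      = t\<^sup>2 * ((w - w\<^sub>0) \<bullet> (w + w\<^sub>0)) + (norm E)\<^sup>2 + 2 * t * (a \<bullet> (w - w\<^sub>0)) + 2 * (a \<bullet> E) + 2 * t * (w \<bullet> E)"
    unfolding e1 e2 e3 distrib_left[of "t\<^sup>2"] by simp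
  have CS: "\<bar>x \<bullet> y\<bar> \<le> p * q" if "norm x \<le> p" "norm y \<le> q" for x y :: 'v and p q
    by (rule order_trans[OF Cauchy_Schwarz_ineq2 mult_mono[OF that order_trans[OF norm_ge_zero that(1)] norm_ge_zero]])
  have 1: "\<bar>(w - w\<^sub>0) \<bullet> (w + w\<^sub>0)\<bar> \<le> \<rho> * (2 * c + \<rho>)"
    using norm_triangle_ineq[of w w\<^sub>0] wn w0 by (intro CS w) auto
  have 2: "(norm E)\<^sup>2 \<le> (c * (\<bar>t\<bar> * \<epsilon>))\<^sup>2" by (rule power_mono[OF E]) simp
  have 3: "\<bar>a \<bullet> (w - w\<^sub>0)\<bar> \<le> c * \<epsilon> * \<rho>" by (rule CS[OF a w])
  have 4: "\<bar>a \<bullet> E\<bar> \<le> c * \<epsilon> * (c * (\<bar>t\<bar> * \<epsilon>))" by (rule CS[OF a E])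
  have 5: "\<bar>w \<bullet> E\<bar> \<le> (c + \<rho>) * (c * (\<bar>t\<bar> * \<epsilon>))" by (rule CS[OF wn E])
  let ?T = "\<bar>t\<bar>"
  have T: "?T * ?T = t\<^sup>2" by (simp add: power2_eq_square)
  have tri: "\<bar>p\<^sub>1 + p\<^sub>2 + p\<^sub>3 + p\<^sub>4 + p\<^sub>5\<bar> \<le> q\<^sub>1 + q\<^sub>2 + q\<^sub>3 + q\<^sub>4 + q\<^sub>5"
    if "\<bar>p\<^sub>1\<bar> \<le> q\<^sub>1" "\<bar>p\<^sub>2\<bar> \<le> q\<^sub>2" "\<bar>p\<^sub>3\<bar> \<le> q\<^sub>3" "\<bar>p\<^sub>4\<bar> \<le> q\<^sub>4" "\<bar>p\<^sub>5\<bar> \<le> q\<^sub>5"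
    for p\<^sub>1 p\<^sub>2 p\<^sub>3 p\<^sub>4 p\<^sub>5 q\<^sub>1 q\<^sub>2 q\<^sub>3 q\<^sub>4 q\<^sub>5 :: real
    using that by linarith
  have "\<bar>t\<^sup>2 * ((w - w\<^sub>0) \<bullet> (w + w\<^sub>0)) + (norm E)\<^sup>2 + 2 * t * (a \<bullet> (w - w\<^sub>0)) + 2 * (a \<bullet> E) + 2 * t * (w \<bullet> E)\<bar>
      \<le> t\<^sup>2 * (\<rho> * (2 * c + \<rho>)) + (c * (?T * \<epsilon>))\<^sup>2 + 2 * ?T * (c * \<epsilon> * \<rho>)
      + 2 * (c * \<epsilon> * (c * (?T * \<epsilon>))) + 2 * ?T * ((c + \<rho>) * (c * (?T * \<epsilon>)))"
  proof (rule tri)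
    show "\<bar>t\<^sup>2 * ((w - w\<^sub>0) \<bullet> (w + w\<^sub>0))\<bar> \<le> t\<^sup>2 * (\<rho> * (2 * c + \<rho>))"
      unfolding abs_mult abs_power2 by (rule mult_left_mono[OF 1 zero_le_power2])
    show "\<bar>(norm E)\<^sup>2\<bar> \<le> (c * (?T * \<epsilon>))\<^sup>2" using 2 by simp
    show "\<bar>2 * t * (a \<bullet> (w - w\<^sub>0))\<bar> \<le> 2 * ?T * (c * \<epsilon> * \<rho>)"
      unfolding abs_mult abs_numeral by (rule mult_left_mono[OF 3]) simp
    show "\<bar>2 * (a \<bullet> E)\<bar> \<le> 2 * (c * \<epsilon> * (c * (?T * \<epsilon>)))"
      unfolding abs_mult abs_numeral by (rule mult_left_mono[OF 4]) simp
    show "\<bar>2 * t * (w \<bullet> E)\<bar> \<le> 2 * ?T * ((c + \<rho>) * (c * (?T * \<epsilon>)))"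
      unfolding abs_mult[of _ "w \<bullet> E"] abs_mult[of 2] abs_numeral by (rule mult_left_mono[OF 5]) simp
  qed
  also have "\<dots> = 2 * ?T * (c * \<epsilon> * \<rho> + c\<^sup>2 * \<epsilon>\<^sup>2) + (t\<^sup>2 * (\<rho> * (2 * c + \<rho>)) + (?T * ?T) * (2 * (c + \<rho>) * c * \<epsilon>) + (?T * ?T) * (c\<^sup>2 * \<epsilon>\<^sup>2))"
    unfolding power_mult_distrib power2_eq_square[of ?T] by (simp only: power2_eq_square ring_distribs ac_simps)
  also have "\<dots> = 2 * ?T * (c * \<epsilon> * \<rho> + c\<^sup>2 * \<epsilon>\<^sup>2) + t\<^sup>2 * (\<rho> * (2 * c + \<rho>) + 2 * (c + \<rho>) * c * \<epsilon> + c\<^sup>2 * \<epsilon>\<^sup>2)"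
    unfolding T distrib_left[of "t\<^sup>2"] ..
  finally show ?thesis unfolding eq .
qed

lemma (in isonormal) log_likelihood_expansion:
  assumes dom: "a \<in> dom z" "w \<in> dom z" "E \<in> dom z"
    and orth: "a \<bullet> w\<^sub>0 = 0" and a: "norm a \<le> c * \<epsilon>" and w: "norm (w - w\<^sub>0) \<le> \<rho>" and w0: "norm w\<^sub>0 \<le> c"
    and E: "norm E \<le> c * (\<bar>t\<bar> * \<epsilon>)" and nonneg: "0 \<le> c" "0 \<le> \<epsilon>"
    and WE: "\<bar>W z E\<bar> \<le> y * (\<bar>t\<bar> * \<epsilon>)" and Ww: "\<bar>W z w - W z w\<^sub>0\<bar> \<le> \<omega>" and y: "0 \<le> y"
    and s: "0 \<le> s"
    and \<delta>: "\<omega> + y * \<epsilon> + s * (c * \<epsilon> * \<rho> + c\<^sup>2 * \<epsilon>\<^sup>2) + (\<rho> * (2 * c + \<rho>) + 2 * (c + \<rho>) * c * \<epsilon> + c\<^sup>2 * \<epsilon>\<^sup>2) / 2 \<le> \<delta>"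
  shows "\<bar>(W z (s *\<^sub>R (a + t *\<^sub>R w + E)) - (norm (s *\<^sub>R (a + t *\<^sub>R w + E)))\<^sup>2 / 2)
      - (W z (s *\<^sub>R a) - (norm (s *\<^sub>R a))\<^sup>2 / 2)
      - (s * t * W z w\<^sub>0 - s\<^sup>2 * t\<^sup>2 * (norm w\<^sub>0)\<^sup>2 / 2)\<bar> \<le> \<delta> * (1 + s\<^sup>2 * t\<^sup>2)"
proof -
  \<comment> \<open>In the local variable \<open>x = s * \<bar>t\<bar>\<close> all errors are linear
    or quadratic, and \<open>x \<le> 1 + x\<^sup>2\<close> absorbs the linear ones into the common
    weight \<open>1 + s\<^sup>2 * t\<^sup>2\<close>.\<close>
  define x where "x = s * \<bar>t\<bar>"
  have x: "0 \<le> x" "x \<le> 1 + x\<^sup>2" "x\<^sup>2 = s\<^sup>2 * t\<^sup>2"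
  proof -
    show "0 \<le> x" using s by (simp add: x_def)
    have "0 \<le> (x - 1)\<^sup>2" by simp
    then have "2 * x \<le> 1 + x\<^sup>2" by (simp add: power2_diff)
    then show "x \<le> 1 + x\<^sup>2" using \<open>0 \<le> x\<close> by linarith
  qed (simp add: x_def power_mult_distrib)
  let ?h = "a + t *\<^sub>R w + E"
  define Q where "Q = (norm ?h)\<^sup>2 - (norm a)\<^sup>2 - t\<^sup>2 * (norm w\<^sub>0)\<^sup>2"
  define A where "A = c * \<epsilon> * \<rho> + c\<^sup>2 * \<epsilon>\<^sup>2"
  define B where "B = \<rho> * (2 * c + \<rho>) + 2 * (c + \<rho>) * c * \<epsilon> + c\<^sup>2 * \<epsilon>\<^sup>2"
  have rho: "0 \<le> \<rho>" by (rule order_trans[OF norm_ge_zero w])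
  have AB: "0 \<le> A" "0 \<le> B" using nonneg rho by (auto simp: A_def B_def)
  have Q: "\<bar>Q\<bar> \<le> 2 * \<bar>t\<bar> * A + t\<^sup>2 * B"
    unfolding Q_def A_def B_def by (rule norm_square_expansion[OF orth a w w0 E nonneg])
  have tw: "t *\<^sub>R w \<in> dom z" by (rule subspace_scale[OF subspace_dom dom(2)])
  have atw: "a + t *\<^sub>R w \<in> dom z" by (rule subspace_add[OF subspace_dom dom(1) tw])
  have h: "?h \<in> dom z" by (rule subspace_add[OF subspace_dom atw dom(3)])
  have Wh: "W z (s *\<^sub>R ?h) = s * (W z a + t * W z w + W z E)"
    unfolding W_scale[OF h] W_add[OF atw dom(3)] W_add[OF dom(1) tw] W_scale[OF dom(2)] ..
  have "(W z (s *\<^sub>R ?h) - (norm (s *\<^sub>R ?h))\<^sup>2 / 2) - (W z (s *\<^sub>R a) - (norm (s *\<^sub>R a))\<^sup>2 / 2)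
      - (s * t * W z w\<^sub>0 - s\<^sup>2 * t\<^sup>2 * (norm w\<^sub>0)\<^sup>2 / 2)
      = s * t * (W z w - W z w\<^sub>0) + s * W z E - s\<^sup>2 * Q / 2"
    unfolding Wh W_scale[OF dom(1)] Q_def norm_scaleR power_mult_distrib by (simp add: algebra_simps diff_divide_distrib)
  also have "\<bar>\<dots>\<bar> \<le> x * \<omega> + x * (y * \<epsilon>) + (x * (s * A) + x\<^sup>2 * (B / 2))"
  proof -
    have "\<bar>s * t * (W z w - W z w\<^sub>0)\<bar> \<le> x * \<omega>"
      using Ww x(1) s by (simp add: abs_mult x_def mult_left_mono)
    moreover have "\<bar>s * W z E\<bar> \<le> x * (y * \<epsilon>)"
      using mult_left_mono[OF WE s] s by (simp add: abs_mult x_def mult_ac)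
    moreover have "\<bar>s\<^sup>2 * Q / 2\<bar> \<le> x * (s * A) + x\<^sup>2 * (B / 2)"
    proof -
      have "s\<^sup>2 * \<bar>Q\<bar> \<le> s\<^sup>2 * (2 * \<bar>t\<bar> * A + t\<^sup>2 * B)" by (rule mult_left_mono[OF Q]) simp
      also have "\<dots> = 2 * (x * (s * A) + x\<^sup>2 * (B / 2))"
        unfolding x(3) unfolding x_def by (simp add: distrib_left power2_eq_square)
      finally have "s\<^sup>2 * \<bar>Q\<bar> / 2 \<le> x * (s * A) + x\<^sup>2 * (B / 2)"
        using divide_right_mono[of "s\<^sup>2 * \<bar>Q\<bar>" "2 * (x * (s * A) + x\<^sup>2 * (B / 2))" 2] by simp
      then show ?thesis by (simp add: abs_mult)
    qed
    ultimately show ?thesis by linarith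
  qed
  also have "\<dots> \<le> (1 + x\<^sup>2) * \<omega> + (1 + x\<^sup>2) * (y * \<epsilon>) + ((1 + x\<^sup>2) * (s * A) + (1 + x\<^sup>2) * (B / 2))"
  proof -
    have om: "0 \<le> \<omega>" by (rule order_trans[OF abs_ge_zero Ww])
    have "x\<^sup>2 \<le> 1 + x\<^sup>2" by simp
    then show ?thesis
      using om AB by (intro add_mono mult_right_mono x(2) mult_nonneg_nonneg s y nonneg) auto
  qed
  also have "\<dots> = (\<omega> + y * \<epsilon> + s * A + B / 2) * (1 + x\<^sup>2)" by (simp add: algebra_simps)
  also have "\<dots> \<le> \<delta> * (1 + x\<^sup>2)"
  proof (rule mult_right_mono)
    show "\<omega> + y * \<epsilon> + s * A + B / 2 \<le> \<delta>" using \<delta> unfolding A_def B_def .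
  qed simp
  finally show ?thesis by (simp add: x(3))
qed

text \<open>The substitution \<open>f = g + h\<close> in both directions. Two density ratios enter
  because \<open>G\<close> restricts the old variable \<open>f\<close> in the upper bound and the
  new variable \<open>g\<close> in the lower bound. Here \<open>c\<close> is the cost of shifting
  the prior and \<open>k\<close> that of expanding the likelihood.\<close>

lemma integrated_likelihood_bounds:
  fixes \<nu> :: "'h::{real_normed_vector,second_countable_topology} measure" and R R\<^sub>0 :: "'h \<Rightarrow> real"
  assumes \<nu>: "sets \<nu> = sets borel" "prob_space \<nu>"
    and r: "density_version (shifted_law \<nu> 0) (shifted_law \<nu> h) r"
    and r': "density_version (shifted_law \<nu> (- h)) (shifted_law \<nu> 0) r'"
    and G: "G \<in> sets borel" and R: "R \<in> borel_measurable borel" and R\<^sub>0: "R\<^sub>0 \<in> borel_measurable borel"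
    and R\<^sub>0_nonneg: "\<And>f. 0 \<le> R\<^sub>0 f"
    and pos: "0 < c" "0 < k" "0 \<le> b"
    and rc: "\<And>f. f \<in> G \<Longrightarrow> 1 / c \<le> r f" "\<And>f. f \<in> G \<Longrightarrow> r' f \<le> c"
    and expand: "AE g in \<nu>. norm (g + h - f\<^sub>0) < 2 * \<epsilon> \<longrightarrow> R (g + h) \<le> k * b * R\<^sub>0 g \<and> b / k * R\<^sub>0 g \<le> R (g + h)"
  shows "(\<integral>\<^sup>+f\<in>G \<inter> {f. norm (f - f\<^sub>0) < \<epsilon>}. ennreal (R f) \<partial>\<nu>) \<le> ennreal (c * k * b) * (\<integral>\<^sup>+f. ennreal (R\<^sub>0 f) \<partial>\<nu>)" (is ?upper)
    and "norm h \<le> \<epsilon> \<Longrightarrow> ennreal (b / (c * k)) * (\<integral>\<^sup>+f\<in>G \<inter> {f. norm (f - f\<^sub>0) < \<epsilon>}. ennreal (R\<^sub>0 f) \<partial>\<nu>) \<le> (\<integral>\<^sup>+f. ennreal (R f) \<partial>\<nu>)"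
proof -
  note \<nu>(1) [measurable_cong, simp] and G [measurable] and R [measurable] and R\<^sub>0 [measurable]
  define \<phi> where "\<phi> \<epsilon>' f = ennreal (R f) * indicator {f. norm (f - f\<^sub>0) < \<epsilon>'} f" for f \<epsilon>'
  have \<phi> [measurable]: "\<phi> \<epsilon>' \<in> borel_measurable borel" for \<epsilon>' unfolding \<phi>_def by measurable
  show ?upper
  proof (cases "0 < \<epsilon>")
    case True
    have "(\<integral>\<^sup>+f\<in>G \<inter> {f. norm (f - f\<^sub>0) < \<epsilon>}. ennreal (R f) \<partial>\<nu>) = (\<integral>\<^sup>+f\<in>G. \<phi> \<epsilon> f \<partial>\<nu>)"
      by (intro nn_integral_cong) (auto simp: \<phi>_def indicator_def)
    also have "\<dots> = ennreal c * (ennreal (1 / c) * (\<integral>\<^sup>+f\<in>G. \<phi> \<epsilon> f \<partial>\<nu>))"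
      using pos by (simp add: mult.assoc[symmetric] ennreal_mult[symmetric])
    also have "\<dots> \<le> ennreal c * (\<integral>\<^sup>+g. \<phi> \<epsilon> (g + h) \<partial>\<nu>)"
      using pos by (intro mult_left_mono shift_bound_upper[OF \<nu>(1) r G _ rc(1) \<phi>]) auto
    also have "\<dots> \<le> ennreal c * (\<integral>\<^sup>+g. ennreal (k * b) * ennreal (R\<^sub>0 g) \<partial>\<nu>)"
    proof (intro mult_left_mono nn_integral_mono_AE)
      show "AE g in \<nu>. \<phi> \<epsilon> (g + h) \<le> ennreal (k * b) * ennreal (R\<^sub>0 g)"
        using expand
      proof eventually_elim
        case (elim g)
        then show ?case using True pos R\<^sub>0_nonneg[of g]
          by (cases "norm (g + h - f\<^sub>0) < \<epsilon>") (auto simp: \<phi>_def ennreal_mult[symmetric] intro!: ennreal_leI)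
      qed
    qed simp
    also have "\<dots> = ennreal c * (ennreal (k * b) * (\<integral>\<^sup>+g. ennreal (R\<^sub>0 g) \<partial>\<nu>))"
      by (subst nn_integral_cmult) auto
    also have "\<dots> = ennreal (c * k * b) * (\<integral>\<^sup>+f. ennreal (R\<^sub>0 f) \<partial>\<nu>)"
      using pos by (simp add: mult.assoc[symmetric] ennreal_mult[symmetric])
    finally show ?thesis .
  next
    case False
    have "\<not> norm (f - f\<^sub>0) < \<epsilon>" for f using False norm_ge_zero[of "f - f\<^sub>0"] by linarith
    then show ?thesis by simp
  qed
  \<comment> \<open>A shift of norm at most \<open>\<epsilon>\<close> moves the ball of radius
    \<open>\<epsilon>\<close> into the one of radius \<open>2 * \<epsilon>\<close>, which is why the
    expansion is required on the larger ball.\<close>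
  assume h: "norm h \<le> \<epsilon>"
  let ?B = "{f. norm (f - f\<^sub>0) < \<epsilon>}"
  have "ennreal (b / (c * k)) * (\<integral>\<^sup>+f\<in>G \<inter> ?B. ennreal (R\<^sub>0 f) \<partial>\<nu>)
      = ennreal (1 / c) * (ennreal (b / k) * (\<integral>\<^sup>+f\<in>G \<inter> ?B. ennreal (R\<^sub>0 f) \<partial>\<nu>))"
    using pos by (simp add: mult.assoc[symmetric] ennreal_mult[symmetric])
  also have "\<dots> = ennreal (1 / c) * (\<integral>\<^sup>+f. ennreal (b / k) * (ennreal (R\<^sub>0 f) * indicator (G \<inter> ?B) f) \<partial>\<nu>)"
    by (subst nn_integral_cmult) measurable
  also have "\<dots> \<le> ennreal (1 / c) * (\<integral>\<^sup>+g\<in>G. \<phi> (2 * \<epsilon>) (g + h) \<partial>\<nu>)"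
  proof (intro mult_left_mono nn_integral_mono_AE)
    show "AE g in \<nu>. ennreal (b / k) * (ennreal (R\<^sub>0 g) * indicator (G \<inter> ?B) g) \<le> \<phi> (2 * \<epsilon>) (g + h) * indicator G g"
      using expand
    proof eventually_elim
      case (elim g)
      show ?case
      proof (cases "g \<in> G \<inter> ?B")
        case True
        then have "norm (g + h - f\<^sub>0) < 2 * \<epsilon>" using h norm_triangle_ineq[of "g - f\<^sub>0" h]
          by (simp add: algebra_simps)
        then show ?thesis using True elim pos R\<^sub>0_nonneg[of g]
          by (auto simp: \<phi>_def ennreal_mult[symmetric] intro!: ennreal_leI)
      qed simp
    qed
  qed simp
  also have "\<dots> \<le> ennreal (1 / c) * (ennreal c * (\<integral>\<^sup>+f. \<phi> (2 * \<epsilon>) f \<partial>\<nu>))"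
    by (intro mult_left_mono shift_bound_lower[OF \<nu> r r' G rc(2) \<phi>]) auto
  also have "\<dots> = (\<integral>\<^sup>+f. \<phi> (2 * \<epsilon>) f \<partial>\<nu>)"
    using pos by (simp add: mult.assoc[symmetric] ennreal_mult[symmetric])
  also have "\<dots> \<le> (\<integral>\<^sup>+f. ennreal (R f) \<partial>\<nu>)"
    by (intro nn_integral_mono) (auto simp: \<phi>_def indicator_def)
  finally show "ennreal (b / (c * k)) * (\<integral>\<^sup>+f\<in>G \<inter> ?B. ennreal (R\<^sub>0 f) \<partial>\<nu>) \<le> (\<integral>\<^sup>+f. ennreal (R f) \<partial>\<nu>)" .
qed


section \<open>Operator norms, priors and concentration\<close>

lemma opnorm_into_bound:
  assumes S: "normed_subspace S nS" and A: "linear A" and le: "opnorm_into S nS A \<le> ereal b"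
  shows "A h \<in> S" and "nS (A h) \<le> b * norm h"
proof -
  have S': "subspace S" "\<And>x c. x \<in> S \<Longrightarrow> nS (c *\<^sub>R x) = \<bar>c\<bar> * nS x" "nS 0 = 0"
    using S subspace_0 by (auto simp: normed_subspace_def)
  have unit: "A h \<in> S \<and> nS (A h) \<le> b" if "norm h \<le> 1" for h
  proof -
    have "(if A h \<in> S then ereal (nS (A h)) else \<infinity>) \<le> opnorm_into S nS A"
      unfolding opnorm_into_def by (rule SUP_upper) (use that in simp)
    also note le
    finally show ?thesis by (auto split: if_splits)
  qed
  have "A h \<in> S \<and> nS (A h) \<le> b * norm h"
  proof (cases "h = 0")
    case True
    then show ?thesis using S' by (simp add: linear_0[OF A] subspace_0)
  next
    case False
    let ?u = "h /\<^sub>R norm h"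
    have u: "A ?u \<in> S" "nS (A ?u) \<le> b" using unit[of ?u] False by auto
    have "A h = norm h *\<^sub>R A ?u" using False by (simp add: linear_scale[OF A])
    then show ?thesis
      using u S'(1,2) False mult_left_mono[OF u(2), of "norm h"] by (simp add: subspace_scale mult.commute)
  qed
  then show "A h \<in> S" "nS (A h) \<le> b * norm h" by auto
qed

lemma emeasure_param_prior_interval:
  assumes \<Theta>: "\<Theta> \<in> sets borel" and p: "p \<in> borel_measurable (restrict_space lborel \<Theta>)"
    and prob: "prob_space (param_prior \<Theta> p)"
    and sub: "{\<theta>\<^sub>0 - r<..<\<theta>\<^sub>0 + r} \<subseteq> \<Theta>" and r: "0 \<le> r"
    and p_le: "\<And>\<theta>. \<theta> \<in> {\<theta>\<^sub>0 - r<..<\<theta>\<^sub>0 + r} \<Longrightarrow> a \<le> p \<theta> \<and> p \<theta> \<le> b" and ab: "0 \<le> a" "0 \<le> b"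
  shows "{\<theta>\<^sub>0 - r<..<\<theta>\<^sub>0 + r} \<in> sets (param_prior \<Theta> p)"
    and "2 * r * a \<le> measure (param_prior \<Theta> p) {\<theta>\<^sub>0 - r<..<\<theta>\<^sub>0 + r}"
    and "measure (param_prior \<Theta> p) {\<theta>\<^sub>0 - r<..<\<theta>\<^sub>0 + r} \<le> 2 * r * b"
proof -
  interpret prob_space "param_prior \<Theta> p" by fact
  let ?I = "{\<theta>\<^sub>0 - r<..<\<theta>\<^sub>0 + r}"
  show I: "?I \<in> sets (param_prior \<Theta> p)"
    using \<Theta> sub by (simp add: sets_restrict_space_iff)
  have "emeasure (param_prior \<Theta> p) ?I = (\<integral>\<^sup>+\<theta>. indicator ?I \<theta> \<partial>param_prior \<Theta> p)" using I by simp
  also have "\<dots> = (\<integral>\<^sup>+\<theta>\<in>\<Theta>. (ennreal (p \<theta>) * indicator ?I \<theta>) \<partial>lborel)"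
    by (rule nn_integral_param_prior[OF \<Theta> p]) (auto intro: measurable_restrict_space1)
  finally have eq: "emeasure (param_prior \<Theta> p) ?I = (\<integral>\<^sup>+\<theta>\<in>\<Theta>. (ennreal (p \<theta>) * indicator ?I \<theta>) \<partial>lborel)" .
  have c: "(\<integral>\<^sup>+\<theta>. ennreal d * indicator ?I \<theta> \<partial>lborel) = ennreal (2 * r * d)" if "0 \<le> d" for d
    using r that by (simp add: nn_integral_cmult_indicator ennreal_mult[symmetric] mult.commute)
  have "ennreal (2 * r * a) \<le> emeasure (param_prior \<Theta> p) ?I"
    unfolding eq c[OF ab(1), symmetric]
    by (intro nn_integral_mono) (use p_le sub in \<open>auto simp: indicator_def ennreal_leI\<close>)
  then show "2 * r * a \<le> measure (param_prior \<Theta> p) ?I"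
    by (simp add: emeasure_eq_measure)
  have "emeasure (param_prior \<Theta> p) ?I \<le> ennreal (2 * r * b)"
    unfolding eq c[OF ab(2), symmetric]
    by (intro nn_integral_mono) (use p_le in \<open>auto simp: indicator_def ennreal_leI\<close>)
  then show "measure (param_prior \<Theta> p) ?I \<le> 2 * r * b"
    using r ab by (simp add: emeasure_eq_measure)
qed

text \<open>The likelihood mass of \<open>C\<close> is at most \<open>x / 2\<close> times that of
  \<open>B\<close>, hence of the whole space, so removing \<open>C\<close> from \<open>X\<close>
  costs posterior mass \<open>x / 2\<close>. The evidence is also shown to be a positive
  real.\<close>

lemma bayes_concentration:
  assumes M: "prob_space M" and L: "L \<in> borel_measurable M" and pos: "\<And>m. 0 < L m"
    and X: "X \<in> sets M" "1 - x / 2 \<le> measure (bayes M L) X" and x: "0 < x" "x < 1"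
    and C: "C \<in> sets M" "(\<integral>\<^sup>+m\<in>C. ennreal (L m) \<partial>M) \<le> ennreal (x / 2) * (\<integral>\<^sup>+m\<in>B. ennreal (L m) \<partial>M)"
    and A: "A \<in> sets M" "X - C \<subseteq> A"
  shows "\<exists>d>0. (\<integral>\<^sup>+m. ennreal (L m) \<partial>M) = ennreal d
      \<and> ennreal ((1 - x) * d) \<le> (\<integral>\<^sup>+m\<in>A. ennreal (L m) \<partial>M)
      \<and> 1 - x \<le> measure (bayes M L) A"
proof -
  interpret M: prob_space M by fact
  let ?D = "\<integral>\<^sup>+m. ennreal (L m) \<partial>M"
  let ?J = "\<lambda>A. \<integral>\<^sup>+m\<in>A. ennreal (L m) \<partial>M"
  have eb: "emeasure (bayes M L) A = ?J A / ?D" if "A \<in> sets M" for A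
    by (rule emeasure_bayes[OF L that])
  \<comment> \<open>An infinite denominator would make the posterior zero, against the mass of
    \<open>X\<close>.\<close>
  have Dfin: "?D \<noteq> \<infinity>"
  proof
    assume "?D = \<infinity>"
    then have "emeasure (bayes M L) X = 0" using eb[OF X(1)] by simp
    then show False using X(2) x by (simp add: measure_def)
  qed
  have "?D \<noteq> 0"
  proof
    assume "?D = 0"
    then have "AE m in M. ennreal (L m) = 0" using L by (simp add: nn_integral_0_iff_AE)
    then have "AE m in M. False"
    proof eventually_elim
      case (elim m)
      then show False using pos[of m] by simp
    qed
    then show False by simp
  qed
  define d where "d = enn2real ?D"
  have D: "?D = ennreal d" using Dfin by (simp add: d_def less_top)
  have d: "0 < d" using \<open>?D \<noteq> 0\<close> Dfin by (simp add: d_def enn2real_positive_iff less_top zero_less_iff_neq_zero)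
  have J_le: "?J A \<le> ennreal d" for A
    unfolding D[symmetric] by (intro nn_integral_mono) (auto simp: indicator_def)
  define j where "j A = enn2real (?J A)" for A
  have J: "?J A = ennreal (j A)" for A
    using J_le[of A] unfolding j_def by (simp add: le_less_trans[OF _ ennreal_less_top] order_le_less_trans)
  have j0: "0 \<le> j A" for A by (simp add: j_def)
  have mb: "measure (bayes M L) A = j A / d" if "A \<in> sets M" for A
    unfolding measure_def eb[OF that] D J using d j0[of A] by (simp add: divide_ennreal)
  have "j C \<le> x / 2 * d"
  proof -
    have "ennreal (j C) \<le> ennreal (x / 2) * ennreal d"
      using C(2) J_le[of B] unfolding J[of C, symmetric] by (meson mult_left_mono order_trans zero_le)
    then show ?thesis using x d by (simp add: ennreal_mult[symmetric] ennreal_le_iff)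
  qed
  moreover have "(1 - x / 2) * d \<le> j X"
    using X(2) d unfolding mb[OF X(1)] by (simp add: pos_le_divide_eq)
  moreover have "j X \<le> j A + j C"
  proof -
    have "?J X \<le> (\<integral>\<^sup>+m. ennreal (L m) * indicator A m + ennreal (L m) * indicator C m \<partial>M)"
      by (intro nn_integral_mono) (use A(2) in \<open>auto simp: indicator_def\<close>)
    also have "\<dots> = ?J A + ?J C" using L A(1) C(1) by (intro nn_integral_add) auto
    finally show ?thesis unfolding J using j0 by (simp add: ennreal_plus[symmetric] ennreal_le_iff del: ennreal_plus)
  qed
  ultimately have jA: "(1 - x) * d \<le> j A" by (simp add: algebra_simps)
  then have "1 - x \<le> measure (bayes M L) A" unfolding mb[OF A(1)] using d by (simp add: pos_le_divide_eq)
  then show ?thesis using d D jA J[of A] by (intro exI[of _ d]) (auto intro: ennreal_leI)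
qed


section \<open>The Bernstein-von Mises theorem\<close>

text \<open>The densities \<open>r n s t\<close> are fixed beforehand: the exceptional set of the
  prior is a union over uncountably many \<open>s\<close> and \<open>t\<close>, which depends on the
  versions chosen and need not be measurable. Hence the outer measure in
  \<open>d_shift\<close>.\<close>

locale bvm_setting =
  fixes e :: "nat \<Rightarrow> 'h::{real_inner,banach,second_countable_topology}"
    and \<Theta> :: "real set"
    and K K' :: "real \<Rightarrow> 'h \<Rightarrow>\<^sub>L 'h"
    and p :: "real \<Rightarrow> real"
    and \<pi>\<^sub>f :: "'h measure"
    and \<theta>\<^sub>0 :: real and f\<^sub>0 :: 'h
    and S :: "'h set" and nS :: "'h \<Rightarrow> real"
    and D\<^sub>0 D\<^sub>1 D\<^sub>2 D\<^sub>3 :: real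
    and \<epsilon> \<eta> \<rho> :: "nat \<Rightarrow> real"
    and \<gamma> :: "nat \<Rightarrow> 'h"
    and r :: "nat \<Rightarrow> real \<Rightarrow> real \<Rightarrow> 'h \<Rightarrow> real"
  assumes basis: "orthonormal_basis e"
    and compact: "compact \<Theta>"
    and p_cont: "continuous_on \<Theta> p"
    and p_bounds: "\<exists>c C. 0 < c \<and> (\<forall>\<theta>\<in>\<Theta>. c \<le> p \<theta> \<and> p \<theta> \<le> C)"
    and p_prob: "prob_space (param_prior \<Theta> p)"
    and pf_prob: "prob_space \<pi>\<^sub>f" and pf_sets: "sets \<pi>\<^sub>f = sets borel"
    and theta0: "\<theta>\<^sub>0 \<in> interior \<Theta>"
    and nonzero: "blinfun_apply (K' \<theta>\<^sub>0) f\<^sub>0 \<noteq> 0"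
    and a_S: "normed_subspace S nS" "stronger_norm S nS"
    and a_entropy: "(\<integral>\<^sup>+r\<in>{0<..<1}. sqrt_entropy r {h \<in> S. nS h \<le> 1} \<partial>lborel) < \<infinity>"
    and b_i: "\<And>\<theta>. \<theta> \<in> \<Theta> \<Longrightarrow> norm (K \<theta>) \<le> D\<^sub>0"
    and b_ii: "\<And>\<theta>. \<theta> \<in> \<Theta> \<Longrightarrow>
        opnorm_into S nS (blinfun_apply (K \<theta> - K \<theta>\<^sub>0)) \<le> ereal (D\<^sub>1 * \<bar>\<theta> - \<theta>\<^sub>0\<bar>)"
    and b_iii: "\<And>\<theta>. \<theta> \<in> \<Theta> \<Longrightarrow>
        opnorm_into S nS (blinfun_apply (K \<theta> - K \<theta>\<^sub>0 - (\<theta> - \<theta>\<^sub>0) *\<^sub>R K' \<theta>\<^sub>0))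
          \<le> ereal (D\<^sub>2 * (\<theta> - \<theta>\<^sub>0)\<^sup>2)"
    and b_iv: "\<And>\<theta>\<^sub>1 \<theta>\<^sub>2 f\<^sub>1 f\<^sub>2. \<theta>\<^sub>1 \<in> \<Theta> \<Longrightarrow> \<theta>\<^sub>2 \<in> \<Theta> \<Longrightarrow>
        norm (blinfun_apply (K \<theta>\<^sub>1) f\<^sub>1 - blinfun_apply (K \<theta>\<^sub>2) f\<^sub>2)
          \<le> D\<^sub>3 * \<bar>\<theta>\<^sub>1 - \<theta>\<^sub>2\<bar> * min (norm f\<^sub>1) (norm f\<^sub>2) + D\<^sub>3 * norm (f\<^sub>1 - f\<^sub>2)"
    and c_joint: "joint_contracts e K (param_prior \<Theta> p) \<pi>\<^sub>f \<theta>\<^sub>0 f\<^sub>0 \<epsilon>"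
    and c_given: "given_contracts e K \<pi>\<^sub>f \<theta>\<^sub>0 f\<^sub>0 \<epsilon>"
    and c_rate: "\<epsilon> \<longlonglongrightarrow> 0" "(\<lambda>n. (1 / sqrt (real n)) / \<epsilon> n) \<longlonglongrightarrow> 0"
    and d_eta: "\<And>n. 1 \<le> n \<Longrightarrow> 0 < \<eta> n" "\<eta> \<longlonglongrightarrow> 0"
    and d_gamma: "(\<lambda>n. norm (\<gamma> n - least_favorable K K' \<theta>\<^sub>0 f\<^sub>0)) \<in> O(\<rho>)"
    and d_rates: "(\<lambda>n. real n * \<epsilon> n ^ 4 + real n * (\<epsilon> n)\<^sup>2 * (\<rho> n)\<^sup>2) \<longlonglongrightarrow> 0"
    and d_ball: "\<And>n. 1 \<le> n \<Longrightarrow>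
        measure \<pi>\<^sub>f {f. norm (f - f\<^sub>0) \<le> \<epsilon> n / (2 * D\<^sub>3 + 2)} \<ge> exp (- (real n * (\<epsilon> n)\<^sup>2 / 65))"
    and d_version: "\<And>n s t. 1 \<le> n \<Longrightarrow> s \<in> {- \<epsilon> n <..< \<epsilon> n} \<Longrightarrow> t \<in> {- \<epsilon> n <..< \<epsilon> n} \<Longrightarrow>
        density_version (shifted_law \<pi>\<^sub>f (s *\<^sub>R \<gamma> n)) (shifted_law \<pi>\<^sub>f ((s + t) *\<^sub>R \<gamma> n)) (r n s t)"
    and d_shift: "\<And>n. 1 \<le> n \<Longrightarrow>
        outer_measure_of \<pi>\<^sub>f
          {f. \<exists>s\<in>{- \<epsilon> n <..< \<epsilon> n}. \<exists>t\<in>{- \<epsilon> n <..< \<epsilon> n}.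
                abs_log (r n s t f) > ereal (\<eta> n * (1 + real n * t\<^sup>2))}
          \<le> ennreal (exp (- (3 * real n * (\<epsilon> n)\<^sup>2)))"
begin

abbreviation \<pi>\<^sub>\<theta> :: "real measure" where "\<pi>\<^sub>\<theta> \<equiv> param_prior \<Theta> p"
abbreviation \<gamma>\<^sub>0 :: 'h where "\<gamma>\<^sub>0 \<equiv> least_favorable K K' \<theta>\<^sub>0 f\<^sub>0"
abbreviation I\<^sub>0 :: real where "I\<^sub>0 \<equiv> efficient_info K K' \<theta>\<^sub>0 f\<^sub>0"
abbreviation LR where "LR n \<equiv> likelihood_ratio e K \<theta>\<^sub>0 f\<^sub>0 n"
abbreviation obs where "obs n \<equiv> obs_map e f\<^sub>0 (K \<theta>\<^sub>0 f\<^sub>0) n"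

text \<open>The derivative at \<open>t = 0\<close> of the path of signals at the parameter
  \<open>\<theta>\<^sub>0 + t\<close> and the function \<open>f\<^sub>0 - t *\<^sub>R g\<close>. At
  the least favorable direction it is the efficient score direction, whose squared norm is the
  efficient information.\<close>

definition score :: "'h \<Rightarrow> 'h \<times> 'h" where
  "score g = (- g, K' \<theta>\<^sub>0 f\<^sub>0 - K \<theta>\<^sub>0 g)"

text \<open>The derivative is taken at \<open>f\<^sub>0\<close> and not at \<open>f\<close>, so that
  the linear term does not depend on the integration variable.\<close>

definition remainder :: "real \<Rightarrow> 'h \<Rightarrow> 'h" where
  "remainder \<theta> f = K \<theta> f - K \<theta>\<^sub>0 f - (\<theta> - \<theta>\<^sub>0) *\<^sub>R K' \<theta>\<^sub>0 f\<^sub>0"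

sublocale W: isonormal noise_law "noise_pairing e" "noise_dom e"
  by (rule isonormal_noise[OF basis])

sublocale \<pi>\<^sub>\<theta>: prob_space \<pi>\<^sub>\<theta> by (rule p_prob)
sublocale \<pi>\<^sub>f: prob_space \<pi>\<^sub>f by (rule pf_prob)
sublocale prior: pair_prob_space \<pi>\<^sub>\<theta> \<pi>\<^sub>f ..

declare pf_sets [simp, measurable_cong]

lemma space_pf [simp]: "space \<pi>\<^sub>f = UNIV"
  using sets_eq_imp_space_eq[OF pf_sets] by simp

lemma theta0_in: "\<theta>\<^sub>0 \<in> \<Theta>"
  by (rule subsetD[OF interior_subset theta0])

lemma Theta_borel [measurable]: "\<Theta> \<in> sets borel"
  using compact by (simp add: borel_compact)

lemma p_measurable: "p \<in> borel_measurable (restrict_space lborel \<Theta>)"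
proof -
  have "p \<in> borel_measurable (restrict_space borel \<Theta>)"
    by (rule borel_measurable_continuous_on_restrict[OF p_cont])
  moreover have "sets (restrict_space lborel \<Theta>) = sets (restrict_space borel \<Theta>)"
    by (rule sets_restrict_space_cong) (rule sets_lborel)
  ultimately show ?thesis using measurable_cong_sets by blast
qed

lemma I0_pos: "0 < I\<^sub>0"
  by (rule efficient_info_pos) (rule nonzero)

lemma I0_score: "I\<^sub>0 = (norm (score \<gamma>\<^sub>0))\<^sup>2"
  by (simp add: efficient_info_def score_def norm_prod_def)

lemma D3_nonneg: "0 \<le> D\<^sub>3"
proof -
  have "f\<^sub>0 \<noteq> 0" using nonzero by auto
  have "0 \<le> norm (K \<theta>\<^sub>0 f\<^sub>0 - K \<theta>\<^sub>0 0)" by simp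
  also have "\<dots> \<le> D\<^sub>3 * norm f\<^sub>0" using b_iv[OF theta0_in theta0_in, of f\<^sub>0 0] by simp
  finally show ?thesis using \<open>f\<^sub>0 \<noteq> 0\<close> by (simp add: zero_le_mult_iff)
qed

lemma score_orthogonal: "(a, K \<theta>\<^sub>0 a) \<bullet> score \<gamma>\<^sub>0 = 0"
  using least_favorable_inner[OF basis, of K K' \<theta>\<^sub>0 f\<^sub>0 a]
  by (simp add: score_def inner_diff_right inner_commute)

text \<open>The two-sided Lipschitz bound \<open>b_iv\<close> gives joint continuity on
  \<open>\<Theta> \<times> UNIV\<close>, the space on which the prior lives.\<close>

lemma measurable_K:
  "(\<lambda>(\<theta>, f). blinfun_apply (K \<theta>) f) \<in> borel_measurable (\<pi>\<^sub>\<theta> \<Otimes>\<^sub>M \<pi>\<^sub>f)"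
proof -
  have "continuous_on (\<Theta> \<times> UNIV) (\<lambda>(\<theta>, f). blinfun_apply (K \<theta>) f)"
    unfolding continuous_on_def
  proof (intro ballI)
    fix x assume x: "x \<in> \<Theta> \<times> (UNIV :: 'h set)"
    let ?F = "at x within \<Theta> \<times> UNIV"
    let ?b = "\<lambda>y. D\<^sub>3 * \<bar>fst y - fst x\<bar> * min (norm (snd y)) (norm (snd x)) + D\<^sub>3 * norm (snd y - snd x)"
    have id: "((\<lambda>y. y) \<longlongrightarrow> x) ?F" by (rule tendsto_ident_at)
    have "(?b \<longlongrightarrow> D\<^sub>3 * \<bar>fst x - fst x\<bar> * min (norm (snd x)) (norm (snd x)) + D\<^sub>3 * norm (snd x - snd x)) ?F"
      by (intro tendsto_intros tendsto_fst[OF id] tendsto_snd[OF id])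
    then have "(?b \<longlongrightarrow> 0) ?F" by simp
    moreover have "\<forall>\<^sub>F y in ?F. norm (blinfun_apply (K (fst y)) (snd y) - blinfun_apply (K (fst x)) (snd x)) \<le> ?b y"
      unfolding eventually_at_topological using x by (intro exI[of _ UNIV]) (auto intro!: b_iv)
    ultimately have "((\<lambda>y. blinfun_apply (K (fst y)) (snd y) - blinfun_apply (K (fst x)) (snd x)) \<longlongrightarrow> 0) ?F"
      by (rule Lim_null_comparison[rotated])
    then show "((\<lambda>(\<theta>, f). blinfun_apply (K \<theta>) f) \<longlongrightarrow> (case x of (\<theta>, f) \<Rightarrow> blinfun_apply (K \<theta>) f)) ?F"
      by (simp add: case_prod_beta' LIM_zero_iff)
  qed
  then have "(\<lambda>(\<theta>, f). blinfun_apply (K \<theta>) f) \<in> borel_measurable (restrict_space borel (\<Theta> \<times> UNIV))"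
    by (rule borel_measurable_continuous_on_restrict)
  moreover have "(\<lambda>x. x) \<in> \<pi>\<^sub>\<theta> \<Otimes>\<^sub>M \<pi>\<^sub>f \<rightarrow>\<^sub>M restrict_space borel (\<Theta> \<times> UNIV)"
  proof (rule measurable_restrict_space2)
    have "(\<lambda>x. x) \<in> \<pi>\<^sub>\<theta> \<rightarrow>\<^sub>M borel"
      by (subst measurable_cong_sets[OF sets_param_prior refl]) (rule measurable_restrict_space1, simp)
    then have "(\<lambda>x. (fst x, snd x)) \<in> \<pi>\<^sub>\<theta> \<Otimes>\<^sub>M \<pi>\<^sub>f \<rightarrow>\<^sub>M borel \<Otimes>\<^sub>M borel"
      by (intro measurable_Pair measurable_compose[OF measurable_fst] measurable_compose[OF measurable_snd])
        (simp_all add: measurable_cong_sets[OF pf_sets refl])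
    then show "(\<lambda>x. x) \<in> \<pi>\<^sub>\<theta> \<Otimes>\<^sub>M \<pi>\<^sub>f \<rightarrow>\<^sub>M borel" by (simp add: borel_prod)
  qed (auto simp: space_pair_measure)
  ultimately show ?thesis by (rule measurable_compose[rotated])
qed

lemma measurable_K_comp [measurable (raw)]:
  assumes "T \<in> M \<rightarrow>\<^sub>M \<pi>\<^sub>\<theta>" and "F \<in> borel_measurable M"
  shows "(\<lambda>m. blinfun_apply (K (T m)) (F m)) \<in> borel_measurable M"
proof -
  have "(\<lambda>m. (T m, F m)) \<in> M \<rightarrow>\<^sub>M \<pi>\<^sub>\<theta> \<Otimes>\<^sub>M \<pi>\<^sub>f"
    using assms by (intro measurable_Pair) (simp_all add: measurable_cong_sets[OF refl pf_sets])
  from measurable_compose[OF this measurable_K] show ?thesis by simp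
qed

lemma borel_measurable_blinfun [measurable (raw)]:
  fixes A :: "'h \<Rightarrow>\<^sub>L 'h"
  assumes "F \<in> borel_measurable M"
  shows "(\<lambda>m. blinfun_apply A (F m)) \<in> borel_measurable M"
  by (rule borel_measurable_continuous_on[OF _ assms]) (intro continuous_intros)

lemma param_prior_to_borel [measurable (raw)]: "T \<in> M \<rightarrow>\<^sub>M \<pi>\<^sub>\<theta> \<Longrightarrow> T \<in> borel_measurable M"
proof -
  have "(\<lambda>x. x) \<in> \<pi>\<^sub>\<theta> \<rightarrow>\<^sub>M borel"
    by (subst measurable_cong_sets[OF sets_param_prior refl]) (rule measurable_restrict_space1, simp)
  then show "T \<in> M \<rightarrow>\<^sub>M \<pi>\<^sub>\<theta> \<Longrightarrow> T \<in> borel_measurable M" using measurable_compose by blast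
qed

lemma measurable_LR:
  assumes "z \<in> space noise_law" and "T \<in> M \<rightarrow>\<^sub>M \<pi>\<^sub>\<theta>" and "F \<in> borel_measurable M"
  shows "(\<lambda>m. LR n z (T m) (F m)) \<in> borel_measurable M"
  unfolding likelihood_ratio_def centered_def using assms by measurable

lemma LR_pos: "0 < LR n z \<theta> f"
  by (simp add: likelihood_ratio_def)


subsection \<open>Rates\<close>

text \<open>Forced by contraction: for a radius that is not positive the neighbourhood is empty, so
  the posterior mass would miss one by more than one half at every data point.\<close>

lemma eps_pos: "\<forall>\<^sub>F n in sequentially. 0 < \<epsilon> n"
proof -
  let ?X = "\<lambda>n. {(\<theta>, f) \<in> space (\<pi>\<^sub>\<theta> \<Otimes>\<^sub>M \<pi>\<^sub>f). \<bar>\<theta> - \<theta>\<^sub>0\<bar> < \<epsilon> n \<and> norm (f - f\<^sub>0) < \<epsilon> n}"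
  have "vanishing noise_law (\<lambda>n. {z \<in> space noise_law. 1 / 2 < \<bar>measure (joint_posterior e K \<pi>\<^sub>\<theta> \<pi>\<^sub>f n (obs n z)) (?X n) - 1\<bar>})"
    by (rule tendsto_in_prob_distrD[OF c_joint[unfolded joint_contracts_def obs_law_eq]]) auto
  then have "\<forall>\<^sub>F n in sequentially. \<exists>B\<in>sets noise_law.
      {z \<in> space noise_law. 1 / 2 < \<bar>measure (joint_posterior e K \<pi>\<^sub>\<theta> \<pi>\<^sub>f n (obs n z)) (?X n) - 1\<bar>} \<subseteq> B \<and> emeasure noise_law B < ennreal 1"
    unfolding vanishing_def by (rule allE[of _ 1]) simp
  then show ?thesis
  proof eventually_elim
    case (elim n)
    show ?case
    proof (rule ccontr)
      assume "\<not> 0 < \<epsilon> n"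
      then have "?X n = {}" by (auto simp: not_less dest: order_trans[OF abs_ge_zero] less_le_trans)
      then have "space noise_law \<subseteq> {z \<in> space noise_law. 1 / 2 < \<bar>measure (joint_posterior e K \<pi>\<^sub>\<theta> \<pi>\<^sub>f n (obs n z)) (?X n) - 1\<bar>}"
        by (simp only: measure_empty) simp
      then obtain B where B: "B \<in> sets noise_law" "space noise_law \<subseteq> B" "emeasure noise_law B < 1"
        using elim by (auto simp: ennreal_1)
      then have "emeasure noise_law (space noise_law) < 1"
        using emeasure_mono[OF B(2,1)] by (meson order_le_less_trans)
      then show False using W.emeasure_space_1 by simp
    qed
  qed
qed

lemma n_eps_square: "filterlim (\<lambda>n. real n * (\<epsilon> n)\<^sup>2) at_top sequentially"
proof -
  have lim: "(\<lambda>n. ((1 / sqrt (real n)) / \<epsilon> n)\<^sup>2) \<longlonglongrightarrow> 0"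
    using tendsto_power[OF c_rate(2), of 2] by simp
  have "filterlim (\<lambda>n. ((1 / sqrt (real n)) / \<epsilon> n)\<^sup>2) (at_right 0) sequentially"
    unfolding filterlim_at_right_to_0[symmetric] filterlim_at
  proof (intro conjI)
    show "\<forall>\<^sub>F n in sequentially. ((1 / sqrt (real n)) / \<epsilon> n)\<^sup>2 \<in> {0<..} \<and> ((1 / sqrt (real n)) / \<epsilon> n)\<^sup>2 \<noteq> 0"
      using eps_pos eventually_gt_at_top[of 0] by eventually_elim auto
  qed (use lim in simp)
  then have "filterlim (\<lambda>n. inverse (((1 / sqrt (real n)) / \<epsilon> n)\<^sup>2)) at_top sequentially"
    by (rule filterlim_compose[OF filterlim_inverse_at_top_right])
  then show ?thesis
    by (rule filterlim_mono_eventually) (use eps_pos in \<open>auto elim!: eventually_mono simp: power_divide power_mult_distrib field_simps\<close>)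
qed

text \<open>Each summand of the rate condition is nonnegative and so tends to zero itself; the
  limits are its square roots. As \<open>n * \<epsilon>\<^sup>2\<close> is eventually at least one,
  the second summand also forces the approximating directions to converge.\<close>

lemma rate_limits:
  shows gamma_lim: "(\<lambda>n. norm (\<gamma> n - \<gamma>\<^sub>0)) \<longlonglongrightarrow> 0"
    and sqrt_eps_square: "(\<lambda>n. sqrt (real n) * (\<epsilon> n)\<^sup>2) \<longlonglongrightarrow> 0"
    and sqrt_eps_gamma: "(\<lambda>n. sqrt (real n) * \<epsilon> n * norm (\<gamma> n - \<gamma>\<^sub>0)) \<longlonglongrightarrow> 0"
proof -
  let ?g = "\<lambda>n. norm (\<gamma> n - \<gamma>\<^sub>0)"
  have part: "(\<lambda>n. real n * \<epsilon> n ^ 4) \<longlonglongrightarrow> 0" "(\<lambda>n. real n * (\<epsilon> n)\<^sup>2 * (\<rho> n)\<^sup>2) \<longlonglongrightarrow> 0"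
    by (rule tendsto_sandwich[OF _ _ tendsto_const d_rates]; simp add: always_eventually)+
  have sq: "(\<lambda>n. a n) \<longlonglongrightarrow> 0" if "(\<lambda>n. (a n)\<^sup>2) \<longlonglongrightarrow> 0" for a :: "nat \<Rightarrow> real"
    using tendsto_real_sqrt[OF that] by (simp add: tendsto_rabs_zero_iff)
  show "(\<lambda>n. sqrt (real n) * (\<epsilon> n)\<^sup>2) \<longlonglongrightarrow> 0"
    by (rule sq) (use part(1) in \<open>simp add: power_mult_distrib flip: power_mult\<close>)
  obtain C where C: "\<forall>\<^sub>F n in sequentially. norm (?g n) \<le> C * norm (\<rho> n)" and "C > 0"
    using d_gamma by (rule landau_o.bigE)
  have nb: "(\<lambda>n. real n * (\<epsilon> n)\<^sup>2 * (?g n)\<^sup>2) \<longlonglongrightarrow> 0"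
  proof (rule tendsto_sandwich[OF _ _ tendsto_const])
    show "(\<lambda>n. C\<^sup>2 * (real n * (\<epsilon> n)\<^sup>2 * (\<rho> n)\<^sup>2)) \<longlonglongrightarrow> 0"
      using tendsto_mult[OF tendsto_const part(2), of "C\<^sup>2"] by simp
    show "\<forall>\<^sub>F n in sequentially. real n * (\<epsilon> n)\<^sup>2 * (?g n)\<^sup>2 \<le> C\<^sup>2 * (real n * (\<epsilon> n)\<^sup>2 * (\<rho> n)\<^sup>2)"
      using C
    proof eventually_elim
      case (elim n)
      then have "(?g n)\<^sup>2 \<le> (C * \<bar>\<rho> n\<bar>)\<^sup>2" by (intro power_mono) auto
      then have "real n * (\<epsilon> n)\<^sup>2 * (?g n)\<^sup>2 \<le> real n * (\<epsilon> n)\<^sup>2 * (C * \<bar>\<rho> n\<bar>)\<^sup>2"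
        by (intro mult_left_mono) auto
      then show ?case by (simp add: power_mult_distrib mult_ac)
    qed
  qed simp
  show "(\<lambda>n. sqrt (real n) * \<epsilon> n * ?g n) \<longlonglongrightarrow> 0"
    by (rule sq) (use nb in \<open>simp add: power_mult_distrib\<close>)
  show "?g \<longlonglongrightarrow> 0"
  proof (rule sq, rule tendsto_sandwich[OF _ _ tendsto_const nb])
    show "\<forall>\<^sub>F n in sequentially. (?g n)\<^sup>2 \<le> real n * (\<epsilon> n)\<^sup>2 * (?g n)\<^sup>2"
      using filterlim_at_top[THEN iffD1, OF n_eps_square, rule_format, of 1]
    proof eventually_elim
      case (elim n)
      then show ?case using mult_right_mono[OF elim, of "(?g n)\<^sup>2"] by simp
    qed
  qed simp
qed

lemma exp_rate:
  assumes "0 < c"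
  shows "(\<lambda>n. exp (- (c * (real n * (\<epsilon> n)\<^sup>2)))) \<longlonglongrightarrow> 0"
proof -
  have "filterlim (\<lambda>n. - (c * (real n * (\<epsilon> n)\<^sup>2))) at_bot sequentially"
    unfolding filterlim_uminus_at_bot minus_minus
    by (rule filterlim_tendsto_pos_mult_at_top[OF tendsto_const assms n_eps_square])
  then show ?thesis by (rule filterlim_compose[OF exp_at_bot])
qed


subsection \<open>The local expansion\<close>

text \<open>The remainder is the Taylor error at \<open>f\<close> plus \<open>(\<theta> -
  \<theta>\<^sub>0) *\<^sub>R K' \<theta>\<^sub>0 (f - f\<^sub>0)\<close>. The first is quadratic in
  \<open>\<theta> - \<theta>\<^sub>0\<close>, the second a product of two small factors once the
  derivative is known to be bounded into \<open>S\<close>.\<close>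

lemma remainder_bound:
  "\<exists>c\<ge>0. \<forall>\<theta>\<in>\<Theta>. \<forall>f s. \<bar>\<theta> - \<theta>\<^sub>0\<bar> \<le> s \<longrightarrow> s \<le> 1 \<longrightarrow> norm (f - f\<^sub>0) \<le> 2 * s \<longrightarrow>
     remainder \<theta> f \<in> S \<and> nS (remainder \<theta> f) \<le> c * (\<bar>\<theta> - \<theta>\<^sub>0\<bar> * s) \<and> norm (remainder \<theta> f) \<le> c * (\<bar>\<theta> - \<theta>\<^sub>0\<bar> * s)"
proof -
  have sub: "subspace S" and nS0: "\<And>x. x \<in> S \<Longrightarrow> 0 \<le> nS x"
    and nS_scale: "\<And>x c. x \<in> S \<Longrightarrow> nS (c *\<^sub>R x) = \<bar>c\<bar> * nS x"
    and nS_add: "\<And>x y. x \<in> S \<Longrightarrow> y \<in> S \<Longrightarrow> nS (x + y) \<le> nS x + nS y"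
    using a_S(1) by (auto simp: normed_subspace_def)
  obtain C where C: "\<And>x. x \<in> S \<Longrightarrow> norm x \<le> C * nS x"
    using a_S(2) by (auto simp: stronger_norm_def)
  let ?A = "\<lambda>\<theta>. blinfun_apply (K \<theta> - K \<theta>\<^sub>0)"
  let ?B = "\<lambda>\<theta>. blinfun_apply (K \<theta> - K \<theta>\<^sub>0 - (\<theta> - \<theta>\<^sub>0) *\<^sub>R K' \<theta>\<^sub>0)"
  have lin: "linear (blinfun_apply T)" for T :: "'h \<Rightarrow>\<^sub>L 'h"
    by (rule bounded_linear.linear[OF blinfun.bounded_linear_right])
  have A: "?A \<theta> h \<in> S" "nS (?A \<theta> h) \<le> D\<^sub>1 * \<bar>\<theta> - \<theta>\<^sub>0\<bar> * norm h" if "\<theta> \<in> \<Theta>" for \<theta> h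
    using opnorm_into_bound[OF a_S(1) lin b_ii[OF that]] by blast+
  have B: "?B \<theta> h \<in> S" "nS (?B \<theta> h) \<le> D\<^sub>2 * (\<theta> - \<theta>\<^sub>0)\<^sup>2 * norm h" if "\<theta> \<in> \<Theta>" for \<theta> h
    using opnorm_into_bound[OF a_S(1) lin b_iii[OF that]] by blast+
  \<comment> \<open>Boundedness of \<open>K' \<theta>\<^sub>0\<close> into \<open>S\<close> is
    obtained from \<open>b_ii\<close> and \<open>b_iii\<close> at one other parameter, which exists
    as \<open>\<theta>\<^sub>0\<close> is interior; \<open>D\<^sub>4\<close> is the resulting
    constant.\<close>
  obtain \<theta>\<^sub>1 where th1: "\<theta>\<^sub>1 \<in> \<Theta>" "\<theta>\<^sub>1 \<noteq> \<theta>\<^sub>0"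
  proof -
    obtain r where r: "0 < r" "cball \<theta>\<^sub>0 r \<subseteq> \<Theta>" using theta0 by (auto simp: mem_interior_cball)
    then have "\<theta>\<^sub>0 + r \<in> \<Theta>" by (intro subsetD[OF r(2)]) (simp add: dist_real_def)
    then show ?thesis using r(1) by (intro that[of "\<theta>\<^sub>0 + r"]) auto
  qed
  let ?t\<^sub>1 = "\<theta>\<^sub>1 - \<theta>\<^sub>0"
  define D\<^sub>4 where "D\<^sub>4 = (\<bar>D\<^sub>1\<bar> * \<bar>?t\<^sub>1\<bar> + \<bar>D\<^sub>2\<bar> * ?t\<^sub>1\<^sup>2) / \<bar>?t\<^sub>1\<bar>"
  have D4: "0 \<le> D\<^sub>4" by (simp add: D\<^sub>4_def)
  have K': "K' \<theta>\<^sub>0 h \<in> S" "nS (K' \<theta>\<^sub>0 h) \<le> D\<^sub>4 * norm h" for h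
  proof -
    have eq: "?t\<^sub>1 *\<^sub>R K' \<theta>\<^sub>0 h = ?A \<theta>\<^sub>1 h + (- 1) *\<^sub>R ?B \<theta>\<^sub>1 h"
      by (simp add: blinfun.diff_left blinfun.scaleR_left)
    have S1: "(- 1) *\<^sub>R ?B \<theta>\<^sub>1 h \<in> S" by (rule subspace_scale[OF sub B(1)[OF th1(1)]])
    have mem: "?t\<^sub>1 *\<^sub>R K' \<theta>\<^sub>0 h \<in> S" unfolding eq by (rule subspace_add[OF sub A(1)[OF th1(1)] S1])
    have "K' \<theta>\<^sub>0 h = (1 / ?t\<^sub>1) *\<^sub>R (?t\<^sub>1 *\<^sub>R K' \<theta>\<^sub>0 h)" using th1(2) by simp
    then show S: "K' \<theta>\<^sub>0 h \<in> S" using subspace_scale[OF sub mem] by metis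
    have "\<bar>?t\<^sub>1\<bar> * nS (K' \<theta>\<^sub>0 h) = nS (?A \<theta>\<^sub>1 h + (- 1) *\<^sub>R ?B \<theta>\<^sub>1 h)"
      unfolding eq[symmetric] by (rule nS_scale[OF S, symmetric])
    also have "\<dots> \<le> nS (?A \<theta>\<^sub>1 h) + nS ((- 1) *\<^sub>R ?B \<theta>\<^sub>1 h)" by (rule nS_add[OF A(1)[OF th1(1)] S1])
    also have "nS ((- 1) *\<^sub>R ?B \<theta>\<^sub>1 h) = nS (?B \<theta>\<^sub>1 h)" using nS_scale[OF B(1)[OF th1(1)], of "- 1" h] by simp
    also have "nS (?A \<theta>\<^sub>1 h) + nS (?B \<theta>\<^sub>1 h) \<le> \<bar>D\<^sub>1\<bar> * \<bar>?t\<^sub>1\<bar> * norm h + \<bar>D\<^sub>2\<bar> * ?t\<^sub>1\<^sup>2 * norm h"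
      by (intro add_mono order_trans[OF A(2)[OF th1(1)]] order_trans[OF B(2)[OF th1(1)]] mult_right_mono) auto
    also have "\<dots> = \<bar>?t\<^sub>1\<bar> * (D\<^sub>4 * norm h)" unfolding D\<^sub>4_def using th1(2) by (simp add: distrib_right)
    finally show "nS (K' \<theta>\<^sub>0 h) \<le> D\<^sub>4 * norm h" using th1(2) by simp
  qed
  define c where "c = \<bar>D\<^sub>2\<bar> * (norm f\<^sub>0 + 2) + 2 * D\<^sub>4"
  have c0: "0 \<le> c" using D4 by (simp add: c_def)
  have main: "remainder \<theta> f \<in> S \<and> nS (remainder \<theta> f) \<le> c * (\<bar>\<theta> - \<theta>\<^sub>0\<bar> * s)"
    if th: "\<theta> \<in> \<Theta>" and s: "\<bar>\<theta> - \<theta>\<^sub>0\<bar> \<le> s" "s \<le> 1" and f: "norm (f - f\<^sub>0) \<le> 2 * s" for \<theta> f s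
  proof -
    let ?t = "\<theta> - \<theta>\<^sub>0"
    have eq: "remainder \<theta> f = ?B \<theta> f + ?t *\<^sub>R K' \<theta>\<^sub>0 (f - f\<^sub>0)"
      unfolding remainder_def blinfun.diff_left blinfun.diff_right blinfun.scaleR_left
      by (simp add: scaleR_diff_right)
    have S1: "?t *\<^sub>R K' \<theta>\<^sub>0 (f - f\<^sub>0) \<in> S" by (rule subspace_scale[OF sub K'(1)])
    have "remainder \<theta> f \<in> S" unfolding eq by (rule subspace_add[OF sub B(1)[OF th] S1])
    have nf: "norm f \<le> norm f\<^sub>0 + 2" using norm_triangle_ineq[of "f - f\<^sub>0" f\<^sub>0] f s by simp
    have t2: "?t\<^sup>2 \<le> \<bar>?t\<bar> * s"
      using mult_left_mono[OF s(1), of "\<bar>?t\<bar>"] by (simp add: power2_eq_square)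
    have "nS (remainder \<theta> f) \<le> nS (?B \<theta> f) + nS (?t *\<^sub>R K' \<theta>\<^sub>0 (f - f\<^sub>0))"
      unfolding eq by (rule nS_add[OF B(1)[OF th] S1])
    also have "nS (?t *\<^sub>R K' \<theta>\<^sub>0 (f - f\<^sub>0)) = \<bar>?t\<bar> * nS (K' \<theta>\<^sub>0 (f - f\<^sub>0))" by (rule nS_scale[OF K'(1)])
    also have "nS (?B \<theta> f) + \<bar>?t\<bar> * nS (K' \<theta>\<^sub>0 (f - f\<^sub>0))
        \<le> \<bar>D\<^sub>2\<bar> * (\<bar>?t\<bar> * s) * (norm f\<^sub>0 + 2) + \<bar>?t\<bar> * (D\<^sub>4 * (2 * s))"
    proof (intro add_mono mult_left_mono)
      have "D\<^sub>2 * ?t\<^sup>2 * norm f \<le> \<bar>D\<^sub>2\<bar> * (\<bar>?t\<bar> * s) * (norm f\<^sub>0 + 2)"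
        using t2 nf order_trans[OF abs_ge_zero s(1)] by (intro mult_mono mult_nonneg_nonneg) auto
      then show "nS (?B \<theta> f) \<le> \<bar>D\<^sub>2\<bar> * (\<bar>?t\<bar> * s) * (norm f\<^sub>0 + 2)" using B(2)[OF th, of f] by linarith
      show "nS (K' \<theta>\<^sub>0 (f - f\<^sub>0)) \<le> D\<^sub>4 * (2 * s)"
        using K'(2)[of "f - f\<^sub>0"] mult_left_mono[OF f D4] by linarith
    qed simp
    also have "\<dots> = c * (\<bar>?t\<bar> * s)" by (simp add: c_def algebra_simps)
    finally show ?thesis using \<open>remainder \<theta> f \<in> S\<close> by simp
  qed
  show ?thesis
  proof (intro exI[of _ "c + \<bar>C\<bar> * c"] conjI ballI allI impI)
    show "0 \<le> c + \<bar>C\<bar> * c" using c0 by simp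
    fix \<theta> f s assume th: "\<theta> \<in> \<Theta>" and s: "\<bar>\<theta> - \<theta>\<^sub>0\<bar> \<le> s" "s \<le> 1" and f: "norm (f - f\<^sub>0) \<le> 2 * s"
    let ?u = "\<bar>\<theta> - \<theta>\<^sub>0\<bar> * s"
    have u0: "0 \<le> ?u" using s(1) by (intro mult_nonneg_nonneg) auto
    have m: "remainder \<theta> f \<in> S" "nS (remainder \<theta> f) \<le> c * ?u" using main[OF th s f] by auto
    have cu: "0 \<le> \<bar>C\<bar> * (c * ?u)" "0 \<le> c * ?u" using c0 u0 by (auto intro!: mult_nonneg_nonneg)
    show "remainder \<theta> f \<in> S" by (rule m)
    show "nS (remainder \<theta> f) \<le> (c + \<bar>C\<bar> * c) * ?u"
      unfolding distrib_right mult.assoc[of "\<bar>C\<bar>"] using m(2) cu by linarith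
    have "norm (remainder \<theta> f) \<le> \<bar>C\<bar> * nS (remainder \<theta> f)"
      using C[OF m(1)] mult_right_mono[OF abs_ge_self nS0[OF m(1)], of C] by linarith
    also have "\<dots> \<le> \<bar>C\<bar> * (c * ?u)" by (rule mult_left_mono[OF m(2)]) simp
    finally show "norm (remainder \<theta> f) \<le> (c + \<bar>C\<bar> * c) * ?u"
      unfolding distrib_right mult.assoc[of "\<bar>C\<bar>"] using cu by linarith
  qed
qed

text \<open>Chaining over the unit ball of \<open>S\<close>, placed in the second component where
  the operators act, and homogeneity. The bound \<open>Y\<close> is common to all \<open>E\<close>;
  only the null set depends on \<open>E\<close>.\<close>

lemma noise_bound_on_S:
  "\<exists>Y\<in>borel_measurable noise_law. (\<forall>z. 0 \<le> Y z) \<and>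
     (\<forall>E\<in>S. \<forall>s. nS E \<le> s \<longrightarrow> (AE z in noise_law. \<bar>noise_pairing e z (0, E)\<bar> \<le> Y z * s))"
proof -
  let ?B = "{h \<in> S. nS h \<le> 1}"
  obtain C where C: "\<And>k. finite (C k)" "\<And>k x. x \<in> ?B \<Longrightarrow> \<exists>c\<in>C k. dist x c \<le> (1 / 2) ^ k"
    and sC: "summable (\<lambda>k. (1 / 2) ^ k * sqrt (ln (real (card (C k)))))"
    using dyadic_nets[OF a_entropy] by blast
  have "\<exists>Y\<in>borel_measurable noise_law. \<forall>x\<in>Pair 0 ` ?B. AE z in noise_law. \<bar>noise_pairing e z x\<bar> \<le> Y z"
  proof (rule W.AE_chaining_bound[where C = "\<lambda>k. Pair 0 ` C k"])
    show "finite (Pair 0 ` C k)" for k using C(1) by simp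
    show "\<exists>c\<in>Pair 0 ` C k. norm (x - c) \<le> (1 / 2) ^ k" if "x \<in> Pair 0 ` ?B" for k x
    proof -
      obtain h where h: "h \<in> ?B" "x = (0, h)" using \<open>x \<in> Pair 0 ` ?B\<close> by blast
      obtain c where "c \<in> C k" "dist h c \<le> (1 / 2) ^ k" using C(2)[OF h(1)] by blast
      then show ?thesis by (intro bexI[of _ "(0, c)"]) (auto simp: h(2) norm_Pair dist_norm)
    qed
    have "card (Pair (0::'h) ` C k) = card (C k)" for k by (rule card_image) (simp add: inj_on_def)
    then show "summable (\<lambda>k. (1 / 2) ^ k * sqrt (ln (real (card (Pair (0::'h) ` C k)))))" using sC by simp
  qed
  then obtain Y where Y [measurable]: "Y \<in> borel_measurable noise_law"
    and bound: "\<And>h. h \<in> ?B \<Longrightarrow> AE z in noise_law. \<bar>noise_pairing e z (0, h)\<bar> \<le> Y z" by blast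
  show ?thesis
  proof (intro bexI[of _ "\<lambda>z. \<bar>Y z\<bar>"] conjI allI ballI impI)
    fix E s assume E: "E \<in> S" "nS E \<le> s"
    have nS: "0 \<le> nS E" "nS E = 0 \<longleftrightarrow> E = 0" "\<And>c. nS (c *\<^sub>R E) = \<bar>c\<bar> * nS E" and sub: "subspace S"
      using a_S(1) E(1) by (auto simp: normed_subspace_def)
    show "AE z in noise_law. \<bar>noise_pairing e z (0, E)\<bar> \<le> \<bar>Y z\<bar> * s"
    proof (cases "s = 0")
      case True
      then have "E = 0" using E nS by auto
      then show ?thesis using True W.W_zero by (simp add: zero_prod_def)
    next
      case False
      then have s: "0 < s" using E nS by linarith
      let ?u = "(1 / s) *\<^sub>R E"
      have "nS ?u = nS E / s" using nS(3)[of "1 / s"] s by simp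
      then have "nS ?u \<le> 1" using E(2) s by (simp add: pos_divide_le_eq)
      then have u: "?u \<in> ?B" using subspace_scale[OF sub E(1)] by simp
      show ?thesis
        using bound[OF u] W.AE_dom[of "(0, ?u)"]
      proof eventually_elim
        case (elim z)
        have "(0, E) = s *\<^sub>R (0, ?u)" using s by simp
        then have "noise_pairing e z (0, E) = s * noise_pairing e z (0, ?u)" using W.W_scale[OF elim(2)] by metis
        then have "\<bar>noise_pairing e z (0, E)\<bar> = s * \<bar>noise_pairing e z (0, ?u)\<bar>" using s by (simp add: abs_mult)
        also have "\<dots> \<le> s * \<bar>Y z\<bar>" using elim(1) s by (intro mult_left_mono) auto
        finally show ?case by (simp add: mult.commute)
      qed
    qed
  qed auto
qed

text \<open>The properties of the noise used by the expansion. They hold for almost all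
  \<open>(\<theta>, g)\<close> only, as the remainder, and with it the exceptional null set, varies
  with both.\<close>

definition regular :: "real \<Rightarrow> ((nat \<Rightarrow> real) \<times> (nat \<Rightarrow> real) \<Rightarrow> real) \<Rightarrow> nat
    \<Rightarrow> (nat \<Rightarrow> real) \<times> (nat \<Rightarrow> real) \<Rightarrow> bool" where
  "regular c Y n z \<longleftrightarrow> score (\<gamma> n) \<in> noise_dom e z \<and>
     (AE \<theta> in \<pi>\<^sub>\<theta>. AE g in \<pi>\<^sub>f. \<bar>\<theta> - \<theta>\<^sub>0\<bar> < \<epsilon> n \<and> norm (g - (\<theta> - \<theta>\<^sub>0) *\<^sub>R \<gamma> n - f\<^sub>0) < 2 * \<epsilon> n \<longrightarrow>
        (g - f\<^sub>0, K \<theta>\<^sub>0 (g - f\<^sub>0)) \<in> noise_dom e z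
        \<and> (0, remainder \<theta> (g - (\<theta> - \<theta>\<^sub>0) *\<^sub>R \<gamma> n)) \<in> noise_dom e z
        \<and> \<bar>noise_pairing e z (0, remainder \<theta> (g - (\<theta> - \<theta>\<^sub>0) *\<^sub>R \<gamma> n))\<bar> \<le> Y z * (c * (\<bar>\<theta> - \<theta>\<^sub>0\<bar> * \<epsilon> n)))"

lemma AE_regular:
  assumes eps: "\<epsilon> n \<le> 1" and Y [measurable]: "Y \<in> borel_measurable noise_law"
    and c: "\<And>\<theta> f. \<theta> \<in> \<Theta> \<Longrightarrow> \<bar>\<theta> - \<theta>\<^sub>0\<bar> \<le> \<epsilon> n \<Longrightarrow> norm (f - f\<^sub>0) \<le> 2 * \<epsilon> n \<Longrightarrow>
       remainder \<theta> f \<in> S \<and> nS (remainder \<theta> f) \<le> c * (\<bar>\<theta> - \<theta>\<^sub>0\<bar> * \<epsilon> n)"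
    and YS: "\<And>E s. E \<in> S \<Longrightarrow> nS E \<le> s \<Longrightarrow> AE z in noise_law. \<bar>noise_pairing e z (0, E)\<bar> \<le> Y z * s"
  shows "AE z in noise_law. regular c Y n z"
proof -
  let ?f = "\<lambda>m. snd m - (fst m - \<theta>\<^sub>0) *\<^sub>R \<gamma> n"
  let ?P = "\<lambda>z m. \<bar>fst m - \<theta>\<^sub>0\<bar> < \<epsilon> n \<and> norm (?f m - f\<^sub>0) < 2 * \<epsilon> n \<longrightarrow>
        (snd m - f\<^sub>0, K \<theta>\<^sub>0 (snd m - f\<^sub>0)) \<in> noise_dom e z
        \<and> (0, remainder (fst m) (?f m)) \<in> noise_dom e z
        \<and> \<bar>noise_pairing e z (0, remainder (fst m) (?f m))\<bar> \<le> Y z * (c * (\<bar>fst m - \<theta>\<^sub>0\<bar> * \<epsilon> n))"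
  have [measurable]: "(\<lambda>x. snd (snd x)) \<in> borel_measurable (noise_law \<Otimes>\<^sub>M (\<pi>\<^sub>\<theta> \<Otimes>\<^sub>M \<pi>\<^sub>f))"
    using measurable_compose[OF measurable_snd measurable_snd, of noise_law \<pi>\<^sub>\<theta> \<pi>\<^sub>f]
    by (simp add: measurable_cong_sets[OF refl pf_sets])
  have [measurable]: "(\<lambda>x. fst (snd x)) \<in> noise_law \<Otimes>\<^sub>M (\<pi>\<^sub>\<theta> \<Otimes>\<^sub>M \<pi>\<^sub>f) \<rightarrow>\<^sub>M \<pi>\<^sub>\<theta>"
    by (rule measurable_compose[OF measurable_snd measurable_fst])
  have [measurable]: "(\<lambda>x. ?f (snd x)) \<in> borel_measurable (noise_law \<Otimes>\<^sub>M (\<pi>\<^sub>\<theta> \<Otimes>\<^sub>M \<pi>\<^sub>f))"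
    by measurable
  have [measurable]: "(\<lambda>x. remainder (fst (snd x)) (?f (snd x))) \<in> borel_measurable (noise_law \<Otimes>\<^sub>M (\<pi>\<^sub>\<theta> \<Otimes>\<^sub>M \<pi>\<^sub>f))"
    unfolding remainder_def by measurable
  have "AE z in noise_law. AE m in \<pi>\<^sub>\<theta> \<Otimes>\<^sub>M \<pi>\<^sub>f. ?P z m"
  proof (rule W.AE_AE_swap)
    show "sigma_finite_measure (\<pi>\<^sub>\<theta> \<Otimes>\<^sub>M \<pi>\<^sub>f)" by (rule prior.P.sigma_finite_measure_axioms)
    show "Measurable.pred (noise_law \<Otimes>\<^sub>M (\<pi>\<^sub>\<theta> \<Otimes>\<^sub>M \<pi>\<^sub>f)) (\<lambda>(z, m). ?P z m)"
      unfolding case_prod_beta' by measurable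
    fix m assume m: "m \<in> space (\<pi>\<^sub>\<theta> \<Otimes>\<^sub>M \<pi>\<^sub>f)"
    show "AE z in noise_law. ?P z m"
    proof (cases "\<bar>fst m - \<theta>\<^sub>0\<bar> < \<epsilon> n \<and> norm (?f m - f\<^sub>0) < 2 * \<epsilon> n")
      case True
      have "fst m \<in> \<Theta>" using m by (auto simp: space_pair_measure)
      then have "remainder (fst m) (?f m) \<in> S" "nS (remainder (fst m) (?f m)) \<le> c * (\<bar>fst m - \<theta>\<^sub>0\<bar> * \<epsilon> n)"
        using c[of "fst m" "?f m"] True by auto
      from YS[OF this] W.AE_dom[of "(snd m - f\<^sub>0, K \<theta>\<^sub>0 (snd m - f\<^sub>0))"] W.AE_dom[of "(0, remainder (fst m) (?f m))"]
      show ?thesis by eventually_elim blast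
    qed auto
  qed
  then show ?thesis
    using W.AE_dom[of "score (\<gamma> n)"]
  proof eventually_elim
    case (elim z)
    have "AE \<theta> in \<pi>\<^sub>\<theta>. AE g in \<pi>\<^sub>f. ?P z (\<theta>, g)" by (rule prior.AE_pair[OF elim(1)])
    then show ?case unfolding regular_def using elim(2) by simp
  qed
qed

lemma D0_nonneg: "0 \<le> D\<^sub>0"
  using order_trans[OF norm_ge_zero b_i[OF theta0_in]] .

lemma norm_graph_le: "norm (a, K \<theta>\<^sub>0 a) \<le> (1 + D\<^sub>0) * norm a"
proof -
  have "norm (a, K \<theta>\<^sub>0 a) \<le> norm a + norm (K \<theta>\<^sub>0 a)" by (rule norm_Pair_le)
  also have "norm (K \<theta>\<^sub>0 a) \<le> norm (K \<theta>\<^sub>0) * norm a" by (rule norm_blinfun)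
  also have "\<dots> \<le> D\<^sub>0 * norm a" by (rule mult_right_mono[OF b_i[OF theta0_in]]) simp
  finally show ?thesis by (simp add: algebra_simps)
qed

lemma score_diff: "score g - score h = - (g - h, K \<theta>\<^sub>0 (g - h))"
  by (simp add: score_def blinfun.diff_right)

text \<open>Splits the signal difference into the part at the true parameter, the linear term and
  the remainder: the summands \<open>a\<close>, \<open>t *\<^sub>R w\<close> and \<open>E\<close> of
  the abstract expansion.\<close>

lemma centered_shift:
  "centered K \<theta>\<^sub>0 f\<^sub>0 n \<theta> (g - (\<theta> - \<theta>\<^sub>0) *\<^sub>R h)
    = sqrt (real n) *\<^sub>R ((g - f\<^sub>0, K \<theta>\<^sub>0 (g - f\<^sub>0)) + (\<theta> - \<theta>\<^sub>0) *\<^sub>R score h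
        + (0, remainder \<theta> (g - (\<theta> - \<theta>\<^sub>0) *\<^sub>R h)))"
  unfolding centered_def
  by (rule arg_cong[where f = "scaleR (sqrt (real n))"])
     (simp add: score_def remainder_def blinfun.diff_right blinfun.add_right blinfun.scaleR_right algebra_simps)

lemma LR_expansion:
  fixes \<theta> \<delta> c :: real and g :: 'h and n :: nat and z :: "(nat \<Rightarrow> real) \<times> (nat \<Rightarrow> real)"
  defines "t \<equiv> \<theta> - \<theta>\<^sub>0"
  defines "f \<equiv> g - t *\<^sub>R \<gamma> n"
  assumes z: "score (\<gamma> n) \<in> noise_dom e z" "(g - f\<^sub>0, K \<theta>\<^sub>0 (g - f\<^sub>0)) \<in> noise_dom e z"
      "(0, remainder \<theta> f) \<in> noise_dom e z"
    and WE: "\<bar>noise_pairing e z (0, remainder \<theta> f)\<bar> \<le> y * (\<bar>t\<bar> * \<epsilon> n)"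
    and Ww: "\<bar>noise_pairing e z (score (\<gamma> n)) - noise_pairing e z (score \<gamma>\<^sub>0)\<bar> \<le> \<omega>"
    and E: "norm (remainder \<theta> f) \<le> c * (\<bar>t\<bar> * \<epsilon> n)"
    and t: "\<bar>t\<bar> < \<epsilon> n" and f: "norm (f - f\<^sub>0) < 2 * \<epsilon> n"
    and \<Gamma>: "norm (\<gamma> n) \<le> \<Gamma>"
    and c: "(1 + D\<^sub>0) * (2 + \<Gamma>) \<le> c" "norm (score \<gamma>\<^sub>0) \<le> c" and eps: "0 < \<epsilon> n" and y: "0 \<le> y"
    and \<rho>: "(1 + D\<^sub>0) * norm (\<gamma> n - \<gamma>\<^sub>0) \<le> \<rho>'"
    and \<delta>: "\<omega> + y * \<epsilon> n + sqrt (real n) * (c * \<epsilon> n * \<rho>' + c\<^sup>2 * (\<epsilon> n)\<^sup>2)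
        + (\<rho>' * (2 * c + \<rho>') + 2 * (c + \<rho>') * c * \<epsilon> n + c\<^sup>2 * (\<epsilon> n)\<^sup>2) / 2 \<le> \<delta>"
  defines "q \<equiv> sqrt (real n) * t * noise_pairing e z (score \<gamma>\<^sub>0) - real n * t\<^sup>2 * I\<^sub>0 / 2"
  shows "LR n z \<theta> f \<le> exp (\<delta> * (1 + real n * t\<^sup>2)) * exp q * LR n z \<theta>\<^sub>0 g"
    and "exp q / exp (\<delta> * (1 + real n * t\<^sup>2)) * LR n z \<theta>\<^sub>0 g \<le> LR n z \<theta> f"
proof -
  let ?a = "(g - f\<^sub>0, K \<theta>\<^sub>0 (g - f\<^sub>0))" and ?E = "(0, remainder \<theta> f)"
  let ?s = "sqrt (real n)"
  have c0: "0 \<le> c" using c(2) norm_ge_zero order_trans by blast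
  \<comment> \<open>The shift enlarges the radius from \<open>2 * \<epsilon> n\<close> by at most
    \<open>\<Gamma> * \<epsilon> n\<close>, whence the factor \<open>2 + \<Gamma>\<close> in the
    condition on \<open>c\<close>.\<close>
  have "norm (g - f\<^sub>0) \<le> norm (f - f\<^sub>0) + norm (t *\<^sub>R \<gamma> n)"
    using norm_triangle_ineq[of "f - f\<^sub>0" "t *\<^sub>R \<gamma> n"] by (simp add: f_def)
  also have "norm (t *\<^sub>R \<gamma> n) \<le> \<epsilon> n * \<Gamma>"
    unfolding norm_scaleR using t \<Gamma> eps by (intro mult_mono) auto
  finally have "norm (g - f\<^sub>0) \<le> (2 + \<Gamma>) * \<epsilon> n" using f by (simp add: algebra_simps)
  then have "(1 + D\<^sub>0) * norm (g - f\<^sub>0) \<le> (1 + D\<^sub>0) * ((2 + \<Gamma>) * \<epsilon> n)"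
    using D0_nonneg by (intro mult_left_mono) auto
  also have "\<dots> \<le> c * \<epsilon> n" using mult_right_mono[OF c(1), of "\<epsilon> n"] eps by (simp add: mult.assoc)
  finally have a: "norm ?a \<le> c * \<epsilon> n" using norm_graph_le[of "g - f\<^sub>0"] by linarith
  have w: "norm (score (\<gamma> n) - score \<gamma>\<^sub>0) \<le> \<rho>'"
    unfolding score_diff norm_minus_cancel using norm_graph_le[of "\<gamma> n - \<gamma>\<^sub>0"] \<rho> by linarith
  have E': "norm ?E \<le> c * (\<bar>t\<bar> * \<epsilon> n)" using E by (simp add: norm_Pair)
  have cs: "centered K \<theta>\<^sub>0 f\<^sub>0 n \<theta> f = ?s *\<^sub>R (?a + t *\<^sub>R score (\<gamma> n) + ?E)"
    unfolding f_def t_def by (rule centered_shift)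
  have c\<^sub>0: "centered K \<theta>\<^sub>0 f\<^sub>0 n \<theta>\<^sub>0 g = ?s *\<^sub>R ?a"
    by (simp add: centered_def blinfun.diff_right)
  have ss: "?s\<^sup>2 = real n" by simp
  have "\<bar>(noise_pairing e z (centered K \<theta>\<^sub>0 f\<^sub>0 n \<theta> f) - (norm (centered K \<theta>\<^sub>0 f\<^sub>0 n \<theta> f))\<^sup>2 / 2)
      - (noise_pairing e z (centered K \<theta>\<^sub>0 f\<^sub>0 n \<theta>\<^sub>0 g) - (norm (centered K \<theta>\<^sub>0 f\<^sub>0 n \<theta>\<^sub>0 g))\<^sup>2 / 2)
      - (?s * t * noise_pairing e z (score \<gamma>\<^sub>0) - ?s\<^sup>2 * t\<^sup>2 * (norm (score \<gamma>\<^sub>0))\<^sup>2 / 2)\<bar> \<le> \<delta> * (1 + ?s\<^sup>2 * t\<^sup>2)"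
    unfolding cs c\<^sub>0
    by (rule W.log_likelihood_expansion[OF z(2,1,3) score_orthogonal a w c(2) E' c0 _ WE Ww y _ \<delta>]) (use eps in auto)
  then have "\<bar>ln (LR n z \<theta> f) - ln (LR n z \<theta>\<^sub>0 g) - q\<bar> \<le> \<delta> * (1 + real n * t\<^sup>2)"
    unfolding ss I0_score[symmetric] by (simp add: likelihood_ratio_def q_def)
  then have "ln (LR n z \<theta> f) \<le> \<delta> * (1 + real n * t\<^sup>2) + q + ln (LR n z \<theta>\<^sub>0 g)"
    and "q - \<delta> * (1 + real n * t\<^sup>2) + ln (LR n z \<theta>\<^sub>0 g) \<le> ln (LR n z \<theta> f)" by linarith+
  then have "exp (ln (LR n z \<theta> f)) \<le> exp (\<delta> * (1 + real n * t\<^sup>2) + q + ln (LR n z \<theta>\<^sub>0 g))"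
    and "exp (q - \<delta> * (1 + real n * t\<^sup>2) + ln (LR n z \<theta>\<^sub>0 g)) \<le> exp (ln (LR n z \<theta> f))" by simp_all
  then show "LR n z \<theta> f \<le> exp (\<delta> * (1 + real n * t\<^sup>2)) * exp q * LR n z \<theta>\<^sub>0 g"
    and "exp q / exp (\<delta> * (1 + real n * t\<^sup>2)) * LR n z \<theta>\<^sub>0 g \<le> LR n z \<theta> f"
    unfolding exp_add exp_diff exp_ln[OF LR_pos] .
qed


lemma space_noise [simp]: "space noise_law = UNIV"
  by (simp add: space_pair_measure)

lemma measurable_LR_slice [measurable]: "LR n z \<theta> \<in> borel_measurable borel"
proof -
  have [measurable]: "(\<lambda>_::'h. z) \<in> borel \<rightarrow>\<^sub>M noise_law" by simp
  show ?thesis unfolding likelihood_ratio_def centered_def by measurable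
qed

lemma measurable_LR_joint: "(\<lambda>(\<theta>, f). LR n z \<theta> f) \<in> borel_measurable (\<pi>\<^sub>\<theta> \<Otimes>\<^sub>M \<pi>\<^sub>f)"
proof -
  have "(\<lambda>m. LR n z (fst m) (snd m)) \<in> borel_measurable (\<pi>\<^sub>\<theta> \<Otimes>\<^sub>M \<pi>\<^sub>f)"
  proof (rule measurable_LR)
    show "snd \<in> borel_measurable (\<pi>\<^sub>\<theta> \<Otimes>\<^sub>M \<pi>\<^sub>f)"
      using measurable_snd[of \<pi>\<^sub>\<theta> \<pi>\<^sub>f] by (simp add: measurable_cong_sets[OF refl pf_sets])
  qed simp_all
  then show ?thesis by (simp add: case_prod_beta')
qed

lemma prior_close:
  assumes "0 < x"
  shows "\<forall>\<^sub>F n in sequentially. {\<theta>\<^sub>0 - \<epsilon> n<..<\<theta>\<^sub>0 + \<epsilon> n} \<subseteq> \<Theta> \<and>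
    (\<forall>\<theta>\<in>{\<theta>\<^sub>0 - \<epsilon> n<..<\<theta>\<^sub>0 + \<epsilon> n}. (1 - x) * p \<theta>\<^sub>0 \<le> p \<theta> \<and> p \<theta> \<le> (1 + x) * p \<theta>\<^sub>0)"
proof -
  have p0: "0 < p \<theta>\<^sub>0" using p_bounds theta0_in by force
  obtain r where r: "0 < r" "ball \<theta>\<^sub>0 r \<subseteq> \<Theta>" using theta0 by (auto simp: mem_interior)
  obtain d where d: "0 < d" "\<And>\<theta>. \<theta> \<in> \<Theta> \<Longrightarrow> dist \<theta> \<theta>\<^sub>0 < d \<Longrightarrow> dist (p \<theta>) (p \<theta>\<^sub>0) < x * p \<theta>\<^sub>0"
    using p_cont theta0_in assms p0 unfolding continuous_on_iff by (metis mult_pos_pos)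
  have "\<forall>\<^sub>F n in sequentially. \<epsilon> n < min r d" using c_rate(1) r(1) d(1) by (intro order_tendstoD) auto
  then show ?thesis
  proof eventually_elim
    case (elim n)
    have sub: "{\<theta>\<^sub>0 - \<epsilon> n<..<\<theta>\<^sub>0 + \<epsilon> n} \<subseteq> \<Theta>"
      by (rule order_trans[OF _ r(2)]) (use elim in \<open>auto simp: dist_real_def\<close>)
    moreover have "\<bar>p \<theta> - p \<theta>\<^sub>0\<bar> < x * p \<theta>\<^sub>0" if "\<theta> \<in> {\<theta>\<^sub>0 - \<epsilon> n<..<\<theta>\<^sub>0 + \<epsilon> n}" for \<theta>
      using d(2)[of \<theta>] sub that elim by (auto simp: dist_real_def)
    ultimately show ?case by (fastforce simp: algebra_simps abs_less_iff)
  qed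
qed

text \<open>The complement of a measurable hull of the exceptional set has the required mass. Since
  \<open>abs_log\<close> is infinite at 0, the densities are positive there and both bounds on them
  follow.\<close>

lemma good_prior_sets:
  "\<exists>G. \<forall>n\<ge>1. G n \<in> sets borel \<and> measure \<pi>\<^sub>f (- G n) \<le> exp (- (3 * real n * (\<epsilon> n)\<^sup>2)) \<and>
     (\<forall>f\<in>G n. \<forall>s\<in>{- \<epsilon> n<..<\<epsilon> n}. \<forall>t\<in>{- \<epsilon> n<..<\<epsilon> n}.
        1 / exp (\<eta> n * (1 + real n * t\<^sup>2)) \<le> r n s t f \<and> r n s t f \<le> exp (\<eta> n * (1 + real n * t\<^sup>2)))"
proof -
  have "\<exists>G. G \<in> sets borel \<and> measure \<pi>\<^sub>f (- G) \<le> exp (- (3 * real n * (\<epsilon> n)\<^sup>2)) \<and>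
     (\<forall>f\<in>G. \<forall>s\<in>{- \<epsilon> n<..<\<epsilon> n}. \<forall>t\<in>{- \<epsilon> n<..<\<epsilon> n}.
        1 / exp (\<eta> n * (1 + real n * t\<^sup>2)) \<le> r n s t f \<and> r n s t f \<le> exp (\<eta> n * (1 + real n * t\<^sup>2)))"
    if n: "1 \<le> n" for n
  proof -
    let ?X = "{f. \<exists>s\<in>{- \<epsilon> n <..< \<epsilon> n}. \<exists>t\<in>{- \<epsilon> n <..< \<epsilon> n}. abs_log (r n s t f) > ereal (\<eta> n * (1 + real n * t\<^sup>2))}"
    obtain B where B: "B \<in> sets \<pi>\<^sub>f" "?X \<subseteq> B" "outer_measure_of \<pi>\<^sub>f ?X = emeasure \<pi>\<^sub>f B"
      using outer_measure_of_attain[of ?X \<pi>\<^sub>f] by auto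
    have "emeasure \<pi>\<^sub>f B \<le> ennreal (exp (- (3 * real n * (\<epsilon> n)\<^sup>2)))"
      using d_shift[OF n] B(3) by simp
    then have mB: "measure \<pi>\<^sub>f B \<le> exp (- (3 * real n * (\<epsilon> n)\<^sup>2))"
      by (simp add: \<pi>\<^sub>f.emeasure_eq_measure)
    show ?thesis
    proof (intro exI[of _ "- B"] conjI ballI)
      show "- B \<in> sets borel" using B(1) by simp
      show "measure \<pi>\<^sub>f (- (- B)) \<le> exp (- (3 * real n * (\<epsilon> n)\<^sup>2))" using mB by simp
      fix f s t assume f: "f \<in> - B" and s: "s \<in> {- \<epsilon> n<..<\<epsilon> n}" and t: "t \<in> {- \<epsilon> n<..<\<epsilon> n}"
      let ?m = "\<eta> n * (1 + real n * t\<^sup>2)"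
      have al: "abs_log (r n s t f) \<le> ereal ?m" using f s t B(2) by (force simp: not_less[symmetric])
      then have ne: "r n s t f \<noteq> 0" by (auto simp: abs_log_def)
      then have pos: "0 < r n s t f"
        using d_version[OF n s t] by (auto simp: density_version_def less_le)
      have "\<bar>ln (r n s t f)\<bar> \<le> ?m" using al ne by (simp add: abs_log_def)
      then have "exp (- ?m) \<le> exp (ln (r n s t f))" "exp (ln (r n s t f)) \<le> exp ?m" by auto
      then show "1 / exp ?m \<le> r n s t f" "r n s t f \<le> exp ?m"
        using pos by (simp_all add: exp_minus inverse_eq_divide)
    qed
  qed
  then show ?thesis by metis
qed


subsection \<open>Evidence\<close>

definition ball_radius :: "nat \<Rightarrow> real" where
  "ball_radius n = \<epsilon> n / (2 * D\<^sub>3 + 2)"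

text \<open>Together with \<open>ball_radius\<close> it makes each of the two terms in
  \<open>b_iv\<close> at most \<open>\<epsilon> n / 2\<close>. The added ones keep the denominators
  positive.\<close>

definition param_radius :: "nat \<Rightarrow> real" where
  "param_radius n = \<epsilon> n / (2 * (D\<^sub>3 + 1) * (norm f\<^sub>0 + 1))"

text \<open>The first component contributes \<open>(\<epsilon> n / 2)\<^sup>2\<close> and the second
  \<open>(\<epsilon> n)\<^sup>2\<close>, which explains the constant 5/4.\<close>

lemma centered_norm_le:
  assumes eps: "0 \<le> \<epsilon> n" and th: "\<theta> \<in> \<Theta>" "\<bar>\<theta> - \<theta>\<^sub>0\<bar> \<le> param_radius n" and f: "norm (f - f\<^sub>0) \<le> ball_radius n"
  shows "(norm (centered K \<theta>\<^sub>0 f\<^sub>0 n \<theta> f))\<^sup>2 \<le> 5 / 4 * (real n * (\<epsilon> n)\<^sup>2)"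
proof -
  have br: "ball_radius n \<le> \<epsilon> n / 2" "D\<^sub>3 * ball_radius n \<le> \<epsilon> n / 2"
  proof -
    have e: "ball_radius n = \<epsilon> n / 2 * (1 / (D\<^sub>3 + 1))" "D\<^sub>3 * ball_radius n = \<epsilon> n / 2 * (D\<^sub>3 / (D\<^sub>3 + 1))"
      using D3_nonneg by (simp_all add: ball_radius_def field_simps)
    have k: "1 / (D\<^sub>3 + 1) \<le> 1" "D\<^sub>3 / (D\<^sub>3 + 1) \<le> 1" using D3_nonneg by simp_all
    show "ball_radius n \<le> \<epsilon> n / 2" unfolding e(1) by (rule mult_left_le[OF k(1)]) (use eps in simp)
    show "D\<^sub>3 * ball_radius n \<le> \<epsilon> n / 2" unfolding e(2) by (rule mult_left_le[OF k(2)]) (use eps in simp)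
  qed
  have pr: "D\<^sub>3 * param_radius n * norm f\<^sub>0 \<le> \<epsilon> n / 2"
  proof -
    have e: "D\<^sub>3 * param_radius n * norm f\<^sub>0 = \<epsilon> n / 2 * ((D\<^sub>3 / (D\<^sub>3 + 1)) * (norm f\<^sub>0 / (norm f\<^sub>0 + 1)))"
      using D3_nonneg by (simp add: param_radius_def field_simps)
    have "(D\<^sub>3 / (D\<^sub>3 + 1)) * (norm f\<^sub>0 / (norm f\<^sub>0 + 1)) \<le> 1"
      using D3_nonneg by (intro mult_le_one) (auto simp: add_nonneg_pos)
    then show ?thesis unfolding e by (rule mult_left_le) (use eps in simp)
  qed
  have "norm (K \<theta> f - K \<theta>\<^sub>0 f\<^sub>0) \<le> D\<^sub>3 * \<bar>\<theta> - \<theta>\<^sub>0\<bar> * min (norm f) (norm f\<^sub>0) + D\<^sub>3 * norm (f - f\<^sub>0)"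
    by (rule b_iv[OF th(1) theta0_in])
  also have "\<dots> \<le> D\<^sub>3 * param_radius n * norm f\<^sub>0 + D\<^sub>3 * ball_radius n"
    using D3_nonneg th(2) f by (intro add_mono mult_mono mult_left_mono) (auto intro: order_trans[OF abs_ge_zero])
  also have "\<dots> \<le> \<epsilon> n" using pr br by linarith
  finally have K: "(norm (K \<theta> f - K \<theta>\<^sub>0 f\<^sub>0))\<^sup>2 \<le> (\<epsilon> n)\<^sup>2" by (intro power_mono) auto
  have "(norm (f - f\<^sub>0))\<^sup>2 \<le> (\<epsilon> n / 2)\<^sup>2" using f br by (intro power_mono) auto
  then have sum: "(norm (f - f\<^sub>0))\<^sup>2 + (norm (K \<theta> f - K \<theta>\<^sub>0 f\<^sub>0))\<^sup>2 \<le> 5 / 4 * (\<epsilon> n)\<^sup>2"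
    using K by (simp add: power_divide)
  have "(norm (centered K \<theta>\<^sub>0 f\<^sub>0 n \<theta> f))\<^sup>2 = real n * ((norm (f - f\<^sub>0))\<^sup>2 + (norm (K \<theta> f - K \<theta>\<^sub>0 f\<^sub>0))\<^sup>2)"
    unfolding centered_def norm_scaleR power_mult_distrib by (simp add: norm_prod_def)
  also have "\<dots> \<le> real n * (5 / 4 * (\<epsilon> n)\<^sup>2)" by (rule mult_left_mono[OF sum]) simp
  finally show ?thesis by simp
qed

lemma evidence_vanishing:
  assumes M: "finite_measure M" and T: "T \<in> M \<rightarrow>\<^sub>M \<pi>\<^sub>\<theta>" and F: "F \<in> borel_measurable M"
    and sets: "\<forall>\<^sub>F n in sequentially. B n \<in> sets M \<and> C n \<in> sets M"
    and B: "\<forall>\<^sub>F n in sequentially. \<forall>m\<in>B n. (norm (centered K \<theta>\<^sub>0 f\<^sub>0 n (T m) (F m)))\<^sup>2 \<le> 5 / 4 * (real n * (\<epsilon> n)\<^sup>2)"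
    and pos: "\<forall>\<^sub>F n in sequentially. 0 < measure M (B n)"
    and ratio: "\<forall>\<^sub>F n in sequentially. measure M (C n) \<le> a * exp (- (2 * (real n * (\<epsilon> n)\<^sup>2))) * measure M (B n)"
    and \<kappa>: "0 < \<kappa>"
  shows "vanishing noise_law (\<lambda>n. {z \<in> space noise_law.
     ennreal \<kappa> * (\<integral>\<^sup>+m\<in>B n. ennreal (LR n z (T m) (F m)) \<partial>M) < (\<integral>\<^sup>+m\<in>C n. ennreal (LR n z (T m) (F m)) \<partial>M)})"
proof -
  let ?y = "\<lambda>n. real n * (\<epsilon> n)\<^sup>2"
  \<comment> \<open>With \<open>S = 5 / 4 * ?y n\<close> in the evidence ratio, \<open>S / 8\<close>
    gives 5/32, and the factor \<open>exp S\<close> against \<open>exp (- (2 * ?y n))\<close> leaves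
    3/4.\<close>
  define b where "b n = 2 * exp (- (5 / 32 * ?y n)) + 2 * a / \<kappa> * exp (- (3 / 4 * ?y n))" for n
  have [measurable]: "(\<lambda>m. centered K \<theta>\<^sub>0 f\<^sub>0 n (T m) (F m)) \<in> borel_measurable M" for n
    unfolding centered_def using T F by measurable
  interpret M: finite_measure M by fact
  show ?thesis
  proof (rule vanishing_emeasure)
    have "b \<longlonglongrightarrow> 2 * 0 + 2 * a / \<kappa> * 0"
      unfolding b_def by (intro tendsto_add tendsto_mult tendsto_const exp_rate) auto
    then show "b \<longlonglongrightarrow> 0" by simp
    show "\<forall>\<^sub>F n in sequentially.
       {z \<in> space noise_law. ennreal \<kappa> * (\<integral>\<^sup>+m\<in>B n. ennreal (LR n z (T m) (F m)) \<partial>M) < (\<integral>\<^sup>+m\<in>C n. ennreal (LR n z (T m) (F m)) \<partial>M)} \<in> sets noise_law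
       \<and> emeasure noise_law {z \<in> space noise_law. ennreal \<kappa> * (\<integral>\<^sup>+m\<in>B n. ennreal (LR n z (T m) (F m)) \<partial>M) < (\<integral>\<^sup>+m\<in>C n. ennreal (LR n z (T m) (F m)) \<partial>M)} \<le> ennreal (b n)"
      using sets B pos ratio eps_pos eventually_ge_at_top[of 1]
    proof eventually_elim
      case (elim n)
      then have [measurable]: "B n \<in> sets M" "C n \<in> sets M" by auto
      have y: "0 < ?y n" using elim by simp
      have "emeasure noise_law {z \<in> space noise_law. ennreal \<kappa> * (\<integral>\<^sup>+m\<in>B n. ennreal (LR n z (T m) (F m)) \<partial>M) < (\<integral>\<^sup>+m\<in>C n. ennreal (LR n z (T m) (F m)) \<partial>M)}
         \<le> ennreal (2 * exp (- (5 / 4 * ?y n) / 8) + 2 * exp (5 / 4 * ?y n) * measure M (C n) / (\<kappa> * measure M (B n)))"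
        unfolding likelihood_ratio_def
        by (rule W.evidence_ratio[OF M]) (use elim y \<kappa> in auto)
      also have "\<dots> \<le> ennreal (b n)"
      proof (rule ennreal_leI)
        have "measure M (C n) / measure M (B n) \<le> a * exp (- (2 * ?y n))"
          using elim by (simp add: pos_divide_le_eq)
        then have "2 * exp (5 / 4 * ?y n) / \<kappa> * (measure M (C n) / measure M (B n))
            \<le> 2 * exp (5 / 4 * ?y n) / \<kappa> * (a * exp (- (2 * ?y n)))"
          using \<kappa> by (intro mult_left_mono) auto
        also have "\<dots> = 2 * a / \<kappa> * (exp (5 / 4 * ?y n) * exp (- (2 * ?y n)))" by simp
        also have "exp (5 / 4 * ?y n) * exp (- (2 * ?y n)) = exp (- (3 / 4 * ?y n))"
          by (simp add: exp_add[symmetric])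
        finally show "2 * exp (- (5 / 4 * ?y n) / 8) + 2 * exp (5 / 4 * ?y n) * measure M (C n) / (\<kappa> * measure M (B n)) \<le> b n"
          by (simp add: b_def)
      qed
      finally show ?case
      proof (intro conjI)
        show "{z \<in> space noise_law. ennreal \<kappa> * (\<integral>\<^sup>+m\<in>B n. ennreal (LR n z (T m) (F m)) \<partial>M) < (\<integral>\<^sup>+m\<in>C n. ennreal (LR n z (T m) (F m)) \<partial>M)} \<in> sets noise_law"
          unfolding likelihood_ratio_def by measurable
      qed
    qed
  qed
qed

lemma prior_times:
  assumes "A \<in> sets \<pi>\<^sub>\<theta>" and "B \<in> sets \<pi>\<^sub>f"
  shows "measure (\<pi>\<^sub>\<theta> \<Otimes>\<^sub>M \<pi>\<^sub>f) (A \<times> B) = measure \<pi>\<^sub>\<theta> A * measure \<pi>\<^sub>f B"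
  unfolding measure_def \<pi>\<^sub>f.emeasure_pair_measure_Times[OF assms] by (rule enn2real_mult)

lemma exp_ratio_le: "exp (- (3 * y)) \<le> exp (- (2 * y)) * exp (- (y / 65))" if "0 \<le> y" for y :: real
  using that by (simp add: exp_add[symmetric])

text \<open>The mass \<open>exp (- 3 y)\<close> of the bad set is at most \<open>exp (- 2 y)\<close>
  times the mass of the ball, because 3 exceeds 2 + 1/65.\<close>

lemma evidence_given_vanishing:
  assumes G: "\<And>n. 1 \<le> n \<Longrightarrow> G n \<in> sets borel \<and> measure \<pi>\<^sub>f (- G n) \<le> exp (- (3 * real n * (\<epsilon> n)\<^sup>2))" and \<kappa>: "0 < \<kappa>"
  shows "vanishing noise_law (\<lambda>n. {z \<in> space noise_law.
     ennreal \<kappa> * (\<integral>\<^sup>+f\<in>{f. norm (f - f\<^sub>0) \<le> ball_radius n}. ennreal (LR n z \<theta>\<^sub>0 f) \<partial>\<pi>\<^sub>f)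
       < (\<integral>\<^sup>+f\<in>- G n. ennreal (LR n z \<theta>\<^sub>0 f) \<partial>\<pi>\<^sub>f)})"
proof (rule evidence_vanishing[where T = "\<lambda>_. \<theta>\<^sub>0" and F = "\<lambda>f. f" and a = 1])
  show "finite_measure \<pi>\<^sub>f" by unfold_locales
  show "(\<lambda>_. \<theta>\<^sub>0) \<in> \<pi>\<^sub>f \<rightarrow>\<^sub>M \<pi>\<^sub>\<theta>" using theta0_in by simp
  show "(\<lambda>f. f) \<in> borel_measurable \<pi>\<^sub>f" by (simp add: measurable_cong_sets[OF pf_sets refl])
  show "\<forall>\<^sub>F n in sequentially. {f. norm (f - f\<^sub>0) \<le> ball_radius n} \<in> sets \<pi>\<^sub>f \<and> - G n \<in> sets \<pi>\<^sub>f"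
    using eventually_ge_at_top[of 1] by eventually_elim (simp add: borel_comp G)
  show "\<forall>\<^sub>F n in sequentially. \<forall>m\<in>{f. norm (f - f\<^sub>0) \<le> ball_radius n}. (norm (centered K \<theta>\<^sub>0 f\<^sub>0 n \<theta>\<^sub>0 m))\<^sup>2 \<le> 5 / 4 * (real n * (\<epsilon> n)\<^sup>2)"
    using eps_pos
  proof eventually_elim
    case (elim n)
    have "0 \<le> param_radius n" using elim D3_nonneg by (simp add: param_radius_def)
    then have "\<bar>\<theta>\<^sub>0 - \<theta>\<^sub>0\<bar> \<le> param_radius n" by simp
    from centered_norm_le[OF less_imp_le[OF elim] theta0_in this] show ?case by blast
  qed
  have ball: "exp (- (real n * (\<epsilon> n)\<^sup>2 / 65)) \<le> measure \<pi>\<^sub>f {f. norm (f - f\<^sub>0) \<le> ball_radius n}" if "1 \<le> n" for n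
    using d_ball[OF that] by (simp add: ball_radius_def)
  show "\<forall>\<^sub>F n in sequentially. 0 < measure \<pi>\<^sub>f {f. norm (f - f\<^sub>0) \<le> ball_radius n}"
    using eventually_ge_at_top[of 1] by eventually_elim (use ball less_le_trans[OF exp_gt_zero] in blast)
  show "\<forall>\<^sub>F n in sequentially. measure \<pi>\<^sub>f (- G n) \<le> 1 * exp (- (2 * (real n * (\<epsilon> n)\<^sup>2))) * measure \<pi>\<^sub>f {f. norm (f - f\<^sub>0) \<le> ball_radius n}"
    using eventually_ge_at_top[of 1]
  proof eventually_elim
    case (elim n)
    let ?y = "real n * (\<epsilon> n)\<^sup>2"
    have "measure \<pi>\<^sub>f (- G n) \<le> exp (- (3 * ?y))" using G[OF elim] by (simp add: mult.assoc)
    also have "\<dots> \<le> exp (- (2 * ?y)) * exp (- (?y / 65))" by (rule exp_ratio_le) simp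
    also have "\<dots> \<le> exp (- (2 * ?y)) * measure \<pi>\<^sub>f {f. norm (f - f\<^sub>0) \<le> ball_radius n}"
      by (rule mult_left_mono[OF ball[OF elim]]) simp
    finally show ?case by simp
  qed
qed (rule \<kappa>)

text \<open>The prior mass of the bad set is bounded only within \<open>|\<theta> - \<theta>\<^sub>0| < \<epsilon> n\<close>, so that the factor \<open>\<epsilon> n\<close>
  cancels against the mass of the neighbourhood in the evidence; otherwise one would need
  \<open>n \<epsilon>\<^sub>n\<^sup>2\<close> to dominate \<open>log (1 / \<epsilon>\<^sub>n)\<close>.\<close>

lemma evidence_joint_vanishing:
  assumes G: "\<And>n. 1 \<le> n \<Longrightarrow> G n \<in> sets borel \<and> measure \<pi>\<^sub>f (- G n) \<le> exp (- (3 * real n * (\<epsilon> n)\<^sup>2))" and \<kappa>: "0 < \<kappa>"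
  shows "vanishing noise_law (\<lambda>n. {z \<in> space noise_law.
     ennreal \<kappa> * (\<integral>\<^sup>+m\<in>{\<theta>\<^sub>0 - param_radius n<..<\<theta>\<^sub>0 + param_radius n} \<times> {f. norm (f - f\<^sub>0) \<le> ball_radius n}. ennreal (LR n z (fst m) (snd m)) \<partial>(\<pi>\<^sub>\<theta> \<Otimes>\<^sub>M \<pi>\<^sub>f))
       < (\<integral>\<^sup>+m\<in>{\<theta>\<^sub>0 - \<epsilon> n<..<\<theta>\<^sub>0 + \<epsilon> n} \<times> - G n. ennreal (LR n z (fst m) (snd m)) \<partial>(\<pi>\<^sub>\<theta> \<Otimes>\<^sub>M \<pi>\<^sub>f))})"
proof -
  define R where "R = 2 * (D\<^sub>3 + 1) * (norm f\<^sub>0 + 1)"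
  have pr_R: "param_radius n = \<epsilon> n / R" for n by (simp add: param_radius_def R_def)
  let ?I = "\<lambda>r. {\<theta>\<^sub>0 - r<..<\<theta>\<^sub>0 + r}" and ?b = "\<lambda>n. {f. norm (f - f\<^sub>0) \<le> ball_radius n}"
  have R1: "1 \<le> R"
  proof -
    have "1 * 1 \<le> (2 * (D\<^sub>3 + 1)) * (norm f\<^sub>0 + 1)" using D3_nonneg by (intro mult_mono) auto
    then show ?thesis by (simp add: R_def)
  qed
  have p0: "0 < p \<theta>\<^sub>0" using p_bounds theta0_in by force
  have fst_snd: "fst \<in> \<pi>\<^sub>\<theta> \<Otimes>\<^sub>M \<pi>\<^sub>f \<rightarrow>\<^sub>M \<pi>\<^sub>\<theta>" "snd \<in> borel_measurable (\<pi>\<^sub>\<theta> \<Otimes>\<^sub>M \<pi>\<^sub>f)"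
    using measurable_snd[of \<pi>\<^sub>\<theta> \<pi>\<^sub>f] by (simp_all add: measurable_cong_sets[OF refl pf_sets])
  \<comment> \<open>Near \<open>\<theta>\<^sub>0\<close> the prior density is within one half and
    three halves of \<open>p \<theta>\<^sub>0\<close>. The interval masses are thus at least
    \<open>\<epsilon> n / R * p \<theta>\<^sub>0\<close> and at most
    \<open>3 * \<epsilon> n * p \<theta>\<^sub>0\<close>, with ratio \<open>3 * R\<close>.\<close>
  have half: "0 < (1 / 2 :: real)" by simp
  have facts: "\<forall>\<^sub>F n in sequentially. ?I (param_radius n) \<subseteq> \<Theta> \<and> ?I (param_radius n) \<in> sets \<pi>\<^sub>\<theta> \<and> ?I (\<epsilon> n) \<in> sets \<pi>\<^sub>\<theta>
     \<and> ?b n \<in> sets \<pi>\<^sub>f \<and> - G n \<in> sets \<pi>\<^sub>f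
     \<and> 0 < \<epsilon> n \<and> 1 \<le> n \<and> \<epsilon> n / R * p \<theta>\<^sub>0 \<le> measure \<pi>\<^sub>\<theta> (?I (param_radius n)) \<and> measure \<pi>\<^sub>\<theta> (?I (\<epsilon> n)) \<le> 3 * \<epsilon> n * p \<theta>\<^sub>0"
    using prior_close[OF half] eps_pos eventually_ge_at_top[of 1]
  proof eventually_elim
    case (elim n)
    have pr: "0 \<le> param_radius n" "param_radius n \<le> \<epsilon> n"
      using elim R1 divide_left_mono[OF R1, of "\<epsilon> n"] by (auto simp: pr_R)
    have sub: "?I (param_radius n) \<subseteq> ?I (\<epsilon> n)" "?I (\<epsilon> n) \<subseteq> \<Theta>" using pr elim by auto
    have bnd: "1 / 2 * p \<theta>\<^sub>0 \<le> p \<theta> \<and> p \<theta> \<le> 3 / 2 * p \<theta>\<^sub>0" if "\<theta> \<in> ?I (\<epsilon> n)" for \<theta>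
      using elim(1) that by auto
    note int = emeasure_param_prior_interval[OF Theta_borel p_measurable p_prob, where a = "1 / 2 * p \<theta>\<^sub>0" and b = "3 / 2 * p \<theta>\<^sub>0"]
    have s1: "?I (param_radius n) \<subseteq> \<Theta>" using sub by (rule order_trans)
    have b1: "1 / 2 * p \<theta>\<^sub>0 \<le> p \<theta> \<and> p \<theta> \<le> 3 / 2 * p \<theta>\<^sub>0" if "\<theta> \<in> ?I (param_radius n)" for \<theta>
      using bnd subsetD[OF sub(1) that] by blast
    have nn: "0 \<le> 1 / 2 * p \<theta>\<^sub>0" "0 \<le> 3 / 2 * p \<theta>\<^sub>0" "0 \<le> \<epsilon> n" using p0 elim by auto
    have 1: "?I (param_radius n) \<in> sets \<pi>\<^sub>\<theta>" by (rule int(1)[OF s1 pr(1) b1 nn(1,2)])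
    have 2: "?I (\<epsilon> n) \<in> sets \<pi>\<^sub>\<theta>" by (rule int(1)[OF sub(2) nn(3) bnd nn(1,2)])
    have 3: "2 * param_radius n * (1 / 2 * p \<theta>\<^sub>0) \<le> measure \<pi>\<^sub>\<theta> (?I (param_radius n))"
      by (rule int(2)[OF s1 pr(1) b1 nn(1,2)])
    have 4: "measure \<pi>\<^sub>\<theta> (?I (\<epsilon> n)) \<le> 2 * \<epsilon> n * (3 / 2 * p \<theta>\<^sub>0)"
      by (rule int(3)[OF sub(2) nn(3) bnd nn(1,2)])
    have "- G n \<in> sets \<pi>\<^sub>f" unfolding pf_sets by (rule borel_comp) (use G[OF elim(3)] in blast)
    moreover have "\<epsilon> n / R * p \<theta>\<^sub>0 \<le> measure \<pi>\<^sub>\<theta> (?I (param_radius n))"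
      using 3 by (simp add: pr_R)
    moreover have "measure \<pi>\<^sub>\<theta> (?I (\<epsilon> n)) \<le> 3 * \<epsilon> n * p \<theta>\<^sub>0" using 4 by simp
    moreover have "?b n \<in> sets \<pi>\<^sub>f" by simp
    ultimately show ?case using s1 1 2 elim(2,3) by blast
  qed
  have ball: "exp (- (real n * (\<epsilon> n)\<^sup>2 / 65)) \<le> measure \<pi>\<^sub>f (?b n)" if "1 \<le> n" for n
    using d_ball[OF that] by (simp add: ball_radius_def)
  show ?thesis
  proof (rule evidence_vanishing[where T = fst and F = snd and a = "3 * R"])
    show "finite_measure (\<pi>\<^sub>\<theta> \<Otimes>\<^sub>M \<pi>\<^sub>f)" by (rule prior.P.finite_measure_axioms)
    show "\<forall>\<^sub>F n in sequentially. ?I (param_radius n) \<times> ?b n \<in> sets (\<pi>\<^sub>\<theta> \<Otimes>\<^sub>M \<pi>\<^sub>f) \<and> ?I (\<epsilon> n) \<times> - G n \<in> sets (\<pi>\<^sub>\<theta> \<Otimes>\<^sub>M \<pi>\<^sub>f)"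
      using facts by eventually_elim (blast intro: pair_measureI)
    show "\<forall>\<^sub>F n in sequentially. \<forall>m\<in>?I (param_radius n) \<times> ?b n. (norm (centered K \<theta>\<^sub>0 f\<^sub>0 n (fst m) (snd m)))\<^sup>2 \<le> 5 / 4 * (real n * (\<epsilon> n)\<^sup>2)"
      using facts
    proof eventually_elim
      case (elim n)
      show ?case
      proof
        fix m assume "m \<in> ?I (param_radius n) \<times> ?b n"
        then have m: "fst m \<in> ?I (param_radius n)" "norm (snd m - f\<^sub>0) \<le> ball_radius n" by auto
        then have "fst m \<in> \<Theta>" "\<bar>fst m - \<theta>\<^sub>0\<bar> \<le> param_radius n" using elim by (blast, auto)
        then show "(norm (centered K \<theta>\<^sub>0 f\<^sub>0 n (fst m) (snd m)))\<^sup>2 \<le> 5 / 4 * (real n * (\<epsilon> n)\<^sup>2)"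
          using elim m(2) by (intro centered_norm_le) auto
      qed
    qed
    show "\<forall>\<^sub>F n in sequentially. 0 < measure (\<pi>\<^sub>\<theta> \<Otimes>\<^sub>M \<pi>\<^sub>f) (?I (param_radius n) \<times> ?b n)"
      using facts
    proof eventually_elim
      case (elim n)
      then have s: "?I (param_radius n) \<in> sets \<pi>\<^sub>\<theta>" "?b n \<in> sets \<pi>\<^sub>f" and n: "1 \<le> n" "0 < \<epsilon> n"
        and lo: "\<epsilon> n / R * p \<theta>\<^sub>0 \<le> measure \<pi>\<^sub>\<theta> (?I (param_radius n))" by blast+
      have "0 < \<epsilon> n / R * p \<theta>\<^sub>0" using n(2) p0 R1 by (intro mult_pos_pos divide_pos_pos) auto
      then have "0 < measure \<pi>\<^sub>\<theta> (?I (param_radius n)) * measure \<pi>\<^sub>f (?b n)"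
        using lo less_le_trans[OF exp_gt_zero ball[OF n(1)]] by (intro mult_pos_pos) auto
      then show ?case by (simp only: prior_times[OF s(1,2)])
    qed
    show "\<forall>\<^sub>F n in sequentially. measure (\<pi>\<^sub>\<theta> \<Otimes>\<^sub>M \<pi>\<^sub>f) (?I (\<epsilon> n) \<times> - G n)
      \<le> 3 * R * exp (- (2 * (real n * (\<epsilon> n)\<^sup>2))) * measure (\<pi>\<^sub>\<theta> \<Otimes>\<^sub>M \<pi>\<^sub>f) (?I (param_radius n) \<times> ?b n)"
      using facts
    proof eventually_elim
      case (elim n)
      then have s: "?I (param_radius n) \<in> sets \<pi>\<^sub>\<theta>" "?b n \<in> sets \<pi>\<^sub>f" "?I (\<epsilon> n) \<in> sets \<pi>\<^sub>\<theta>" "- G n \<in> sets \<pi>\<^sub>f" and n: "1 \<le> n" "0 < \<epsilon> n"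
        and lo: "\<epsilon> n / R * p \<theta>\<^sub>0 \<le> measure \<pi>\<^sub>\<theta> (?I (param_radius n))" and hi: "measure \<pi>\<^sub>\<theta> (?I (\<epsilon> n)) \<le> 3 * \<epsilon> n * p \<theta>\<^sub>0" by blast+
      let ?y = "real n * (\<epsilon> n)\<^sup>2"
      have "measure \<pi>\<^sub>f (- G n) \<le> exp (- (3 * ?y))" using G[OF n(1)] by (simp add: mult.assoc)
      also have "\<dots> \<le> exp (- (2 * ?y)) * exp (- (?y / 65))" by (rule exp_ratio_le) simp
      also have "\<dots> \<le> exp (- (2 * ?y)) * measure \<pi>\<^sub>f (?b n)"
        by (rule mult_left_mono[OF ball[OF n(1)]]) simp
      finally have mG: "measure \<pi>\<^sub>f (- G n) \<le> exp (- (2 * ?y)) * measure \<pi>\<^sub>f (?b n)" .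
      have "3 * \<epsilon> n * p \<theta>\<^sub>0 = 3 * R * (\<epsilon> n / R * p \<theta>\<^sub>0)" using R1 by simp
      also have "\<dots> \<le> 3 * R * measure \<pi>\<^sub>\<theta> (?I (param_radius n))" by (rule mult_left_mono[OF lo]) (use R1 in simp)
      finally have mI: "measure \<pi>\<^sub>\<theta> (?I (\<epsilon> n)) \<le> 3 * R * measure \<pi>\<^sub>\<theta> (?I (param_radius n))" using hi by linarith
      have "measure \<pi>\<^sub>\<theta> (?I (\<epsilon> n)) * measure \<pi>\<^sub>f (- G n)
          \<le> (3 * R * measure \<pi>\<^sub>\<theta> (?I (param_radius n))) * (exp (- (2 * ?y)) * measure \<pi>\<^sub>f (?b n))"
        by (rule mult_mono[OF mI mG]) (use R1 in \<open>auto intro!: mult_nonneg_nonneg\<close>)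
      also have "\<dots> = 3 * R * exp (- (2 * ?y)) * (measure \<pi>\<^sub>\<theta> (?I (param_radius n)) * measure \<pi>\<^sub>f (?b n))" by (simp only: ac_simps)
      finally show ?case by (simp only: prior_times[OF s(1,2)] prior_times[OF s(3,4)])
    qed
  qed (rule fst_snd \<kappa>)+
qed


subsection \<open>Total variation\<close>

text \<open>The deterministic core: at a single \<open>n\<close> and a single noise point outside
  all bad events, the integrated likelihood is squeezed between perturbed normal densities and the
  bound on the posterior marginal applies.\<close>

lemma tv_bound:
  fixes n :: nat and z :: "(nat \<Rightarrow> real) \<times> (nat \<Rightarrow> real)" and x c M \<Gamma> \<omega> \<delta> d :: real
  defines "V \<equiv> noise_pairing e z (score \<gamma>\<^sub>0)" and "\<rho>' \<equiv> (1 + D\<^sub>0) * norm (\<gamma> n - \<gamma>\<^sub>0)"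
  defines "Q \<equiv> sqrt 2 * exp (I\<^sub>0 / 8 * (1 + 2 * V\<^sup>2 / I\<^sub>0\<^sup>2))"
  assumes n: "1 \<le> n" and eps: "0 < \<epsilon> n" "\<epsilon> n \<le> 1" and x: "0 < x" "x < 1 / 4"
    and close: "{\<theta>\<^sub>0 - \<epsilon> n<..<\<theta>\<^sub>0 + \<epsilon> n} \<subseteq> \<Theta>"
      "\<And>\<theta>. \<theta> \<in> {\<theta>\<^sub>0 - \<epsilon> n<..<\<theta>\<^sub>0 + \<epsilon> n} \<Longrightarrow> (1 - x) * p \<theta>\<^sub>0 \<le> p \<theta> \<and> p \<theta> \<le> (1 + x) * p \<theta>\<^sub>0"
    and reg: "regular c Y n z" and Y: "0 \<le> Y z" "Y z \<le> M"
    and c: "(1 + D\<^sub>0) * (2 + \<Gamma>) \<le> c" "norm (score \<gamma>\<^sub>0) \<le> c"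
    and rem: "\<And>\<theta> f. \<theta> \<in> \<Theta> \<Longrightarrow> \<bar>\<theta> - \<theta>\<^sub>0\<bar> \<le> \<epsilon> n \<Longrightarrow> norm (f - f\<^sub>0) \<le> 2 * \<epsilon> n \<Longrightarrow>
        norm (remainder \<theta> f) \<le> c * (\<bar>\<theta> - \<theta>\<^sub>0\<bar> * \<epsilon> n)"
    and \<Gamma>: "norm (\<gamma> n) \<le> \<Gamma>"
    and Ww: "\<bar>noise_pairing e z (score (\<gamma> n)) - V\<bar> \<le> \<omega>"
    and \<delta>: "\<omega> + M * c * \<epsilon> n + sqrt (real n) * (c * \<epsilon> n * \<rho>' + c\<^sup>2 * (\<epsilon> n)\<^sup>2)
        + (\<rho>' * (2 * c + \<rho>') + 2 * (c + \<rho>') * c * \<epsilon> n + c\<^sup>2 * (\<epsilon> n)\<^sup>2) / 2 \<le> \<delta> - \<eta> n"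
      "\<delta> \<le> I\<^sub>0 / 8" "0 \<le> \<delta>"
    and Q: "Q * (8 * \<delta> / I\<^sub>0) \<le> x" "Q * exp (- (I\<^sub>0 / 8 * real n * (\<epsilon> n / (1 + \<Gamma>))\<^sup>2)) \<le> x"
    and G: "G \<in> sets borel"
      "\<And>f s t. f \<in> G \<Longrightarrow> s \<in> {- \<epsilon> n<..<\<epsilon> n} \<Longrightarrow> t \<in> {- \<epsilon> n<..<\<epsilon> n} \<Longrightarrow>
        1 / exp (\<eta> n * (1 + real n * t\<^sup>2)) \<le> r n s t f \<and> r n s t f \<le> exp (\<eta> n * (1 + real n * t\<^sup>2))"
    and joint: "1 - x \<le> measure (bayes (\<pi>\<^sub>\<theta> \<Otimes>\<^sub>M \<pi>\<^sub>f) (\<lambda>(\<theta>, f). LR n z \<theta> f))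
        ({\<theta>\<^sub>0 - \<epsilon> n<..<\<theta>\<^sub>0 + \<epsilon> n} \<times> (G \<inter> {f. norm (f - f\<^sub>0) < \<epsilon> n}))"
    and d: "0 < d" "(\<integral>\<^sup>+f. ennreal (LR n z \<theta>\<^sub>0 f) \<partial>\<pi>\<^sub>f) = ennreal d"
      "ennreal ((1 - x) * d) \<le> (\<integral>\<^sup>+f\<in>G \<inter> {f. norm (f - f\<^sub>0) < \<epsilon> n}. ennreal (LR n z \<theta>\<^sub>0 f) \<partial>\<pi>\<^sub>f)"
  shows "\<bar>tv_dist (distr (bayes (\<pi>\<^sub>\<theta> \<Otimes>\<^sub>M \<pi>\<^sub>f) (\<lambda>(\<theta>, f). LR n z \<theta> f)) borel fst)
      (normal_law (\<theta>\<^sub>0 + 1 / sqrt (real n) * (1 / I\<^sub>0 * V)) (1 / real n * (1 / I\<^sub>0)))\<bar>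
    \<le> 2 * (x + ((1 + x) / ((1 - x)\<^sup>2 * (1 - 2 * x)) * (1 + x) - 1))"
    (is "\<bar>tv_dist ?P ?N\<bar> \<le> 2 * ?b")
proof -
  let ?G = "G \<inter> {f. norm (f - f\<^sub>0) < \<epsilon> n}"
  let ?y = "\<lambda>\<theta>. 1 + real n * (\<theta> - \<theta>\<^sub>0)\<^sup>2"
  define q where "q t = sqrt (real n) * t * V - real n * t\<^sup>2 * I\<^sub>0 / 2" for t
  define u where "u \<theta> = exp (\<delta> * ?y \<theta> + q (\<theta> - \<theta>\<^sub>0))" for \<theta>
  define l where "l \<theta> = exp (- (\<delta> * ?y \<theta>) + q (\<theta> - \<theta>\<^sub>0))" for \<theta>
  \<comment> \<open>The lower bound needs the shift to have norm at most
    \<open>\<epsilon> n\<close>, so it is used only for parameters within \<open>\<tau>\<close>; the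
    normal mass outside is negligible as \<open>n * \<tau>\<^sup>2\<close> grows.\<close>
  define \<tau> where "\<tau> = \<epsilon> n / (1 + \<Gamma>)"
  define Z where "Z = sqrt (2 * pi * (1 / real n * (1 / I\<^sub>0))) * exp (V\<^sup>2 / (2 * I\<^sub>0))"
  have \<Gamma>0: "0 \<le> \<Gamma>" using order_trans[OF norm_ge_zero \<Gamma>] .
  have \<tau>: "0 < \<tau>" "\<tau> \<le> \<epsilon> n" "\<tau> * \<Gamma> \<le> \<epsilon> n"
  proof -
    show "0 < \<tau>" using eps(1) \<Gamma>0 by (simp add: \<tau>_def)
    have "\<tau> * (1 + \<Gamma>) = \<epsilon> n" using \<Gamma>0 by (simp add: \<tau>_def)
    then have "\<tau> + \<tau> * \<Gamma> = \<epsilon> n" by (simp add: distrib_left)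
    moreover have "0 \<le> \<tau> * \<Gamma>" using \<open>0 < \<tau>\<close> \<Gamma>0 by simp
    ultimately show "\<tau> \<le> \<epsilon> n" "\<tau> * \<Gamma> \<le> \<epsilon> n" using \<open>0 < \<tau>\<close> by linarith+
  qed
  have Zpos: "0 < Z" using n I0_pos by (simp add: Z_def)
  have cpos: "0 \<le> c" using c(2) norm_ge_zero order_trans by blast
  interpret N: prob_space ?N by (rule prob_space_normal_law) (use n I0_pos in simp)
  have bounds: "(\<integral>\<^sup>+f\<in>?G. ennreal (LR n z \<theta> f) \<partial>\<pi>\<^sub>f) \<le> ennreal (d * u \<theta>)"
      "\<bar>\<theta> - \<theta>\<^sub>0\<bar> < \<tau> \<Longrightarrow> ennreal ((1 - x) * d * l \<theta>) \<le> (\<integral>\<^sup>+f. ennreal (LR n z \<theta> f) \<partial>\<pi>\<^sub>f)"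
    if th: "\<theta> \<in> \<Theta>" "\<theta> \<in> {\<theta>\<^sub>0 - \<epsilon> n<..<\<theta>\<^sub>0 + \<epsilon> n}"
    and ae: "AE g in \<pi>\<^sub>f. \<bar>\<theta> - \<theta>\<^sub>0\<bar> < \<epsilon> n \<and> norm (g - (\<theta> - \<theta>\<^sub>0) *\<^sub>R \<gamma> n - f\<^sub>0) < 2 * \<epsilon> n \<longrightarrow>
        (g - f\<^sub>0, K \<theta>\<^sub>0 (g - f\<^sub>0)) \<in> noise_dom e z
        \<and> (0, remainder \<theta> (g - (\<theta> - \<theta>\<^sub>0) *\<^sub>R \<gamma> n)) \<in> noise_dom e z
        \<and> \<bar>noise_pairing e z (0, remainder \<theta> (g - (\<theta> - \<theta>\<^sub>0) *\<^sub>R \<gamma> n))\<bar> \<le> Y z * (c * (\<bar>\<theta> - \<theta>\<^sub>0\<bar> * \<epsilon> n))" for \<theta>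
  proof -
    define t where "t = \<theta> - \<theta>\<^sub>0"
    let ?h = "- t *\<^sub>R \<gamma> n"
    have t: "\<bar>t\<bar> < \<epsilon> n" "t \<in> {- \<epsilon> n<..<\<epsilon> n}" "- t \<in> {- \<epsilon> n<..<\<epsilon> n}" "0 \<in> {- \<epsilon> n<..<\<epsilon> n}"
      using th(2) eps(1) by (auto simp: t_def)
    \<comment> \<open>The tolerance \<open>\<delta>\<close> is split into
      \<open>\<delta> - \<eta> n\<close> for the likelihood expansion and \<open>\<eta> n\<close>
      for the shift of the prior.\<close>
    define k where "k = exp ((\<delta> - \<eta> n) * (1 + real n * t\<^sup>2))"
    define m where "m = exp (\<eta> n * (1 + real n * t\<^sup>2))"
    have km: "m * k = exp (\<delta> * (1 + real n * t\<^sup>2))" by (simp add: k_def m_def exp_add[symmetric] algebra_simps)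
    \<comment> \<open>The two ratios are \<open>r n s (- t)\<close> with \<open>s = 0\<close> and
      \<open>s = t\<close>: the prior shifted by \<open>?h\<close> against the prior, and the prior
      against its shift by \<open>- ?h\<close>.\<close>
    have r1: "density_version (shifted_law \<pi>\<^sub>f 0) (shifted_law \<pi>\<^sub>f ?h) (r n 0 (- t))"
      using d_version[OF n t(4,3)] by simp
    have r2: "density_version (shifted_law \<pi>\<^sub>f (- ?h)) (shifted_law \<pi>\<^sub>f 0) (r n t (- t))"
      using d_version[OF n t(2,3)] by simp
    have rG: "1 / m \<le> r n 0 (- t) f" "r n t (- t) f \<le> m" if "f \<in> G" for f
      using G(2)[OF that t(4,3)] G(2)[OF that t(2,3)] by (auto simp: m_def)
    have mk: "0 < m" "0 < k" "0 \<le> exp (q t)" by (auto simp: m_def k_def)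
    have expand: "AE g in \<pi>\<^sub>f. norm (g + ?h - f\<^sub>0) < 2 * \<epsilon> n \<longrightarrow>
        LR n z \<theta> (g + ?h) \<le> k * exp (q t) * LR n z \<theta>\<^sub>0 g \<and> exp (q t) / k * LR n z \<theta>\<^sub>0 g \<le> LR n z \<theta> (g + ?h)"
      using ae
    proof eventually_elim
      case (elim g)
      show ?case
      proof
        assume g: "norm (g + ?h - f\<^sub>0) < 2 * \<epsilon> n"
        let ?f = "g - (\<theta> - \<theta>\<^sub>0) *\<^sub>R \<gamma> n"
        have f: "g + ?h = ?f" by (simp add: t_def algebra_simps)
        have nf: "norm (?f - f\<^sub>0) < 2 * \<epsilon> n" using g unfolding f .
        have "\<bar>\<theta> - \<theta>\<^sub>0\<bar> < \<epsilon> n" using t(1) by (simp add: t_def)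
        with elim nf have z: "(g - f\<^sub>0, K \<theta>\<^sub>0 (g - f\<^sub>0)) \<in> noise_dom e z" "(0, remainder \<theta> ?f) \<in> noise_dom e z"
          and W: "\<bar>noise_pairing e z (0, remainder \<theta> ?f)\<bar> \<le> (Y z * c) * (\<bar>\<theta> - \<theta>\<^sub>0\<bar> * \<epsilon> n)"
          by (auto simp: mult.assoc)
        have sc: "score (\<gamma> n) \<in> noise_dom e z" using reg by (simp add: regular_def)
        have nr: "norm (remainder \<theta> ?f) \<le> c * (\<bar>\<theta> - \<theta>\<^sub>0\<bar> * \<epsilon> n)"
          by (rule rem[OF th(1)]) (use t(1) nf in \<open>auto simp: t_def\<close>)
        have yc: "0 \<le> Y z * c" using Y(1) cpos by simp
        have "Y z * c * \<epsilon> n \<le> M * c * \<epsilon> n" using Y(2) cpos eps(1) by (intro mult_right_mono) auto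
        then have dd: "\<omega> + Y z * c * \<epsilon> n + sqrt (real n) * (c * \<epsilon> n * \<rho>' + c\<^sup>2 * (\<epsilon> n)\<^sup>2)
          + (\<rho>' * (2 * c + \<rho>') + 2 * (c + \<rho>') * c * \<epsilon> n + c\<^sup>2 * (\<epsilon> n)\<^sup>2) / 2 \<le> \<delta> - \<eta> n"
          using \<delta>(1) by linarith
        have \<rho>: "(1 + D\<^sub>0) * norm (\<gamma> n - \<gamma>\<^sub>0) \<le> \<rho>'" by (simp add: \<rho>'_def)
        note exp = LR_expansion[where \<theta> = \<theta> and g = g and n = n and z = z and \<delta> = "\<delta> - \<eta> n" and c = c and \<rho>' = \<rho>',
            OF sc z W Ww[unfolded V_def] nr \<open>\<bar>\<theta> - \<theta>\<^sub>0\<bar> < \<epsilon> n\<close> nf \<Gamma> c eps(1) yc \<rho> dd]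
        show "LR n z \<theta> (g + ?h) \<le> k * exp (q t) * LR n z \<theta>\<^sub>0 g \<and> exp (q t) / k * LR n z \<theta>\<^sub>0 g \<le> LR n z \<theta> (g + ?h)"
          using exp unfolding f unfolding k_def q_def V_def t_def by blast
      qed
    qed
    note ilb = integrated_likelihood_bounds[OF pf_sets pf_prob r1 r2 G(1) measurable_LR_slice measurable_LR_slice
        less_imp_le[OF LR_pos] mk _ _ expand]
    have ut: "u \<theta> = m * k * exp (q t)" unfolding km u_def t_def exp_add ..
    have lt: "l \<theta> = exp (q t) / (m * k)" unfolding km l_def t_def by (simp add: exp_diff)
    have "(\<integral>\<^sup>+f\<in>?G. ennreal (LR n z \<theta> f) \<partial>\<pi>\<^sub>f) \<le> ennreal (m * k * exp (q t)) * ennreal d"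
      unfolding d(2)[symmetric] by (rule ilb(1)) (fact rG)+
    also have "\<dots> = ennreal (d * u \<theta>)"
      unfolding ut[symmetric] using d(1) by (subst ennreal_mult[symmetric]) (auto simp: u_def mult.commute)
    finally show "(\<integral>\<^sup>+f\<in>?G. ennreal (LR n z \<theta> f) \<partial>\<pi>\<^sub>f) \<le> ennreal (d * u \<theta>)" .
    assume "\<bar>\<theta> - \<theta>\<^sub>0\<bar> < \<tau>"
    then have "norm ?h \<le> \<tau> * \<Gamma>" using \<Gamma> by (auto simp: t_def intro!: mult_mono)
    then have nh: "norm ?h \<le> \<epsilon> n" using \<tau>(3) by linarith
    have "ennreal ((1 - x) * d * l \<theta>) = ennreal (exp (q t) / (m * k)) * ennreal ((1 - x) * d)"
      unfolding lt[symmetric] using d(1) x by (subst ennreal_mult[symmetric]) (auto simp: l_def mult.commute)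
    also have "\<dots> \<le> ennreal (exp (q t) / (m * k)) * (\<integral>\<^sup>+f\<in>?G. ennreal (LR n z \<theta>\<^sub>0 f) \<partial>\<pi>\<^sub>f)"
      by (rule mult_left_mono[OF d(3)]) simp
    also have "\<dots> \<le> (\<integral>\<^sup>+f. ennreal (LR n z \<theta> f) \<partial>\<pi>\<^sub>f)" by (rule ilb(2)[OF _ _ nh]) (fact rG)+
    finally show "ennreal ((1 - x) * d * l \<theta>) \<le> (\<integral>\<^sup>+f. ennreal (LR n z \<theta> f) \<partial>\<pi>\<^sub>f)" .
  qed
  note reg_ae = conjunct2[OF reg[unfolded regular_def]]
  have U: "AE \<theta> in \<pi>\<^sub>\<theta>. \<theta> \<in> {\<theta>\<^sub>0 - \<epsilon> n<..<\<theta>\<^sub>0 + \<epsilon> n} \<longrightarrow> (\<integral>\<^sup>+f\<in>?G. ennreal (LR n z \<theta> f) \<partial>\<pi>\<^sub>f) \<le> ennreal (d * u \<theta>)"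
    using reg_ae AE_space
  proof eventually_elim
    case (elim \<theta>)
    then show ?case using bounds(1)[OF _ _ elim(1)] by simp
  qed
  have L: "AE \<theta> in \<pi>\<^sub>\<theta>. \<theta> \<in> {\<theta>\<^sub>0 - \<tau><..<\<theta>\<^sub>0 + \<tau>} \<longrightarrow> ennreal ((1 - x) * d * l \<theta>) \<le> (\<integral>\<^sup>+f. ennreal (LR n z \<theta> f) \<partial>\<pi>\<^sub>f)"
    using reg_ae AE_space
  proof eventually_elim
    case (elim \<theta>)
    show ?case
    proof
      assume "\<theta> \<in> {\<theta>\<^sub>0 - \<tau><..<\<theta>\<^sub>0 + \<tau>}"
      then have "\<bar>\<theta> - \<theta>\<^sub>0\<bar> < \<tau>" "\<theta> \<in> {\<theta>\<^sub>0 - \<epsilon> n<..<\<theta>\<^sub>0 + \<epsilon> n}" using \<tau>(2) by auto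
      then show "ennreal ((1 - x) * d * l \<theta>) \<le> (\<integral>\<^sup>+f. ennreal (LR n z \<theta> f) \<partial>\<pi>\<^sub>f)"
        using bounds(2)[OF _ _ elim(1)] elim(2) by simp
    qed
  qed
  have u_int: "(\<integral>\<^sup>+\<theta>\<in>F. ennreal (u \<theta>) \<partial>lborel) \<le> ennreal (Z * (measure ?N F + x))" if "F \<in> sets borel" for F
  proof -
    have "(\<integral>\<^sup>+\<theta>\<in>F. ennreal (u \<theta>) \<partial>lborel) \<le> ennreal (Z * (measure ?N F + Q * (8 * \<delta> / I\<^sub>0)))"
      unfolding u_def q_def Z_def Q_def by (rule perturbed_normal_upper[OF I0_pos n \<delta>(3,2) that])
    also have "\<dots> \<le> ennreal (Z * (measure ?N F + x))"
      by (intro ennreal_leI mult_left_mono add_left_mono Q(1)) (use Zpos in simp)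
    finally show ?thesis .
  qed
  have l_int: "ennreal (Z * (1 - 2 * x)) \<le> (\<integral>\<^sup>+\<theta>\<in>{\<theta>\<^sub>0 - \<tau><..<\<theta>\<^sub>0 + \<tau>}. ennreal (l \<theta>) \<partial>lborel)"
  proof -
    have "Z * (1 - 2 * x) \<le> Z * (1 - Q * (8 * \<delta> / I\<^sub>0) - Q * exp (- (I\<^sub>0 / 8 * real n * \<tau>\<^sup>2)))"
      using Q Zpos unfolding \<tau>_def by (intro mult_left_mono) linarith+
    then have "ennreal (Z * (1 - 2 * x)) \<le> ennreal (Z * (1 - Q * (8 * \<delta> / I\<^sub>0) - Q * exp (- (I\<^sub>0 / 8 * real n * \<tau>\<^sup>2))))"
      by (rule ennreal_leI)
    also have "\<dots> \<le> (\<integral>\<^sup>+\<theta>\<in>{\<theta>\<^sub>0 - \<tau><..<\<theta>\<^sub>0 + \<tau>}. ennreal (l \<theta>) \<partial>lborel)"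
      unfolding l_def q_def Z_def Q_def by (rule perturbed_normal_lower[OF I0_pos n \<delta>(3,2) less_imp_le[OF \<tau>(1)]])
    finally show ?thesis .
  qed
  have p0: "0 < p \<theta>\<^sub>0" using p_bounds theta0_in by force
  have Gs: "?G \<in> sets \<pi>\<^sub>f" using G(1) by simp
  have um: "u \<in> borel_measurable borel" "l \<in> borel_measurable borel" unfolding u_def l_def q_def by measurable
  have ul0: "0 \<le> u \<theta>" "0 \<le> l \<theta>" for \<theta> by (auto simp: u_def l_def)
  have pc: "p \<theta> \<le> (1 + x) * p \<theta>\<^sub>0" "(1 - x) * p \<theta>\<^sub>0 \<le> p \<theta>" if "\<theta> \<in> {\<theta>\<^sub>0 - \<epsilon> n<..<\<theta>\<^sub>0 + \<epsilon> n}" for \<theta>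
    using close(2)[OF that] by auto
  note pmb = posterior_marginal_bound[where NF = "measure ?N", OF Theta_borel p_measurable p_prob pf_prob measurable_LR_joint Gs x p0
      close(1) \<tau>(2) _ _ joint d(1) order_refl um _ _ U L Zpos _ l_int]
  show ?thesis
  proof (rule tv_dist_le)
    show "prob_space ?P" by (rule pmb(1)) (fact pc ul0 u_int measure_nonneg)+
    show "sets ?P = sets borel" by simp
    show "prob_space ?N" by unfold_locales
    show "sets ?N = sets borel" by simp
    fix F :: "real set" assume F: "F \<in> sets borel"
    \<comment> \<open>As \<open>a \<ge> 1\<close> and normal probabilities are at most one,
      \<open>a * measure ?N F\<close> exceeds \<open>measure ?N F\<close> by at most
      \<open>a - 1\<close>, uniformly in \<open>F\<close>.\<close>
    define a where "a = (1 + x) / ((1 - x)\<^sup>2 * (1 - 2 * x))"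
    have den: "0 < (1 - x)\<^sup>2 * (1 - 2 * x)" "(1 - x)\<^sup>2 * (1 - 2 * x) \<le> 1"
      using x by (auto intro!: mult_le_one power_le_one)
    have a1: "1 \<le> a" using den x unfolding a_def by (subst le_divide_eq) auto
    have split: "k * (N + x) / D = k / D * N + k / D * x" for k N D :: real
      by (simp add: distrib_left add_divide_distrib)
    have "measure ?P F \<le> x + (1 + x) * (measure ?N F + x) / ((1 - x)\<^sup>2 * (1 - 2 * x))" by (rule pmb(2)[OF _ _ _ _ _ _ F]) (fact pc ul0 u_int measure_nonneg)+
    also have "\<dots> = x + (a * measure ?N F + a * x)"
      unfolding a_def by (rule arg_cong[where f = "\<lambda>y. x + y"]) (rule split)
    also have "a * measure ?N F \<le> measure ?N F + (a - 1)"
    proof -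
      have "(a - 1) * measure ?N F \<le> (a - 1) * 1" by (rule mult_left_mono[OF N.prob_le_1]) (use a1 in simp)
      then show ?thesis by (simp add: left_diff_distrib)
    qed
    finally have "measure ?P F \<le> measure ?N F + (x + (a + a * x - 1))" by linarith
    then show "measure ?P F \<le> measure ?N F + ?b" by (simp add: a_def distrib_left)
  qed
qed

text \<open>The difference of the scores has norm tending to zero, so its Gaussian tails vanish. The
  two signs are two lower tails, compared through \<open>exp (- y) \<le> 1 / y\<close>.\<close>

lemma score_vanishing:
  assumes \<omega>: "0 < \<omega>"
  shows "vanishing noise_law (\<lambda>n. {z \<in> space noise_law. \<omega> < \<bar>noise_pairing e z (score (\<gamma> n)) - noise_pairing e z (score \<gamma>\<^sub>0)\<bar>})"
proof -
  \<comment> \<open>The added \<open>inverse (real (Suc n))\<close> keeps the scale positive even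
    where \<open>\<gamma> n\<close> equals its limit.\<close>
  define s where "s n = (1 + D\<^sub>0) * norm (\<gamma> n - \<gamma>\<^sub>0) + inverse (real (Suc n))" for n
  have s0: "0 < s n" for n using D0_nonneg unfolding s_def by (intro add_nonneg_pos mult_nonneg_nonneg) auto
  have "s \<longlonglongrightarrow> (1 + D\<^sub>0) * 0 + 0"
    unfolding s_def by (intro tendsto_add tendsto_mult tendsto_const gamma_lim LIMSEQ_inverse_real_of_nat)
  then have s_lim: "s \<longlonglongrightarrow> 0" by simp
  have tail: "vanishing noise_law (\<lambda>n. {z \<in> space noise_law. noise_pairing e z (h n) \<le> - \<omega>})"
    if h: "\<And>n. norm (h n) \<le> s n" for h
  proof (rule vanishing_emeasure)
    have "(\<lambda>n. 2 / \<omega>\<^sup>2 * (s n)\<^sup>2) \<longlonglongrightarrow> 2 / \<omega>\<^sup>2 * 0\<^sup>2" by (intro tendsto_mult tendsto_power tendsto_const s_lim)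
    then show "(\<lambda>n. 2 / \<omega>\<^sup>2 * (s n)\<^sup>2) \<longlonglongrightarrow> 0" by simp
    show "\<forall>\<^sub>F n in sequentially. {z \<in> space noise_law. noise_pairing e z (h n) \<le> - \<omega>} \<in> sets noise_law
        \<and> emeasure noise_law {z \<in> space noise_law. noise_pairing e z (h n) \<le> - \<omega>} \<le> ennreal (2 / \<omega>\<^sup>2 * (s n)\<^sup>2)"
    proof (intro always_eventually allI conjI)
      fix n
      show "{z \<in> space noise_law. noise_pairing e z (h n) \<le> - \<omega>} \<in> sets noise_law" by measurable
      have "emeasure noise_law {z \<in> space noise_law. noise_pairing e z (h n) \<le> - \<omega>} \<le> ennreal (exp (- (\<omega>\<^sup>2 / (2 * (s n)\<^sup>2))))"
        by (rule W.lower_tail[OF s0 h less_imp_le[OF \<omega>]])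
      also have "\<dots> \<le> ennreal (2 / \<omega>\<^sup>2 * (s n)\<^sup>2)"
      proof (rule ennreal_leI)
        let ?y = "\<omega>\<^sup>2 / (2 * (s n)\<^sup>2)"
        have y: "0 < ?y" using \<omega> s0[of n] by simp
        have "?y \<le> exp ?y" using exp_ge_add_one_self[of ?y] by linarith
        then have "inverse (exp ?y) \<le> inverse ?y" using y by (rule le_imp_inverse_le)
        then show "exp (- ?y) \<le> 2 / \<omega>\<^sup>2 * (s n)\<^sup>2" by (simp add: exp_minus)
      qed
      finally show "emeasure noise_law {z \<in> space noise_law. noise_pairing e z (h n) \<le> - \<omega>} \<le> ennreal (2 / \<omega>\<^sup>2 * (s n)\<^sup>2)" .
    qed
  qed
  have le: "norm (score (\<gamma> n) - score \<gamma>\<^sub>0) \<le> s n" for n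
    unfolding score_diff norm_minus_cancel s_def
    using norm_graph_le[of "\<gamma> n - \<gamma>\<^sub>0"] inverse_nonnegative_iff_nonnegative[of "real (Suc n)"] by linarith
  have le': "norm (score \<gamma>\<^sub>0 - score (\<gamma> n)) \<le> s n" for n
    using le[of n] by (simp only: norm_minus_commute)
  have null: "vanishing noise_law (\<lambda>n. {z \<in> space noise_law. \<not> (score (\<gamma> n) \<in> noise_dom e z \<and> score \<gamma>\<^sub>0 \<in> noise_dom e z)})"
  proof (rule vanishing_AE)
    show "\<forall>\<^sub>F n in sequentially. AE z in noise_law. z \<notin> {z \<in> space noise_law. \<not> (score (\<gamma> n) \<in> noise_dom e z \<and> score \<gamma>\<^sub>0 \<in> noise_dom e z)}"
    proof (rule always_eventually, rule allI)
      fix n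
      show "AE z in noise_law. z \<notin> {z \<in> space noise_law. \<not> (score (\<gamma> n) \<in> noise_dom e z \<and> score \<gamma>\<^sub>0 \<in> noise_dom e z)}"
        using W.AE_dom[of "score (\<gamma> n)"] W.AE_dom[of "score \<gamma>\<^sub>0"] by eventually_elim simp
    qed
  qed auto
  show ?thesis
  proof (rule vanishing_mono[OF vanishing_Un[OF null vanishing_Un[OF tail[OF le] tail[OF le']]]],
      intro always_eventually allI subsetI)
    fix n z
    assume z: "z \<in> {z \<in> space noise_law. \<omega> < \<bar>noise_pairing e z (score (\<gamma> n)) - noise_pairing e z (score \<gamma>\<^sub>0)\<bar>}"
    show "z \<in> {z \<in> space noise_law. \<not> (score (\<gamma> n) \<in> noise_dom e z \<and> score \<gamma>\<^sub>0 \<in> noise_dom e z)} \<union>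
        ({z \<in> space noise_law. noise_pairing e z (score (\<gamma> n) - score \<gamma>\<^sub>0) \<le> - \<omega>} \<union>
         {z \<in> space noise_law. noise_pairing e z (score \<gamma>\<^sub>0 - score (\<gamma> n)) \<le> - \<omega>})"
    proof (cases "score (\<gamma> n) \<in> noise_dom e z \<and> score \<gamma>\<^sub>0 \<in> noise_dom e z")
      case True
      then show ?thesis using z W.W_diff[of "score (\<gamma> n)" z "score \<gamma>\<^sub>0"] W.W_diff[of "score \<gamma>\<^sub>0" z "score (\<gamma> n)"] by auto
    qed (use z in auto)
  qed
qed


definition good_noise :: "real \<Rightarrow> ((nat \<Rightarrow> real) \<times> (nat \<Rightarrow> real) \<Rightarrow> real) \<Rightarrow> nat
    \<Rightarrow> (nat \<Rightarrow> real) \<times> (nat \<Rightarrow> real) \<Rightarrow> bool" where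
  "good_noise c Y n z \<longleftrightarrow> regular c Y n z
     \<and> (\<gamma>\<^sub>0, K \<theta>\<^sub>0 \<gamma>\<^sub>0) \<in> noise_dom e z \<and> (0, K' \<theta>\<^sub>0 f\<^sub>0) \<in> noise_dom e z
     \<and> joint_posterior e K \<pi>\<^sub>\<theta> \<pi>\<^sub>f n (obs n z) = bayes (\<pi>\<^sub>\<theta> \<Otimes>\<^sub>M \<pi>\<^sub>f) (\<lambda>(\<theta>, f). LR n z \<theta> f)
     \<and> posterior_given e K \<theta>\<^sub>0 \<pi>\<^sub>f n (obs n z) = bayes \<pi>\<^sub>f (LR n z \<theta>\<^sub>0)"

lemma AE_posteriors:
  assumes n: "1 \<le> n"
  shows "AE z in noise_law. joint_posterior e K \<pi>\<^sub>\<theta> \<pi>\<^sub>f n (obs n z) = bayes (\<pi>\<^sub>\<theta> \<Otimes>\<^sub>M \<pi>\<^sub>f) (\<lambda>(\<theta>, f). LR n z \<theta> f)"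
    and "AE z in noise_law. posterior_given e K \<theta>\<^sub>0 \<pi>\<^sub>f n (obs n z) = bayes \<pi>\<^sub>f (LR n z \<theta>\<^sub>0)"
proof -
  have s: "snd \<in> borel_measurable (\<pi>\<^sub>\<theta> \<Otimes>\<^sub>M \<pi>\<^sub>f)"
    using measurable_snd[of \<pi>\<^sub>\<theta> \<pi>\<^sub>f] by (simp add: measurable_cong_sets[OF refl pf_sets])
  have "AE z in noise_law. bayes (\<pi>\<^sub>\<theta> \<Otimes>\<^sub>M \<pi>\<^sub>f) (\<lambda>m. likelihood e K n (obs n z) (fst m) (snd m))
     = bayes (\<pi>\<^sub>\<theta> \<Otimes>\<^sub>M \<pi>\<^sub>f) (\<lambda>m. LR n z (fst m) (snd m))"
    by (rule AE_bayes_likelihood[OF basis n prior.P.sigma_finite_measure_axioms s measurable_K_comp[OF measurable_fst s]])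
  then show "AE z in noise_law. joint_posterior e K \<pi>\<^sub>\<theta> \<pi>\<^sub>f n (obs n z) = bayes (\<pi>\<^sub>\<theta> \<Otimes>\<^sub>M \<pi>\<^sub>f) (\<lambda>(\<theta>, f). LR n z \<theta> f)"
    by (simp add: joint_posterior_def case_prod_beta')
  have i: "(\<lambda>f. f) \<in> borel_measurable \<pi>\<^sub>f" by (simp add: measurable_cong_sets[OF pf_sets refl])
  have "AE z in noise_law. bayes \<pi>\<^sub>f (\<lambda>f. likelihood e K n (obs n z) \<theta>\<^sub>0 f) = bayes \<pi>\<^sub>f (\<lambda>f. LR n z \<theta>\<^sub>0 f)"
    by (rule AE_bayes_likelihood[OF basis n \<pi>\<^sub>f.sigma_finite_measure_axioms i borel_measurable_blinfun[OF i]])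
  then show "AE z in noise_law. posterior_given e K \<theta>\<^sub>0 \<pi>\<^sub>f n (obs n z) = bayes \<pi>\<^sub>f (LR n z \<theta>\<^sub>0)"
    by (simp add: posterior_given_def)
qed

lemma contraction_vanishing:
  assumes "0 < a"
  shows "vanishing noise_law (\<lambda>n. {z \<in> space noise_law. a < \<bar>measure (joint_posterior e K \<pi>\<^sub>\<theta> \<pi>\<^sub>f n (obs n z))
      {(\<theta>, f) \<in> space (\<pi>\<^sub>\<theta> \<Otimes>\<^sub>M \<pi>\<^sub>f). \<bar>\<theta> - \<theta>\<^sub>0\<bar> < \<epsilon> n \<and> norm (f - f\<^sub>0) < \<epsilon> n} - 1\<bar>})"
    and "vanishing noise_law (\<lambda>n. {z \<in> space noise_law. a < \<bar>measure (posterior_given e K \<theta>\<^sub>0 \<pi>\<^sub>f n (obs n z))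
      {f. norm (f - f\<^sub>0) < \<epsilon> n} - 1\<bar>})"
  by (rule tendsto_in_prob_distrD[OF c_joint[unfolded joint_contracts_def obs_law_eq] measurable_obs_map assms],
      rule tendsto_in_prob_distrD[OF c_given[unfolded given_contracts_def obs_law_eq] measurable_obs_map assms])

section \<open>Choice of the constants and assembly\<close>

theorem bernstein_von_mises:
  "tendsto_in_prob (\<lambda>n. obs_law e K n \<theta>\<^sub>0 f\<^sub>0)
     (\<lambda>n x. tv_dist (param_posterior e K \<pi>\<^sub>\<theta> \<pi>\<^sub>f n x)
        (normal_law (\<theta>\<^sub>0 + 1 / sqrt (real n) * Delta e K K' n \<theta>\<^sub>0 f\<^sub>0 x) (1 / real n * (1 / I\<^sub>0)))) 0"
proof -
  obtain c\<^sub>0 where c0: "0 \<le> c\<^sub>0" and rem: "\<And>\<theta> f s. \<theta> \<in> \<Theta> \<Longrightarrow> \<bar>\<theta> - \<theta>\<^sub>0\<bar> \<le> s \<Longrightarrow> s \<le> 1 \<Longrightarrow> norm (f - f\<^sub>0) \<le> 2 * s \<Longrightarrow>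
     remainder \<theta> f \<in> S \<and> nS (remainder \<theta> f) \<le> c\<^sub>0 * (\<bar>\<theta> - \<theta>\<^sub>0\<bar> * s) \<and> norm (remainder \<theta> f) \<le> c\<^sub>0 * (\<bar>\<theta> - \<theta>\<^sub>0\<bar> * s)"
    using remainder_bound by blast
  obtain Y where Y [measurable]: "Y \<in> borel_measurable noise_law" and Y0: "\<And>z. 0 \<le> Y z"
    and YS: "\<And>E s. E \<in> S \<Longrightarrow> nS E \<le> s \<Longrightarrow> AE z in noise_law. \<bar>noise_pairing e z (0, E)\<bar> \<le> Y z * s"
    using noise_bound_on_S by blast
  obtain G where G: "\<And>n. 1 \<le> n \<Longrightarrow> G n \<in> sets borel \<and> measure \<pi>\<^sub>f (- G n) \<le> exp (- (3 * real n * (\<epsilon> n)\<^sup>2))"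
    and Gr: "\<And>n f s t. 1 \<le> n \<Longrightarrow> f \<in> G n \<Longrightarrow> s \<in> {- \<epsilon> n<..<\<epsilon> n} \<Longrightarrow> t \<in> {- \<epsilon> n<..<\<epsilon> n} \<Longrightarrow>
        1 / exp (\<eta> n * (1 + real n * t\<^sup>2)) \<le> r n s t f \<and> r n s t f \<le> exp (\<eta> n * (1 + real n * t\<^sup>2))"
    using good_prior_sets by blast
  define \<Gamma> where "\<Gamma> = norm \<gamma>\<^sub>0 + 1"
  define c where "c = c\<^sub>0 + (1 + D\<^sub>0) * (2 + \<Gamma>) + norm (score \<gamma>\<^sub>0)"
  have \<Gamma>0: "0 \<le> \<Gamma>" by (simp add: \<Gamma>_def)
  have dg: "0 \<le> (1 + D\<^sub>0) * (2 + \<Gamma>)" using D0_nonneg \<Gamma>0 by (intro mult_nonneg_nonneg) auto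
  have c: "c\<^sub>0 \<le> c" "(1 + D\<^sub>0) * (2 + \<Gamma>) \<le> c" "norm (score \<gamma>\<^sub>0) \<le> c" "0 \<le> c"
    using c0 dg norm_ge_zero[of "score \<gamma>\<^sub>0"] unfolding c_def by linarith+
  have rem_c: "remainder \<theta> f \<in> S \<and> nS (remainder \<theta> f) \<le> c * (\<bar>\<theta> - \<theta>\<^sub>0\<bar> * s) \<and> norm (remainder \<theta> f) \<le> c * (\<bar>\<theta> - \<theta>\<^sub>0\<bar> * s)"
    if "\<theta> \<in> \<Theta>" "\<bar>\<theta> - \<theta>\<^sub>0\<bar> \<le> s" "s \<le> 1" "norm (f - f\<^sub>0) \<le> 2 * s" for \<theta> f s
  proof -
    have "0 \<le> \<bar>\<theta> - \<theta>\<^sub>0\<bar> * s" using order_trans[OF abs_ge_zero that(2)] by simp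
    then have "c\<^sub>0 * (\<bar>\<theta> - \<theta>\<^sub>0\<bar> * s) \<le> c * (\<bar>\<theta> - \<theta>\<^sub>0\<bar> * s)" by (rule mult_right_mono[OF c(1)])
    then show ?thesis using rem[OF that] by linarith
  qed
  define V where "V z = noise_pairing e z (score \<gamma>\<^sub>0)" for z
  have V [measurable]: "V \<in> borel_measurable noise_law" unfolding V_def by measurable
  define TV where "TV n x = tv_dist (param_posterior e K \<pi>\<^sub>\<theta> \<pi>\<^sub>f n x)
        (normal_law (\<theta>\<^sub>0 + 1 / sqrt (real n) * Delta e K K' n \<theta>\<^sub>0 f\<^sub>0 x) (1 / real n * (1 / I\<^sub>0)))" for n x
  define \<rho>' where "\<rho>' n = (1 + D\<^sub>0) * norm (\<gamma> n - \<gamma>\<^sub>0)" for n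
  have eps1: "\<forall>\<^sub>F n in sequentially. \<epsilon> n < 1" using c_rate(1) by (rule order_tendstoD) simp
  have null: "vanishing noise_law (\<lambda>n. {z \<in> space noise_law. \<not> good_noise c Y n z})"
  proof (rule vanishing_AE)
    show "\<forall>\<^sub>F n in sequentially. AE z in noise_law. z \<notin> {z \<in> space noise_law. \<not> good_noise c Y n z}"
      using eps1 eventually_ge_at_top[of 1]
    proof eventually_elim
      case (elim n)
      have "AE z in noise_law. regular c Y n z"
      proof (rule AE_regular[OF less_imp_le[OF elim(1)] Y _ YS])
        fix \<theta> f assume "\<theta> \<in> \<Theta>" "\<bar>\<theta> - \<theta>\<^sub>0\<bar> \<le> \<epsilon> n" "norm (f - f\<^sub>0) \<le> 2 * \<epsilon> n"
        then show "remainder \<theta> f \<in> S \<and> nS (remainder \<theta> f) \<le> c * (\<bar>\<theta> - \<theta>\<^sub>0\<bar> * \<epsilon> n)"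
          using rem_c less_imp_le[OF elim(1)] by blast
      qed
      then show "AE z in noise_law. z \<notin> {z \<in> space noise_law. \<not> good_noise c Y n z}"
        using AE_posteriors[OF elim(2)] W.AE_dom[of "(\<gamma>\<^sub>0, K \<theta>\<^sub>0 \<gamma>\<^sub>0)"] W.AE_dom[of "(0, K' \<theta>\<^sub>0 f\<^sub>0)"]
        by eventually_elim (simp add: good_noise_def)
    qed
  qed auto
  have lims: "\<eta> \<longlonglongrightarrow> 0" "\<rho>' \<longlonglongrightarrow> 0" "(\<lambda>n. sqrt (real n) * (c * \<epsilon> n * \<rho>' n + c\<^sup>2 * (\<epsilon> n)\<^sup>2)) \<longlonglongrightarrow> 0"
  proof -
    show "\<eta> \<longlonglongrightarrow> 0" by (rule d_eta)
    have "\<rho>' \<longlonglongrightarrow> (1 + D\<^sub>0) * 0" unfolding \<rho>'_def by (intro tendsto_mult tendsto_const gamma_lim)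
    then show "\<rho>' \<longlonglongrightarrow> 0" by simp
    have "(\<lambda>n. c * (1 + D\<^sub>0) * (sqrt (real n) * \<epsilon> n * norm (\<gamma> n - \<gamma>\<^sub>0)) + c\<^sup>2 * (sqrt (real n) * (\<epsilon> n)\<^sup>2)) \<longlonglongrightarrow> c * (1 + D\<^sub>0) * 0 + c\<^sup>2 * 0"
      by (intro tendsto_add tendsto_mult[OF tendsto_const] sqrt_eps_gamma sqrt_eps_square)
    then show "(\<lambda>n. sqrt (real n) * (c * \<epsilon> n * \<rho>' n + c\<^sup>2 * (\<epsilon> n)\<^sup>2)) \<longlonglongrightarrow> 0"
      by (simp add: \<rho>'_def algebra_simps)
  qed
  have "vanishing noise_law (\<lambda>n. {z \<in> space noise_law. a < \<bar>TV n (obs n z) - 0\<bar>})" if a: "0 < a" for a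
  proof (rule vanishing_if_bounded[where Y = "\<lambda>z. \<bar>V z\<bar> + Y z", OF W.prob_space_axioms])
    fix M :: real assume M: "0 < M"
    \<comment> \<open>The final bound on the distance tends to zero with \<open>x\<close>, so
      \<open>x\<close> is fixed by the threshold \<open>a\<close> alone.\<close>
    obtain x where x: "0 < x" "x < 1 / 4" and xa: "2 * (x + ((1 + x) / ((1 - x)\<^sup>2 * (1 - 2 * x)) * (1 + x) - 1)) < a"
    proof -
      have "((\<lambda>x. 2 * (x + ((1 + x) / ((1 - x)\<^sup>2 * (1 - 2 * x)) * (1 + x) - 1))) \<longlongrightarrow> 0) (at_right (0::real))"
        by (auto intro!: tendsto_eq_intros)
      then have "\<forall>\<^sub>F x in at_right (0::real). 2 * (x + ((1 + x) / ((1 - x)\<^sup>2 * (1 - 2 * x)) * (1 + x) - 1)) < a"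
        using a by (rule order_tendstoD)
      moreover have "\<forall>\<^sub>F x in at_right (0::real). x < 1 / 4"
        by (rule order_tendstoD[OF tendsto_ident_at]) simp
      ultimately have "\<forall>\<^sub>F x in at_right (0::real). 2 * (x + ((1 + x) / ((1 - x)\<^sup>2 * (1 - 2 * x)) * (1 + x) - 1)) < a \<and> x < 1 / 4 \<and> 0 < x"
        using eventually_at_right_less[of "0::real"] by eventually_elim simp
      then show ?thesis using that eventually_happens[of _ "at_right (0::real)"] by (auto simp: trivial_limit_at_right_real)
    qed
    define QM where "QM = sqrt 2 * exp (I\<^sub>0 / 8 * (1 + 2 * M\<^sup>2 / I\<^sub>0\<^sup>2))"
    have QM: "0 < QM" by (simp add: QM_def)
    \<comment> \<open>The first entry keeps \<open>\<delta>\<close> within the range of the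
      perturbation bounds, the second makes their error at most \<open>x\<close> whenever the score
      noise is bounded by \<open>M\<close>.\<close>
    define \<delta> where "\<delta> = min (I\<^sub>0 / 8) (x * I\<^sub>0 / (8 * QM))"
    have \<delta>: "0 < \<delta>" "\<delta> \<le> I\<^sub>0 / 8" "QM * (8 * \<delta> / I\<^sub>0) \<le> x"
    proof -
      show "0 < \<delta>" "\<delta> \<le> I\<^sub>0 / 8" using I0_pos x QM by (auto simp: \<delta>_def)
      have "\<delta> \<le> x * I\<^sub>0 / (8 * QM)" by (simp add: \<delta>_def)
      then show "QM * (8 * \<delta> / I\<^sub>0) \<le> x" using I0_pos QM by (simp add: field_simps)
    qed
    define T where "T n = {\<theta>\<^sub>0 - param_radius n<..<\<theta>\<^sub>0 + param_radius n} \<times> {f. norm (f - f\<^sub>0) \<le> ball_radius n}" for n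
    define B\<^sub>1 where "B\<^sub>1 n = {z \<in> space noise_law. x / 2 < \<bar>measure (joint_posterior e K \<pi>\<^sub>\<theta> \<pi>\<^sub>f n (obs n z))
      {(\<theta>, f) \<in> space (\<pi>\<^sub>\<theta> \<Otimes>\<^sub>M \<pi>\<^sub>f). \<bar>\<theta> - \<theta>\<^sub>0\<bar> < \<epsilon> n \<and> norm (f - f\<^sub>0) < \<epsilon> n} - 1\<bar>}" for n
    define B\<^sub>2 where "B\<^sub>2 n = {z \<in> space noise_law. x / 2 < \<bar>measure (posterior_given e K \<theta>\<^sub>0 \<pi>\<^sub>f n (obs n z)) {f. norm (f - f\<^sub>0) < \<epsilon> n} - 1\<bar>}" for n
    define B\<^sub>3 where "B\<^sub>3 n = {z \<in> space noise_law. ennreal (x / 2) * (\<integral>\<^sup>+m\<in>T n. ennreal (LR n z (fst m) (snd m)) \<partial>(\<pi>\<^sub>\<theta> \<Otimes>\<^sub>M \<pi>\<^sub>f))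
       < (\<integral>\<^sup>+m\<in>{\<theta>\<^sub>0 - \<epsilon> n<..<\<theta>\<^sub>0 + \<epsilon> n} \<times> - G n. ennreal (LR n z (fst m) (snd m)) \<partial>(\<pi>\<^sub>\<theta> \<Otimes>\<^sub>M \<pi>\<^sub>f))}" for n
    define B\<^sub>4 where "B\<^sub>4 n = {z \<in> space noise_law.
       ennreal (x / 2) * (\<integral>\<^sup>+f\<in>{f. norm (f - f\<^sub>0) \<le> ball_radius n}. ennreal (LR n z \<theta>\<^sub>0 f) \<partial>\<pi>\<^sub>f)
       < (\<integral>\<^sup>+f\<in>- G n. ennreal (LR n z \<theta>\<^sub>0 f) \<partial>\<pi>\<^sub>f)}" for n
    define B\<^sub>5 where "B\<^sub>5 n = {z \<in> space noise_law. \<delta> / 2 < \<bar>noise_pairing e z (score (\<gamma> n)) - noise_pairing e z (score \<gamma>\<^sub>0)\<bar>}" for n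
    define B\<^sub>6 where "B\<^sub>6 n = {z \<in> space noise_law. \<not> good_noise c Y n z}" for n
    have x2: "0 < x / 2" using x by simp
    \<comment> \<open>The bad events: failure of either contraction, likelihood mass outside the
      good prior set in either model, a large score difference, and an irregular noise
      point.\<close>
    have van: "vanishing noise_law (\<lambda>n. B\<^sub>1 n \<union> (B\<^sub>2 n \<union> (B\<^sub>3 n \<union> (B\<^sub>4 n \<union> (B\<^sub>5 n \<union> B\<^sub>6 n)))))"
    proof (intro vanishing_Un)
      show "vanishing noise_law B\<^sub>1" unfolding B\<^sub>1_def by (rule contraction_vanishing(1)[OF x2])
      show "vanishing noise_law B\<^sub>2" unfolding B\<^sub>2_def by (rule contraction_vanishing(2)[OF x2])
      show "vanishing noise_law B\<^sub>3" unfolding B\<^sub>3_def T_def by (rule evidence_joint_vanishing[OF G x2])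
      show "vanishing noise_law B\<^sub>4" unfolding B\<^sub>4_def by (rule evidence_given_vanishing[OF G x2])
      show "vanishing noise_law B\<^sub>5" unfolding B\<^sub>5_def by (rule score_vanishing) (use \<delta> in simp)
      show "vanishing noise_law B\<^sub>6" unfolding B\<^sub>6_def by (rule null)
    qed
    \<comment> \<open>Half of \<open>\<delta>\<close> goes to the deterministic errors and
      \<open>\<eta> n\<close>, the other half to the random score difference.\<close>
    have rate: "\<forall>\<^sub>F n in sequentially. M * c * \<epsilon> n + sqrt (real n) * (c * \<epsilon> n * \<rho>' n + c\<^sup>2 * (\<epsilon> n)\<^sup>2)
        + (\<rho>' n * (2 * c + \<rho>' n) + 2 * (c + \<rho>' n) * c * \<epsilon> n + c\<^sup>2 * (\<epsilon> n)\<^sup>2) / 2 + \<eta> n < \<delta> / 2"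
    proof (rule order_tendstoD)
      have "(\<lambda>n. M * c * \<epsilon> n + sqrt (real n) * (c * \<epsilon> n * \<rho>' n + c\<^sup>2 * (\<epsilon> n)\<^sup>2)
        + (\<rho>' n * (2 * c + \<rho>' n) + 2 * (c + \<rho>' n) * c * \<epsilon> n + c\<^sup>2 * (\<epsilon> n)\<^sup>2) / 2 + \<eta> n)
        \<longlonglongrightarrow> M * c * 0 + 0 + (0 * (2 * c + 0) + 2 * (c + 0) * c * 0 + c\<^sup>2 * 0\<^sup>2) / 2 + 0"
        by (intro tendsto_add lims(3) tendsto_divide tendsto_mult[OF tendsto_const c_rate(1)]
            tendsto_mult[OF lims(2)] tendsto_mult[OF _ c_rate(1)] tendsto_mult[OF tendsto_const] tendsto_mult[OF _ tendsto_const]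
            tendsto_const lims(1,2) tendsto_power c_rate(1)) simp
      then show "(\<lambda>n. M * c * \<epsilon> n + sqrt (real n) * (c * \<epsilon> n * \<rho>' n + c\<^sup>2 * (\<epsilon> n)\<^sup>2)
        + (\<rho>' n * (2 * c + \<rho>' n) + 2 * (c + \<rho>' n) * c * \<epsilon> n + c\<^sup>2 * (\<epsilon> n)\<^sup>2) / 2 + \<eta> n) \<longlonglongrightarrow> 0" by simp
    qed (use \<delta> in simp)
    have tail: "\<forall>\<^sub>F n in sequentially. QM * exp (- (I\<^sub>0 / 8 / (1 + \<Gamma>)\<^sup>2 * (real n * (\<epsilon> n)\<^sup>2))) < x"
    proof (rule order_tendstoD)
      have "0 < I\<^sub>0 / 8 / (1 + \<Gamma>)\<^sup>2" using I0_pos \<Gamma>0 by simp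
      then have "(\<lambda>n. QM * exp (- (I\<^sub>0 / 8 / (1 + \<Gamma>)\<^sup>2 * (real n * (\<epsilon> n)\<^sup>2)))) \<longlonglongrightarrow> QM * 0"
        by (intro tendsto_mult tendsto_const exp_rate)
      then show "(\<lambda>n. QM * exp (- (I\<^sub>0 / 8 / (1 + \<Gamma>)\<^sup>2 * (real n * (\<epsilon> n)\<^sup>2)))) \<longlonglongrightarrow> 0" by simp
    qed (use x in simp)
    have gam: "\<forall>\<^sub>F n in sequentially. norm (\<gamma> n - \<gamma>\<^sub>0) < 1" using gamma_lim by (rule order_tendstoD) simp
    show "vanishing noise_law (\<lambda>n. {z \<in> space noise_law. a < \<bar>TV n (obs n z) - 0\<bar>} \<inter> {z \<in> space noise_law. \<bar>\<bar>V z\<bar> + Y z\<bar> \<le> M})"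
    proof (rule vanishing_mono[OF van])
      show "\<forall>\<^sub>F n in sequentially. {z \<in> space noise_law. a < \<bar>TV n (obs n z) - 0\<bar>} \<inter> {z \<in> space noise_law. \<bar>\<bar>V z\<bar> + Y z\<bar> \<le> M}
          \<subseteq> B\<^sub>1 n \<union> (B\<^sub>2 n \<union> (B\<^sub>3 n \<union> (B\<^sub>4 n \<union> (B\<^sub>5 n \<union> B\<^sub>6 n))))"
        using rate tail gam eps1 eps_pos eventually_ge_at_top[of 1] prior_close[OF x(1)]
      proof eventually_elim
        case (elim n)
        note n = elim(6) and eps = elim(5) and eps1 = less_imp_le[OF elim(4)]
        have sub: "{\<theta>\<^sub>0 - \<epsilon> n<..<\<theta>\<^sub>0 + \<epsilon> n} \<subseteq> \<Theta>"
          and pc: "\<And>\<theta>. \<theta> \<in> {\<theta>\<^sub>0 - \<epsilon> n<..<\<theta>\<^sub>0 + \<epsilon> n} \<Longrightarrow> (1 - x) * p \<theta>\<^sub>0 \<le> p \<theta> \<and> p \<theta> \<le> (1 + x) * p \<theta>\<^sub>0"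
          using elim(7) by auto
        let ?I = "{\<theta>\<^sub>0 - \<epsilon> n<..<\<theta>\<^sub>0 + \<epsilon> n}" and ?b = "{f. norm (f - f\<^sub>0) < \<epsilon> n}"
        have I: "?I \<in> sets \<pi>\<^sub>\<theta>" using sub Theta_borel by (simp add: sets_restrict_space_iff)
        have b: "?b \<in> sets \<pi>\<^sub>f" by simp
        have Gn: "G n \<in> sets \<pi>\<^sub>f" "- G n \<in> sets \<pi>\<^sub>f"
          unfolding pf_sets using G[OF n] by (blast, intro borel_comp) blast
        show ?case
        proof (rule subsetI, rule ccontr)
          fix z
          assume z: "z \<in> {z \<in> space noise_law. a < \<bar>TV n (obs n z) - 0\<bar>} \<inter> {z \<in> space noise_law. \<bar>\<bar>V z\<bar> + Y z\<bar> \<le> M}"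
            and "z \<notin> B\<^sub>1 n \<union> (B\<^sub>2 n \<union> (B\<^sub>3 n \<union> (B\<^sub>4 n \<union> (B\<^sub>5 n \<union> B\<^sub>6 n))))"
          then have z': "z \<notin> B\<^sub>1 n" "z \<notin> B\<^sub>2 n" "z \<notin> B\<^sub>3 n" "z \<notin> B\<^sub>4 n" "z \<notin> B\<^sub>5 n" "z \<notin> B\<^sub>6 n" by auto
          have VY: "\<bar>V z\<bar> \<le> M" "Y z \<le> M" using z Y0[of z] by auto
          have good: "good_noise c Y n z" using z'(6) by (simp add: B\<^sub>6_def)
          then have reg: "regular c Y n z" and dom: "(\<gamma>\<^sub>0, K \<theta>\<^sub>0 \<gamma>\<^sub>0) \<in> noise_dom e z" "(0, K' \<theta>\<^sub>0 f\<^sub>0) \<in> noise_dom e z"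
            and jp: "joint_posterior e K \<pi>\<^sub>\<theta> \<pi>\<^sub>f n (obs n z) = bayes (\<pi>\<^sub>\<theta> \<Otimes>\<^sub>M \<pi>\<^sub>f) (\<lambda>(\<theta>, f). LR n z \<theta> f)"
            and gp: "posterior_given e K \<theta>\<^sub>0 \<pi>\<^sub>f n (obs n z) = bayes \<pi>\<^sub>f (LR n z \<theta>\<^sub>0)"
            by (auto simp: good_noise_def)
          have X: "{(\<theta>, f) \<in> space (\<pi>\<^sub>\<theta> \<Otimes>\<^sub>M \<pi>\<^sub>f). \<bar>\<theta> - \<theta>\<^sub>0\<bar> < \<epsilon> n \<and> norm (f - f\<^sub>0) < \<epsilon> n} = ?I \<times> ?b"
            using sub by (auto simp: space_pair_measure)
          have "1 - x / 2 \<le> measure (bayes (\<pi>\<^sub>\<theta> \<Otimes>\<^sub>M \<pi>\<^sub>f) (\<lambda>(\<theta>, f). LR n z \<theta> f)) (?I \<times> ?b)"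
          proof -
            have "\<bar>measure (joint_posterior e K \<pi>\<^sub>\<theta> \<pi>\<^sub>f n (obs n z)) (?I \<times> ?b) - 1\<bar> \<le> x / 2"
              using z'(1) unfolding B\<^sub>1_def X by (simp add: not_less)
            then show ?thesis unfolding jp by linarith
          qed
          moreover have "(\<integral>\<^sup>+m\<in>?I \<times> - G n. ennreal ((\<lambda>(\<theta>, f). LR n z \<theta> f) m) \<partial>(\<pi>\<^sub>\<theta> \<Otimes>\<^sub>M \<pi>\<^sub>f))
              \<le> ennreal (x / 2) * (\<integral>\<^sup>+m\<in>T n. ennreal ((\<lambda>(\<theta>, f). LR n z \<theta> f) m) \<partial>(\<pi>\<^sub>\<theta> \<Otimes>\<^sub>M \<pi>\<^sub>f))"
            using z'(3) unfolding B\<^sub>3_def by (simp add: case_prod_beta' not_less)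
          ultimately have "\<exists>d>0. (\<integral>\<^sup>+m. ennreal ((\<lambda>(\<theta>, f). LR n z \<theta> f) m) \<partial>(\<pi>\<^sub>\<theta> \<Otimes>\<^sub>M \<pi>\<^sub>f)) = ennreal d
              \<and> ennreal ((1 - x) * d) \<le> (\<integral>\<^sup>+m\<in>?I \<times> (G n \<inter> ?b). ennreal ((\<lambda>(\<theta>, f). LR n z \<theta> f) m) \<partial>(\<pi>\<^sub>\<theta> \<Otimes>\<^sub>M \<pi>\<^sub>f))
              \<and> 1 - x \<le> measure (bayes (\<pi>\<^sub>\<theta> \<Otimes>\<^sub>M \<pi>\<^sub>f) (\<lambda>(\<theta>, f). LR n z \<theta> f)) (?I \<times> (G n \<inter> ?b))"
            by (intro bayes_concentration[OF prior.P.prob_space_axioms measurable_LR_joint _ pair_measureI[OF I b] _ x(1) _ pair_measureI[OF I Gn(2)]]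
                pair_measureI[OF I sets.Int[OF Gn(1) b]]) (use x in \<open>auto simp: LR_pos\<close>)
          then have joint: "1 - x \<le> measure (bayes (\<pi>\<^sub>\<theta> \<Otimes>\<^sub>M \<pi>\<^sub>f) (\<lambda>(\<theta>, f). LR n z \<theta> f)) (?I \<times> (G n \<inter> ?b))" by blast
          have "1 - x / 2 \<le> measure (bayes \<pi>\<^sub>f (LR n z \<theta>\<^sub>0)) ?b"
          proof -
            have "\<bar>measure (posterior_given e K \<theta>\<^sub>0 \<pi>\<^sub>f n (obs n z)) ?b - 1\<bar> \<le> x / 2"
              using z'(2) unfolding B\<^sub>2_def by (simp add: not_less)
            then show ?thesis unfolding gp by linarith
          qed
          moreover have "(\<integral>\<^sup>+f\<in>- G n. ennreal (LR n z \<theta>\<^sub>0 f) \<partial>\<pi>\<^sub>f)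
              \<le> ennreal (x / 2) * (\<integral>\<^sup>+f\<in>{f. norm (f - f\<^sub>0) \<le> ball_radius n}. ennreal (LR n z \<theta>\<^sub>0 f) \<partial>\<pi>\<^sub>f)"
            using z'(4) unfolding B\<^sub>4_def by (simp add: not_less)
          moreover have "LR n z \<theta>\<^sub>0 \<in> borel_measurable \<pi>\<^sub>f" by simp
          ultimately have "\<exists>d>0. (\<integral>\<^sup>+f. ennreal (LR n z \<theta>\<^sub>0 f) \<partial>\<pi>\<^sub>f) = ennreal d
              \<and> ennreal ((1 - x) * d) \<le> (\<integral>\<^sup>+f\<in>G n \<inter> ?b. ennreal (LR n z \<theta>\<^sub>0 f) \<partial>\<pi>\<^sub>f)
              \<and> 1 - x \<le> measure (bayes \<pi>\<^sub>f (LR n z \<theta>\<^sub>0)) (G n \<inter> ?b)"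
            by (intro bayes_concentration[OF pf_prob _ _ b _ x(1) _ Gn(2)] sets.Int[OF Gn(1) b]) (use x in \<open>auto simp: LR_pos\<close>)
          then obtain d where d: "0 < d" "(\<integral>\<^sup>+f. ennreal (LR n z \<theta>\<^sub>0 f) \<partial>\<pi>\<^sub>f) = ennreal d"
              "ennreal ((1 - x) * d) \<le> (\<integral>\<^sup>+f\<in>G n \<inter> ?b. ennreal (LR n z \<theta>\<^sub>0 f) \<partial>\<pi>\<^sub>f)" by blast
          have Ww: "\<bar>noise_pairing e z (score (\<gamma> n)) - noise_pairing e z (score \<gamma>\<^sub>0)\<bar> \<le> \<delta> / 2"
            using z'(5) by (simp add: B\<^sub>5_def not_less)
          have gn: "norm (\<gamma> n) \<le> \<Gamma>"
            using norm_triangle_ineq[of "\<gamma> n - \<gamma>\<^sub>0" \<gamma>\<^sub>0] elim(3) by (simp add: \<Gamma>_def)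
          have QV: "sqrt 2 * exp (I\<^sub>0 / 8 * (1 + 2 * (noise_pairing e z (score \<gamma>\<^sub>0))\<^sup>2 / I\<^sub>0\<^sup>2)) \<le> QM"
          proof -
            have "(noise_pairing e z (score \<gamma>\<^sub>0))\<^sup>2 \<le> M\<^sup>2"
              using VY(1) unfolding V_def by (metis abs_le_square_iff abs_of_pos M)
            then have "I\<^sub>0 / 8 * (1 + 2 * (noise_pairing e z (score \<gamma>\<^sub>0))\<^sup>2 / I\<^sub>0\<^sup>2) \<le> I\<^sub>0 / 8 * (1 + 2 * M\<^sup>2 / I\<^sub>0\<^sup>2)"
              using I0_pos by (intro mult_left_mono add_left_mono divide_right_mono) auto
            then show ?thesis unfolding QM_def by simp
          qed
          have Q1: "sqrt 2 * exp (I\<^sub>0 / 8 * (1 + 2 * (noise_pairing e z (score \<gamma>\<^sub>0))\<^sup>2 / I\<^sub>0\<^sup>2)) * (8 * \<delta> / I\<^sub>0) \<le> x"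
            using mult_right_mono[OF QV, of "8 * \<delta> / I\<^sub>0"] \<delta> I0_pos by simp
          have ex: "I\<^sub>0 / 8 * real n * (\<epsilon> n / (1 + \<Gamma>))\<^sup>2 = I\<^sub>0 / 8 / (1 + \<Gamma>)\<^sup>2 * (real n * (\<epsilon> n)\<^sup>2)"
            by (simp add: power_divide)
          have Q2: "sqrt 2 * exp (I\<^sub>0 / 8 * (1 + 2 * (noise_pairing e z (score \<gamma>\<^sub>0))\<^sup>2 / I\<^sub>0\<^sup>2)) * exp (- (I\<^sub>0 / 8 * real n * (\<epsilon> n / (1 + \<Gamma>))\<^sup>2)) \<le> x"
            unfolding ex using mult_right_mono[OF QV exp_ge_zero] elim(2) by (meson less_imp_le order_trans)
          have dd: "\<delta> / 2 + M * c * \<epsilon> n + sqrt (real n) * (c * \<epsilon> n * ((1 + D\<^sub>0) * norm (\<gamma> n - \<gamma>\<^sub>0)) + c\<^sup>2 * (\<epsilon> n)\<^sup>2)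
             + ((1 + D\<^sub>0) * norm (\<gamma> n - \<gamma>\<^sub>0) * (2 * c + (1 + D\<^sub>0) * norm (\<gamma> n - \<gamma>\<^sub>0)) + 2 * (c + (1 + D\<^sub>0) * norm (\<gamma> n - \<gamma>\<^sub>0)) * c * \<epsilon> n + c\<^sup>2 * (\<epsilon> n)\<^sup>2) / 2 \<le> \<delta> - \<eta> n"
            using elim(1) unfolding \<rho>'_def by linarith
          have "\<bar>tv_dist (distr (bayes (\<pi>\<^sub>\<theta> \<Otimes>\<^sub>M \<pi>\<^sub>f) (\<lambda>(\<theta>, f). LR n z \<theta> f)) borel fst)
              (normal_law (\<theta>\<^sub>0 + 1 / sqrt (real n) * (1 / I\<^sub>0 * noise_pairing e z (score \<gamma>\<^sub>0))) (1 / real n * (1 / I\<^sub>0)))\<bar>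
            \<le> 2 * (x + ((1 + x) / ((1 - x)\<^sup>2 * (1 - 2 * x)) * (1 + x) - 1))"
          proof (rule tv_bound[where c = c and M = M and \<Gamma> = \<Gamma> and \<omega> = "\<delta> / 2" and \<delta> = \<delta> and d = d and G = "G n" and Y = Y])
            fix \<theta> f assume "\<theta> \<in> \<Theta>" "\<bar>\<theta> - \<theta>\<^sub>0\<bar> \<le> \<epsilon> n" "norm (f - f\<^sub>0) \<le> 2 * \<epsilon> n"
            then show "norm (remainder \<theta> f) \<le> c * (\<bar>\<theta> - \<theta>\<^sub>0\<bar> * \<epsilon> n)" using rem_c eps1 by blast
          next
            show "G n \<in> sets borel" using G[OF n] by blast
            show "0 \<le> \<delta>" using \<delta> by simp
          qed (fact n eps eps1 x sub pc reg Y0 VY c(2,3) gn Ww dd \<delta>(2) Q1 Q2 Gr[OF n] joint d)+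
          \<comment> \<open>At a good noise point the Bayes formula with the original likelihood and
            the one with the likelihood ratio give the same posterior, and the centring is the fixed
            noise functional.\<close>
          moreover have "TV n (obs n z) = tv_dist (distr (bayes (\<pi>\<^sub>\<theta> \<Otimes>\<^sub>M \<pi>\<^sub>f) (\<lambda>(\<theta>, f). LR n z \<theta> f)) borel fst)
              (normal_law (\<theta>\<^sub>0 + 1 / sqrt (real n) * (1 / I\<^sub>0 * noise_pairing e z (score \<gamma>\<^sub>0))) (1 / real n * (1 / I\<^sub>0)))"
            unfolding TV_def param_posterior_def jp Delta_obs[OF basis n dom] score_def ..
          ultimately have "\<bar>TV n (obs n z) - 0\<bar> < a" using xa by simp
          then show False using z by auto
        qed
      qed
    qed
  qed auto
  then show ?thesis
    unfolding obs_law_eq TV_def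
    by (rule tendsto_in_prob_distrI[where T' = "obs_map_inv e f\<^sub>0 (K \<theta>\<^sub>0 f\<^sub>0)"]) (auto simp: obs_map_inverse)
qed

end

theorem corollary2p4:
  fixes e :: "nat \<Rightarrow> 'h::{real_inner,banach,second_countable_topology}"
    and \<Theta> :: "real set"
    and K K' :: "real \<Rightarrow> 'h \<Rightarrow>\<^sub>L 'h"
    and p :: "real \<Rightarrow> real"
    and \<pi>\<^sub>f :: "'h measure"
    and \<theta>\<^sub>0 :: real and f\<^sub>0 :: 'h
    and S :: "'h set" and nS :: "'h \<Rightarrow> real"
    and D\<^sub>0 D\<^sub>1 D\<^sub>2 D\<^sub>3 :: real
    and \<epsilon> \<eta> \<rho> :: "nat \<Rightarrow> real"
    and \<gamma> :: "nat \<Rightarrow> 'h"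
    and r :: "nat \<Rightarrow> real \<Rightarrow> real \<Rightarrow> 'h \<Rightarrow> real"
  assumes basis: "orthonormal_basis e"
    and compact: "compact \<Theta>"
    and p_cont: "continuous_on \<Theta> p"
    and p_bounds: "\<exists>c C. 0 < c \<and> (\<forall>\<theta>\<in>\<Theta>. c \<le> p \<theta> \<and> p \<theta> \<le> C)"
    and p_prob: "prob_space (param_prior \<Theta> p)"
    and pf_prob: "prob_space \<pi>\<^sub>f" and pf_sets: "sets \<pi>\<^sub>f = sets borel"
    and theta0: "\<theta>\<^sub>0 \<in> interior \<Theta>"
    and nonzero: "blinfun_apply (K' \<theta>\<^sub>0) f\<^sub>0 \<noteq> 0"
    and a_S: "normed_subspace S nS" "stronger_norm S nS"
    and a_range: "\<And>\<theta> h. \<theta> \<in> \<Theta> \<Longrightarrow> blinfun_apply (K \<theta>) h \<in> S"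
    and a_entropy: "(\<integral>\<^sup>+r\<in>{0<..<1}. sqrt_entropy r {h \<in> S. nS h \<le> 1} \<partial>lborel) < \<infinity>"
    and b_deriv: "\<And>\<theta> f. \<theta> \<in> \<Theta> \<Longrightarrow>
        ((\<lambda>s. (blinfun_apply (K (\<theta> + s)) f - blinfun_apply (K \<theta>) f) /\<^sub>R s)
          \<longlongrightarrow> blinfun_apply (K' \<theta>) f) (at 0 within {s. \<theta> + s \<in> \<Theta>})"
    and b_i: "\<And>\<theta>. \<theta> \<in> \<Theta> \<Longrightarrow> norm (K \<theta>) \<le> D\<^sub>0" "\<And>\<theta>. \<theta> \<in> \<Theta> \<Longrightarrow> norm (K' \<theta>) \<le> D\<^sub>0"
    and b_ii: "\<And>\<theta>. \<theta> \<in> \<Theta> \<Longrightarrow>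
        opnorm_into S nS (blinfun_apply (K \<theta> - K \<theta>\<^sub>0)) \<le> ereal (D\<^sub>1 * \<bar>\<theta> - \<theta>\<^sub>0\<bar>)"
    and b_iii: "\<And>\<theta>. \<theta> \<in> \<Theta> \<Longrightarrow>
        opnorm_into S nS (blinfun_apply (K \<theta> - K \<theta>\<^sub>0 - (\<theta> - \<theta>\<^sub>0) *\<^sub>R K' \<theta>\<^sub>0))
          \<le> ereal (D\<^sub>2 * (\<theta> - \<theta>\<^sub>0)\<^sup>2)"
    and b_iv: "\<And>\<theta>\<^sub>1 \<theta>\<^sub>2 f\<^sub>1 f\<^sub>2. \<theta>\<^sub>1 \<in> \<Theta> \<Longrightarrow> \<theta>\<^sub>2 \<in> \<Theta> \<Longrightarrow>
        norm (blinfun_apply (K \<theta>\<^sub>1) f\<^sub>1 - blinfun_apply (K \<theta>\<^sub>2) f\<^sub>2)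
          \<le> D\<^sub>3 * \<bar>\<theta>\<^sub>1 - \<theta>\<^sub>2\<bar> * min (norm f\<^sub>1) (norm f\<^sub>2) + D\<^sub>3 * norm (f\<^sub>1 - f\<^sub>2)"
    and c_joint: "joint_contracts e K (param_prior \<Theta> p) \<pi>\<^sub>f \<theta>\<^sub>0 f\<^sub>0 \<epsilon>"
    and c_given: "given_contracts e K \<pi>\<^sub>f \<theta>\<^sub>0 f\<^sub>0 \<epsilon>"
    and c_rate: "\<epsilon> \<longlonglongrightarrow> 0" "(\<lambda>n. (1 / sqrt (real n)) / \<epsilon> n) \<longlonglongrightarrow> 0"
    and d_eta: "\<And>n. 1 \<le> n \<Longrightarrow> 0 < \<eta> n" "\<eta> \<longlonglongrightarrow> 0"
    and d_gamma: "(\<lambda>n. norm (\<gamma> n - least_favorable K K' \<theta>\<^sub>0 f\<^sub>0)) \<in> O(\<rho>)"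
    and d_rates: "(\<lambda>n. real n * \<epsilon> n ^ 4 + real n * (\<epsilon> n)\<^sup>2 * (\<rho> n)\<^sup>2) \<longlonglongrightarrow> 0"
    and d_ball: "\<And>n. 1 \<le> n \<Longrightarrow>
        measure \<pi>\<^sub>f {f. norm (f - f\<^sub>0) \<le> \<epsilon> n / (2 * D\<^sub>3 + 2)} \<ge> exp (- (real n * (\<epsilon> n)\<^sup>2 / 65))"
    and d_version: "\<And>n s t. 1 \<le> n \<Longrightarrow> s \<in> {- \<epsilon> n <..< \<epsilon> n} \<Longrightarrow> t \<in> {- \<epsilon> n <..< \<epsilon> n} \<Longrightarrow>
        density_version (shifted_law \<pi>\<^sub>f (s *\<^sub>R \<gamma> n)) (shifted_law \<pi>\<^sub>f ((s + t) *\<^sub>R \<gamma> n)) (r n s t)"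
    and d_shift: "\<And>n. 1 \<le> n \<Longrightarrow>
        outer_measure_of \<pi>\<^sub>f
          {f. \<exists>s\<in>{- \<epsilon> n <..< \<epsilon> n}. \<exists>t\<in>{- \<epsilon> n <..< \<epsilon> n}.
                abs_log (r n s t f) > ereal (\<eta> n * (1 + real n * t\<^sup>2))}
          \<le> ennreal (exp (- (3 * real n * (\<epsilon> n)\<^sup>2)))"
  shows "tendsto_in_prob (\<lambda>n. obs_law e K n \<theta>\<^sub>0 f\<^sub>0)
           (\<lambda>n x. tv_dist (param_posterior e K (param_prior \<Theta> p) \<pi>\<^sub>f n x)
              (normal_law (\<theta>\<^sub>0 + 1 / sqrt (real n) * Delta e K K' n \<theta>\<^sub>0 f\<^sub>0 x)
                 (1 / real n * (1 / efficient_info K K' \<theta>\<^sub>0 f\<^sub>0))))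
           0"
proof -
  have "bvm_setting e \<Theta> K K' p \<pi>\<^sub>f \<theta>\<^sub>0 f\<^sub>0 S nS D\<^sub>0 D\<^sub>1 D\<^sub>2 D\<^sub>3 \<epsilon> \<eta> \<rho> \<gamma> r"
    by (rule bvm_setting.intro) (fact assms)+
  then show ?thesis by (rule bvm_setting.bernstein_von_mises)
qed

end
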